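(* Let $K$ be an algebraically closed field, let $r,k$ be positive integers and let $n=2r$. Let $p=[1,\ldots,n]$ be the pfaffian of the whole matrix $X(t)$, and let $p^{(h)}=[1,\ldots,n]^{(h)}$ be the coefficient of $t^h$ in $p$. Then: a) the Gröbner basis with respect to $\prec$ of the pfaffian jet ideal $I^{2r,k}_r$ is given by $[1,\ldots,n]^{(0)},\ldots,[1,\ldots,n]^{(k-1)}$; b) the pfaffian jet ideal $I^{2r,k}_r$ is prime of codimension $k$; c) $R^{2r,k}_r$ is a complete intersection and, therefore, Cohen-Macaulay, of multiplicity $r^k$.
   Context: Let $K$ be an algebraically closed field and $n,k,r$ positive integers with $2r\le n$. Let $A^{n,k}=K[x_{ij}^{(h)} : 1\le i<j\le n,\ h=0,\ldots,k-1]$, a polynomial ring in $kn(n-1)/2$ variables. Let $t$ be a further indeterminate and let $X(t)$ be the $n\times n$ skew-symmetric matrix (zero diagonal) with entries $x_{ij}(t)=x_{ij}^{(0)}+x_{ij}^{(1)}t+\cdots+x_{ij}^{(k-1)}t^{k-1}$ for $i<j$ and $x_{ji}(t)=-x_{ij}(t)$. For $1\le a_1<\cdots<a_{2r}\le n$, $[a_1,\ldots,a_{2r}]\in A^{n,k}[t]$ denotes the pfaffian of the submatrix of $X(t)$ with rows and columns $a_1,\ldots,a_{2r}$; it is called a $2r$-pfaffian of $X(t)$. Write a $2r$-pfaffian as $p=\sum_{h\ge 0}p^{(h)}t^h$ with $p^{(h)}\in A^{n,k}$. The pfaffian jet ideal $I^{n,k}_r\subseteq A^{n,k}$ is the ideal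 generated by $p^{(h)}$ for all $2r$-pfaffians $p$ of $X(t)$ and all $h=0,\ldots,k-1$, and $R^{n,k}_r=A^{n,k}/I^{n,k}_r$. The monomial order $\prec$ is the degree reverse lexicographic order on the monomials of $A^{n,k}$ induced by the ordering of the variables $x_{1,2}^{(k-1)}>\cdots>x_{1,n}^{(k-1)}>x_{2,3}^{(k-1)}>\cdots>x_{n-1,n}^{(k-1)}>x_{1,2}^{(k-2)}>\cdots>x_{n-1,n}^{(k-2)}>\cdots>x_{1,2}^{(0)}>\cdots>x_{1,n}^{(0)}>x_{2,3}^{(0)}>\cdots>x_{n-1,n}^{(0)}$; that is, variables with larger upper index are larger, and among variables with the same upper index, $x_{ij}^{(h)}>x_{i'j'}^{(h)}$ if $i<i'$, or $i=i'$ and $j<j'$. Codimension of an ideal means its height; multiplicity is with respect to the standard grading. *)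

theory Defs
  imports
    "HOL-Library.Poly_Mapping"
    "HOL-Library.Extended_Nat"
    "HOL-Computational_Algebra.Polynomial"
    "HOL-Combinatorics.Permutations"
    "HOL-Algebra.Ideal"
    "HOL-Algebra.QuotRing"
    "HOL-Algebra.Ring_Divisibility"
    "HOL-Algebra.Embedded_Algebras"
begin

section \<open>Commutative algebra\<close>

text \<open>A list of length \<open>l + 1\<close> is a chain of prime ideals of length \<open>l\<close>.\<close>

definition prime_chain :: "('a, 'm) ring_scheme \<Rightarrow> 'a set list \<Rightarrow> bool" where
  "prime_chain R Ps \<longleftrightarrow> sorted_wrt (\<subset>) Ps \<and> (\<forall>P \<in> set Ps. primeideal P R)"

definition prime_height :: "('a, 'm) ring_scheme \<Rightarrow> 'a set \<Rightarrow> enat" where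
  "prime_height R P = Sup {enat (length Ps) | Ps. prime_chain R (Ps @ [P])}"

definition ideal_height :: "('a, 'm) ring_scheme \<Rightarrow> 'a set \<Rightarrow> enat" where
  "ideal_height R I = Inf {prime_height R P | P. primeideal P R \<and> I \<subseteq> P}"

definition krull_dim :: "('a, 'm) ring_scheme \<Rightarrow> enat" where
  "krull_dim R = Sup {prime_height R P | P. primeideal P R}"

definition regular_sequence :: "('a, 'm) ring_scheme \<Rightarrow> 'a list \<Rightarrow> bool" where
  "regular_sequence R fs \<longleftrightarrow>
     set fs \<subseteq> carrier R \<and> genideal R (set fs) \<noteq> carrier R \<and>
     (\<forall>i < length fs. \<forall>a \<in> carrier R.
        mult R (fs ! i) a \<in> genideal R (set (take i fs)) \<longrightarrow>
        a \<in> genideal R (set (take i fs)))"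

definition ideal_depth :: "('a, 'm) ring_scheme \<Rightarrow> 'a set \<Rightarrow> enat" where
  "ideal_depth R I = Sup {enat (length fs) | fs. regular_sequence R fs \<and> set fs \<subseteq> I}"

text \<open>
  Cohen-Macaulay rings as in Eisenbud, Commutative Algebra, Section 18.2: depth and codimension of
  every maximal ideal agree. Here the depth of a maximal ideal \<open>P\<close> is computed in the
  ring itself; in the Noetherian case it equals the depth of the localization at \<open>P\<close>.
\<close>

definition cohen_macaulay :: "('a, 'm) ring_scheme \<Rightarrow> bool" where
  "cohen_macaulay R \<longleftrightarrow>
     cring R \<and> noetherian_ring R \<and>
     (\<forall>P. maximalideal P R \<longrightarrow> ideal_depth R P = ideal_height R P)"

text \<open>
  The quotient \<open>A/I\<close> of a polynomial ring \<open>A\<close> (or of any other regular ring)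
  is a complete intersection if \<open>I\<close> is generated by a regular sequence.
\<close>

definition complete_intersection_quotient :: "('a, 'm) ring_scheme \<Rightarrow> 'a set \<Rightarrow> bool" where
  "complete_intersection_quotient A I \<longleftrightarrow>
     (\<exists>fs. regular_sequence A fs \<and> I = genideal A (set fs))"

text \<open>
  In the following, \<open>R\<close> is a ring with a subfield \<open>K\<close>, graded with
  components \<open>C 0, C 1, ...\<close>
\<close>

definition hilbert_function ::
  "('a, 'm) ring_scheme \<Rightarrow> 'a set \<Rightarrow> (nat \<Rightarrow> 'a set) \<Rightarrow> nat \<Rightarrow> nat" where
  "hilbert_function R K C d = ring.dim R K (C d)"

definition hilbert_polynomial ::
  "('a, 'm) ring_scheme \<Rightarrow> 'a set \<Rightarrow> (nat \<Rightarrow> 'a set) \<Rightarrow> rat poly" where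
  "hilbert_polynomial R K C =
     (THE P. \<exists>N. \<forall>d \<ge> N. poly P (of_nat d) = of_nat (hilbert_function R K C d))"

text \<open>
  Bruns and Herzog, Cohen-Macaulay Rings, Definition 4.1.5: with \<open>D\<close> the Krull dimension,
  the multiplicity is \<open>(D - 1)!\<close> times the coefficient of degree \<open>D - 1\<close> of the
  Hilbert polynomial if \<open>D > 0\<close>, and the length of \<open>R\<close>, i.e. its dimension over
  \<open>K\<close>, if \<open>D = 0\<close>.
\<close>

definition multiplicity_graded ::
  "('a, 'm) ring_scheme \<Rightarrow> 'a set \<Rightarrow> (nat \<Rightarrow> 'a set) \<Rightarrow> rat" where
  "multiplicity_graded R K C =
     (let D = the_enat (krull_dim R) in
      if D = 0 then of_nat (ring.dim R K (carrier R))
      else fact (D - 1) * Polynomial.coeff (hilbert_polynomial R K C) (D - 1))"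


section \<open>Polynomial rings and Groebner bases\<close>

type_synonym 'v monomial = "'v \<Rightarrow>\<^sub>0 nat"
type_synonym ('v, 'a) mpol = "'v monomial \<Rightarrow>\<^sub>0 'a"

definition mon_degree :: "'v monomial \<Rightarrow> nat" where
  "mon_degree m = (\<Sum>v \<in> Poly_Mapping.keys m. Poly_Mapping.lookup m v)"

definition mvar :: "'v \<Rightarrow> ('v, 'a::field) mpol" where
  "mvar v = Poly_Mapping.single (Poly_Mapping.single v 1) 1"

definition polynomial_ring :: "'v set \<Rightarrow> ('v, 'a::field) mpol ring" where
  "polynomial_ring V =
     \<lparr>carrier = {f. \<forall>m \<in> Poly_Mapping.keys f. Poly_Mapping.keys m \<subseteq> V},
      mult = (*), one = 1, zero = 0, add = (+)\<rparr>"

definition homogeneous_part :: "'v set \<Rightarrow> nat \<Rightarrow> ('v, 'a::field) mpol set" where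
  "homogeneous_part V d =
     {f \<in> carrier (polynomial_ring V). \<forall>m \<in> Poly_Mapping.keys f. mon_degree m = d}"

text \<open>
  The quotient of the standard graded polynomial ring by a homogeneous ideal: base field and
  graded components are the images of the constants and of the homogeneous parts.
\<close>

definition multiplicity_quotient :: "'v set \<Rightarrow> ('v, 'a::field) mpol set \<Rightarrow> rat" where
  "multiplicity_quotient V I =
     multiplicity_graded (polynomial_ring V Quot I)
       (a_r_coset (polynomial_ring V) I ` range (Poly_Mapping.single 0))
       (\<lambda>d. a_r_coset (polynomial_ring V) I ` homogeneous_part V d)"

text \<open>
  Degree reverse lexicographic order induced by a strict linear order of the variables: among
  monomials of equal degree, the smaller one has the greater exponent at the smallest variable
  where the two differ.
\<close>

definition degrevlex_less ::
  "('v \<Rightarrow> 'v \<Rightarrow> bool) \<Rightarrow> 'v monomial \<Rightarrow> 'v monomial \<Rightarrow> bool" where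
  "degrevlex_less vless m m' \<longleftrightarrow>
     mon_degree m < mon_degree m' \<or>
     mon_degree m = mon_degree m' \<and>
     (\<exists>v. Poly_Mapping.lookup m v > Poly_Mapping.lookup m' v \<and>
        (\<forall>w. vless w v \<longrightarrow> Poly_Mapping.lookup m w = Poly_Mapping.lookup m' w))"

definition leading_monomial ::
  "('v monomial \<Rightarrow> 'v monomial \<Rightarrow> bool) \<Rightarrow> ('v, 'a::field) mpol \<Rightarrow> 'v monomial" where
  "leading_monomial prec f =
     (THE m. m \<in> Poly_Mapping.keys f \<and> (\<forall>m' \<in> Poly_Mapping.keys f. m' \<noteq> m \<longrightarrow> prec m' m))"

definition leading_ideal ::
  "('v monomial \<Rightarrow> 'v monomial \<Rightarrow> bool) \<Rightarrow> 'v set \<Rightarrow> ('v, 'a::field) mpol set \<Rightarrow>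
   ('v, 'a) mpol set" where
  "leading_ideal prec V F =
     genideal (polynomial_ring V)
       {Poly_Mapping.single (leading_monomial prec f) 1 | f. f \<in> F \<and> f \<noteq> 0}"

definition groebner_basis ::
  "('v monomial \<Rightarrow> 'v monomial \<Rightarrow> bool) \<Rightarrow> 'v set \<Rightarrow> ('v, 'a::field) mpol set \<Rightarrow>
   ('v, 'a) mpol set \<Rightarrow> bool" where
  "groebner_basis prec V I G \<longleftrightarrow>
     finite G \<and> G \<subseteq> I \<and> leading_ideal prec V G = leading_ideal prec V I"


section \<open>Pfaffian jet ideals\<close>

text \<open>
  The pfaffian of a skew-symmetric matrix of size \<open>2r\<close> with rows and columns indexed from 0:
  the sum over perfect matchings, each one represented by the unique permutation \<open>s\<close> listing
  its edges \<open>s (2i) < s (2i + 1)\<close> by increasing smaller endpoint. It needs no division and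
  is meaningful in every characteristic.
\<close>

definition pfaffian :: "nat \<Rightarrow> (nat \<Rightarrow> nat \<Rightarrow> 'b::comm_ring_1) \<Rightarrow> 'b" where
  "pfaffian r M =
     (\<Sum>s | s permutes {..<2 * r} \<and> (\<forall>i < r. s (2 * i) < s (2 * i + 1)) \<and>
           (\<forall>i j. i < j \<and> j < r \<longrightarrow> s (2 * i) < s (2 * j)).
        of_int (sign s) * (\<Prod>i < r. M (s (2 * i)) (s (2 * i + 1))))"

text \<open>The triple \<open>(h, i, j)\<close> is the variable with upper index \<open>h\<close> and lower indices
  \<open>i, j\<close>.\<close>

type_synonym jet_var = "nat \<times> nat \<times> nat"

definition jet_vars :: "nat \<Rightarrow> nat \<Rightarrow> jet_var set" where
  "jet_vars n k = {(h, i, j). h < k \<and> 1 \<le> i \<and> i < j \<and> j \<le> n}"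

fun jet_var_less :: "jet_var \<Rightarrow> jet_var \<Rightarrow> bool" where
  "jet_var_less (h, i, j) (h', i', j') \<longleftrightarrow>
     h < h' \<or> h = h' \<and> (i > i' \<or> i = i' \<and> j > j')"

abbreviation jet_order :: "jet_var monomial \<Rightarrow> jet_var monomial \<Rightarrow> bool" where
  "jet_order \<equiv> degrevlex_less jet_var_less"

definition jet_entry :: "nat \<Rightarrow> nat \<Rightarrow> nat \<Rightarrow> (jet_var, 'a::field) mpol poly" where
  "jet_entry k i j = (\<Sum>h < k. Polynomial.monom (mvar (h, i, j)) h)"

definition jet_matrix :: "nat \<Rightarrow> nat \<Rightarrow> nat \<Rightarrow> (jet_var, 'a::field) mpol poly" where
  "jet_matrix k i j =
     (if i < j then jet_entry k i j else if j < i then - jet_entry k j i else 0)"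

text \<open>The pfaffian of the submatrix with the rows and columns listed in \<open>xs\<close>.\<close>

definition jet_pfaffian :: "nat \<Rightarrow> nat list \<Rightarrow> (jet_var, 'a::field) mpol poly" where
  "jet_pfaffian k xs = pfaffian (length xs div 2) (\<lambda>i j. jet_matrix k (xs ! i) (xs ! j))"

definition jet_ring :: "nat \<Rightarrow> nat \<Rightarrow> (jet_var, 'a::field) mpol ring" where
  "jet_ring n k = polynomial_ring (jet_vars n k)"

definition pfaffian_jet_ideal :: "nat \<Rightarrow> nat \<Rightarrow> nat \<Rightarrow> (jet_var, 'a::field) mpol set" where
  "pfaffian_jet_ideal n k r =
     genideal (jet_ring n k)
       {Polynomial.coeff (jet_pfaffian k xs) h | xs h.
          sorted_wrt (<) xs \<and> length xs = 2 * r \<and> set xs \<subseteq> {1..n} \<and> h < k}"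

end

theory Submission
  imports Defs
begin

text \<open>
  Write \<open>I\<close> for the Pfaffian jet ideal, generated by \<open>p^(0), ..., p^(k-1)\<close>, and \<open>N\<close> for the number
  of variables. The proof rests on one principle: if the leading monomials of \<open>f_1, ..., f_l\<close> (for
  a degree reverse lexicographic order) are pairwise coprime, then in a combination
  \<open>a_1 f_1 + ... + a_l f_l\<close> with reduced coefficients leading terms cannot cancel. Hence the \<open>f_i\<close>
  are a Groebner basis and a regular sequence, and the monomials divisible by none of the leading
  monomials form a basis of the quotient (\<open>lead_in_J\<close>, \<open>nonzerodivisor_mod_J\<close>, \<open>std_in_J_zero\<close>).
  It is applied for two different orders.

  Groebner basis. The monomials of \<open>p^(h)\<close> are the perfect matchings of \<open>{1, ..., 2r}\<close> whose edges
  carry levels with sum \<open>h\<close>. The leading one consists of all triples \<open>(l, i, j)\<close>, \<open>i < j\<close>, with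
  \<open>2 h + i + j = 2 l r + 2 r + 1\<close>: for \<open>h = q r + s\<close> with \<open>s < r\<close> this is the antidiagonal of the
  rows \<open>1, ..., 2 (r - s)\<close> at level \<open>q\<close> together with the antidiagonal of the remaining \<open>2 s\<close> rows
  at level \<open>q + 1\<close> (\<open>matching_first_difference\<close>, \<open>pf_coeff_lead\<close>). A triple determines \<open>h\<close>, so
  these monomials are pairwise coprime.

  Primality. One has \<open>p^(h) = x_12^(h) q + g_h\<close>, where \<open>q\<close> is the Pfaffian of the rows
  \<open>3, ..., 2r\<close> at \<open>t = 0\<close>, and \<open>g_h\<close> contains no \<open>x_12^(h')\<close> with \<open>h' \<ge> h\<close>. The leading monomial
  of \<open>q\<close> is coprime to those of the generators, hence \<open>q\<close> is a nonzerodivisor modulo \<open>I\<close>. After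
  inversion of \<open>q\<close>, all \<open>x_12^(h)\<close> can be eliminated. No nonzero polynomial \<open>b\<close> in the other
  variables lies in \<open>I\<close>: at a point where \<open>b\<close> and \<open>q\<close> do not vanish, the equations \<open>p^(h) = 0\<close> can
  be solved successively for \<open>x_12^(h)\<close>. So \<open>I\<close> becomes prime after inversion of \<open>q\<close>, and is prime
  itself (\<open>pf_ideal_prime\<close>).

  Height. A regular sequence of length \<open>k\<close> in a prime yields a chain of \<open>k\<close> primes properly below
  it (\<open>depth_le_height\<close>). Conversely, each step down in a chain of primes raises the order of
  growth of the affine Hilbert function by one at least (\<open>grows_prime_chain\<close>), and this order is
  at most \<open>N\<close>. As it is at least \<open>N - k\<close> for \<open>I\<close>, the height of \<open>I\<close> is at most \<open>k\<close>.

  Cohen-Macaulay property and multiplicity. Let \<open>z_h\<close> be the variable \<open>(l, 1, j)\<close> of the leading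
  matching of \<open>h\<close>, and add \<open>z_h\<close> to all other variables of this matching. Under this linear change
  of coordinates the monomial \<open>z_h^r\<close> appears in \<open>p^(h)\<close>, and for an order in which the \<open>z_h\<close> are
  the largest variables it is the leading one (\<open>to_z_pf_coeff_lead\<close>). So the \<open>p^(h)\<close> followed by
  the \<open>D = N - k\<close> other coordinates, each shifted by an arbitrary constant, are a regular sequence
  (\<open>pf_regular_sequence\<close>). By the Nullstellensatz every maximal ideal of the quotient belongs to a
  point; with the coordinates of the point as constants the sequence lies in the maximal ideal,
  which has therefore depth at least \<open>D\<close>. Its height is at most \<open>D\<close> by the growth argument.
  Finally the products of a monomial in the \<open>z_h\<close> with all exponents below \<open>r\<close> and a monomial in
  the other \<open>D\<close> coordinates form a basis of the quotient. For \<open>D > 0\<close>, counting them by degree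
  gives a Hilbert polynomial of degree \<open>D - 1\<close> with leading coefficient \<open>r^k / (D - 1)!\<close>.
\<close>

section \<open>Polynomials and degree reverse lexicographic orders\<close>

abbreviation lookup where "lookup \<equiv> Poly_Mapping.lookup"
abbreviation keys where "keys \<equiv> Poly_Mapping.keys"
abbreviation single where "single \<equiv> Poly_Mapping.single"

definition polys :: "'v set \<Rightarrow> ('v, 'a::field) mpol set" where
  "polys V = {f. \<forall>m\<in>keys f. keys m \<subseteq> V}"

lemma keys_add_nat: "keys (a + b :: 'v \<Rightarrow>\<^sub>0 nat) = keys a \<union> keys b"
  by (auto simp: in_keys_iff lookup_add)

lemma mpol_eq_sum: "f = (\<Sum>m\<in>keys f. single m (lookup f m))"
proof (rule poly_mapping_eqI)
  fix k
  have "lookup (\<Sum>m\<in>keys f. single m (lookup f m)) k = (\<Sum>m\<in>keys f. if m = k then lookup f m else 0)"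
    by (simp add: lookup_sum lookup_single when_def)
  then show "lookup f k = lookup (\<Sum>m\<in>keys f. single m (lookup f m)) k"
    by (simp add: in_keys_iff)
qed

lemma polys_mono: "V \<subseteq> W \<Longrightarrow> polys V \<subseteq> polys W"
  by (auto simp: polys_def)

lemma polys_single: "keys m \<subseteq> V \<Longrightarrow> single m c \<in> polys V"
  by (auto simp: polys_def)

lemma polys_0 [simp]: "0 \<in> polys V" by (auto simp: polys_def)
lemma polys_1 [simp]: "1 \<in> polys V" by (auto simp: polys_def)
lemma polys_const [simp]: "single 0 c \<in> polys V" by (rule polys_single) simp

lemma polys_add [intro]: "f \<in> polys V \<Longrightarrow> g \<in> polys V \<Longrightarrow> f + g \<in> polys V"
  using keys_add[of f g] by (auto simp: polys_def)

lemma polys_uminus [intro]: "f \<in> polys V \<Longrightarrow> - f \<in> polys V"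
  by (auto simp: polys_def in_keys_iff)

lemma polys_diff [intro]: "f \<in> polys V \<Longrightarrow> g \<in> polys V \<Longrightarrow> f - g \<in> polys V"
  using polys_add[OF _ polys_uminus, of f V g] by simp

lemma polys_mult [intro]: "f \<in> polys V \<Longrightarrow> g \<in> polys V \<Longrightarrow> f * g \<in> polys V"
  using keys_mult[of f g] by (fastforce simp: polys_def keys_add_nat)

lemma polys_sum [intro]: "(\<And>x. x \<in> S \<Longrightarrow> f x \<in> polys V) \<Longrightarrow> sum f S \<in> polys V"
  by (induction S rule: infinite_finite_induct) auto

lemma polys_prod [intro]: "(\<And>x. x \<in> S \<Longrightarrow> f x \<in> polys V) \<Longrightarrow> prod f S \<in> polys V"
  by (induction S rule: infinite_finite_induct) auto

lemma polys_power [intro]: "f \<in> polys V \<Longrightarrow> f ^ n \<in> polys V"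
  by (induction n) auto

lemma polys_mvar: "v \<in> V \<Longrightarrow> mvar v \<in> polys V"
  unfolding mvar_def by (rule polys_single) simp

lemma mon_degree_superset: "finite S \<Longrightarrow> keys m \<subseteq> S \<Longrightarrow> mon_degree m = (\<Sum>v\<in>S. lookup m v)"
  unfolding mon_degree_def by (rule sum.mono_neutral_left) (auto simp: in_keys_iff)

lemma mon_degree_add: "mon_degree (a + b) = mon_degree a + mon_degree b"
proof -
  have "mon_degree (a + b) = (\<Sum>v\<in>keys a \<union> keys b. lookup (a + b) v)"
    by (rule mon_degree_superset) (auto simp: keys_add_nat)
  moreover have "mon_degree a = (\<Sum>v\<in>keys a \<union> keys b. lookup a v)"
    by (rule mon_degree_superset) auto
  moreover have "mon_degree b = (\<Sum>v\<in>keys a \<union> keys b. lookup b v)"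
    by (rule mon_degree_superset) auto
  ultimately show ?thesis by (simp add: lookup_add sum.distrib)
qed

lemma mon_degree_0 [simp]: "mon_degree 0 = 0"
  by (simp add: mon_degree_def)

lemma mon_degree_single [simp]: "mon_degree (single v n) = n"
  by (simp add: mon_degree_def)

lemma mon_degree_sum: "mon_degree (\<Sum>x\<in>S. f x) = (\<Sum>x\<in>S. mon_degree (f x))"
  by (induction S rule: infinite_finite_induct) (auto simp: mon_degree_add)

lemma lookup_le_mon_degree: "lookup m v \<le> mon_degree m"
  by (cases "v \<in> keys m") (auto simp: mon_degree_def in_keys_iff intro: member_le_sum)

lemma monomials_degree_le:
  assumes "finite V"
  shows "finite {m. keys m \<subseteq> V \<and> mon_degree m \<le> d}"
    and "card {m. keys m \<subseteq> V \<and> mon_degree m \<le> d} \<le> (d + 1) ^ card V"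
proof -
  let ?M = "{m. keys m \<subseteq> V \<and> mon_degree m \<le> d}"
  let ?r = "\<lambda>m. restrict (lookup m) V"
  have inj: "inj_on ?r ?M"
  proof (rule inj_onI)
    fix a b assume a: "a \<in> ?M" and b: "b \<in> ?M" and eq: "?r a = ?r b"
    show "a = b"
    proof (rule poly_mapping_eqI)
      fix v show "lookup a v = lookup b v"
      proof (cases "v \<in> V")
        case True then show ?thesis using fun_cong[OF eq, of v] by simp
      next
        case False then have "v \<notin> keys a" "v \<notin> keys b" using a b by auto
        then show ?thesis by (simp add: in_keys_iff)
      qed
    qed
  qed
  have sub: "?r ` ?M \<subseteq> PiE V (\<lambda>_. {0..d})"
  proof
    fix x assume "x \<in> ?r ` ?M"
    then obtain m where m: "mon_degree m \<le> d" "x = ?r m" by auto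
    have "lookup m v \<le> d" for v using lookup_le_mon_degree[of m v] m(1) by linarith
    then show "x \<in> PiE V (\<lambda>_. {0..d})" using m(2) by auto
  qed
  have fin: "finite (PiE V (\<lambda>_. {0..d}))" using assms by (auto intro: finite_PiE)
  show "finite ?M" using inj_on_finite[OF inj sub fin] .
  show "card ?M \<le> (d + 1) ^ card V"
    using card_inj_on_le[OF inj sub fin] assms by (simp add: card_PiE)
qed

definition mdvd :: "('v \<Rightarrow>\<^sub>0 nat) \<Rightarrow> ('v \<Rightarrow>\<^sub>0 nat) \<Rightarrow> bool" where
  "mdvd a b \<longleftrightarrow> (\<forall>v. lookup a v \<le> lookup b v)"

lemma mdvdE:
  assumes "mdvd a b" obtains c where "b = a + c"
proof
  show "b = a + (b - a)"
    using assms by (intro poly_mapping_eqI) (simp add: lookup_add lookup_minus mdvd_def)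
qed

lemma mdvd_add: "mdvd a (a + c)"
  by (simp add: mdvd_def lookup_add)

lemma mdvd_add_coprime:
  assumes "mdvd a (b + c)" "keys a \<inter> keys c = {}"
  shows "mdvd a b"
  unfolding mdvd_def
proof
  fix v show "lookup a v \<le> lookup b v"
  proof (cases "v \<in> keys a")
    case True
    then have "lookup c v = 0" using assms(2) by (auto simp: in_keys_iff)
    then show ?thesis using assms(1) by (metis add.right_neutral lookup_add mdvd_def)
  qed (simp add: in_keys_iff)
qed

lemma in_keys_sum: "k \<in> keys (sum f S) \<Longrightarrow> \<exists>t\<in>S. k \<in> keys (f t)"
  by (metis (no_types, lifting) in_keys_iff lookup_sum sum.neutral)

text \<open>
  The same ring is considered with two orders of its variables: the order of the theorem, and one
  adapted to a Noether normalization. The order is therefore a parameter of the theory of leading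
  monomials.
\<close>

locale variable_order =
  fixes vless :: "'v \<Rightarrow> 'v \<Rightarrow> bool" (infix "\<sqsubset>\<^sub>v" 50)
  assumes vless_irrefl: "\<not> v \<sqsubset>\<^sub>v v"
    and vless_trans: "u \<sqsubset>\<^sub>v v \<Longrightarrow> v \<sqsubset>\<^sub>v w \<Longrightarrow> u \<sqsubset>\<^sub>v w"
    and vless_total: "v \<noteq> w \<Longrightarrow> v \<sqsubset>\<^sub>v w \<or> w \<sqsubset>\<^sub>v v"
begin

abbreviation prec (infix "\<prec>" 50) where "prec \<equiv> degrevlex_less vless"

lemma finite_vless_minimal:
  assumes "finite S" "S \<noteq> {}"
  shows "\<exists>v\<in>S. \<forall>w. w \<sqsubset>\<^sub>v v \<longrightarrow> w \<notin> S"
  using assms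
proof (induction rule: finite_ne_induct)
  case (singleton x) then show ?case using vless_irrefl by auto
next
  case (insert x F)
  then obtain v where v: "v \<in> F" "\<forall>w. w \<sqsubset>\<^sub>v v \<longrightarrow> w \<notin> F" by auto
  show ?case
  proof (cases "x \<sqsubset>\<^sub>v v")
    case True
    then have "\<forall>w. w \<sqsubset>\<^sub>v x \<longrightarrow> w \<notin> insert x F" using v vless_irrefl vless_trans by blast
    then show ?thesis by blast
  next
    case False then show ?thesis using v by blast
  qed
qed

lemma prec_irrefl: "\<not> a \<prec> a"
  by (auto simp: degrevlex_less_def)

lemma prec_trans:
  assumes "a \<prec> b" "b \<prec> c" shows "a \<prec> c"
proof (cases "mon_degree a < mon_degree b \<or> mon_degree b < mon_degree c")
  case True then show ?thesis using assms by (auto simp: degrevlex_less_def)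
next
  case False
  then have deg: "mon_degree a = mon_degree c" using assms by (auto simp: degrevlex_less_def)
  obtain v where v: "lookup a v > lookup b v" "\<And>w. w \<sqsubset>\<^sub>v v \<Longrightarrow> lookup a w = lookup b w"
    using assms False by (auto simp: degrevlex_less_def)
  obtain u where u: "lookup b u > lookup c u" "\<And>w. w \<sqsubset>\<^sub>v u \<Longrightarrow> lookup b w = lookup c w"
    using assms False by (auto simp: degrevlex_less_def)
  consider "u = v" | "u \<sqsubset>\<^sub>v v" | "v \<sqsubset>\<^sub>v u" using vless_total by blast
  then have "\<exists>v. lookup a v > lookup c v \<and> (\<forall>w. w \<sqsubset>\<^sub>v v \<longrightarrow> lookup a w = lookup c w)"
  proof cases
    case 1 then show ?thesis using u v by (metis less_trans)
  next
    case 2 then show ?thesis using u v vless_trans by (metis)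
  next
    case 3 then show ?thesis using u v vless_trans by (metis)
  qed
  then show ?thesis using deg by (auto simp: degrevlex_less_def)
qed

lemma prec_total:
  assumes "a \<noteq> b" shows "a \<prec> b \<or> b \<prec> a"
proof -
  let ?S = "{v. lookup a v \<noteq> lookup b v}"
  have "?S \<subseteq> keys a \<union> keys b" by (auto simp: in_keys_iff)
  then have "finite ?S" by (rule finite_subset) simp
  moreover have "?S \<noteq> {}" using assms poly_mapping_eqI[of a b] by auto
  ultimately have "\<exists>v\<in>?S. \<forall>w. w \<sqsubset>\<^sub>v v \<longrightarrow> w \<notin> ?S" by (rule finite_vless_minimal)
  then obtain v where v: "lookup a v \<noteq> lookup b v" "\<forall>w. w \<sqsubset>\<^sub>v v \<longrightarrow> lookup a w = lookup b w"
    by auto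
  then have "lookup a v < lookup b v \<or> lookup b v < lookup a v" by linarith
  moreover have "mon_degree a < mon_degree b \<or> mon_degree b < mon_degree a \<or> mon_degree a = mon_degree b"
    by linarith
  ultimately show ?thesis using v(2) unfolding degrevlex_less_def by (elim disjE) (simp_all, (metis v(2))+)
qed

lemma prec_add: "a \<prec> b \<Longrightarrow> c + a \<prec> c + b"
  by (auto simp: degrevlex_less_def mon_degree_add lookup_add)

lemma prec_add_both:
  assumes "a \<prec> b \<or> a = b" "c \<prec> d \<or> c = d" "(a, c) \<noteq> (b, d)"
  shows "a + c \<prec> b + d"
proof -
  have "a + c \<prec> b + c \<or> a = b" using assms(1) prec_add[of a b c] by (auto simp: add.commute)
  moreover have "b + c \<prec> b + d \<or> c = d" using assms(2) prec_add[of c d b] by auto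
  ultimately show ?thesis using assms(3) prec_trans by metis
qed

lemma prec_degree: "a \<prec> b \<Longrightarrow> mon_degree a \<le> mon_degree b"
  by (auto simp: degrevlex_less_def)

lemma finite_prec_maximal:
  assumes "finite S" "S \<noteq> {}"
  shows "\<exists>m\<in>S. \<forall>m'\<in>S. m' \<noteq> m \<longrightarrow> m' \<prec> m"
  using assms
proof (induction rule: finite_ne_induct)
  case (insert x F)
  then obtain m where m: "m \<in> F" "\<forall>m'\<in>F. m' \<noteq> m \<longrightarrow> m' \<prec> m" by auto
  show ?case using m prec_total[of x m] prec_trans by (metis insert_iff)
qed auto

text \<open>
  A relation instead of a function: \<open>lead 0 m\<close> is false, so that \<open>lead f m\<close> expresses also that
  \<open>f \<noteq> 0\<close>.
\<close>

definition lead :: "('v, 'a::field) mpol \<Rightarrow> 'v monomial \<Rightarrow> bool" where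
  "lead f m \<longleftrightarrow> lookup f m \<noteq> 0 \<and> (\<forall>m'\<in>keys f. m' \<noteq> m \<longrightarrow> m' \<prec> m)"

lemma lead_keys: "lead f m \<Longrightarrow> m \<in> keys f"
  by (auto simp: lead_def in_keys_iff)

lemma lead_nonzero: "lead f m \<Longrightarrow> f \<noteq> 0"
  by (auto simp: lead_def)

lemma lead_unique:
  assumes "lead f m" "lead f n" shows "m = n"
proof (rule ccontr)
  assume "m \<noteq> n"
  then have "m \<prec> n" "n \<prec> m"
    using assms lead_keys[OF assms(1)] lead_keys[OF assms(2)] by (auto simp: lead_def)
  then show False using prec_trans prec_irrefl by blast
qed

lemma lead_prec: "lead f m \<Longrightarrow> k \<in> keys f \<Longrightarrow> m \<prec> n \<Longrightarrow> k \<prec> n"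
  by (cases "k = m") (auto simp: lead_def intro: prec_trans)

lemma lead_exists: "f \<noteq> 0 \<Longrightarrow> \<exists>m. lead f m"
  using finite_prec_maximal[of "keys f"] by (auto simp: lead_def in_keys_iff)

lemma leading_monomial_eq:
  assumes "lead f m" shows "leading_monomial prec f = m"
  unfolding leading_monomial_def
proof (rule the_equality)
  show "m \<in> keys f \<and> (\<forall>m'\<in>keys f. m' \<noteq> m \<longrightarrow> m' \<prec> m)"
    using assms by (auto simp: lead_def in_keys_iff)
next
  fix n assume "n \<in> keys f \<and> (\<forall>m'\<in>keys f. m' \<noteq> n \<longrightarrow> m' \<prec> n)"
  then have "lead f n" by (auto simp: lead_def in_keys_iff)
  then show "n = m" using assms lead_unique by blast
qed

lemma lead_single: "c \<noteq> 0 \<Longrightarrow> lead (single m c) m"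
  by (auto simp: lead_def)

lemma lead_mvar: "lead (mvar v) (single v 1)"
  unfolding mvar_def by (rule lead_single) simp

lemma lead_add:
  assumes "lead f m" "\<And>k. k \<in> keys g \<Longrightarrow> k \<prec> m"
  shows "lead (f + g) m"
proof -
  have "lookup g m = 0" using assms(2) prec_irrefl by (auto simp: in_keys_iff)
  then show ?thesis using assms keys_add[of f g] unfolding lead_def by (auto simp: lookup_add)
qed

text \<open>
  Splitting off the leading term is the form in which division uses a leading monomial.
\<close>

lemma lead_split:
  assumes "lead f m"
  obtains f' where "f = single m (lookup f m) + f'" "\<And>k. k \<in> keys f' \<Longrightarrow> k \<prec> m \<and> k \<in> keys f"
proof
  let ?g = "f - single m (lookup f m)"
  show "f = single m (lookup f m) + ?g" by simp
  fix k assume k: "k \<in> keys ?g"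
  then have "k \<noteq> m" by (auto simp: in_keys_iff lookup_minus)
  then have "k \<in> keys f" using k by (auto simp: in_keys_iff lookup_minus lookup_single)
  then show "k \<prec> m \<and> k \<in> keys f" using assms \<open>k \<noteq> m\<close> by (auto simp: lead_def)
qed

text \<open>
  Products of smaller monomials are smaller, so the product of the leading terms occurs only once
  in the expansion and is not cancelled.
\<close>

lemma lead_mult:
  assumes "lead f m" "lead g n" shows "lead (f * g) (m + n)"
proof -
  obtain f' where f: "f = single m (lookup f m) + f'" "\<And>k. k \<in> keys f' \<Longrightarrow> k \<prec> m"
    using lead_split[OF assms(1)] by metis
  obtain g' where g: "g = single n (lookup g n) + g'" "\<And>k. k \<in> keys g' \<Longrightarrow> k \<prec> n"
    using lead_split[OF assms(2)] by metis
  let ?c = "lookup f m" let ?d = "lookup g n"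
  have "f * g = (single m ?c + f') * g" using f(1) by simp
  also have "\<dots> = single m ?c * (single n ?d + g') + f' * g" using g(1) by (simp add: distrib_right)
  finally have "f * g = single m ?c * single n ?d + single m ?c * g' + f' * g"
    by (simp add: distrib_left)
  then have eq: "f * g = single (m + n) (?c * ?d) + (single m ?c * g' + f' * g)"
    by (simp add: mult_single add.assoc)
  have "lead (single (m + n) (?c * ?d)) (m + n)"
    using assms by (intro lead_single) (auto simp: lead_def)
  moreover have "k \<prec> m + n" if k: "k \<in> keys (single m ?c * g' + f' * g)" for k
  proof -
    consider "k \<in> keys (single m ?c * g')" | "k \<in> keys (f' * g)" using k keys_add[of "single m ?c * g'" "f' * g"] by blast
    then show ?thesis
    proof cases
      case 1
      then obtain b where "b \<in> keys g'" "k = m + b" using keys_mult[of "single m ?c" g'] by (auto split: if_splits)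
      then show ?thesis using g(2) prec_add by auto
    next
      case 2
      then obtain a b where ab: "a \<in> keys f'" "b \<in> keys g" "k = a + b" using keys_mult[of f' g] by auto
      have "a \<prec> m" using ab f by auto
      moreover have "b \<prec> n \<or> b = n" using ab assms(2) by (auto simp: lead_def)
      ultimately show ?thesis using ab prec_irrefl by (auto intro!: prec_add_both)
    qed
  qed
  ultimately show ?thesis using eq lead_add by metis
qed

lemma lead_prod:
  assumes "finite S" "\<And>x. x \<in> S \<Longrightarrow> lead (f x) (m x)"
  shows "lead (prod f S) (sum m S)"
  using assms
proof (induction rule: finite_induct)
  case empty show ?case using lead_single[of 1 0] by (simp)
next
  case (insert x F) then show ?case by (simp add: lead_mult)
qed

lemma lead_sum_dominant:
  assumes "finite S" "s \<in> S" "lead (f s) m"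
    and "\<And>t k. t \<in> S \<Longrightarrow> t \<noteq> s \<Longrightarrow> k \<in> keys (f t) \<Longrightarrow> k \<prec> m"
  shows "lead (sum f S) m"
proof -
  have "sum f S = f s + sum f (S - {s})" using assms by (simp add: sum.remove)
  moreover have "k \<prec> m" if k: "k \<in> keys (sum f (S - {s}))" for k
  proof -
    obtain t where "t \<in> S - {s}" "k \<in> keys (f t)"
      using in_keys_sum[OF k] by blast
    then show ?thesis using assms(4) by auto
  qed
  ultimately show ?thesis using lead_add assms(3) by metis
qed

end

section \<open>Sequences with coprime leading monomials\<close>

text \<open>
  The hypotheses of Buchberger's product criterion. All initial segments of the sequence are
  treated together: \<open>J i\<close> is the ideal of the first \<open>i\<close> members. This allows induction over \<open>i\<close>,
  and comparing \<open>J i\<close> with \<open>J (Suc i)\<close> yields regular sequences.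
\<close>

locale coprime_leads = variable_order vless for vless :: "'v \<Rightarrow> 'v \<Rightarrow> bool" (infix "\<sqsubset>\<^sub>v" 50) +
  fixes V :: "'v set" and F :: "nat \<Rightarrow> ('v, 'a::field) mpol" and \<mu> :: "nat \<Rightarrow> 'v monomial" and l :: nat
  assumes finite_V: "finite V"
    and F_polys: "i < l \<Longrightarrow> F i \<in> polys V"
    and F_lead: "i < l \<Longrightarrow> lead (F i) (\<mu> i)"
    and coprime: "i < j \<Longrightarrow> j < l \<Longrightarrow> keys (\<mu> i) \<inter> keys (\<mu> j) = {}"
begin

definition std :: "nat \<Rightarrow> 'v monomial \<Rightarrow> bool" where
  "std i m \<longleftrightarrow> (\<forall>j<i. \<not> mdvd (\<mu> j) m)"

definition J :: "nat \<Rightarrow> ('v, 'a) mpol set" where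
  "J i = {\<Sum>j<i. a j * F j | a. \<forall>j<i. a j \<in> polys V}"

text \<open>
  For homogeneous members, division preserves degrees. This makes Hilbert functions accessible.
\<close>

definition homog :: "nat \<Rightarrow> bool" where
  "homog i \<longleftrightarrow> (\<forall>j<i. \<forall>k\<in>keys (F j). mon_degree k = mon_degree (\<mu> j))"

lemma J_I: "(\<And>j. j < i \<Longrightarrow> a j \<in> polys V) \<Longrightarrow> (\<Sum>j<i. a j * F j) \<in> J i"
  unfolding J_def by blast

lemma J_0: "0 \<in> J i"
  using J_I[of i "\<lambda>_. 0"] by simp

lemma J_add: assumes "f \<in> J i" "g \<in> J i" shows "f + g \<in> J i"
proof -
  obtain a b where "f = (\<Sum>j<i. a j * F j)" "g = (\<Sum>j<i. b j * F j)"
    and ab: "\<forall>j<i. a j \<in> polys V" "\<forall>j<i. b j \<in> polys V"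
    using assms unfolding J_def by blast
  then have "f + g = (\<Sum>j<i. (a j + b j) * F j)" by (simp add: sum.distrib distrib_right)
  then show ?thesis using J_I[of i "\<lambda>j. a j + b j"] ab by auto
qed

lemma J_mult: assumes "f \<in> J i" "c \<in> polys V" shows "c * f \<in> J i"
proof -
  obtain a where "f = (\<Sum>j<i. a j * F j)" and a: "\<forall>j<i. a j \<in> polys V"
    using assms unfolding J_def by blast
  then have "c * f = (\<Sum>j<i. (c * a j) * F j)" by (simp add: sum_distrib_left mult.assoc)
  then show ?thesis using J_I[of i "\<lambda>j. c * a j"] a assms by auto
qed

lemma J_uminus: "f \<in> J i \<Longrightarrow> - f \<in> J i"
  using J_mult[of f i "- 1"] by (auto simp: polys_uminus)

lemma J_diff: "f \<in> J i \<Longrightarrow> g \<in> J i \<Longrightarrow> f - g \<in> J i"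
  using J_add[OF _ J_uminus, of f i g] by simp

lemma J_sum: "(\<And>x. x \<in> S \<Longrightarrow> f x \<in> J i) \<Longrightarrow> sum f S \<in> J i"
  by (induction S rule: infinite_finite_induct) (auto simp: J_0 J_add)

lemma J_gen: assumes "j < i" shows "F j \<in> J i"
proof -
  have "(\<Sum>j'<i. (if j' = j then 1 else 0) * F j') = F j"
    using assms by (simp add: if_distrib[of "\<lambda>x. x * _"] cong: if_cong)
  then show ?thesis using J_I[of i "\<lambda>j'. if j' = j then 1 else 0"] by (auto split: if_splits)
qed

lemma J_polys: "i \<le> l \<Longrightarrow> J i \<subseteq> polys V"
  unfolding J_def using F_polys by (auto intro!: polys_sum polys_mult)

lemma J_Suc:
  assumes "g \<in> J (Suc i)"
  obtains b a where "b \<in> J i" "a \<in> polys V" "g = b + a * F i"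
proof -
  obtain a where "g = (\<Sum>j<Suc i. a j * F j)" "\<forall>j<Suc i. a j \<in> polys V"
    using assms unfolding J_def by blast
  then show ?thesis using that[of "\<Sum>j<i. a j * F j" "a i"] J_I[of i a] by auto
qed

text \<open>
  A monomial divisible by the leading monomial of some \<open>F j\<close> is congruent to a combination of
  smaller monomials. As a degree order has only finitely many monomials below a given one, the
  replacement terminates with a normal form.
\<close>

lemma monomial_division:
  assumes "i \<le> l" "keys m \<subseteq> V"
  shows "\<exists>g\<in>polys V. single m 1 - g \<in> J i \<and>
    (\<forall>k\<in>keys g. std i k \<and> (k = m \<or> k \<prec> m) \<and> (homog i \<longrightarrow> mon_degree k = mon_degree m))"
  using assms(2)
proof (induction "card {a. keys a \<subseteq> V \<and> a \<prec> m}" arbitrary: m rule: less_induct)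
  case less
  show ?case
  proof (cases "std i m")
    case True
    then show ?thesis using less.prems
      by (intro bexI[of _ "single m 1"]) (auto simp: J_0 polys_single)
  next
    case False
    then obtain j where j: "j < i" "mdvd (\<mu> j) m" by (auto simp: std_def)
    then obtain u where u: "m = \<mu> j + u" using mdvdE by blast
    have uV: "keys u \<subseteq> V" using less.prems u by (simp add: keys_add_nat)
    have jl: "j < l" using j assms by simp
    let ?c = "lookup (F j) (\<mu> j)"
    have c: "?c \<noteq> 0" using F_lead[OF jl] by (simp add: lead_def)
    obtain F' where F': "F j = single (\<mu> j) ?c + F'" "\<And>k. k \<in> keys F' \<Longrightarrow> k \<prec> \<mu> j \<and> k \<in> keys (F j)"
      using lead_split[OF F_lead[OF jl]] by blast
    define h where "h = - single u (inverse ?c) * F'"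
    have h: "h = single m 1 - single u (inverse ?c) * F j"
    proof -
      have "single u (inverse ?c) * F j = single m 1 + single u (inverse ?c) * F'"
        by (subst F'(1)) (use c in \<open>simp add: distrib_left mult_single u add.commute\<close>)
      then show ?thesis unfolding h_def by simp
    qed
    have hV: "h \<in> polys V" unfolding h using less.prems uV F_polys[OF jl]
      by (auto intro!: polys_diff polys_mult polys_single)
    have hk: "k \<prec> m" "keys k \<subseteq> V" "homog i \<Longrightarrow> mon_degree k = mon_degree m" if k: "k \<in> keys h" for k
    proof -
      obtain b where b: "b \<in> keys F'" "k = u + b"
        using k keys_mult[of "- single u (inverse ?c)" F'] unfolding h_def by (auto split: if_splits)
      show "k \<prec> m" using b F'(2) u prec_add[of b "\<mu> j" u] by (simp add: add.commute)
      show "keys k \<subseteq> V" using hV k by (auto simp: polys_def)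
      show "mon_degree k = mon_degree m" if "homog i"
        using that j b F'(2) u by (auto simp: homog_def mon_degree_add)
    qed
    have "\<exists>g\<in>polys V. single k 1 - g \<in> J i \<and>
      (\<forall>k'\<in>keys g. std i k' \<and> (k' = k \<or> k' \<prec> k) \<and> (homog i \<longrightarrow> mon_degree k' = mon_degree k))"
      if k: "k \<in> keys h" for k
    proof (rule less.hyps)
      have fin: "finite {a. keys a \<subseteq> V \<and> a \<prec> m}"
        by (rule finite_subset[OF _ monomials_degree_le(1)[OF finite_V, of "mon_degree m"]])
          (auto dest: prec_degree)
      show "card {a. keys a \<subseteq> V \<and> a \<prec> k} < card {a. keys a \<subseteq> V \<and> a \<prec> m}"
        using hk[OF k] prec_irrefl[of k] prec_trans by (intro psubset_card_mono[OF fin]) blast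
    qed (use hk[OF k] in auto)
    then obtain G where G: "\<And>k. k \<in> keys h \<Longrightarrow> G k \<in> polys V" "\<And>k. k \<in> keys h \<Longrightarrow> single k 1 - G k \<in> J i"
      "\<And>k k'. k \<in> keys h \<Longrightarrow> k' \<in> keys (G k) \<Longrightarrow> std i k' \<and> (k' = k \<or> k' \<prec> k) \<and> (homog i \<longrightarrow> mon_degree k' = mon_degree k)"
      by metis
    define g where "g = (\<Sum>k\<in>keys h. single 0 (lookup h k) * G k)"
    have "g \<in> polys V" unfolding g_def using G by (auto intro!: polys_sum polys_mult)
    moreover have "single m 1 - g \<in> J i"
    proof -
      have "h - g = (\<Sum>k\<in>keys h. single 0 (lookup h k) * (single k 1 - G k))"
        unfolding g_def by (subst (1) mpol_eq_sum)
          (simp add: sum_subtractf[symmetric] right_diff_distrib mult_single)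
      also have "\<dots> \<in> J i" using G by (intro J_sum J_mult) auto
      finally have "h - g \<in> J i" .
      moreover have "single u (inverse ?c) * F j \<in> J i" using j uV by (intro J_mult J_gen polys_single)
      ultimately have "(h - g) + single u (inverse ?c) * F j \<in> J i" by (rule J_add)
      then show ?thesis unfolding h by simp
    qed
    moreover have "std i k' \<and> (k' = m \<or> k' \<prec> m) \<and> (homog i \<longrightarrow> mon_degree k' = mon_degree m)"
      if k': "k' \<in> keys g" for k'
    proof -
      obtain k where k: "k \<in> keys h" "k' \<in> keys (single 0 (lookup h k) * G k)"
        using in_keys_sum[OF k'[unfolded g_def]] by blast
      then have "k' \<in> keys (G k)" using keys_mult[of "single 0 (lookup h k)" "G k"] by (auto split: if_splits)
      then show ?thesis using G(3)[OF k(1)] hk[OF k(1)] prec_trans by metis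
    qed
    ultimately show ?thesis by blast
  qed
qed

lemma division:
  assumes "i \<le> l" "f \<in> polys V"
  obtains g where "g \<in> polys V" "f - g \<in> J i"
    "\<And>k. k \<in> keys g \<Longrightarrow> std i k"
    "\<And>k. k \<in> keys g \<Longrightarrow> \<exists>m\<in>keys f. (k = m \<or> k \<prec> m) \<and> (homog i \<longrightarrow> mon_degree k = mon_degree m)"
proof -
  have "\<forall>m\<in>keys f. \<exists>g\<in>polys V. single m 1 - g \<in> J i \<and>
    (\<forall>k\<in>keys g. std i k \<and> (k = m \<or> k \<prec> m) \<and> (homog i \<longrightarrow> mon_degree k = mon_degree m))"
    using assms monomial_division by (auto simp: polys_def)
  then obtain G where G: "\<And>k. k \<in> keys f \<Longrightarrow> G k \<in> polys V" "\<And>k. k \<in> keys f \<Longrightarrow> single k 1 - G k \<in> J i"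
      "\<And>k k'. k \<in> keys f \<Longrightarrow> k' \<in> keys (G k) \<Longrightarrow> std i k' \<and> (k' = k \<or> k' \<prec> k) \<and> (homog i \<longrightarrow> mon_degree k' = mon_degree k)"
    by metis
  define g where "g = (\<Sum>k\<in>keys f. single 0 (lookup f k) * G k)"
  have "g \<in> polys V" unfolding g_def using G by (auto intro!: polys_sum polys_mult)
  moreover have "f - g = (\<Sum>k\<in>keys f. single 0 (lookup f k) * (single k 1 - G k))"
    unfolding g_def by (subst (1) mpol_eq_sum)
      (simp add: sum_subtractf[symmetric] right_diff_distrib mult_single)
  then have "f - g \<in> J i" using G by (auto intro!: J_sum J_mult)
  moreover have *: "\<exists>m\<in>keys f. std i k' \<and> (k' = m \<or> k' \<prec> m) \<and> (homog i \<longrightarrow> mon_degree k' = mon_degree m)"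
    if k': "k' \<in> keys g" for k'
  proof -
    obtain k where k: "k \<in> keys f" "k' \<in> keys (single 0 (lookup f k) * G k)"
      using in_keys_sum[OF k'[unfolded g_def]] by blast
    then have "k' \<in> keys (G k)" using keys_mult[of "single 0 (lookup f k)" "G k"] by (auto split: if_splits)
    then show ?thesis using G(3)[OF k(1)] k(1) by blast
  qed
  ultimately show ?thesis using that by blast
qed

text \<open>
  Write a member of \<open>J (Suc i)\<close> as \<open>b + a F_i\<close> with \<open>b \<in> J i\<close> and \<open>a\<close> in normal form with respect
  to the first \<open>i\<close> members. By coprimality the leading monomial of \<open>a F_i\<close> is divisible by none of
  the first \<open>i\<close> leading monomials, but that of \<open>b\<close> is. So these two monomials differ, nothing
  cancels, and one of them is the leading monomial of the sum.
\<close>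

lemma lead_in_J:
  assumes "i \<le> l" "g \<in> J i" "lead g m"
  shows "\<exists>j<i. mdvd (\<mu> j) m"
  using assms
proof (induction i arbitrary: g m)
  case 0
  then have "g = 0" by (simp add: J_def)
  then show ?case using 0 lead_nonzero by blast
next
  case (Suc i)
  obtain b0 a0 where b0: "b0 \<in> J i" "a0 \<in> polys V" "g = b0 + a0 * F i" using J_Suc[OF Suc.prems(2)] .
  have il: "i < l" "i \<le> l" using Suc.prems by auto
  obtain a where a: "a \<in> polys V" "a0 - a \<in> J i" "\<And>k. k \<in> keys a \<Longrightarrow> std i k"
    using division[OF il(2) b0(2)] by metis
  define b where "b = b0 + F i * (a0 - a)"
  have b: "b \<in> J i" unfolding b_def using b0 a F_polys[OF il(1)] by (intro J_add J_mult)
  have g: "g = b + a * F i" unfolding b_def b0(3) by (simp add: algebra_simps)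
  show ?case
  proof (cases "a = 0")
    case True
    then have "\<exists>j<i. mdvd (\<mu> j) m" using Suc.IH[of b m] b g il Suc.prems by simp
    then show ?thesis using less_Suc_eq by blast
  next
    case False
    then obtain u where u: "lead a u" using lead_exists by blast
    let ?w = "u + \<mu> i"
    have la: "lead (a * F i) ?w" by (rule lead_mult[OF u F_lead[OF il(1)]])
    have nd: "\<not> mdvd (\<mu> j) ?w" if "j < i" for j
      using mdvd_add_coprime[of "\<mu> j" u "\<mu> i"] coprime[OF that il(1)] a(3)[OF lead_keys[OF u]] that
      by (auto simp: std_def)
    show ?thesis
    proof (cases "b = 0")
      case True
      then have "m = ?w" using la g lead_unique Suc.prems by simp
      then show ?thesis using mdvd_add[of "\<mu> i" u] by (auto simp: add.commute)
    next
      case False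
      then obtain v where v: "lead b v" using lead_exists by blast
      then obtain j where j: "j < i" "mdvd (\<mu> j) v" using Suc.IH b il by blast
      then have "v \<noteq> ?w" using nd by blast
      then consider "v \<prec> ?w" | "?w \<prec> v" using prec_total by blast
      then show ?thesis
      proof cases
        case 1
        have "k \<prec> ?w" if "k \<in> keys b" for k
          using lead_prec[OF v that 1] .
        then have "lead (a * F i + b) ?w" using lead_add[OF la] by blast
        then have "m = ?w" using g lead_unique Suc.prems by (simp add: add.commute)
        then show ?thesis using mdvd_add[of "\<mu> i" u] by (auto simp: add.commute)
      next
        case 2
        have "k \<prec> v" if "k \<in> keys (a * F i)" for k
          using lead_prec[OF la that 2] .
        then have "lead (b + a * F i) v" using lead_add[OF v] by blast
        then have "m = v" using g lead_unique Suc.prems by simp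
        then show ?thesis using j less_Suc_eq by blast
      qed
    qed
  qed
qed

text \<open>Uniqueness of normal forms.\<close>

lemma std_in_J_zero:
  assumes "i \<le> l" "g \<in> J i" "\<And>k. k \<in> keys g \<Longrightarrow> std i k"
  shows "g = 0"
proof (rule ccontr)
  assume "g \<noteq> 0"
  then obtain m where m: "lead g m" using lead_exists by blast
  then show False using lead_in_J[OF assms(1,2) m] assms(3)[OF lead_keys[OF m]] by (auto simp: std_def)
qed

text \<open>
  Reduce \<open>a0\<close> to normal form \<open>a\<close>. Since the leading monomial of \<open>g\<close> is coprime to all \<open>\<mu> j\<close>, the
  leading monomial of \<open>g a\<close> is divisible by some \<open>\<mu> j\<close> only if that of \<open>a\<close> is; so \<open>a = 0\<close>. This
  covers the members of the sequence themselves as well as other polynomials.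
\<close>

lemma nonzerodivisor_mod_J:
  assumes "i \<le> l" "g \<in> polys V" "lead g n" "\<And>j. j < i \<Longrightarrow> keys (\<mu> j) \<inter> keys n = {}"
    and "a0 \<in> polys V" "g * a0 \<in> J i"
  shows "a0 \<in> J i"
proof -
  obtain a where a: "a \<in> polys V" "a0 - a \<in> J i" "\<And>k. k \<in> keys a \<Longrightarrow> std i k"
    using division[OF assms(1,5)] by metis
  have "g * a0 - g * (a0 - a) \<in> J i" by (rule J_diff[OF assms(6) J_mult[OF a(2) assms(2)]])
  then have ga: "a * g \<in> J i" by (simp add: algebra_simps)
  have "a = 0"
  proof (rule ccontr)
    assume "a \<noteq> 0"
    then obtain u where u: "lead a u" using lead_exists by blast
    obtain j where j: "j < i" "mdvd (\<mu> j) (u + n)"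
      using lead_in_J[OF assms(1) ga lead_mult[OF u assms(3)]] by blast
    then have "mdvd (\<mu> j) u" using mdvd_add_coprime assms(4) by blast
    then show False using a(3)[OF lead_keys[OF u]] j by (auto simp: std_def)
  qed
  then show ?thesis using a by simp
qed

lemma F_regular:
  assumes "i < l" "a \<in> polys V" "F i * a \<in> J i"
  shows "a \<in> J i"
  using assms by (intro nonzerodivisor_mod_J[of i "F i" "\<mu> i" a] F_polys F_lead coprime) auto

lemma one_notin_J:
  assumes "i \<le> l" "\<And>j. j < i \<Longrightarrow> \<mu> j \<noteq> 0"
  shows "1 \<notin> J i"
proof
  assume "1 \<in> J i"
  moreover have "std i 0"
    unfolding std_def mdvd_def
  proof (intro allI impI notI)
    fix j assume "j < i" "\<forall>v. lookup (\<mu> j) v \<le> lookup 0 v"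
    then have "\<mu> j = 0" by (intro poly_mapping_eqI) simp
    then show False using assms(2) \<open>j < i\<close> by blast
  qed
  ultimately show False using std_in_J_zero[OF assms(1), of 1] by simp
qed

end

lemma mpol_no_zero_divisors:
  assumes "variable_order (vless :: 'v \<Rightarrow> 'v \<Rightarrow> bool)" "f * g = (0 :: ('v, 'a::field) mpol)"
  shows "f = 0 \<or> g = 0"
proof (rule ccontr)
  interpret variable_order vless by fact
  assume "\<not> ?thesis"
  then obtain m n where "lead f m" "lead g n" using lead_exists by metis
  then have "f * g \<noteq> 0" using lead_mult lead_nonzero by blast
  then show False using assms by simp
qed

section \<open>Regular sequences and chains of primes\<close>

text \<open>
  Krull's theorem: an ideal that is maximal among those containing \<open>J\<close> and disjoint from the
  multiplicative set \<open>S\<close> is prime. If \<open>a b \<in> M\<close> with \<open>b \<notin> M\<close>, the colon ideal \<open>M : a\<close> is larger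
  than \<open>M\<close> and meets \<open>S\<close>, say in \<open>s\<close>; if \<open>a \<notin> M\<close> too, then \<open>M : s\<close> is larger than \<open>M\<close> and contains
  some \<open>t \<in> S\<close>, although \<open>s t\<close> belongs to \<open>S\<close>, which is disjoint from \<open>M\<close>.
\<close>

lemma (in cring) exists_prime_disjoint:
  assumes J: "ideal J R" and S: "S \<subseteq> carrier R" "\<one> \<in> S" "\<And>s t. s \<in> S \<Longrightarrow> t \<in> S \<Longrightarrow> s \<otimes> t \<in> S"
    and JS: "J \<inter> S = {}"
  obtains Q where "primeideal Q R" "J \<subseteq> Q" "Q \<inter> S = {}"
proof -
  let ?A = "{I. ideal I R \<and> J \<subseteq> I \<and> I \<inter> S = {}}"
  have "\<exists>M\<in>?A. \<forall>X\<in>?A. M \<subseteq> X \<longrightarrow> X = M"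
  proof (rule subset_Zorn_nonempty)
    show "?A \<noteq> {}" using J JS by blast
    fix C assume C: "C \<noteq> {}" "subset.chain ?A C"
    then have "subset.chain {I. ideal I R} C" unfolding pred_on.chain_def by blast
    from chain_Union_is_ideal[OF this] have "ideal (\<Union>C) R" using C(1) by simp
    moreover have "J \<subseteq> \<Union>C" "\<Union>C \<inter> S = {}" using C unfolding pred_on.chain_def by blast+
    ultimately show "\<Union>C \<in> ?A" by simp
  qed
  then obtain M where M: "ideal M R" "J \<subseteq> M" "M \<inter> S = {}"
    and max: "\<And>X. ideal X R \<Longrightarrow> J \<subseteq> X \<Longrightarrow> X \<inter> S = {} \<Longrightarrow> M \<subseteq> X \<Longrightarrow> X = M" by auto
  interpret M: ideal M R by fact
  have colon: "ideal {x \<in> carrier R. a \<otimes> x \<in> M} R" "M \<subseteq> {x \<in> carrier R. a \<otimes> x \<in> M}" if "a \<in> carrier R" for a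
    using M.helper_max_prime[OF is_cring that] M.I_l_closed that M.a_Hcarr by auto
  have meets: "\<exists>s\<in>S. a \<otimes> s \<in> M" if a: "a \<in> carrier R" and x: "x \<in> carrier R" "a \<otimes> x \<in> M" "x \<notin> M" for a x
  proof (rule ccontr)
    assume "\<not> ?thesis"
    then have "{x \<in> carrier R. a \<otimes> x \<in> M} \<inter> S = {}" by blast
    then have "{x \<in> carrier R. a \<otimes> x \<in> M} = M" using max[OF colon(1)[OF a]] colon(2)[OF a] M(2) by blast
    then show False using x by blast
  qed
  have "primeideal M R"
  proof (rule primeidealI[OF M(1) is_cring])
    show "carrier R \<noteq> M" using M(3) S by blast
    fix a b assume ab: "a \<in> carrier R" "b \<in> carrier R" "a \<otimes> b \<in> M"
    show "a \<in> M \<or> b \<in> M"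
    proof (rule ccontr)
      assume n: "\<not> ?thesis"
      then obtain s where s: "s \<in> S" "a \<otimes> s \<in> M" using meets ab by blast
      then have "s \<otimes> a \<in> M" using ab S m_comm by (metis subsetD)
      then obtain t where "t \<in> S" "s \<otimes> t \<in> M" using meets[of s a] ab n s S by blast
      then show False using S(3) s M(3) by blast
    qed
  qed
  then show ?thesis using that M by blast
qed

lemma regular_sequence_butlast:
  assumes "cring R" "regular_sequence R (fs @ [f])"
  shows "regular_sequence R fs"
proof -
  interpret cring R by fact
  have c: "set fs \<subseteq> carrier R" "f \<in> carrier R" using assms(2) by (auto simp: regular_sequence_def)
  have id: "ideal (Idl\<^bsub>R\<^esub> (set (fs @ [f]))) R" using c by (intro genideal_ideal) auto
  have "genideal R (set fs) \<noteq> carrier R"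
  proof
    assume "genideal R (set fs) = carrier R"
    moreover have "genideal R (set fs) \<subseteq> genideal R (set (fs @ [f]))"
      using c by (intro subset_Idl_subset) auto
    moreover have "genideal R (set (fs @ [f])) \<subseteq> carrier R"
      using ideal.Icarr[OF id] by blast
    ultimately show False using assms(2) unfolding regular_sequence_def by blast
  qed
  moreover have "mult R (fs ! i) a \<in> genideal R (set (take i fs)) \<longrightarrow> a \<in> genideal R (set (take i fs))"
    if "i < length fs" "a \<in> carrier R" for i a
  proof -
    have "\<forall>i<length (fs @ [f]). \<forall>a\<in>carrier R. mult R ((fs @ [f]) ! i) a \<in> genideal R (set (take i (fs @ [f]))) \<longrightarrow>
        a \<in> genideal R (set (take i (fs @ [f])))"
      using assms(2) unfolding regular_sequence_def by blast
    from this[rule_format, of i a] show ?thesis using that by (simp add: nth_append)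
  qed
  ultimately show ?thesis using c unfolding regular_sequence_def by blast
qed

lemma regular_sequence_last:
  assumes "regular_sequence R (fs @ [f])" "a \<in> carrier R" "mult R f a \<in> genideal R (set fs)"
  shows "a \<in> genideal R (set fs)"
proof -
  have "\<forall>i<length (fs @ [f]). \<forall>a\<in>carrier R. mult R ((fs @ [f]) ! i) a \<in> genideal R (set (take i (fs @ [f]))) \<longrightarrow>
      a \<in> genideal R (set (take i (fs @ [f])))"
    using assms(1) unfolding regular_sequence_def by blast
  from this[rule_format, of "length fs" a] assms show ?thesis by simp
qed

text \<open>
  Let \<open>f\<close> be the last member and \<open>J\<close> the ideal of the others. The elements \<open>s f^n\<close> with \<open>s \<notin> Q\<close>
  form a multiplicative set, and it avoids \<open>J\<close>: powers of \<open>f\<close> can be cancelled modulo \<open>J\<close>, and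
  \<open>J \<subseteq> Q\<close>. A prime containing \<open>J\<close> and disjoint from this set lies in \<open>Q\<close> and omits \<open>f\<close>, so it is a
  proper step down.
\<close>

lemma (in cring) regular_sequence_prime_chain:
  assumes "primeideal Q R" "regular_sequence R fs" "set fs \<subseteq> Q"
  shows "\<exists>Ps. length Ps = length fs \<and> prime_chain R (Ps @ [Q])"
  using assms
proof (induction fs arbitrary: Q rule: rev_induct)
  case Nil
  then show ?case by (intro exI[of _ "[]"]) (auto simp: prime_chain_def)
next
  case (snoc f fs)
  interpret Q: primeideal Q R by fact
  have c: "f \<in> carrier R" "f \<in> Q" "set fs \<subseteq> carrier R" "set fs \<subseteq> Q"
    using snoc.prems by (auto simp: regular_sequence_def)
  let ?J = "genideal R (set fs)"
  have J: "ideal ?J R" "?J \<subseteq> Q" using c(3) genideal_ideal genideal_minimal[OF Q.is_ideal c(4)] by auto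
  interpret J: ideal ?J R by fact
  let ?S = "{s \<otimes> f [^] n | s n. s \<in> carrier R - Q \<and> (n::nat) \<in> UNIV}"
  have cancel: "a \<in> ?J" if "a \<in> carrier R" "a \<otimes> f [^] n \<in> ?J" for a and n :: nat
    using that(2)
  proof (induction n)
    case 0 then show ?case using that by simp
  next
    case (Suc n)
    have "f \<otimes> (a \<otimes> f [^] n) = a \<otimes> f [^] Suc n" using that c by (simp add: m_ac)
    then have "a \<otimes> f [^] n \<in> ?J"
      using regular_sequence_last[OF snoc.prems(2), of "a \<otimes> f [^] n"] Suc.prems that c by simp
    then show ?case using Suc.IH by blast
  qed
  obtain Q' where Q': "primeideal Q' R" "?J \<subseteq> Q'" "Q' \<inter> ?S = {}"
  proof (rule exists_prime_disjoint[OF J(1), of ?S])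
    show "?S \<subseteq> carrier R" using c by auto
    have "\<one> = \<one> \<otimes> f [^] (0::nat)" "\<one> \<in> carrier R - Q" using Q.one_imp_carrier Q.I_notcarr by auto
    then show "\<one> \<in> ?S" by blast
    show "x \<otimes> y \<in> ?S" if xy: "x \<in> ?S" "y \<in> ?S" for x y
    proof -
      obtain s m t n where x: "x = s \<otimes> f [^] (m::nat)" "s \<in> carrier R - Q" and y: "y = t \<otimes> f [^] (n::nat)" "t \<in> carrier R - Q"
        using xy by blast
      have "x \<otimes> y = (s \<otimes> t) \<otimes> f [^] (m + n)" using x y c by (simp add: m_ac nat_pow_mult[symmetric])
      moreover have "s \<otimes> t \<in> carrier R - Q" using Q.I_prime x y by auto
      ultimately show ?thesis by blast
    qed
    show "?J \<inter> ?S = {}" using cancel J(2) by blast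
  qed blast
  interpret Q': primeideal Q' R by fact
  have sub: "Q' \<subseteq> Q"
  proof
    fix s assume s: "s \<in> Q'"
    have "s = s \<otimes> f [^] (0::nat)" using s Q'.a_Hcarr by simp
    then show "s \<in> Q" using s Q'(3) Q'.a_Hcarr by blast
  qed
  have "f = \<one> \<otimes> f [^] (1::nat)" using c by simp
  then have "f \<in> ?S" using Q.one_imp_carrier Q.I_notcarr by blast
  then have "Q' \<subset> Q" using sub c Q'(3) by blast
  moreover have "set fs \<subseteq> Q'" using Q'(2) genideal_self c by blast
  then obtain Ps where Ps: "length Ps = length fs" "prime_chain R (Ps @ [Q'])"
    using snoc.IH[OF Q'(1) regular_sequence_butlast[OF is_cring snoc.prems(2)]] by blast
  ultimately have "prime_chain R ((Ps @ [Q']) @ [Q])"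
    using snoc.prems(1) unfolding prime_chain_def by (auto simp: sorted_wrt_append)
  then show ?case using Ps(1) by (intro exI[of _ "Ps @ [Q']"]) simp
qed

lemma (in cring) depth_le_height:
  assumes "primeideal Q R" shows "ideal_depth R Q \<le> prime_height R Q"
  unfolding ideal_depth_def
proof (rule Sup_least, clarify)
  fix fs assume "regular_sequence R fs" "set fs \<subseteq> Q"
  then obtain Ps where "length Ps = length fs" "prime_chain R (Ps @ [Q])"
    using regular_sequence_prime_chain[OF assms] by blast
  then show "enat (length fs) \<le> prime_height R Q"
    unfolding prime_height_def by (intro Sup_upper) (auto intro!: exI[of _ Ps])
qed

lemma prime_chain_replace_last:
  assumes "prime_chain R (Ps @ [P])" "P \<subseteq> Q" "primeideal Q R"
  shows "prime_chain R (Ps @ [Q])"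
  using assms unfolding prime_chain_def by (auto simp: sorted_wrt_append)

lemma prime_height_mono:
  assumes "P \<subseteq> Q" "primeideal Q R" shows "prime_height R P \<le> prime_height R Q"
  unfolding prime_height_def using prime_chain_replace_last[OF _ assms] by (intro Sup_subset_mono) blast

text \<open>The infimum over all primes above a prime is attained at the prime itself.\<close>

lemma ideal_height_prime:
  assumes "primeideal P R" shows "ideal_height R P = prime_height R P"
  unfolding ideal_height_def
proof (rule antisym)
  show "Inf {prime_height R P' | P'. primeideal P' R \<and> P \<subseteq> P'} \<le> prime_height R P"
    using assms by (intro Inf_lower) blast
  show "prime_height R P \<le> Inf {prime_height R P' | P'. primeideal P' R \<and> P \<subseteq> P'}"
    using prime_height_mono by (intro Inf_greatest) blast
qed

lemma prime_height_le:
  assumes "\<And>Ps. prime_chain R (Ps @ [P]) \<Longrightarrow> length Ps \<le> n"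
  shows "prime_height R P \<le> enat n"
  unfolding prime_height_def using assms by (intro Sup_least) auto

section \<open>Quotients of commutative rings\<close>

text \<open>
  The projection to the quotient is the coset map; ideals and chains of primes of the quotient are
  pulled back along it.
\<close>

locale cring_ideal = A: cring A + I: ideal I A for I and A (structure)
begin

abbreviation proj where "proj \<equiv> a_r_coset A I"

lemma Quot_cring: "cring (A Quot I)"
  by (rule I.quotient_is_cring[OF A.is_cring])

lemma proj_hom: "ring_hom_cring A (A Quot I) proj"
  by (rule I.rcos_ring_hom_cring[OF A.is_cring])

lemma carrier_Quot: "carrier (A Quot I) = proj ` carrier A"
  unfolding FactRing_def using A_RCOSETS_def'[of A I] by auto

sublocale Q: cring "A Quot I" by (rule Quot_cring)
sublocale P: ring_hom_cring A "A Quot I" proj by (rule proj_hom)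

lemma proj_eq_iff: "a \<in> carrier A \<Longrightarrow> b \<in> carrier A \<Longrightarrow> proj a = proj b \<longleftrightarrow> a \<ominus> b \<in> I"
  using A.quotient_eq_iff_same_a_r_cos[OF I.is_ideal] by simp

lemma proj_eq_zero_iff: "a \<in> carrier A \<Longrightarrow> proj a = zero (A Quot I) \<longleftrightarrow> a \<in> I"
  using proj_eq_iff[of a \<zero>] P.hom_zero by (simp add: a_minus_def)

lemma proj_mem_image:
  assumes "ideal L A" "I \<subseteq> L" "a \<in> carrier A" "proj a \<in> proj ` L" shows "a \<in> L"
proof -
  interpret L: ideal L A by fact
  obtain b where b: "b \<in> L" "proj a = proj b" using assms by blast
  then have "a \<ominus> b \<in> L" using proj_eq_iff[of a b] L.a_Hcarr assms by auto
  then have "(a \<ominus> b) \<oplus> b \<in> L" using b by simp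
  moreover have "(a \<ominus> b) \<oplus> b = a" using assms b L.a_Hcarr by algebra
  ultimately show ?thesis by simp
qed

lemma proj_image_ideal: "ideal L A \<Longrightarrow> ideal (proj ` L) (A Quot I)"
  by (rule A.ring_ideal_imp_quot_ideal[OF I.is_ideal])

lemma vimage_ideal: "ideal L (A Quot I) \<Longrightarrow> ideal {a \<in> carrier A. proj a \<in> L} A"
  by (rule ring_hom_ring.ideal_vimage[OF I.rcos_ring_hom_ring])

lemma proj_mem_genideal_iff:
  assumes "S \<subseteq> carrier A" "a \<in> carrier A"
  shows "proj a \<in> genideal (A Quot I) (proj ` S) \<longleftrightarrow> a \<in> genideal A (I \<union> S)"
proof
  have cS: "proj ` S \<subseteq> carrier (A Quot I)" using assms carrier_Quot by auto
  have IS: "I \<union> S \<subseteq> carrier A" using assms I.a_subset by auto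
  show "a \<in> genideal A (I \<union> S)" if "proj a \<in> genideal (A Quot I) (proj ` S)"
  proof (rule proj_mem_image)
    show id: "ideal (genideal A (I \<union> S)) A" by (rule A.genideal_ideal[OF IS])
    show "I \<subseteq> genideal A (I \<union> S)" using A.genideal_self[OF IS] by blast
    have "genideal (A Quot I) (proj ` S) \<subseteq> proj ` genideal A (I \<union> S)"
      using A.genideal_self[OF IS] by (intro Q.genideal_minimal proj_image_ideal id) blast
    then show "proj a \<in> proj ` genideal A (I \<union> S)" using that by blast
  qed fact
  show "proj a \<in> genideal (A Quot I) (proj ` S)" if a: "a \<in> genideal A (I \<union> S)"
  proof -
    let ?L = "genideal (A Quot I) (proj ` S)"
    have L: "ideal ?L (A Quot I)" by (rule Q.genideal_ideal[OF cS])
    interpret L: ideal ?L "A Quot I" by fact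
    have "proj b \<in> ?L" if "b \<in> I" for b
      using that proj_eq_zero_iff[of b] I.a_Hcarr L.zero_closed by auto
    then have "I \<union> S \<subseteq> {a \<in> carrier A. proj a \<in> ?L}" using Q.genideal_self[OF cS] IS by auto
    then have "genideal A (I \<union> S) \<subseteq> {a \<in> carrier A. proj a \<in> ?L}"
      by (intro A.genideal_minimal vimage_ideal L)
    then show ?thesis using a by blast
  qed
qed

lemma vimage_prime:
  assumes "primeideal L (A Quot I)"
  shows "primeideal {a \<in> carrier A. proj a \<in> L} A" "I \<subseteq> {a \<in> carrier A. proj a \<in> L}"
proof -
  interpret L: primeideal L "A Quot I" by fact
  show "primeideal {a \<in> carrier A. proj a \<in> L} A"
  proof (rule primeidealI[OF vimage_ideal[OF L.is_ideal] A.is_cring])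
    have "proj \<one> \<notin> L" using L.one_imp_carrier L.I_notcarr P.hom_one by metis
    then show "carrier A \<noteq> {a \<in> carrier A. proj a \<in> L}" by blast
    show "a \<in> {a \<in> carrier A. proj a \<in> L} \<or> b \<in> {a \<in> carrier A. proj a \<in> L}"
      if "a \<in> carrier A" "b \<in> carrier A" "a \<otimes> b \<in> {a \<in> carrier A. proj a \<in> L}" for a b
      using that L.I_prime[of "proj a" "proj b"] P.hom_closed by auto
  qed
  show "I \<subseteq> {a \<in> carrier A. proj a \<in> L}"
  proof
    fix b assume b: "b \<in> I"
    then have "proj b = zero (A Quot I)" using proj_eq_zero_iff[of b] I.a_Hcarr by auto
    then have "proj b \<in> L" using L.zero_closed by simp
    then show "b \<in> {a \<in> carrier A. proj a \<in> L}" using b I.a_Hcarr by simp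
  qed
qed

lemma vimage_strict:
  assumes "L \<subset> L'" "L' \<subseteq> carrier (A Quot I)"
  shows "{a \<in> carrier A. proj a \<in> L} \<subset> {a \<in> carrier A. proj a \<in> L'}"
proof -
  obtain x where "x \<in> L'" "x \<notin> L" using assms by blast
  moreover then obtain a where "a \<in> carrier A" "x = proj a" using assms carrier_Quot by auto
  ultimately have "a \<in> carrier A" "proj a \<in> L'" "proj a \<notin> L" by auto
  then show ?thesis using assms by blast
qed

lemma prime_chain_vimage:
  assumes "prime_chain (A Quot I) Ps"
  shows "prime_chain A (map (\<lambda>L. {a \<in> carrier A. proj a \<in> L}) Ps)"
    and "\<forall>P\<in>set (map (\<lambda>L. {a \<in> carrier A. proj a \<in> L}) Ps). I \<subseteq> P"
proof -
  have car: "L \<subseteq> carrier (A Quot I)" if "L \<in> set Ps" for L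
  proof -
    have "ideal L (A Quot I)" using assms that primeideal.axioms(1) unfolding prime_chain_def by blast
    then show ?thesis using ideal.Icarr[of L "A Quot I"] by blast
  qed
  have "sorted_wrt (\<lambda>L L'. {a \<in> carrier A. proj a \<in> L} \<subset> {a \<in> carrier A. proj a \<in> L'}) Ps"
  proof (rule sorted_wrt_mono_rel[of Ps "(\<subset>)"])
    show "sorted_wrt (\<subset>) Ps" using assms by (simp add: prime_chain_def)
    show "{a \<in> carrier A. proj a \<in> L} \<subset> {a \<in> carrier A. proj a \<in> L'}"
      if "L \<in> set Ps" "L' \<in> set Ps" "L \<subset> L'" for L L'
      by (rule vimage_strict[OF that(3) car[OF that(2)]])
  qed
  then show "prime_chain A (map (\<lambda>L. {a \<in> carrier A. proj a \<in> L}) Ps)"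
    using assms vimage_prime(1) unfolding prime_chain_def by (auto simp: sorted_wrt_map)
  show "\<forall>P\<in>set (map (\<lambda>L. {a \<in> carrier A. proj a \<in> L}) Ps). I \<subseteq> P"
    using assms vimage_prime(2) unfolding prime_chain_def by auto
qed

text \<open>Generators of the preimage of an ideal project to generators of the ideal.\<close>

lemma noetherian_Quot:
  assumes "noetherian_ring A" shows "noetherian_ring (A Quot I)"
proof (rule Q.noetherian_ringI)
  fix L assume L: "ideal L (A Quot I)"
  let ?L = "{a \<in> carrier A. proj a \<in> L}"
  obtain S where S: "S \<subseteq> carrier A" "finite S" "?L = genideal A S"
    using noetherian_ring.finetely_gen[OF assms vimage_ideal[OF L]] by blast
  have SL: "S \<subseteq> ?L" using S A.genideal_self by blast
  have cS: "proj ` S \<subseteq> carrier (A Quot I)" using S carrier_Quot by auto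
  have "L \<subseteq> genideal (A Quot I) (proj ` S)"
  proof
    fix x assume x: "x \<in> L"
    then obtain a where a: "a \<in> carrier A" "x = proj a" using ideal.Icarr[OF L] carrier_Quot by auto
    then have "a \<in> genideal A S" using x S by blast
    then have "a \<in> genideal A (I \<union> S)" using A.subset_Idl_subset[of "I \<union> S" S] S I.a_subset by blast
    then show "x \<in> genideal (A Quot I) (proj ` S)" using proj_mem_genideal_iff S a by blast
  qed
  moreover have "genideal (A Quot I) (proj ` S) \<subseteq> L"
    using SL by (intro Q.genideal_minimal L) auto
  ultimately show "\<exists>S\<subseteq>carrier (A Quot I). finite S \<and> L = genideal (A Quot I) S"
    using S cS by (intro exI[of _ "proj ` S"]) auto
qed

end

text \<open>
  Membership in the ideal generated by images of elements means membership of a preimage in the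
  ideal generated by these elements and \<open>gs\<close>. So the condition for the images of \<open>fs\<close> is the
  condition for the members of \<open>gs @ fs\<close> that come after \<open>gs\<close>.
\<close>

lemma regular_sequence_Quot:
  assumes "cring A" "regular_sequence A (gs @ fs)"
  shows "regular_sequence (A Quot genideal A (set gs)) (map (a_r_coset A (genideal A (set gs))) fs)"
proof -
  interpret A: cring A by fact
  have c: "set gs \<subseteq> carrier A" "set fs \<subseteq> carrier A" using assms by (auto simp: regular_sequence_def)
  let ?I = "genideal A (set gs)"
  interpret cring_ideal ?I A by (intro cring_ideal.intro A.genideal_ideal assms(1) c)
  have gen: "genideal A (?I \<union> S) = genideal A (set gs \<union> S)" if "S \<subseteq> carrier A" for S
  proof
    show "genideal A (set gs \<union> S) \<subseteq> genideal A (?I \<union> S)"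
      using A.genideal_self[OF c(1)] that I.a_subset by (intro A.subset_Idl_subset) auto
    have "?I \<subseteq> genideal A (set gs \<union> S)" using c that by (intro A.subset_Idl_subset) auto
    then show "genideal A (?I \<union> S) \<subseteq> genideal A (set gs \<union> S)"
      using c that A.genideal_self[of "set gs \<union> S"] by (intro A.genideal_minimal A.genideal_ideal) auto
  qed
  have iff: "proj a \<in> genideal (A Quot ?I) (proj ` S) \<longleftrightarrow> a \<in> genideal A (set gs \<union> S)"
    if "S \<subseteq> carrier A" "a \<in> carrier A" for a S
    using proj_mem_genideal_iff[OF that] gen[OF that(1)] by simp
  show ?thesis
    unfolding regular_sequence_def
  proof (intro conjI allI impI ballI)
    show "set (map proj fs) \<subseteq> carrier (A Quot ?I)" using c carrier_Quot by auto
    have "\<one>\<^bsub>A\<^esub> \<notin> genideal A (set gs \<union> set fs)"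
      using assms(2) ideal.one_imp_carrier[OF A.genideal_ideal[of "set gs \<union> set fs"]] c
      unfolding regular_sequence_def set_append by blast
    then have "proj \<one>\<^bsub>A\<^esub> \<notin> genideal (A Quot ?I) (proj ` set fs)" using iff[OF c(2) A.one_closed] by blast
    moreover have "proj \<one>\<^bsub>A\<^esub> \<in> carrier (A Quot ?I)" using carrier_Quot by blast
    ultimately show "genideal (A Quot ?I) (set (map proj fs)) \<noteq> carrier (A Quot ?I)" by auto
    fix i x assume i: "i < length (map proj fs)" and x: "x \<in> carrier (A Quot ?I)"
      and m: "map proj fs ! i \<otimes>\<^bsub>A Quot ?I\<^esub> x \<in> genideal (A Quot ?I) (set (take i (map proj fs)))"
    obtain a where a: "a \<in> carrier A" "x = proj a" using x carrier_Quot by auto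
    have fi: "fs ! i \<in> carrier A" using i c by auto
    have S: "set (take i fs) \<subseteq> carrier A" using c(2) set_take_subset[of i fs] by (rule subset_trans[rotated])
    have eq: "set (take i (map proj fs)) = proj ` set (take i fs)" by (simp add: take_map)
    have "proj (fs ! i \<otimes>\<^bsub>A\<^esub> a) \<in> genideal (A Quot ?I) (proj ` set (take i fs))"
      using m i a fi unfolding eq by simp
    then have "fs ! i \<otimes>\<^bsub>A\<^esub> a \<in> genideal A (set gs \<union> set (take i fs))"
      using iff[OF S A.m_closed[OF fi a(1)]] by blast
    moreover have "\<forall>i<length (gs @ fs). \<forall>a\<in>carrier A. mult A ((gs @ fs) ! i) a \<in> genideal A (set (take i (gs @ fs))) \<longrightarrow>
        a \<in> genideal A (set (take i (gs @ fs)))"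
      using assms(2) unfolding regular_sequence_def by blast
    from this[rule_format, of "length gs + i" a]
    have "fs ! i \<otimes>\<^bsub>A\<^esub> a \<in> genideal A (set gs \<union> set (take i fs)) \<Longrightarrow> a \<in> genideal A (set gs \<union> set (take i fs))"
      using i a by (simp add: nth_append)
    ultimately show "x \<in> genideal (A Quot ?I) (set (take i (map proj fs)))"
      unfolding eq using iff[OF S a(1)] a by simp
  qed
qed

section \<open>The ring of polynomials in a set of variables\<close>

lemma polynomial_ring_simps [simp]:
  "carrier (polynomial_ring V) = polys V" "mult (polynomial_ring V) = (*)" "one (polynomial_ring V) = 1"
  "zero (polynomial_ring V) = 0" "add (polynomial_ring V) = (+)"
  by (simp_all add: polynomial_ring_def polys_def)

lemma polynomial_ring_cring: "cring (polynomial_ring V)"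
proof (rule cringI)
  show "abelian_group (polynomial_ring V)"
  proof (rule abelian_groupI)
    fix x assume "x \<in> carrier (polynomial_ring V)"
    then show "\<exists>y\<in>carrier (polynomial_ring V). y \<oplus>\<^bsub>polynomial_ring V\<^esub> x = \<zero>\<^bsub>polynomial_ring V\<^esub>"
      by (intro bexI[of _ "- x"]) auto
  qed (auto simp: add.assoc add.commute)
  show "comm_monoid (polynomial_ring V)"
    by (rule comm_monoidI) (auto simp: mult.assoc mult.commute)
qed (auto simp: distrib_right)

lemma polynomial_ring_a_inv: "f \<in> polys V \<Longrightarrow> a_inv (polynomial_ring V) f = - f"
proof -
  assume f: "f \<in> polys V"
  interpret cring "polynomial_ring V" by (rule polynomial_ring_cring)
  show ?thesis using minus_equality[of "- f" f] f by auto
qed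

lemma polynomial_ring_minus: "f \<in> polys V \<Longrightarrow> g \<in> polys V \<Longrightarrow> a_minus (polynomial_ring V) f g = f - g"
  by (simp add: a_minus_def polynomial_ring_a_inv)

lemma ideal_polynomial_ringI:
  assumes "J \<subseteq> polys V" "0 \<in> J" "\<And>f g. f \<in> J \<Longrightarrow> g \<in> J \<Longrightarrow> f + g \<in> J"
    "\<And>f c. f \<in> J \<Longrightarrow> c \<in> polys V \<Longrightarrow> c * f \<in> J"
  shows "ideal J (polynomial_ring V)"
proof -
  interpret cring "polynomial_ring V" by (rule polynomial_ring_cring)
  have r: "f * c \<in> J" if "f \<in> J" "c \<in> polys V" for f c
    using assms(4)[OF that] by (simp add: mult.commute)
  show ?thesis
  proof (rule idealI[OF ring_axioms])
    show "subgroup J (add_monoid (polynomial_ring V))"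
    proof (rule subgroup.intro)
      fix x assume x: "x \<in> J"
      have "- 1 * x \<in> J" using x by (intro assms(4)) auto
      then show "inv\<^bsub>add_monoid (polynomial_ring V)\<^esub> x \<in> J"
        using x assms(1) polynomial_ring_a_inv[of x V] unfolding a_inv_def by auto
    qed (simp_all add: assms(1-3))
  qed (simp_all add: assms(4) r)
qed

lemma ideal_polynomial_ringD:
  assumes "ideal J (polynomial_ring V)"
  shows "J \<subseteq> polys V" "0 \<in> J" "f \<in> J \<Longrightarrow> g \<in> J \<Longrightarrow> f + g \<in> J"
    "f \<in> J \<Longrightarrow> c \<in> polys V \<Longrightarrow> c * f \<in> J" "f \<in> J \<Longrightarrow> - f \<in> J" "f \<in> J \<Longrightarrow> g \<in> J \<Longrightarrow> f - g \<in> J"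
proof -
  have sg: "additive_subgroup J (polynomial_ring V)" using assms by (rule ideal.axioms(1))
  show 1: "J \<subseteq> polys V" using additive_subgroup.a_subset[OF sg] by simp
  show "0 \<in> J" using additive_subgroup.zero_closed[OF sg] by simp
  show a: "f + g \<in> J" if "f \<in> J" "g \<in> J" for f g using additive_subgroup.a_closed[OF sg that] by simp
  show m: "f \<in> J \<Longrightarrow> c \<in> polys V \<Longrightarrow> c * f \<in> J" for f c using ideal.I_l_closed[OF assms, of f c] by simp
  show u: "- f \<in> J" if "f \<in> J" for f using m[OF that, of "- 1"] by (auto simp: polys_uminus)
  show "f \<in> J \<Longrightarrow> g \<in> J \<Longrightarrow> f - g \<in> J" using a[OF _ u, of f g] by simp
qed

lemma ideal_polynomial_ring_sum:
  assumes "ideal J (polynomial_ring V)" "\<And>x. x \<in> S \<Longrightarrow> f x \<in> J"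
  shows "sum f S \<in> J"
  using assms(2) by (induction S rule: infinite_finite_induct)
    (auto intro: ideal_polynomial_ringD[OF assms(1)])

context coprime_leads
begin

lemma J_ideal: "i \<le> l \<Longrightarrow> ideal (J i) (polynomial_ring V)"
  using J_polys J_0 J_add J_mult by (intro ideal_polynomial_ringI) auto

lemma J_eq_genideal:
  assumes "i \<le> l" shows "J i = genideal (polynomial_ring V) (F ` {..<i})"
proof
  interpret A: cring "polynomial_ring V" by (rule polynomial_ring_cring)
  have c: "F ` {..<i} \<subseteq> carrier (polynomial_ring V)" using assms F_polys by auto
  have id: "ideal (genideal (polynomial_ring V) (F ` {..<i})) (polynomial_ring V)"
    by (rule A.genideal_ideal[OF c])
  show "J i \<subseteq> genideal (polynomial_ring V) (F ` {..<i})"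
    unfolding J_def using A.genideal_self[OF c]
    by (auto intro!: ideal_polynomial_ring_sum[OF id] ideal_polynomial_ringD(4)[OF id])
  show "genideal (polynomial_ring V) (F ` {..<i}) \<subseteq> J i"
    using J_gen by (intro A.genideal_minimal J_ideal assms) auto
qed

text \<open>The leading monomials must not be constant, otherwise the ideal is the whole ring.\<close>

lemma F_regular_sequence:
  assumes "\<And>j. j < l \<Longrightarrow> \<mu> j \<noteq> 0"
  shows "regular_sequence (polynomial_ring V) (map F [0..<l])"
proof -
  have take: "genideal (polynomial_ring V) (set (take i (map F [0..<l]))) = J i" if "i \<le> l" for i
    using J_eq_genideal[OF that] that by (simp add: take_map take_upt atLeast0LessThan)
  have all: "genideal (polynomial_ring V) (set (map F [0..<l])) = J l" using take[of l] by simp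
  have one: "1 \<notin> J l" using one_notin_J assms by blast
  show ?thesis
    unfolding regular_sequence_def all
    using one F_polys F_regular take by (auto simp: less_imp_le)
qed

end

section \<open>Growth of the Hilbert function and chains of primes\<close>

definition polys_le :: "'v set \<Rightarrow> nat \<Rightarrow> ('v, 'a::field) mpol set" where
  "polys_le V d = {f \<in> polys V. \<forall>m\<in>keys f. mon_degree m \<le> d}"

definition lin_indep_mod :: "('v, 'a::field) mpol set \<Rightarrow> 'i set \<Rightarrow> ('i \<Rightarrow> ('v, 'a) mpol) \<Rightarrow> bool" where
  "lin_indep_mod J S b \<longleftrightarrow> (\<forall>c. (\<Sum>i\<in>S. single 0 (c i) * b i) \<in> J \<longrightarrow> (\<forall>i\<in>S. c i = 0))"

text \<open>
  The affine Hilbert function of the quotient by \<open>J\<close> grows at least like a polynomial of degree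
  \<open>a\<close>. This notion is used in place of dimension theory. The lower bound is a binomial
  coefficient, and not a power of \<open>t\<close>, since Pascal's rule is precisely the induction step below;
  the factor \<open>e\<close> leaves room for the degree of the elements by which one multiplies.
\<close>

definition grows :: "'v set \<Rightarrow> ('v, 'a::field) mpol set \<Rightarrow> nat \<Rightarrow> bool" where
  "grows V J a \<longleftrightarrow> (\<exists>e. \<forall>t. \<exists>b. (\<forall>i<(t + a choose a). b i \<in> polys_le V (e * t)) \<and>
     lin_indep_mod J {..<(t + a choose a)} b)"

lemma polys_le_polys: "f \<in> polys_le V d \<Longrightarrow> f \<in> polys V"
  by (simp add: polys_le_def)

lemma polys_le_mono: "f \<in> polys_le V d \<Longrightarrow> d \<le> d' \<Longrightarrow> f \<in> polys_le V d'"
  unfolding polys_le_def by (auto intro: order_trans)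

lemma polys_le_mult: "f \<in> polys_le V d \<Longrightarrow> g \<in> polys_le V e \<Longrightarrow> f * g \<in> polys_le V (d + e)"
  unfolding polys_le_def using keys_mult[of f g] by (fastforce simp: mon_degree_add add_mono)

lemma polys_le_exists: assumes "f \<in> polys V" shows "\<exists>d. f \<in> polys_le V d"
proof -
  have "mon_degree m \<le> (\<Sum>m\<in>keys f. mon_degree m)" if "m \<in> keys f" for m
    using that by (intro member_le_sum) auto
  then show ?thesis using assms unfolding polys_le_def by blast
qed

lemma sum_lessThan_add: "(\<Sum>i<m + n. g i) = (\<Sum>i<m. g i) + (\<Sum>i<n. g (m + i :: nat))"
  by (induction n) (auto simp: add.assoc)

lemma lin_indep_mod_antimono: "lin_indep_mod Q S b \<Longrightarrow> P \<subseteq> Q \<Longrightarrow> lin_indep_mod P S b"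
  unfolding lin_indep_mod_def by blast

lemma grows_antimono: "grows V Q a \<Longrightarrow> P \<subseteq> Q \<Longrightarrow> grows V P a"
  unfolding grows_def using lin_indep_mod_antimono by meson

lemma grows_0:
  assumes "ideal J (polynomial_ring V)" "1 \<notin> J"
  shows "grows V J 0"
proof -
  have "lin_indep_mod J {..<1::nat} (\<lambda>_. 1)"
    unfolding lin_indep_mod_def
  proof (intro allI impI ballI)
    fix c :: "nat \<Rightarrow> 'b" and i assume "(\<Sum>i<1. single 0 (c i) * 1) \<in> J" "i \<in> {..<1::nat}"
    then have c: "single 0 (c 0) \<in> J" "i = 0" by auto
    show "c i = 0"
    proof (rule ccontr)
      assume "c i \<noteq> 0"
      then have "single 0 (inverse (c 0)) * single 0 (c 0) = (1 :: ('a, 'b) mpol)" using c by (simp add: mult_single)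
      then show False using ideal_polynomial_ringD(4)[OF assms(1) c(1), of "single 0 (inverse (c 0))"] assms(2) by simp
    qed
  qed
  moreover have "1 \<in> polys_le V d" for d by (simp add: polys_le_def)
  ultimately show ?thesis unfolding grows_def by (intro exI[of _ 0] allI exI[of _ "\<lambda>_. 1"]) auto
qed

text \<open>
  Independent elements modulo \<open>P\<close> in degree \<open>t + 1\<close> are obtained from independent elements \<open>q_i\<close>
  modulo \<open>Q\<close> and from the products of \<open>f\<close> with independent elements \<open>b_i\<close> modulo \<open>P\<close> of degree
  \<open>t\<close>. Read modulo \<open>Q\<close>, a relation between them shows that the coefficients of the \<open>q_i\<close> vanish;
  then \<open>f\<close> can be cancelled.
\<close>

lemma grows_Suc:
  assumes P: "ideal P (polynomial_ring V)" and Q: "ideal Q (polynomial_ring V)" and PQ: "P \<subseteq> Q"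
    and f: "f \<in> Q" and nzd: "\<And>a. a \<in> polys V \<Longrightarrow> f * a \<in> P \<Longrightarrow> a \<in> P"
    and grow: "grows V Q a"
  shows "grows V P (Suc a)"
proof -
  obtain e where e: "\<And>t. \<exists>b. (\<forall>i<(t + a choose a). b i \<in> polys_le V (e * t)) \<and> lin_indep_mod Q {..<(t + a choose a)} b"
    using grow unfolding grows_def by blast
  have fV: "f \<in> polys V" using f ideal_polynomial_ringD(1)[OF Q] by blast
  then obtain e' where e': "f \<in> polys_le V e'" using polys_le_exists by blast
  define E where "E = e + e'"
  have "\<exists>b. (\<forall>i<(t + Suc a choose Suc a). b i \<in> polys_le V (E * t)) \<and> lin_indep_mod P {..<(t + Suc a choose Suc a)} b" for t
  proof (induction t)
    case 0
    obtain b where "\<forall>i<(0 + a choose a). b i \<in> polys_le V (e * 0)" "lin_indep_mod Q {..<(0 + a choose a)} b"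
      using e by blast
    then show ?case using lin_indep_mod_antimono[OF _ PQ] by (intro exI[of _ b]) auto
  next
    case (Suc t)
    let ?m = "Suc t + a choose a" let ?n = "t + Suc a choose Suc a"
    obtain b where b: "\<forall>i<?n. b i \<in> polys_le V (E * t)" "lin_indep_mod P {..<?n} b" using Suc by blast
    obtain q where q: "\<forall>i<?m. q i \<in> polys_le V (e * Suc t)" "lin_indep_mod Q {..<?m} q" using e by blast
    have card: "(Suc t + Suc a choose Suc a) = ?m + ?n" by simp
    define h where "h i = (if i < ?m then q i else f * b (i - ?m))" for i
    have "h i \<in> polys_le V (E * Suc t)" if "i < ?m + ?n" for i
    proof (cases "i < ?m")
      case True
      have "e * Suc t \<le> E * Suc t" unfolding E_def by (simp add: algebra_simps)
      then show ?thesis using True q polys_le_mono[of "q i"] unfolding h_def by auto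
    next
      case False
      then have "b (i - ?m) \<in> polys_le V (E * t)" using b that by auto
      then have "f * b (i - ?m) \<in> polys_le V (e' + E * t)" by (rule polys_le_mult[OF e'])
      moreover have "e' + E * t \<le> E * Suc t" by (simp add: E_def algebra_simps)
      ultimately have "f * b (i - ?m) \<in> polys_le V (E * Suc t)" by (rule polys_le_mono)
      then show ?thesis using False unfolding h_def by simp
    qed
    moreover have "lin_indep_mod P {..<?m + ?n} h"
      unfolding lin_indep_mod_def
    proof (intro allI impI)
      fix c assume sP: "(\<Sum>i<?m + ?n. single 0 (c i) * h i) \<in> P"
      let ?x = "\<Sum>i<?m. single 0 (c i) * q i" let ?y = "\<Sum>i<?n. single 0 (c (?m + i)) * b i"
      have y: "?y \<in> polys V" using b polys_le_polys by (intro polys_sum polys_mult) auto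
      have "(\<Sum>i<?n. single 0 (c (?m + i)) * h (?m + i)) = f * ?y"
        by (simp add: h_def sum_distrib_left mult.left_commute)
      moreover have "(\<Sum>i<?m. single 0 (c i) * h i) = ?x" by (intro sum.cong) (auto simp: h_def)
      ultimately have eq: "(\<Sum>i<?m + ?n. single 0 (c i) * h i) = ?x + f * ?y"
        unfolding sum_lessThan_add by simp
      have fy: "f * ?y \<in> Q" using ideal_polynomial_ringD(4)[OF Q f y] by (simp add: mult.commute)
      have "?x + f * ?y - f * ?y \<in> Q" using sP PQ eq fy by (intro ideal_polynomial_ringD(6)[OF Q]) auto
      then have "?x \<in> Q" by simp
      then have c0: "\<forall>i\<in>{..<?m}. c i = 0" using q(2) unfolding lin_indep_mod_def by blast
      then have "?x = 0" by simp
      then have "?y \<in> P" using nzd[OF y] sP eq by simp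
      then have c1: "\<forall>i\<in>{..<?n}. c (?m + i) = 0" using b(2) unfolding lin_indep_mod_def
        by (elim allE[of _ "\<lambda>i. c (?m + i)"]) blast
      show "\<forall>i\<in>{..<?m + ?n}. c i = 0"
      proof
        fix i assume i: "i \<in> {..<?m + ?n}"
        show "c i = 0"
        proof (cases "i < ?m")
          case False
          then have "i - ?m \<in> {..<?n}" "?m + (i - ?m) = i" using i by auto
          then show ?thesis using c1 by metis
        qed (use c0 in auto)
      qed
    qed
    ultimately show ?case unfolding card by blast
  qed
  then show ?thesis unfolding grows_def by blast
qed

text \<open>
  Gaussian elimination: an equation in which the unknown \<open>p\<close> occurs is used to eliminate \<open>p\<close> from
  all others.
\<close>

lemma exists_nontrivial_solution:
  fixes x :: "'i \<Rightarrow> 'u \<Rightarrow> 'a::field"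
  assumes "finite U" "finite S" "card U < card S"
  shows "\<exists>c. (\<exists>i\<in>S. c i \<noteq> 0) \<and> (\<forall>u\<in>U. (\<Sum>i\<in>S. c i * x i u) = 0)"
  using assms
proof (induction U arbitrary: S x rule: finite_induct)
  case empty
  then obtain i where "i \<in> S" by (metis card.empty card_gt_0_iff ex_in_conv)
  then show ?case by (intro exI[of _ "\<lambda>_. 1"]) auto
next
  case (insert u U)
  show ?case
  proof (cases "\<forall>i\<in>S. x i u = 0")
    case True
    obtain c where "\<exists>i\<in>S. c i \<noteq> 0" "\<forall>u\<in>U. (\<Sum>i\<in>S. c i * x i u) = 0"
      using insert.IH[OF insert.prems(1), of x] insert.prems insert.hyps by auto
    then show ?thesis using True by (intro exI[of _ c]) auto
  next
    case False
    then obtain p where p: "p \<in> S" "x p u \<noteq> 0" by blast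
    let ?S = "S - {p}"
    let ?y = "\<lambda>i w. x i w - x i u / x p u * x p w"
    have "card U < card ?S" using insert p by simp
    then obtain c where c: "\<exists>i\<in>?S. c i \<noteq> 0" "\<forall>w\<in>U. (\<Sum>i\<in>?S. c i * ?y i w) = 0"
      using insert.IH[of ?S ?y] insert.prems by auto
    define d where "d = (\<Sum>i\<in>?S. c i * (x i u / x p u))"
    define c' where "c' = c(p := - d)"
    have sum: "(\<Sum>i\<in>S. c' i * x i w) = (\<Sum>i\<in>?S. c i * x i w) - d * x p w" for w
    proof -
      have "(\<Sum>i\<in>S. c' i * x i w) = c' p * x p w + (\<Sum>i\<in>?S. c' i * x i w)"
        using p insert.prems by (simp add: sum.remove)
      moreover have "(\<Sum>i\<in>?S. c' i * x i w) = (\<Sum>i\<in>?S. c i * x i w)"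
        by (intro sum.cong) (auto simp: c'_def)
      ultimately show ?thesis by (simp add: c'_def)
    qed
    have "(\<Sum>i\<in>S. c' i * x i w) = 0" if "w \<in> U" for w
      using c(2) that unfolding sum d_def
      by (simp add: right_diff_distrib sum_subtractf sum_distrib_right mult.assoc)
    moreover have "d * x p u = (\<Sum>i\<in>?S. c i * x i u)"
      unfolding d_def sum_distrib_right using p by (intro sum.cong) auto
    then have "(\<Sum>i\<in>S. c' i * x i u) = 0" unfolding sum by simp
    moreover have "\<exists>i\<in>S. c' i \<noteq> 0" using c(1) by (auto simp: c'_def)
    ultimately show ?thesis by (intro exI[of _ c']) auto
  qed
qed

lemma lin_indep_mod_card_le:
  assumes J: "ideal J (polynomial_ring V)" and S: "finite S" and indep: "lin_indep_mod J S b"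
    and U: "finite U" "\<And>i. i \<in> S \<Longrightarrow> \<exists>c. b i - (\<Sum>u\<in>U. single 0 (c u) * g u) \<in> J"
  shows "card S \<le> card U"
proof (rule ccontr)
  assume "\<not> card S \<le> card U"
  then have lt: "card U < card S" by simp
  obtain x where x: "\<And>i. i \<in> S \<Longrightarrow> b i - (\<Sum>u\<in>U. single 0 (x i u) * g u) \<in> J" using U(2) by metis
  obtain c where c: "\<exists>i\<in>S. c i \<noteq> 0" "\<forall>u\<in>U. (\<Sum>i\<in>S. c i * x i u) = 0"
    using exists_nontrivial_solution[OF U(1) S lt] by blast
  have "(\<Sum>i\<in>S. single 0 (c i) * (b i - (\<Sum>u\<in>U. single 0 (x i u) * g u))) \<in> J"
    using x by (intro ideal_polynomial_ring_sum[OF J] ideal_polynomial_ringD(4)[OF J]) auto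
  moreover have "(\<Sum>i\<in>S. single 0 (c i) * (\<Sum>u\<in>U. single 0 (x i u) * g u)) = 0"
  proof -
    have "(\<Sum>i\<in>S. single 0 (c i) * (\<Sum>u\<in>U. single 0 (x i u) * g u))
        = (\<Sum>i\<in>S. \<Sum>u\<in>U. single 0 (c i * x i u) * g u)"
      by (simp add: sum_distrib_left mult.assoc[symmetric] mult_single)
    also have "\<dots> = (\<Sum>u\<in>U. \<Sum>i\<in>S. single 0 (c i * x i u) * g u)" by (rule sum.swap)
    also have "\<dots> = (\<Sum>u\<in>U. single 0 (\<Sum>i\<in>S. c i * x i u) * g u)"
    proof (rule sum.cong[OF refl])
      fix u
      have "single 0 (\<Sum>i\<in>S. c i * x i u) = (\<Sum>i\<in>S. single 0 (c i * x i u) :: ('a, 'b) mpol)"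
        by (induction S rule: infinite_finite_induct) (auto simp: single_add)
      then show "(\<Sum>i\<in>S. single 0 (c i * x i u) * g u) = single 0 (\<Sum>i\<in>S. c i * x i u) * g u"
        by (simp add: sum_distrib_right)
    qed
    also have "\<dots> = 0" using c(2) by simp
    finally show ?thesis .
  qed
  ultimately have "(\<Sum>i\<in>S. single 0 (c i) * b i) \<in> J"
    by (simp add: right_diff_distrib sum_subtractf)
  then show False using indep c(1) unfolding lin_indep_mod_def by blast
qed

text \<open>
  A polynomial bound of degree \<open>D\<close> for a quantity of order \<open>t^a\<close> forces \<open>a \<le> D\<close>. The witness is
  the first \<open>t\<close> beyond the constant of the estimate.
\<close>

lemma growth_exponent_le:
  assumes "\<And>t::nat. (t + a choose a) \<le> C * (e * t + 1) ^ D"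
  shows "a \<le> D"
proof (rule ccontr)
  assume "\<not> a \<le> D"
  then have a: "Suc D \<le> a" by simp
  define t where "t = C * a ^ a * (e + 1) ^ D + 1"
  have t1: "1 \<le> t" by (simp add: t_def)
  have "real t ^ a / real a ^ a \<le> (real (t + a) / real a) ^ a"
    by (simp add: power_divide divide_right_mono power_mono)
  also have "\<dots> \<le> real (t + a choose a)" by (rule binomial_ge_n_over_k_pow_k) simp
  also have "\<dots> \<le> real (C * (e * t + 1) ^ D)" using assms by (simp only: of_nat_le_iff)
  also have "\<dots> \<le> real (C * ((e + 1) * t) ^ D)"
    using t1 by (intro of_nat_mono mult_left_mono power_mono) auto
  finally have "real t ^ a \<le> real (C * ((e + 1) * t) ^ D) * real a ^ a"
    using a by (simp add: field_simps)
  then have "real (t ^ a) \<le> real (C * ((e + 1) * t) ^ D * a ^ a)" by simp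
  then have "t ^ a \<le> C * ((e + 1) * t) ^ D * a ^ a" by (simp only: of_nat_le_iff)
  also have "\<dots> = (C * a ^ a * (e + 1) ^ D) * t ^ D" by (simp only: power_mult_distrib mult_ac)
  finally have "t ^ a \<le> (C * a ^ a * (e + 1) ^ D) * t ^ D" .
  moreover have "t * t ^ D \<le> t ^ a" using power_increasing[OF a t1] by simp
  ultimately have "t * t ^ D \<le> (C * a ^ a * (e + 1) ^ D) * t ^ D" by linarith
  then have "t \<le> C * a ^ a * (e + 1) ^ D" using t1 by simp
  then show False by (simp add: t_def)
qed

text \<open>
  If the elements of degree at most \<open>d\<close> are spanned modulo \<open>J\<close> by polynomially many elements, the
  degree of that polynomial bounds the growth.
\<close>

lemma grows_le:
  assumes J: "ideal J (polynomial_ring V)" and grow: "grows V J a"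
    and U: "\<And>d. finite (U d)" "\<And>d. card (U d) \<le> C * (d + 1) ^ D"
      "\<And>d f. f \<in> polys_le V d \<Longrightarrow> \<exists>c. f - (\<Sum>u\<in>U d. single 0 (c u) * g u) \<in> J"
  shows "a \<le> D"
proof -
  obtain e where e: "\<And>t. \<exists>b. (\<forall>i<(t + a choose a). b i \<in> polys_le V (e * t)) \<and> lin_indep_mod J {..<(t + a choose a)} b"
    using grow unfolding grows_def by blast
  show ?thesis
  proof (rule growth_exponent_le[of a C e D])
    fix t
    obtain b where b: "\<forall>i<(t + a choose a). b i \<in> polys_le V (e * t)" "lin_indep_mod J {..<(t + a choose a)} b"
      using e by blast
    have "card {..<(t + a choose a)} \<le> card (U (e * t))"
      using b(1) U(3) by (intro lin_indep_mod_card_le[OF J _ b(2) U(1), where g = g]) auto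
    also have "\<dots> \<le> C * (e * t + 1) ^ D" by (rule U(2))
    finally show "(t + a choose a) \<le> C * (e * t + 1) ^ D" by simp
  qed
qed

lemma grows_le_card:
  assumes "finite V" "ideal J (polynomial_ring V)" "grows V J a"
  shows "a \<le> card V"
proof (rule grows_le[OF assms(2,3), of "\<lambda>d. {m. keys m \<subseteq> V \<and> mon_degree m \<le> d}" 1 "card V" "\<lambda>m. single m 1"])
  fix d and f :: "('a, 'b) mpol" assume f: "f \<in> polys_le V d"
  let ?U = "{m. keys m \<subseteq> V \<and> mon_degree m \<le> d}"
  have "(\<Sum>m\<in>keys f. single m (lookup f m)) = (\<Sum>m\<in>?U. single m (lookup f m))"
    using f monomials_degree_le(1)[OF assms(1)]
    by (intro sum.mono_neutral_left) (auto simp: polys_le_def polys_def in_keys_iff)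
  then have "f = (\<Sum>m\<in>?U. single 0 (lookup f m) * single m 1)"
    using mpol_eq_sum[of f] by (simp add: mult_single)
  then have "f - (\<Sum>m\<in>?U. single 0 (lookup f m) * single m 1) \<in> J"
    using ideal_polynomial_ringD(2)[OF assms(2)] by simp
  then show "\<exists>c. f - (\<Sum>m\<in>?U. single 0 (c m) * single m 1) \<in> J" by blast
qed (use monomials_degree_le[OF assms(1)] in auto)

text \<open>
  Each element of the larger prime outside the smaller one is a nonzerodivisor modulo the smaller
  one, so the growth exponent increases by one with every step down the chain.
\<close>

lemma grows_prime_chain:
  assumes "prime_chain (polynomial_ring V) (Ps @ [Q])" "grows V Q a"
  shows "\<exists>P\<in>set (Ps @ [Q]). grows V P (a + length Ps)"
  using assms
proof (induction Ps arbitrary: Q a rule: rev_induct)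
  case (snoc P Ps)
  have PQ: "P \<subset> Q" "primeideal P (polynomial_ring V)" "primeideal Q (polynomial_ring V)"
    using snoc.prems(1) unfolding prime_chain_def by (auto simp: sorted_wrt_append)
  interpret P: primeideal P "polynomial_ring V" by fact
  interpret Q: primeideal Q "polynomial_ring V" by fact
  obtain f where f: "f \<in> Q" "f \<notin> P" using PQ by blast
  have "grows V P (Suc a)"
  proof (rule grows_Suc[OF P.is_ideal Q.is_ideal _ f(1) _ snoc.prems(2)])
    show "b \<in> P" if "b \<in> polys V" "f * b \<in> P" for b
      using P.I_prime[of f b] that f Q.Icarr[OF f(1)] by auto
  qed (use PQ in blast)
  moreover have "prime_chain (polynomial_ring V) (Ps @ [P])"
    using snoc.prems(1) unfolding prime_chain_def by (auto simp: sorted_wrt_append)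
  ultimately show ?case using snoc.IH[of P "Suc a"] by auto
qed auto

lemma grows_regular_sequence:
  assumes "regular_sequence (polynomial_ring V) (gs @ fs)"
  shows "grows V (genideal (polynomial_ring V) (set gs)) (length fs)"
  using assms
proof (induction fs arbitrary: gs)
  case Nil
  interpret A: cring "polynomial_ring V" by (rule polynomial_ring_cring)
  have c: "set gs \<subseteq> carrier (polynomial_ring V)" using Nil by (auto simp: regular_sequence_def)
  have id: "ideal (genideal (polynomial_ring V) (set gs)) (polynomial_ring V)" by (rule A.genideal_ideal[OF c])
  then have "1 \<notin> genideal (polynomial_ring V) (set gs)"
    using ideal.one_imp_carrier[OF id] Nil by (auto simp: regular_sequence_def)
  then show ?case using grows_0[OF id] by simp
next
  case (Cons f fs)
  interpret A: cring "polynomial_ring V" by (rule polynomial_ring_cring)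
  have c: "set gs \<subseteq> carrier (polynomial_ring V)" "f \<in> carrier (polynomial_ring V)"
    using Cons.prems by (auto simp: regular_sequence_def)
  have cf: "set (gs @ [f]) \<subseteq> carrier (polynomial_ring V)" using c by auto
  have gr: "grows V (genideal (polynomial_ring V) (set (gs @ [f]))) (length fs)"
    using Cons.IH[of "gs @ [f]"] Cons.prems by simp
  have "grows V (genideal (polynomial_ring V) (set gs)) (Suc (length fs))"
  proof (rule grows_Suc[OF A.genideal_ideal[OF c(1)] A.genideal_ideal[OF cf] _ _ _ gr])
    show "genideal (polynomial_ring V) (set gs) \<subseteq> genideal (polynomial_ring V) (set (gs @ [f]))"
      using cf by (intro A.subset_Idl_subset) auto
    show "f \<in> genideal (polynomial_ring V) (set (gs @ [f]))" using A.genideal_self[OF cf] by auto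
    have r: "\<forall>i<length (gs @ f # fs). \<forall>a\<in>polys V. (gs @ f # fs) ! i * a \<in> genideal (polynomial_ring V) (set (take i (gs @ f # fs))) \<longrightarrow>
      a \<in> genideal (polynomial_ring V) (set (take i (gs @ f # fs)))"
      using Cons.prems unfolding regular_sequence_def by simp
    show "a \<in> genideal (polynomial_ring V) (set gs)"
      if "a \<in> polys V" "f * a \<in> genideal (polynomial_ring V) (set gs)" for a
      using r[rule_format, of "length gs" a] that by simp
  qed
  then show ?case by simp
qed

section \<open>Dickson's lemma and Hilbert's basis theorem\<close>

text \<open>A decreasing sequence of natural numbers is eventually constant.\<close>

lemma nat_seq_mono_subseq:
  fixes s :: "nat \<Rightarrow> nat"
  shows "\<exists>f :: nat \<Rightarrow> nat. strict_mono f \<and> mono (\<lambda>n. s (f n))"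
proof -
  obtain f where f: "strict_mono f" "monoseq (\<lambda>n. s (f n))"
    using seq_monosub[of s] by auto
  consider "incseq (\<lambda>n. s (f n))" | "decseq (\<lambda>n. s (f n))" using f(2) monoseq_iff by blast
  then show ?thesis
  proof cases
    case 1
    then have "mono (\<lambda>n. s (f n))" by (auto simp: mono_def incseq_def)
    then show ?thesis using f(1) by blast
  next
    case 2
    obtain N where N: "\<And>n. s (f N) \<le> s (f n)"
      using ex_has_least_nat[of "\<lambda>_. True" 0 "\<lambda>n. s (f n)"] by auto
    have "s (f (N + n)) = s (f N)" for n
      using N 2 by (intro antisym) (auto simp: decseq_def)
    then have "mono (\<lambda>n. s (f (N + n)))" by (simp add: mono_def)
    moreover have "strict_mono (\<lambda>n. f (N + n))" using f(1) by (simp add: strict_mono_def)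
    ultimately show ?thesis by blast
  qed
qed

text \<open>
  Pass to a subsequence in which the exponents are nondecreasing, one variable after the other.
\<close>

lemma dickson:
  fixes m :: "nat \<Rightarrow> 'v monomial"
  assumes "finite V" "\<And>n. keys (m n) \<subseteq> V"
  shows "\<exists>i j. i < j \<and> mdvd (m i) (m j)"
proof -
  have "\<exists>f :: nat \<Rightarrow> nat. strict_mono f \<and> (\<forall>v\<in>V. mono (\<lambda>n. lookup (m (f n)) v))"
    using assms(1)
  proof (induction V rule: finite_induct)
    case empty show ?case by (rule exI[of _ "\<lambda>n. n"]) (simp add: strict_mono_def)
  next
    case (insert v V)
    then obtain f :: "nat \<Rightarrow> nat" where f: "strict_mono f" "\<forall>v\<in>V. mono (\<lambda>n. lookup (m (f n)) v)" by blast
    obtain g :: "nat \<Rightarrow> nat" where g: "strict_mono g" "mono (\<lambda>n. lookup (m (f (g n))) v)"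
      using nat_seq_mono_subseq[of "\<lambda>n. lookup (m (f n)) v"] by blast
    have "mono (\<lambda>n. lookup (m (f (g n))) w)" if "w \<in> V" for w
      using f(2) that g(1) strict_mono_mono unfolding mono_def by blast
    then show ?case using f g by (intro exI[of _ "\<lambda>n. f (g n)"]) (auto simp: strict_mono_def)
  qed
  then obtain f :: "nat \<Rightarrow> nat" where f: "strict_mono f" "\<forall>v\<in>V. mono (\<lambda>n. lookup (m (f n)) v)" by blast
  have "lookup (m (f 0)) v \<le> lookup (m (f 1)) v" for v
  proof (cases "v \<in> V")
    case True then show ?thesis using f(2) by (auto simp: mono_def)
  next
    case False
    then have "v \<notin> keys (m (f 0))" using assms(2) by blast
    then show ?thesis by (simp add: in_keys_iff)
  qed
  moreover have "f 0 < f 1" using f(1) by (simp add: strict_mono_def)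
  ultimately show ?thesis unfolding mdvd_def by blast
qed

lemma mdvd_refl: "mdvd a a" by (simp add: mdvd_def)
lemma mdvd_trans: "mdvd a b \<Longrightarrow> mdvd b c \<Longrightarrow> mdvd a c" unfolding mdvd_def by (meson order_trans)

text \<open>
  The minimal elements for divisibility divide all others, and Dickson's lemma leaves no room for
  infinitely many of them.
\<close>

lemma finite_mdvd_basis:
  assumes "finite V" "\<And>m. m \<in> M \<Longrightarrow> keys m \<subseteq> V"
  shows "\<exists>G\<subseteq>M. finite G \<and> (\<forall>m\<in>M. \<exists>g\<in>G. mdvd g m)"
proof (intro exI conjI ballI)
  let ?G = "{m\<in>M. \<forall>m'\<in>M. mdvd m' m \<longrightarrow> m' = m}"
  show "finite ?G"
  proof (rule ccontr)
    assume "infinite ?G"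
    then obtain f :: "nat \<Rightarrow> _" where f: "inj f" "range f \<subseteq> ?G" using infinite_countable_subset by blast
    have fG: "f n \<in> ?G" for n using f(2) by blast
    then have "keys (f n) \<subseteq> V" for n using assms(2) by blast
    then obtain i j where "i < j" "mdvd (f i) (f j)" using dickson[OF assms(1)] by blast
    then show False using fG[of i] fG[of j] f(1) by (auto simp: inj_def)
  qed
  show "\<exists>g\<in>?G. mdvd g m" if "m \<in> M" for m
    using that
  proof (induction "mon_degree m" arbitrary: m rule: less_induct)
    case less
    show ?case
    proof (cases "m \<in> ?G")
      case True then show ?thesis using mdvd_refl by blast
    next
      case False
      then obtain m' where m': "m' \<in> M" "mdvd m' m" "m' \<noteq> m" using less.prems by blast
      obtain u where u: "m = m' + u" using mdvdE[OF m'(2)] .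
      then have "u \<noteq> 0" using m'(3) by auto
      then obtain v where "lookup u v \<noteq> 0" using poly_mapping_eqI[of u 0] by auto
      then have "0 < mon_degree u" using lookup_le_mon_degree[of u v] by linarith
      then have "mon_degree m' < mon_degree m" by (simp add: u mon_degree_add)
      then obtain g where "g \<in> ?G" "mdvd g m'" using less.hyps m'(1) by blast
      then show ?thesis using mdvd_trans m'(2) by blast
    qed
  qed
qed auto

text \<open>
  Choose members of the ideal whose leading monomials divide all leading monomials of the ideal.
  Subtracting a multiple of one of them lowers the leading monomial, and only finitely many
  monomials lie below a given one.
\<close>

lemma (in variable_order) polynomial_ring_noetherian:
  assumes V: "finite (V :: 'v set)"
  shows "noetherian_ring (polynomial_ring V :: ('v, 'a::field) mpol ring)"
proof -
  interpret A: cring "polynomial_ring V :: ('v, 'a::field) mpol ring" by (rule polynomial_ring_cring)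
  show ?thesis
  proof (rule A.noetherian_ringI)
    fix I :: "('v, 'a) mpol set" assume I: "ideal I (polynomial_ring V)"
    let ?M = "{m. \<exists>f\<in>I. lead f m}"
    have lead_V: "keys m \<subseteq> V" if "f \<in> I" "lead f m" for f m
      using lead_keys[OF that(2)] that(1) ideal_polynomial_ringD(1)[OF I] unfolding polys_def by blast
    then have "keys m \<subseteq> V" if "m \<in> ?M" for m using that by blast
    then obtain G where G: "G \<subseteq> ?M" "finite G" "\<forall>m\<in>?M. \<exists>g\<in>G. mdvd g m"
      using finite_mdvd_basis[OF V] by meson
    have "\<forall>g\<in>G. \<exists>f. f \<in> I \<and> lead f g" using G(1) by blast
    from bchoice[OF this] obtain F where "\<forall>g\<in>G. F g \<in> I \<and> lead (F g) g" by blast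
    then have F: "\<And>g. g \<in> G \<Longrightarrow> F g \<in> I \<and> lead (F g) g" by blast
    have FV: "F ` G \<subseteq> polys V" using F ideal_polynomial_ringD(1)[OF I] by blast
    let ?L = "genideal (polynomial_ring V) (F ` G)"
    have L: "ideal ?L (polynomial_ring V)" using FV by (intro A.genideal_ideal) simp
    have FL: "F g \<in> ?L" if "g \<in> G" for g using A.genideal_self[of "F ` G"] FV that by auto
    have "f \<in> ?L" if "f \<in> I" "lead f m" for f m
      using that
    proof (induction "card {a. keys a \<subseteq> V \<and> a \<prec> m}" arbitrary: f m rule: less_induct)
      case less
      obtain g where g: "g \<in> G" "mdvd g m" using G(3) less.prems by blast
      then obtain u where u: "m = g + u" using mdvdE by blast
      have mV: "keys m \<subseteq> V" using less.prems lead_V by blast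
      then have uV: "keys u \<subseteq> V" by (simp add: u keys_add_nat)
      let ?c = "lookup (F g) g"
      have c: "?c \<noteq> 0" using F[OF g(1)] by (simp add: lead_def)
      let ?s = "single u (lookup f m / ?c)"
      define h where "h = f - ?s * F g"
      have h: "h \<in> I" unfolding h_def using less.prems F[OF g(1)] uV
        by (intro ideal_polynomial_ringD(6)[OF I] ideal_polynomial_ringD(4)[OF I] polys_single) auto
      have sL: "?s * F g \<in> ?L" using FL[OF g(1)] uV by (intro ideal_polynomial_ringD(4)[OF L] polys_single)
      have ls: "lead (?s * F g) m"
        using lead_mult[OF lead_single[of "lookup f m / ?c" u] conjunct2[OF F[OF g(1)]]] less.prems c
        by (simp add: u add.commute lead_def)
      have lk: "lookup (?s * F g) m = lookup f m"
      proof -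
        obtain F' where F': "F g = single g ?c + F'" "\<And>k. k \<in> keys F' \<Longrightarrow> k \<prec> g \<and> k \<in> keys (F g)"
          using lead_split[OF conjunct2[OF F[OF g(1)]]] by blast
        have "lookup (?s * F') m = 0"
        proof (rule ccontr)
          assume "lookup (?s * F') m \<noteq> 0"
          then obtain b where "b \<in> keys F'" "m = u + b"
            using keys_mult[of ?s F'] by (auto simp: in_keys_iff[symmetric] split: if_splits)
          then show False using F'(2) u prec_irrefl by (auto simp: add.commute)
        qed
        moreover have "?s * F g = single m (lookup f m) + ?s * F'"
          by (subst F'(1)) (use c in \<open>simp add: distrib_left mult_single u add.commute\<close>)
        ultimately show ?thesis by (simp add: lookup_add)
      qed
      have hl: "k \<prec> m" if k: "k \<in> keys h" for k
      proof -
        have "k \<noteq> m" using k lk by (auto simp: h_def in_keys_iff lookup_minus)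
        moreover have "k \<in> keys f \<or> k \<in> keys (?s * F g)" using k by (auto simp: h_def in_keys_iff lookup_minus)
        ultimately show ?thesis using less.prems(2) ls by (auto simp: lead_def)
      qed
      have "h \<in> ?L"
      proof (cases "h = 0")
        case True then show ?thesis using ideal_polynomial_ringD(2)[OF L] by simp
      next
        case False
        then obtain n where n: "lead h n" using lead_exists by blast
        have nm: "n \<prec> m" using hl lead_keys[OF n] by blast
        have nV: "keys n \<subseteq> V" using lead_V[OF h n] .
        have fin: "finite {a. keys a \<subseteq> V \<and> a \<prec> m}"
          by (rule finite_subset[OF _ monomials_degree_le(1)[OF V, of "mon_degree m"]]) (auto dest: prec_degree)
        have "card {a. keys a \<subseteq> V \<and> a \<prec> n} < card {a. keys a \<subseteq> V \<and> a \<prec> m}"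
          using nm nV prec_irrefl[of n] prec_trans by (intro psubset_card_mono[OF fin]) blast
        then show ?thesis using less.hyps h n by blast
      qed
      then have "h + ?s * F g \<in> ?L" using sL by (rule ideal_polynomial_ringD(3)[OF L])
      then show ?case by (simp add: h_def)
    qed
    then have "I \<subseteq> ?L" using lead_exists ideal_polynomial_ringD(2)[OF L] by (metis subsetI)
    moreover have "F ` G \<subseteq> I" using F by blast
    then have "?L \<subseteq> I" by (rule A.genideal_minimal[OF I])
    ultimately show "\<exists>S\<subseteq>carrier (polynomial_ring V). finite S \<and> I = genideal (polynomial_ring V) S"
      using FV G(2) by (intro exI[of _ "F ` G"]) auto
  qed
qed

section \<open>Extension of homomorphisms to an algebraically closed field\<close>

text \<open>A root of \<open>q - 1\<close>.\<close>

lemma poly_nonzero_point: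
  fixes q :: "'a::alg_closed_field poly"
  assumes "q \<noteq> 0" shows "\<exists>c. poly q c \<noteq> 0"
proof (cases "degree q = 0")
  case True
  then obtain a where "q = [:a:]" by (auto elim: degree_eq_zeroE)
  then show ?thesis using assms by auto
next
  case False
  have "Polynomial.coeff (q - 1) (degree q) = lead_coeff q" using False by simp
  then have "Polynomial.coeff (q - 1) (degree q) \<noteq> 0" using assms by simp
  then have "degree q \<le> degree (q - 1)" by (rule le_degree)
  then obtain c where "poly (q - 1) c = 0" using alg_closed_imp_poly_has_root[of "q - 1"] False by auto
  then show ?thesis by (intro exI[of _ c]) simp
qed

text \<open>
  Homomorphisms to the field that kill a prime \<open>P\<close> are constructed by adjoining one generator at a
  time. All subalgebras that occur are subsets of one ring \<open>B\<close>, with \<open>\<kappa>\<close> the inclusion of the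
  constants, so that the induction stays within one type; the quotients by \<open>P\<close> are never formed.
\<close>

locale prime_in_algebra =
  fixes \<kappa> :: "'a::alg_closed_field \<Rightarrow> 'c::comm_ring_1" and B P :: "'c set"
  assumes \<kappa>_add: "\<kappa> (a + b) = \<kappa> a + \<kappa> b" and \<kappa>_mult: "\<kappa> (a * b) = \<kappa> a * \<kappa> b"
    and \<kappa>_1: "\<kappa> 1 = 1" and \<kappa>_B: "\<kappa> a \<in> B"
    and B_add: "x \<in> B \<Longrightarrow> y \<in> B \<Longrightarrow> x + y \<in> B" and B_mult: "x \<in> B \<Longrightarrow> y \<in> B \<Longrightarrow> x * y \<in> B"
    and P_0: "0 \<in> P" and P_add: "x \<in> P \<Longrightarrow> y \<in> P \<Longrightarrow> x + y \<in> P"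
    and P_mult: "x \<in> B \<Longrightarrow> y \<in> P \<Longrightarrow> x * y \<in> P" and P_1: "1 \<notin> P"
    and P_prime: "x \<in> B \<Longrightarrow> y \<in> B \<Longrightarrow> x * y \<in> P \<Longrightarrow> x \<in> P \<or> y \<in> P"
begin

lemma \<kappa>_0: "\<kappa> 0 = 0" using \<kappa>_add[of 0 0] by simp

lemma \<kappa>_uminus: "\<kappa> (- a) = - \<kappa> a"
  using \<kappa>_add[of a "- a"] \<kappa>_0 by (simp add: add_eq_0_iff)

lemma minus_one_B: "- 1 \<in> B" using \<kappa>_B[of "- 1"] \<kappa>_uminus \<kappa>_1 by simp

lemma P_uminus: "x \<in> P \<Longrightarrow> - x \<in> P" using P_mult[OF minus_one_B] by simp

lemma P_diff: "x \<in> P \<Longrightarrow> y \<in> P \<Longrightarrow> x - y \<in> P" using P_add[OF _ P_uminus] by simp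

lemma P_sum: "(\<And>i. i \<in> A \<Longrightarrow> f i \<in> P) \<Longrightarrow> sum f A \<in> P"
  by (induction A rule: infinite_finite_induct) (auto simp: P_0 P_add)

lemma B_1: "1 \<in> B" using \<kappa>_B[of 1] \<kappa>_1 by simp

lemma B_power: "x \<in> B \<Longrightarrow> x ^ n \<in> B"
  by (induction n) (auto simp: B_1 B_mult)

lemma P_power_cancel: "x \<in> B \<Longrightarrow> x \<notin> P \<Longrightarrow> y \<in> B \<Longrightarrow> x ^ n * y \<in> P \<Longrightarrow> y \<in> P"
proof (induction n)
  case (Suc n)
  have "x ^ n * y \<in> B" using Suc.prems by (intro B_mult B_power)
  then have "x ^ n * y \<in> P" using P_prime[of x "x ^ n * y"] Suc.prems by (auto simp: mult.assoc)
  then show ?case using Suc by blast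
qed auto

definition subalgebra :: "'c set \<Rightarrow> bool" where
  "subalgebra S \<longleftrightarrow> S \<subseteq> B \<and> range \<kappa> \<subseteq> S \<and> (\<forall>x\<in>S. \<forall>y\<in>S. x + y \<in> S \<and> x * y \<in> S)"

definition point :: "'c set \<Rightarrow> ('c \<Rightarrow> 'a) \<Rightarrow> bool" where
  "point S \<chi> \<longleftrightarrow> (\<forall>x\<in>S. \<forall>y\<in>S. \<chi> (x + y) = \<chi> x + \<chi> y \<and> \<chi> (x * y) = \<chi> x * \<chi> y) \<and>
     (\<forall>c. \<chi> (\<kappa> c) = c) \<and> (\<forall>x\<in>S \<inter> P. \<chi> x = 0)"

text \<open>
  The statement for a subalgebra that is strong enough to be inherited by an extension by one
  generator: points outside \<open>P\<close> can be separated from \<open>P\<close>.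
\<close>

definition enough_points :: "'c set \<Rightarrow> bool" where
  "enough_points S \<longleftrightarrow> subalgebra S \<and> (\<forall>g\<in>S - P. \<exists>\<chi>. point S \<chi> \<and> \<chi> g \<noteq> 0)"

lemma enough_points_constants: "enough_points (range \<kappa>)"
  unfolding enough_points_def
proof (intro conjI ballI)
  show "subalgebra (range \<kappa>)"
    unfolding subalgebra_def using \<kappa>_B by (auto simp: \<kappa>_add[symmetric] \<kappa>_mult[symmetric])
  have in_P: "c = 0" if "\<kappa> c \<in> P" for c
  proof (rule ccontr)
    assume "c \<noteq> 0"
    then have "\<kappa> (inverse c) * \<kappa> c = 1" by (simp add: \<kappa>_mult[symmetric] \<kappa>_1)
    then show False using P_mult[OF \<kappa>_B that, of "inverse c"] P_1 by simp
  qed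
  have inj: "inj \<kappa>"
  proof (rule injI)
    fix a b assume "\<kappa> a = \<kappa> b"
    then have "\<kappa> (a + - b) = 0" by (simp only: \<kappa>_add \<kappa>_uminus) simp
    then show "a = b" using in_P[of "a + - b"] P_0 by simp
  qed
  fix g assume g: "g \<in> range \<kappa> - P"
  have inv: "inv_into UNIV \<kappa> (\<kappa> c) = c" for c using inj by simp
  have "point (range \<kappa>) (inv_into UNIV \<kappa>)"
    unfolding point_def using in_P by (auto simp: \<kappa>_add[symmetric] \<kappa>_mult[symmetric] inv)
  moreover have "inv_into UNIV \<kappa> g \<noteq> 0"
  proof -
    obtain c where c: "g = \<kappa> c" using g by auto
    then show ?thesis using g P_0 \<kappa>_0 by (auto simp: inv)
  qed
  ultimately show "\<exists>\<chi>. point (range \<kappa>) \<chi> \<and> \<chi> g \<noteq> 0" by blast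
qed

definition polys_over :: "'c set \<Rightarrow> 'c poly set" where
  "polys_over S = {F. \<forall>i. Polynomial.coeff F i \<in> S}"

context
  fixes S assumes S: "subalgebra S"
begin

lemma S_B: "x \<in> S \<Longrightarrow> x \<in> B" and S_\<kappa>: "\<kappa> c \<in> S" and S_add: "x \<in> S \<Longrightarrow> y \<in> S \<Longrightarrow> x + y \<in> S"
  and S_mult: "x \<in> S \<Longrightarrow> y \<in> S \<Longrightarrow> x * y \<in> S"
  using S unfolding subalgebra_def by auto

lemma S_0: "0 \<in> S" using S_\<kappa>[of 0] \<kappa>_0 by simp
lemma S_1: "1 \<in> S" using S_\<kappa>[of 1] \<kappa>_1 by simp
lemma S_minus1: "- 1 \<in> S" using S_\<kappa>[of "- 1"] \<kappa>_1 \<kappa>_uminus by simp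
lemma S_uminus: "x \<in> S \<Longrightarrow> - x \<in> S" using S_mult[OF S_minus1] by simp
lemma S_diff: "x \<in> S \<Longrightarrow> y \<in> S \<Longrightarrow> x - y \<in> S" using S_add[OF _ S_uminus] by simp
lemma S_sum: "(\<And>i. i \<in> A \<Longrightarrow> f i \<in> S) \<Longrightarrow> sum f A \<in> S"
  by (induction A rule: infinite_finite_induct) (auto simp: S_0 S_add)
lemma S_power: "x \<in> S \<Longrightarrow> x ^ n \<in> S" by (induction n) (auto simp: S_1 S_mult)

lemma over_coeff: "F \<in> polys_over S \<Longrightarrow> Polynomial.coeff F i \<in> S" by (simp add: polys_over_def)
lemma over_const: "a \<in> S \<Longrightarrow> [:a:] \<in> polys_over S"
  by (auto simp: polys_over_def S_0 coeff_pCons split: nat.split)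
lemma over_monom: "a \<in> S \<Longrightarrow> Polynomial.monom a n \<in> polys_over S"
  by (auto simp: polys_over_def S_0)
lemma over_add: "F \<in> polys_over S \<Longrightarrow> G \<in> polys_over S \<Longrightarrow> F + G \<in> polys_over S"
  by (auto simp: polys_over_def S_add)
lemma over_diff: "F \<in> polys_over S \<Longrightarrow> G \<in> polys_over S \<Longrightarrow> F - G \<in> polys_over S"
  by (auto simp: polys_over_def S_diff)
lemma over_mult: "F \<in> polys_over S \<Longrightarrow> G \<in> polys_over S \<Longrightarrow> F * G \<in> polys_over S"
  by (auto simp: polys_over_def coeff_mult intro!: S_sum S_mult)
lemma over_smult: "a \<in> S \<Longrightarrow> F \<in> polys_over S \<Longrightarrow> Polynomial.smult a F \<in> polys_over S"
  by (auto simp: polys_over_def S_mult)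
lemma over_0: "0 \<in> polys_over S" by (auto simp: polys_over_def S_0)

lemma over_eval_B: "F \<in> polys_over S \<Longrightarrow> x \<in> B \<Longrightarrow> poly F x \<in> B"
proof -
  assume F: "F \<in> polys_over S" and x: "x \<in> B"
  have p: "x ^ i \<in> B" for i using x by (induction i) (auto simp: B_1 B_mult)
  have "(\<Sum>i\<in>A. Polynomial.coeff F i * x ^ i) \<in> B" if "finite A" for A :: "nat set"
    using that by (induction A rule: finite_induct)
      (use \<kappa>_B[of 0] \<kappa>_0 in \<open>auto intro!: B_add B_mult p S_B[OF over_coeff[OF F]]\<close>)
  then show ?thesis by (simp add: poly_altdef)
qed

lemma over_eval_P:
  assumes "\<And>i. Polynomial.coeff F i \<in> P" "x \<in> B" shows "poly F x \<in> P"
proof -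
  have p: "x ^ i \<in> B" for i using assms(2) by (induction i) (auto simp: B_1 B_mult)
  then have "x ^ i * Polynomial.coeff F i \<in> P" for i using P_mult assms(1) by blast
  then show ?thesis by (simp add: poly_altdef mult.commute P_sum)
qed

text \<open>
  Division with remainder over a subring, where the leading coefficient cannot be inverted but a
  power of it can be multiplied in.
\<close>

lemma pseudo_division:
  assumes F: "F \<in> polys_over S" "degree F > 0" and H: "H \<in> polys_over S"
  shows "\<exists>e q R. q \<in> polys_over S \<and> R \<in> polys_over S \<and>
    Polynomial.smult (lead_coeff F ^ e) H = q * F + R \<and> degree R < degree F"
  using H
proof (induction "degree H" arbitrary: H rule: less_induct)
  case less
  show ?case
  proof (cases "degree H < degree F")
    case True
    then show ?thesis using less.prems over_0 by (intro exI[of _ 0] exI[of _ "0::'c poly"] exI[of _ H]) auto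
  next
    case False
    let ?l = "lead_coeff F" and ?n = "degree H" and ?m = "degree F"
    let ?M = "Polynomial.monom (lead_coeff H) (?n - ?m)"
    define H' where "H' = Polynomial.smult ?l H - ?M * F"
    have M: "?M \<in> polys_over S" using over_monom over_coeff less.prems by blast
    have H': "H' \<in> polys_over S" unfolding H'_def
      using less.prems F M over_coeff by (intro over_diff over_smult over_mult)
    have "degree (?M * F) \<le> ?n"
      using False degree_monom_le[of "lead_coeff H" "?n - ?m"] degree_mult_le[of ?M F] by linarith
    then have "degree H' \<le> ?n" unfolding H'_def
      by (intro degree_diff_le) (auto intro: order_trans[OF degree_smult_le])
    moreover have "Polynomial.coeff H' ?n = 0"
    proof -
      have "Polynomial.coeff (?M * F) ?n = lead_coeff H * ?l" using False by (simp add: coeff_monom_mult)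
      then show ?thesis unfolding H'_def coeff_diff coeff_smult by (simp add: mult.commute)
    qed
    ultimately have "degree H' < ?n" using False F(2)
      by (metis eq_zero_or_degree_less degree_0 gr0I le_zero_eq linorder_not_less)
    then obtain e q R where eq: "q \<in> polys_over S" "R \<in> polys_over S" "degree R < ?m"
      "Polynomial.smult (?l ^ e) H' = q * F + R" using less.hyps H' by blast
    have "Polynomial.smult (?l ^ Suc e) H = Polynomial.smult (?l ^ e) (H' + ?M * F)"
      unfolding H'_def by (simp add: mult.commute)
    also have "\<dots> = (q + Polynomial.smult (?l ^ e) ?M) * F + R"
      using eq(4) by (simp add: smult_add_right algebra_simps)
    finally have "Polynomial.smult (?l ^ Suc e) H = (q + Polynomial.smult (?l ^ e) ?M) * F + R" .
    moreover have "q + Polynomial.smult (?l ^ e) ?M \<in> polys_over S"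
      using eq M F over_coeff by (intro over_add over_smult S_power)
    ultimately show ?thesis using eq by blast
  qed
qed

context
  fixes \<chi> assumes \<chi>: "point S \<chi>"
begin

lemma \<chi>_add: "x \<in> S \<Longrightarrow> y \<in> S \<Longrightarrow> \<chi> (x + y) = \<chi> x + \<chi> y" and \<chi>_mult: "x \<in> S \<Longrightarrow> y \<in> S \<Longrightarrow> \<chi> (x * y) = \<chi> x * \<chi> y"
  and \<chi>_\<kappa>: "\<chi> (\<kappa> c) = c" and \<chi>_P: "x \<in> S \<Longrightarrow> x \<in> P \<Longrightarrow> \<chi> x = 0"
  using \<chi> unfolding point_def by auto

lemma \<chi>_0: "\<chi> 0 = 0" using \<chi>_\<kappa>[of 0] \<kappa>_0 by simp
lemma \<chi>_1: "\<chi> 1 = 1" using \<chi>_\<kappa>[of 1] \<kappa>_1 by simp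

lemma \<chi>_sum: "(\<And>i. i \<in> A \<Longrightarrow> f i \<in> S) \<Longrightarrow> \<chi> (sum f A) = (\<Sum>i\<in>A. \<chi> (f i))"
  by (induction A rule: infinite_finite_induct) (auto simp: \<chi>_0 \<chi>_add S_sum)

lemma \<chi>_power: "x \<in> S \<Longrightarrow> \<chi> (x ^ n) = \<chi> x ^ n"
  by (induction n) (auto simp: \<chi>_1 \<chi>_mult S_power)

abbreviation ev :: "'a \<Rightarrow> 'c poly \<Rightarrow> 'a" where "ev c F \<equiv> poly (map_poly \<chi> F) c"

lemma map_poly_add: "F \<in> polys_over S \<Longrightarrow> G \<in> polys_over S \<Longrightarrow> map_poly \<chi> (F + G) = map_poly \<chi> F + map_poly \<chi> G"
  by (rule poly_eqI) (simp add: coeff_map_poly \<chi>_0 \<chi>_add over_coeff)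

lemma map_poly_mult: "F \<in> polys_over S \<Longrightarrow> G \<in> polys_over S \<Longrightarrow> map_poly \<chi> (F * G) = map_poly \<chi> F * map_poly \<chi> G"
  by (rule poly_eqI) (simp add: coeff_map_poly \<chi>_0 coeff_mult \<chi>_sum \<chi>_mult over_coeff S_mult)

lemma map_poly_smult: "a \<in> S \<Longrightarrow> F \<in> polys_over S \<Longrightarrow> map_poly \<chi> (Polynomial.smult a F) = Polynomial.smult (\<chi> a) (map_poly \<chi> F)"
  by (rule poly_eqI) (simp add: coeff_map_poly \<chi>_0 \<chi>_mult over_coeff)

text \<open>
  The value of \<open>\<chi>'\<close> at \<open>F(x)\<close> is \<open>F\<close> with coefficients mapped by \<open>\<chi>\<close>, evaluated at \<open>c\<close>; the
  hypothesis on \<open>c\<close> makes this independent of the choice of \<open>F\<close>.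
\<close>

lemma point_extend:
  assumes x: "x \<in> B" and c: "\<And>F. F \<in> polys_over S \<Longrightarrow> poly F x \<in> P \<Longrightarrow> ev c F = 0"
  shows "\<exists>\<chi>'. point {poly F x | F. F \<in> polys_over S} \<chi>' \<and> (\<forall>F\<in>polys_over S. \<chi>' (poly F x) = ev c F)"
proof -
  define \<chi>' where "\<chi>' y = ev c (SOME F. F \<in> polys_over S \<and> poly F x = y)" for y
  have \<chi>': "\<chi>' (poly F x) = ev c F" if F: "F \<in> polys_over S" for F
  proof -
    let ?G = "SOME G. G \<in> polys_over S \<and> poly G x = poly F x"
    have G: "?G \<in> polys_over S \<and> poly ?G x = poly F x" by (rule someI[of _ F]) (simp add: F)
    then have "poly (F - ?G) x \<in> P" using P_0 by simp
    then have "ev c (F - ?G) = 0" using c over_diff F G by blast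
    moreover have "map_poly \<chi> F = map_poly \<chi> (F - ?G) + map_poly \<chi> ?G"
      using map_poly_add[of "F - ?G" ?G] over_diff F G by simp
    ultimately show ?thesis unfolding \<chi>'_def by simp
  qed
  have "point {poly F x | F. F \<in> polys_over S} \<chi>'"
    unfolding point_def
  proof (intro conjI ballI allI)
    fix y z assume "y \<in> {poly F x | F. F \<in> polys_over S}" "z \<in> {poly F x | F. F \<in> polys_over S}"
    then obtain F G where FG: "y = poly F x" "z = poly G x" "F \<in> polys_over S" "G \<in> polys_over S" by blast
    show "\<chi>' (y + z) = \<chi>' y + \<chi>' z"
      using \<chi>'[of "F + G"] \<chi>'[of F] \<chi>'[of G] FG over_add map_poly_add by simp
    show "\<chi>' (y * z) = \<chi>' y * \<chi>' z"
      using \<chi>'[of "F * G"] \<chi>'[of F] \<chi>'[of G] FG over_mult map_poly_mult by simp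
  next
    fix a
    have "map_poly \<chi> [:\<kappa> a:] = [:a:]" by (simp add: map_poly_pCons \<chi>_\<kappa> \<chi>_0)
    then show "\<chi>' (\<kappa> a) = a" using \<chi>'[of "[:\<kappa> a:]"] over_const S_\<kappa> by simp
  next
    fix y assume "y \<in> {poly F x | F. F \<in> polys_over S} \<inter> P"
    then show "\<chi>' y = 0" using \<chi>' c by auto
  qed
  then show ?thesis using \<chi>' by blast
qed

end

lemma subalgebra_extend: "x \<in> B \<Longrightarrow> subalgebra {poly F x | F. F \<in> polys_over S}"
  unfolding subalgebra_def
proof (intro conjI ballI)
  assume x: "x \<in> B"
  show "{poly F x | F. F \<in> polys_over S} \<subseteq> B" using over_eval_B x by auto
  show "range \<kappa> \<subseteq> {poly F x | F. F \<in> polys_over S}"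
  proof clarify
    fix a show "\<exists>F. \<kappa> a = poly F x \<and> F \<in> polys_over S"
      using over_const[OF S_\<kappa>, of a] by (intro exI[of _ "[:\<kappa> a:]"]) auto
  qed
  fix y z assume "y \<in> {poly F x | F. F \<in> polys_over S}" "z \<in> {poly F x | F. F \<in> polys_over S}"
  then obtain F G where FG: "y = poly F x" "z = poly G x" "F \<in> polys_over S" "G \<in> polys_over S" by blast
  show "y + z \<in> {poly F x | F. F \<in> polys_over S}" using FG over_add[of F G] by (auto intro!: exI[of _ "F + G"])
  show "y * z \<in> {poly F x | F. F \<in> polys_over S}" using FG over_mult[of F G] by (auto intro!: exI[of _ "F * G"])
qed

text \<open>
  Among the polynomials in \<open>T\<close> with some coefficient outside \<open>P\<close> take one of least degree. If its
  leading coefficient were in \<open>P\<close>, dropping the leading term would give one of smaller degree.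
\<close>

lemma minimal_not_in_P:
  assumes T: "\<And>H. T H \<Longrightarrow> H \<in> polys_over S" "T G" "\<exists>i. Polynomial.coeff G i \<notin> P"
    and sub: "\<And>H n. T H \<Longrightarrow> lead_coeff H \<in> P \<Longrightarrow> T (H - Polynomial.monom (lead_coeff H) (degree H))"
  shows "\<exists>F. T F \<and> lead_coeff F \<notin> P \<and> (\<forall>H. T H \<longrightarrow> degree H < degree F \<longrightarrow> (\<forall>i. Polynomial.coeff H i \<in> P))"
proof -
  define Q where "Q H \<longleftrightarrow> T H \<and> (\<exists>i. Polynomial.coeff H i \<notin> P)" for H
  have "Q G" using T Q_def by blast
  then obtain F where F: "Q F" "\<And>H. Q H \<Longrightarrow> degree F \<le> degree H"
    using ex_has_least_nat[of Q G degree] by blast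
  have "lead_coeff F \<notin> P"
  proof
    assume l: "lead_coeff F \<in> P"
    let ?F = "F - Polynomial.monom (lead_coeff F) (degree F)"
    obtain i where i: "Polynomial.coeff F i \<notin> P" using F(1) Q_def by blast
    then have ni: "i \<noteq> degree F" "i \<le> degree F" using l by auto (metis P_0 le_degree)
    then have "Polynomial.coeff ?F i \<notin> P" using i by auto
    then have Q: "Q ?F" using sub F(1) l Q_def by blast
    have "degree ?F \<le> degree F" by (intro degree_diff_le) (auto intro: degree_monom_le)
    moreover have "Polynomial.coeff ?F (degree F) = 0" by simp
    ultimately have "degree ?F < degree F"
      using ni by (metis eq_zero_or_degree_less degree_0 gr0I le_zero_eq)
    then show False using F(2)[OF Q] by simp
  qed
  then show ?thesis using F Q_def by (meson linorder_not_less)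
qed

text \<open>
  Let \<open>g = G(x)\<close>. If \<open>x\<close> is transcendental over the fraction field of \<open>S\<close> modulo \<open>P\<close>, a point of
  \<open>S\<close> can be extended by any value for \<open>x\<close>, and one chooses a value at which \<open>G\<close> does not vanish.
  If \<open>x\<close> is algebraic, let \<open>F\<close> be a polynomial of least degree with \<open>F(x) \<in> P\<close> among those with
  some coefficient outside \<open>P\<close>; it is irreducible over that fraction field. So \<open>F\<close> and \<open>G\<close>
  generate the unit ideal there, that is, some \<open>d \<in> S\<close> outside \<open>P\<close> lies in \<open>P + (g)\<close>. Take a point
  of \<open>S\<close> at which neither \<open>d\<close> nor the leading coefficient of \<open>F\<close> vanishes, and send \<open>x\<close> to a root
  of \<open>F\<close>; then \<open>g\<close> cannot go to zero since \<open>d\<close> does not.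
\<close>

lemma enough_points_extend:
  assumes good: "enough_points S" and x: "x \<in> B"
  shows "enough_points {poly F x | F. F \<in> polys_over S}"
  unfolding enough_points_def
proof (intro conjI ballI subalgebra_extend x)
  fix g assume g: "g \<in> {poly F x | F. F \<in> polys_over S} - P"
  then obtain G where G: "G \<in> polys_over S" "g = poly G x" "poly G x \<notin> P" by blast
  have G_coeff: "\<exists>i. Polynomial.coeff G i \<notin> P" using over_eval_P x G by blast
  have gB: "g \<in> B" using over_eval_B[OF G(1) x] G(2) by simp
  show "\<exists>\<chi>. point {poly F x | F. F \<in> polys_over S} \<chi> \<and> \<chi> g \<noteq> 0"
  proof (cases "\<exists>F\<in>polys_over S. poly F x \<in> P \<and> (\<exists>i. Polynomial.coeff F i \<notin> P)")
    case False
    obtain j where j: "Polynomial.coeff G j \<notin> P" using G_coeff by blast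
    then obtain \<chi> where \<chi>: "point S \<chi>" "\<chi> (Polynomial.coeff G j) \<noteq> 0"
      using good over_coeff[OF G(1)] unfolding enough_points_def by blast
    have "Polynomial.coeff (map_poly \<chi> G) j \<noteq> 0" using \<chi> \<chi>_0 by (simp add: coeff_map_poly)
    then have "map_poly \<chi> G \<noteq> 0" by auto
    then obtain c where c: "poly (map_poly \<chi> G) c \<noteq> 0" using poly_nonzero_point by blast
    have "poly (map_poly \<chi> F) c = 0" if "F \<in> polys_over S" "poly F x \<in> P" for F
    proof -
      have "map_poly \<chi> F = 0"
        using False that \<chi>_P[OF \<chi>(1)] over_coeff by (intro poly_eqI) (auto simp: coeff_map_poly \<chi>_0[OF \<chi>(1)])
      then show ?thesis by simp
    qed
    from point_extend[OF \<chi>(1) x this]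
    obtain \<chi>' where "point {poly F x | F. F \<in> polys_over S} \<chi>'" "\<forall>F\<in>polys_over S. \<chi>' (poly F x) = poly (map_poly \<chi> F) c"
      by blast
    then show ?thesis using c G by (intro exI[of _ \<chi>']) auto
  next
    case True
    define T where "T F \<longleftrightarrow> F \<in> polys_over S \<and> poly F x \<in> P" for F
    obtain F0 where F0: "T F0" "\<exists>i. Polynomial.coeff F0 i \<notin> P" using True T_def by blast
    have xp: "x ^ n \<in> B" for n using x by (induction n) (auto simp: B_1 B_mult)
    have "\<exists>F. T F \<and> lead_coeff F \<notin> P \<and> (\<forall>H. T H \<longrightarrow> degree H < degree F \<longrightarrow> (\<forall>i. Polynomial.coeff H i \<in> P))"
    proof (rule minimal_not_in_P[where T = T, OF _ F0])
      fix H assume H: "T H" "lead_coeff H \<in> P"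
      have "poly (H - Polynomial.monom (lead_coeff H) (degree H)) x = poly H x - x ^ degree H * lead_coeff H"
        by (simp add: poly_monom mult.commute)
      also have "\<dots> \<in> P" using H(1) by (intro P_diff P_mult[OF xp H(2)]) (simp add: T_def)
      finally have "poly (H - Polynomial.monom (lead_coeff H) (degree H)) x \<in> P" .
      then show "T (H - Polynomial.monom (lead_coeff H) (degree H))"
        using H over_diff over_monom over_coeff by (simp add: T_def)
    qed (simp add: T_def)
    then obtain F where F: "F \<in> polys_over S" "poly F x \<in> P" "lead_coeff F \<notin> P"
      and F_min: "\<And>H i. H \<in> polys_over S \<Longrightarrow> poly H x \<in> P \<Longrightarrow> degree H < degree F \<Longrightarrow> Polynomial.coeff H i \<in> P"
      unfolding T_def by blast
    have deg_F: "degree F > 0"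
    proof (rule ccontr)
      assume "\<not> degree F > 0"
      then obtain a where "F = [:a:]" by (metis degree_eq_zeroE gr0I)
      then show False using F by simp
    qed
    \<comment> \<open>U contains the polynomials whose value at x lies in P + (g). One of least degree plays the
        role of a greatest common divisor of F and G.\<close>
    define U where "U H \<longleftrightarrow> H \<in> polys_over S \<and> (\<exists>Y\<in>polys_over S. poly H x - poly Y x * g \<in> P)" for H
    have "U G" unfolding U_def using G over_const[OF S_1] P_0 by (auto intro!: bexI[of _ "[:1:]"])
    have "\<exists>F. U F \<and> lead_coeff F \<notin> P \<and> (\<forall>H. U H \<longrightarrow> degree H < degree F \<longrightarrow> (\<forall>i. Polynomial.coeff H i \<in> P))"
    proof (rule minimal_not_in_P[where T = U, OF _ \<open>U G\<close> G_coeff])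
      fix H assume H: "U H" "lead_coeff H \<in> P"
      then obtain Y where Y: "Y \<in> polys_over S" "poly H x - poly Y x * g \<in> P" by (auto simp: U_def)
      have "poly (H - Polynomial.monom (lead_coeff H) (degree H)) x - poly Y x * g
          = (poly H x - poly Y x * g) - x ^ degree H * lead_coeff H" by (simp add: poly_monom mult.commute)
      also have "\<dots> \<in> P" by (rule P_diff[OF Y(2) P_mult[OF xp H(2)]])
      finally have "poly (H - Polynomial.monom (lead_coeff H) (degree H)) x - poly Y x * g \<in> P" .
      then show "U (H - Polynomial.monom (lead_coeff H) (degree H))"
        using H Y over_diff over_monom over_coeff by (auto simp: U_def)
    qed (simp add: U_def)
    then obtain D where D: "U D" "lead_coeff D \<notin> P"
      and D_min: "\<And>H i. U H \<Longrightarrow> degree H < degree D \<Longrightarrow> Polynomial.coeff H i \<in> P"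
      by blast
    obtain Y where Y: "Y \<in> polys_over S" "poly D x - poly Y x * g \<in> P" using D(1) by (auto simp: U_def)
    have DS: "D \<in> polys_over S" using D(1) by (simp add: U_def)
    let ?l = "lead_coeff F" and ?l' = "lead_coeff D"
    have lS: "?l \<in> S" "?l' \<in> S" using over_coeff F(1) DS by auto
    \<comment> \<open>Otherwise D divides both F and G up to a nonzero factor modulo P. From F it follows that
        the quotient q or D takes a value in P at x; the first contradicts the minimality of the
        degree of F, the second puts g into P.\<close>
    have "degree D = 0"
    proof (rule ccontr)
      assume "degree D \<noteq> 0"
      then have deg_D: "degree D > 0" by simp
      have rem: "(\<forall>i. Polynomial.coeff R i \<in> P)"
        if H: "U H" and q: "q \<in> polys_over S" "R \<in> polys_over S" "degree R < degree D"
          "Polynomial.smult (?l' ^ e) H = q * D + R" for H q R e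
      proof -
        obtain Z where Z: "Z \<in> polys_over S" "poly H x - poly Z x * g \<in> P" using H by (auto simp: U_def)
        let ?W = "Polynomial.smult (?l' ^ e) Z - q * Y"
        have "?l' ^ e * poly H x = poly q x * poly D x + poly R x"
          using arg_cong[OF q(4), of "\<lambda>p. poly p x"] by simp
        then have eqR: "poly R x = ?l' ^ e * poly H x - poly q x * poly D x" by simp
        have "poly R x - poly ?W x * g = ?l' ^ e * (poly H x - poly Z x * g) - poly q x * (poly D x - poly Y x * g)"
          unfolding eqR by (simp add: algebra_simps)
        also have "\<dots> \<in> P"
          by (rule P_diff[OF P_mult[OF S_B[OF S_power[OF lS(2)]] Z(2)] P_mult[OF over_eval_B[OF q(1) x] Y(2)]])
        finally have "poly R x - poly ?W x * g \<in> P" .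
        moreover have "?W \<in> polys_over S" using lS Z q Y by (intro over_diff over_smult over_mult S_power)
        ultimately have "U R" using q(2) unfolding U_def by blast
        then show ?thesis using D_min q(3) by blast
      qed
      have UF: "U F" unfolding U_def using F over_0 by (intro conjI bexI[of _ 0]) auto
      obtain e q R where q: "q \<in> polys_over S" "R \<in> polys_over S" "degree R < degree D"
        "Polynomial.smult (?l' ^ e) F = q * D + R" using pseudo_division[OF DS deg_D F(1)] by blast
      have R: "\<forall>i. Polynomial.coeff R i \<in> P" by (rule rem[OF UF q])
      have "?l' ^ e * poly F x = poly q x * poly D x + poly R x"
        using arg_cong[OF q(4), of "\<lambda>p. poly p x"] by simp
      then have "poly q x * poly D x = ?l' ^ e * poly F x - poly R x" by simp
      also have "\<dots> \<in> P" using F(2) S_B[OF S_power[OF lS(2)]] over_eval_P R x by (intro P_diff P_mult) auto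
      finally consider "poly q x \<in> P" | "poly D x \<in> P"
        using P_prime over_eval_B q(1) DS x by blast
      then show False
      proof cases
        case 1
        show False
        proof (cases "\<exists>i. Polynomial.coeff q i \<notin> P")
          case False
          have "Polynomial.coeff (q * D) i \<in> P" for i
            using False over_coeff[OF DS] S_B P_mult by (auto simp: coeff_mult mult.commute intro!: P_sum)
          then have "Polynomial.coeff (q * D + R) (degree F) \<in> P" using R P_add by simp
          then have "?l' ^ e * ?l \<in> P" unfolding q(4)[symmetric] by simp
          then show False using P_power_cancel D(2) F(3) lS S_B by blast
        next
          case True
          define n where "n = Max {i. Polynomial.coeff q i \<notin> P}"
          have fin: "finite {i. Polynomial.coeff q i \<notin> P}"
          proof (rule finite_subset)
            show "{i. Polynomial.coeff q i \<notin> P} \<subseteq> {..degree q}"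
            proof (rule subsetI)
              fix i assume "i \<in> {i. Polynomial.coeff q i \<notin> P}"
              then have "Polynomial.coeff q i \<noteq> 0" using P_0 by (metis mem_Collect_eq)
              then show "i \<in> {..degree q}" using le_degree by simp
            qed
          qed simp
          have n: "Polynomial.coeff q n \<notin> P" using Max_in[OF fin] True unfolding n_def by blast
          have n_max: "Polynomial.coeff q i \<in> P" if "i > n" for i
            using Max_ge[OF fin, of i] that unfolding n_def by fastforce
          define q' where "q' = (\<Sum>i\<le>n. Polynomial.monom (Polynomial.coeff q i) i)"
          have cq': "Polynomial.coeff q' i = (if i \<le> n then Polynomial.coeff q i else 0)" for i
            by (simp add: q'_def coeff_sum)
          have q'S: "q' \<in> polys_over S" using over_coeff[OF q(1)] S_0 by (auto simp: polys_over_def cq')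
          have dq': "degree q' \<le> n" by (rule degree_le) (simp add: cq')
          have "poly (q - q') x \<in> P" using n_max P_0 by (intro over_eval_P x) (auto simp: cq')
          then have "poly q x - poly (q - q') x \<in> P" using 1 by (intro P_diff)
          then have "poly q' x \<in> P" by simp
          moreover have "Polynomial.coeff q' n \<notin> P" using n by (simp add: cq')
          ultimately have "degree F \<le> degree q'" using F_min[OF q'S] by (meson linorder_not_less)
          then have nF: "degree F \<le> n" using dq' by simp
          let ?N = "n + degree D"
          have "Polynomial.coeff (q * D + R) ?N = ?l' ^ e * Polynomial.coeff F ?N" unfolding q(4)[symmetric] by simp
          moreover have "Polynomial.coeff F ?N = 0" "Polynomial.coeff R ?N = 0"
            using nF deg_D q(3) by (auto intro!: coeff_eq_0)
          ultimately have "Polynomial.coeff (q * D) ?N = 0" by simp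
          moreover have "Polynomial.coeff (q * D) ?N = Polynomial.coeff q n * ?l' +
              (\<Sum>i\<in>{..?N} - {n}. Polynomial.coeff q i * Polynomial.coeff D (?N - i))"
            unfolding coeff_mult by (subst sum.remove[of _ n]) auto
          moreover have "Polynomial.coeff q i * Polynomial.coeff D (?N - i) \<in> P" if "i \<in> {..?N} - {n}" for i
          proof (cases "i > n")
            case True
            then show ?thesis using n_max P_mult S_B[OF over_coeff[OF DS]] by (subst mult.commute) blast
          next
            case False
            then have "Polynomial.coeff D (?N - i) = 0" using that by (intro coeff_eq_0) auto
            then show ?thesis using P_0 by simp
          qed
          then have "(\<Sum>i\<in>{..?N} - {n}. Polynomial.coeff q i * Polynomial.coeff D (?N - i)) \<in> P" by (rule P_sum)
          ultimately have "Polynomial.coeff q n * ?l' \<in> P"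
            using P_uminus by (metis add_eq_0_iff add.commute)
          then show False using P_prime n D(2) S_B over_coeff q(1) lS by blast
        qed
      next
        case 2
        obtain e q R where q: "q \<in> polys_over S" "R \<in> polys_over S" "degree R < degree D"
          "Polynomial.smult (?l' ^ e) G = q * D + R" using pseudo_division[OF DS deg_D G(1)] by blast
        have R: "\<forall>i. Polynomial.coeff R i \<in> P" by (rule rem[OF \<open>U G\<close> q])
        have "?l' ^ e * poly G x = poly q x * poly D x + poly R x"
          using arg_cong[OF q(4), of "\<lambda>p. poly p x"] by simp
        also have "\<dots> \<in> P" using 2 over_eval_B[OF q(1) x] over_eval_P R x by (intro P_add P_mult) auto
        finally have "g \<in> P" using P_power_cancel[OF S_B[OF lS(2)] D(2) gB] G(2) by blast
        then show False using G by simp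
      qed
    qed
    then obtain d where d: "D = [:d:]" by (elim degree_eq_zeroE)
    then have dl: "?l' = d" by simp
    \<comment> \<open>The constant D is the element d, and the point of S must avoid it as well as the leading
        coefficient of F, so that F still has a root.\<close>
    have "?l * ?l' \<notin> P"
      using P_prime[OF S_B[OF lS(1)] S_B[OF lS(2)]] D(2) F(3) by blast
    then have "?l * d \<in> S - P" using S_mult[OF lS] unfolding dl by blast
    then obtain \<chi> where \<chi>: "point S \<chi>" "\<chi> (?l * d) \<noteq> 0"
      using good unfolding enough_points_def by blast
    have \<chi>ld: "\<chi> ?l \<noteq> 0" "\<chi> d \<noteq> 0" using \<chi> \<chi>_mult[OF \<chi>(1)] lS dl by auto
    have "Polynomial.coeff (map_poly \<chi> F) (degree F) \<noteq> 0" using \<chi>ld by (simp add: coeff_map_poly \<chi>_0[OF \<chi>(1)])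
    then have "degree (map_poly \<chi> F) \<ge> degree F" by (rule le_degree)
    then obtain c where c: "poly (map_poly \<chi> F) c = 0"
      using alg_closed_imp_poly_has_root[of "map_poly \<chi> F"] deg_F by auto
    have "poly (map_poly \<chi> H) c = 0" if H: "H \<in> polys_over S" "poly H x \<in> P" for H
    proof -
      obtain e q R where q: "q \<in> polys_over S" "R \<in> polys_over S" "degree R < degree F"
        "Polynomial.smult (?l ^ e) H = q * F + R" using pseudo_division[OF F(1) deg_F H(1)] by blast
      have "?l ^ e * poly H x = poly q x * poly F x + poly R x"
        using arg_cong[OF q(4), of "\<lambda>p. poly p x"] by simp
      then have "poly R x = ?l ^ e * poly H x - poly q x * poly F x" by simp
      also have "\<dots> \<in> P" using H(2) F(2) S_B[OF S_power[OF lS(1)]] over_eval_B[OF q(1) x] by (intro P_diff P_mult)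
      finally have "Polynomial.coeff R i \<in> P" for i using F_min q by blast
      then have "map_poly \<chi> R = 0" using \<chi>_P[OF \<chi>(1)] over_coeff[OF q(2)]
        by (intro poly_eqI) (auto simp: coeff_map_poly \<chi>_0[OF \<chi>(1)])
      moreover have "Polynomial.smult (\<chi> ?l ^ e) (map_poly \<chi> H) = map_poly \<chi> q * map_poly \<chi> F + map_poly \<chi> R"
        using arg_cong[OF q(4), of "map_poly \<chi>"] map_poly_smult[OF \<chi>(1) S_power[OF lS(1)] H(1), of e]
          map_poly_add[OF \<chi>(1) over_mult[OF q(1) F(1)] q(2)] map_poly_mult[OF \<chi>(1) q(1) F(1)] \<chi>_power[OF \<chi>(1) lS(1), of e]
        by simp
      ultimately have "\<chi> ?l ^ e * poly (map_poly \<chi> H) c = 0"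
        using c by (metis add.right_neutral mult_zero_right poly_mult poly_smult)
      then show ?thesis using \<chi>ld by simp
    qed
    from point_extend[OF \<chi>(1) x this]
    obtain \<chi>' where \<chi>': "point {poly F x | F. F \<in> polys_over S} \<chi>'"
      "\<forall>F\<in>polys_over S. \<chi>' (poly F x) = poly (map_poly \<chi> F) c" by blast
    have "\<chi>' g \<noteq> 0"
    proof
      assume g0: "\<chi>' g = 0"
      have DYG: "D - Y * G \<in> polys_over S" using DS Y(1) G(1) by (intro over_diff over_mult)
      have "poly (D - Y * G) x \<in> P" using Y(2) G(2) by simp
      then have "\<chi>' (poly (D - Y * G) x) = 0" using \<chi>'(1) DYG unfolding point_def by blast
      then have e0: "poly (map_poly \<chi> (D - Y * G)) c = 0" using \<chi>'(2) DYG by metis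
      have "map_poly \<chi> D = map_poly \<chi> (D - Y * G) + map_poly \<chi> Y * map_poly \<chi> G"
        using map_poly_add[OF \<chi>(1) DYG over_mult[OF Y(1) G(1)]] map_poly_mult[OF \<chi>(1) Y(1) G(1)] by simp
      moreover have "poly (map_poly \<chi> G) c = 0" using g0 \<chi>'(2) G by simp
      ultimately have "poly (map_poly \<chi> D) c = 0" using e0 by simp
      moreover have "map_poly \<chi> D = [:\<chi> d:]" by (simp add: d map_poly_pCons \<chi>_0[OF \<chi>(1)])
      ultimately show False using \<chi>ld by simp
    qed
    then show ?thesis using \<chi>'(1) by blast
  qed
qed

end

end

section \<open>The Nullstellensatz\<close>

lemma mvar_power: "mvar v ^ n = single (single v n) 1"
  by (induction n) (auto simp: mvar_def mult_single single_add[symmetric])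

lemma prod_single: "(\<Prod>x\<in>A. single (f x) (1::'a::comm_semiring_1)) = single (\<Sum>x\<in>A. f x) 1"
  by (induction A rule: infinite_finite_induct) (auto simp: mult_single)

lemma single_eq_prod: "single m 1 = (\<Prod>v\<in>keys m. mvar v ^ lookup m v)"
proof -
  have "(\<Prod>v\<in>keys m. mvar v ^ lookup m v) = (\<Prod>v\<in>keys m. single (single v (lookup m v)) (1::'b))"
    by (simp add: mvar_power)
  also have "\<dots> = single (\<Sum>v\<in>keys m. single v (lookup m v)) 1" by (rule prod_single)
  also have "\<dots> = single m 1" using mpol_eq_sum[of m] by simp
  finally show ?thesis by simp
qed

lemma polys_induct [consumes 1, case_names const var add mult]:
  assumes f: "f \<in> polys V" and const: "\<And>c. T (single 0 c)" and var: "\<And>v. v \<in> V \<Longrightarrow> T (mvar v)"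
    and add: "\<And>f g. T f \<Longrightarrow> T g \<Longrightarrow> T (f + g)" and mult: "\<And>f g. T f \<Longrightarrow> T g \<Longrightarrow> T (f * g)"
  shows "T f"
proof -
  have power: "T (g ^ n)" if "T g" for g n
    using that const[of 1] mult by (induction n) auto
  have prod: "T (\<Prod>x\<in>A. g x)" if "\<And>x. x \<in> A \<Longrightarrow> T (g x)" for A :: "'a set" and g
    using that const[of 1] mult by (induction A rule: infinite_finite_induct) auto
  have sum: "T (\<Sum>x\<in>A. g x)" if "\<And>x. x \<in> A \<Longrightarrow> T (g x)" for A :: "'a monomial set" and g
    using that const[of 0] add by (induction A rule: infinite_finite_induct) auto
  have "T (single m c)" if "keys m \<subseteq> V" for m c
  proof -
    have "T (single 0 c * single m 1)"
      using that unfolding single_eq_prod by (intro mult const prod power var) auto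
    then show ?thesis by (simp add: mult_single)
  qed
  then have "T (\<Sum>m\<in>keys f. single m (lookup f m))" using f by (intro sum) (auto simp: polys_def)
  then show ?thesis using mpol_eq_sum[of f] by simp
qed

text \<open>Adjoin the variables one at a time to the field of constants.\<close>

theorem nullstellensatz:
  fixes P :: "('v, 'a::alg_closed_field) mpol set"
  assumes V: "finite V" and P: "primeideal P (polynomial_ring V)" and g: "g \<in> polys V" "g \<notin> P"
  obtains \<chi> :: "('v, 'a) mpol \<Rightarrow> 'a" where "\<And>x y. x \<in> polys V \<Longrightarrow> y \<in> polys V \<Longrightarrow> \<chi> (x + y) = \<chi> x + \<chi> y"
    "\<And>x y. x \<in> polys V \<Longrightarrow> y \<in> polys V \<Longrightarrow> \<chi> (x * y) = \<chi> x * \<chi> y" "\<And>c. \<chi> (single 0 c) = c"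
    "\<And>x. x \<in> P \<Longrightarrow> \<chi> x = 0" "\<chi> g \<noteq> 0"
proof -
  interpret Q: primeideal P "polynomial_ring V" by fact
  note D = ideal_polynomial_ringD[OF Q.is_ideal]
  interpret prime_in_algebra "single 0" "polys V" P
  proof
    show "1 \<notin> P" using Q.one_imp_carrier Q.I_notcarr by auto
    show "x \<in> P \<or> y \<in> P" if "x \<in> polys V" "y \<in> polys V" "x * y \<in> P" for x y
      using Q.I_prime[of x y] that by simp
  qed (auto simp: single_add mult_single D)
  have "enough_points (polys W)" if "W \<subseteq> V" for W
    using finite_subset[OF that V] that
  proof (induction W rule: finite_induct)
    case empty
    have "polys {} = range (single 0 :: 'a \<Rightarrow> ('v, 'a) mpol)"
    proof
      show "polys {} \<subseteq> range (single 0 :: 'a \<Rightarrow> ('v, 'a) mpol)"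
      proof
        fix f :: "('v, 'a) mpol" assume "f \<in> polys {}"
        then show "f \<in> range (single 0)"
          by (induction rule: polys_induct) (auto simp: single_add[symmetric] mult_single)
      qed
    qed auto
    then show ?case using enough_points_constants by simp
  next
    case (insert v W)
    then have good: "enough_points (polys W)" by simp
    then have sub: "subalgebra (polys W)" by (simp add: enough_points_def)
    have vV: "mvar v \<in> polys V" using insert by (intro polys_mvar) auto
    let ?E = "{poly F (mvar v) | F. F \<in> polys_over (polys W)}"
    have sE: "subalgebra ?E" by (rule subalgebra_extend[OF sub vV])
    have "?E = polys (insert v W)"
    proof
      show "?E \<subseteq> polys (insert v W)"
      proof clarify
        fix F assume F: "F \<in> polys_over (polys W)"
        show "poly F (mvar v) \<in> polys (insert v W)"
          unfolding poly_altdef using over_coeff[OF sub F] polys_mono[of W "insert v W"]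
          by (intro polys_sum polys_mult polys_power polys_mvar) auto
      qed
      show "polys (insert v W) \<subseteq> ?E"
      proof
        fix f :: "('v, 'a) mpol" assume "f \<in> polys (insert v W)"
        then show "f \<in> ?E"
        proof (induction rule: polys_induct)
          case (const c)
          have "[:single 0 c:] \<in> polys_over (polys W)" using over_const[OF sub] by simp
          then show ?case by (intro CollectI exI[of _ "[:single 0 c:]"]) auto
        next
          case (var u)
          show ?case
          proof (cases "u = v")
            case True
            have "Polynomial.monom 1 1 \<in> polys_over (polys W)" using over_monom[OF sub, of 1] by simp
            moreover have "poly (Polynomial.monom 1 1) (mvar v) = mvar v" by (simp add: poly_monom)
            ultimately show ?thesis using True by (metis (mono_tags, lifting) mem_Collect_eq)
          next
            case False
            then have "[:mvar u:] \<in> polys_over (polys W)" using over_const[OF sub] var by (simp add: polys_mvar)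
            then show ?thesis by (intro CollectI exI[of _ "[:mvar u:]"]) auto
          qed
        next
          case (add f g) then show ?case using sE unfolding subalgebra_def by blast
        next
          case (mult f g) then show ?case using sE unfolding subalgebra_def by blast
        qed
      qed
    qed
    then show ?case using enough_points_extend[OF sub good vV] by simp
  qed
  then obtain \<chi> where "point (polys V) \<chi>" "\<chi> g \<noteq> 0" using g unfolding enough_points_def by blast
  then show ?thesis using that D(1) unfolding point_def by blast
qed

section \<open>Matchings of given total level\<close>

interpretation jet: variable_order jet_var_less
proof
  show "\<not> jet_var_less v v" for v by (cases v) auto
  show "jet_var_less u v \<Longrightarrow> jet_var_less v w \<Longrightarrow> jet_var_less u w" for u v w
    by (cases u; cases v; cases w) auto
  show "v \<noteq> w \<Longrightarrow> jet_var_less v w \<or> jet_var_less w v" for v w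
    by (cases v; cases w) auto
qed

text \<open>
  The monomials of \<open>p^(h)\<close>: perfect matchings of \<open>{b+1, ..., b+2\<rho>}\<close> whose edges \<open>{i, j}\<close> carry
  levels \<open>l\<close> with sum \<open>h\<close>. That all vertices are covered follows from disjointness by counting.
  The offset \<open>b\<close> is \<open>0\<close> for the Pfaffian itself and \<open>2\<close> for the cofactor of the edge \<open>{1, 2}\<close>.
\<close>

definition leveled_matching :: "nat \<Rightarrow> nat \<Rightarrow> nat \<Rightarrow> jet_var set \<Rightarrow> bool" where
  "leveled_matching b \<rho> h T \<longleftrightarrow> finite T \<and> card T = \<rho> \<and>
     (\<forall>(l, i, j)\<in>T. b < i \<and> i < j \<and> j \<le> b + 2 * \<rho>) \<and>
     (\<forall>(l, i, j)\<in>T. \<forall>(l', i', j')\<in>T. (l, i, j) \<noteq> (l', i', j') \<longrightarrow> {i, j} \<inter> {i', j'} = {}) \<and>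
     (\<Sum>x\<in>T. fst x) = h"

lemma leveled_matching_bounds:
  assumes "leveled_matching b \<rho> h T" "(l, i, j) \<in> T"
  shows "b < i" "i < j" "j \<le> b + 2 * \<rho>"
proof -
  have "\<forall>(l, i, j)\<in>T. b < i \<and> i < j \<and> j \<le> b + 2 * \<rho>" using assms(1) by (simp add: leveled_matching_def)
  from bspec[OF this assms(2)] show "b < i" "i < j" "j \<le> b + 2 * \<rho>" by auto
qed

lemma leveled_matching_disjoint:
  assumes "leveled_matching b \<rho> h T" "(l, i, j) \<in> T" "(l', i', j') \<in> T" "(l, i, j) \<noteq> (l', i', j')"
  shows "{i, j} \<inter> {i', j'} = {}"
proof -
  have "\<forall>(l, i, j)\<in>T. \<forall>(l', i', j')\<in>T. (l, i, j) \<noteq> (l', i', j') \<longrightarrow> {i, j} \<inter> {i', j'} = {}"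
    using assms(1) by (simp add: leveled_matching_def)
  from bspec[OF this assms(2)] have "\<forall>(l', i', j')\<in>T. (l, i, j) \<noteq> (l', i', j') \<longrightarrow> {i, j} \<inter> {i', j'} = {}" by simp
  from bspec[OF this assms(3)] assms(4) show ?thesis by simp
qed

lemma leveled_matching_inj:
  assumes "leveled_matching b \<rho> h T" shows "inj_on (\<lambda>x. fst (snd x)) T"
proof (rule inj_onI)
  fix x y assume xy: "x \<in> T" "y \<in> T" "fst (snd x) = fst (snd y)"
  obtain l i j l' i' j' where "x = (l, i, j)" "y = (l', i', j')" by (cases x, cases y) auto
  then show "x = y" using leveled_matching_disjoint[OF assms, of l i j l' i' j'] xy by auto
qed

text \<open>
  With \<open>h = q \<rho> + s\<close>, \<open>s < \<rho>\<close>, these are the edges on the antidiagonal of the first \<open>2 (\<rho> - s)\<close>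
  vertices at level \<open>q\<close> and those on the antidiagonal of the last \<open>2 s\<close> vertices at level \<open>q + 1\<close>.
  In this description by a single equation it is evident that an edge with its level determines
  \<open>h\<close>.
\<close>

definition leading_matching :: "nat \<Rightarrow> nat \<Rightarrow> nat \<Rightarrow> jet_var set" where
  "leading_matching b \<rho> h =
     {(l, i, j). b < i \<and> i < j \<and> j \<le> b + 2 * \<rho> \<and> 2 * h + i + j = 2 * l * \<rho> + 2 * \<rho> + 1 + 2 * b}"

lemma leading_matching_iff:
  assumes h: "h = q * \<rho> + s" "s < \<rho>" "m = \<rho> - s"
  shows "(l, i, j) \<in> leading_matching b \<rho> h \<longleftrightarrow> b < i \<and> i < j \<and> j \<le> b + 2 * \<rho> \<and>
    (l = q \<and> i + j = 2 * b + 2 * m + 1 \<or> l = q + 1 \<and> i + j = 2 * b + 2 * \<rho> + 2 * m + 1)"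
    (is "?L \<longleftrightarrow> ?B \<and> ?R")
proof (cases ?B)
  case B: True
  consider "l = q" | "l = q + 1" | "l < q" | "l > q + 1" by linarith
  then show ?thesis
  proof cases
    case 1
    then show ?thesis using B h by (auto simp: leading_matching_def algebra_simps)
  next
    case 2
    then show ?thesis using B h by (auto simp: leading_matching_def algebra_simps)
  next
    case 3
    then have "(l + 1) * \<rho> \<le> q * \<rho>" by (intro mult_right_mono) auto
    then have "\<not> ?L" using B h by (auto simp: leading_matching_def algebra_simps)
    then show ?thesis using 3 by auto
  next
    case 4
    then have "(q + 2) * \<rho> \<le> l * \<rho>" by (intro mult_right_mono) auto
    then have "\<not> ?L" using B h by (auto simp: leading_matching_def algebra_simps)
    then show ?thesis using 4 by auto
  qed
qed (auto simp: leading_matching_def)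

lemma finite_leading_matching: "finite (leading_matching b \<rho> h)"
proof (cases "\<rho> = 0")
  case True then have "leading_matching b \<rho> h = {}" by (auto simp: leading_matching_def)
  then show ?thesis by simp
next
  case False
  then have h: "h = h div \<rho> * \<rho> + h mod \<rho>" "h mod \<rho> < \<rho>" "\<rho> - h mod \<rho> = \<rho> - h mod \<rho>" by auto
  have "leading_matching b \<rho> h \<subseteq> {..h div \<rho> + 1} \<times> {..b + 2 * \<rho>} \<times> {..b + 2 * \<rho>}"
    using leading_matching_iff[OF h] by (auto; fastforce)
  then show ?thesis by (rule finite_subset) simp
qed

text \<open>
  The smallest difference \<open>v = (l0, i0, j0)\<close> has to lie in \<open>T\<close>. Suppose that it lies in the
  leading matching. Then no edge of \<open>T\<close> of level \<open>l0\<close> starts at \<open>i0\<close>, as all smaller edges agree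
  with the antidiagonal. If \<open>l0 = q\<close>, the edges of \<open>T\<close> of level \<open>q\<close> start in \<open>{b+1, ..., b+m}\<close>,
  where \<open>m = \<rho> - s\<close>, but not at \<open>i0\<close>; so there are fewer than \<open>m\<close> of them, no level is below \<open>q\<close>,
  and the sum of all levels exceeds \<open>h\<close>. If \<open>l0 = q + 1\<close>, then \<open>T\<close> contains all \<open>m\<close> edges of level
  \<open>q\<close>, the sum of the levels forces level \<open>q + 1\<close> for the other \<open>s\<close> edges, and their smaller
  endpoints fill an interval of length \<open>s\<close> that contains \<open>i0\<close>.
\<close>

lemma matching_first_difference:
  assumes T: "leveled_matching b \<rho> h T" and ne: "T \<noteq> leading_matching b \<rho> h"
  shows "\<exists>v\<in>T - leading_matching b \<rho> h. \<forall>w. jet_var_less w v \<longrightarrow> (w \<in> T \<longleftrightarrow> w \<in> leading_matching b \<rho> h)"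
proof -
  let ?M = "leading_matching b \<rho> h"
  define q where "q = h div \<rho>"
  define s where "s = h mod \<rho>"
  define m where "m = \<rho> - s"
  have finT: "finite T" and cardT: "card T = \<rho>" and lev: "(\<Sum>x\<in>T. fst x) = h"
    using T by (auto simp: leveled_matching_def)
  note bd = leveled_matching_bounds[OF T] and disj = leveled_matching_disjoint[OF T]
  have sum_indicator: "(\<Sum>x\<in>T. fst x + (if fst x = q then 1 else 0)) = h + card {x\<in>T. fst x = q}"
  proof -
    have "(\<Sum>x\<in>T. if fst x = q then 1 else 0) = (\<Sum>x\<in>{x\<in>T. fst x = q}. 1 :: nat)"
      using finT by (rule sum.inter_filter[symmetric])
    then show ?thesis unfolding sum.distrib lev by simp
  qed
  have \<rho>: "\<rho> > 0"
  proof (rule ccontr)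
    assume "\<not> \<rho> > 0"
    then have "T = {}" "?M = {}" using cardT finT by (auto simp: leading_matching_def)
    then show False using ne by simp
  qed
  have h: "h = q * \<rho> + s" "s < \<rho>" "m = \<rho> - s" using \<rho> by (auto simp: q_def s_def m_def)
  note M = leading_matching_iff[OF h]
  note inj = leveled_matching_inj[OF T]
  let ?D = "(T - ?M) \<union> (?M - T)"
  have "finite ?D" "?D \<noteq> {}" using finT finite_leading_matching ne by auto
  then obtain v where v: "v \<in> ?D" "\<And>w. jet_var_less w v \<Longrightarrow> w \<notin> ?D"
    using jet.finite_vless_minimal by blast
  then have below: "w \<in> T \<longleftrightarrow> w \<in> ?M" if "jet_var_less w v" for w using that by blast
  show ?thesis
  proof (cases "v \<in> T")
    case True then show ?thesis using v below by blast
  next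
    case False
    then have vM: "v \<in> ?M" "v \<notin> T" using v by auto
    obtain l0 i0 j0 where v0: "v = (l0, i0, j0)" by (cases v) auto
    have v_bd: "b < i0" "i0 < j0" "j0 \<le> b + 2 * \<rho>" using vM(1) unfolding v0 M by auto
    \<comment> \<open>Let (i0, j) be an edge of T at the level of v. For j > j0 it is below v, hence on the
        antidiagonal i + j = N, which contains (i0, j0). For j < j0 the antidiagonal edge of j is
        below v, hence in T, and meets (i0, j).\<close>
    have no_i0: False if x: "(l0, i0, j) \<in> T" and sum: "i0 + j0 = N" "odd N"
      and N: "\<And>a c. b < a \<Longrightarrow> a < c \<Longrightarrow> c \<le> b + 2 * \<rho> \<Longrightarrow> a + c = N \<Longrightarrow> (l0, a, c) \<in> ?M"
        "\<And>a c. (l0, a, c) \<in> ?M \<Longrightarrow> a + c = N" for j N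
    proof -
      consider "j > j0" | "j = j0" | "j < j0" by linarith
      then show False
      proof cases
        case 1
        then have "(l0, i0, j) \<in> ?M" using below[of "(l0, i0, j)"] x v0 by auto
        then show False using N(2) sum 1 by fastforce
      next
        case 2 then show False using x vM v0 by simp
      next
        case 3
        have ij: "i0 < j" using bd[OF x] by simp
        define j' where "j' = N - j"
        have j': "i0 < j'" "j' < j0" "j + j' = N" using 3 ij sum(1) by (auto simp: j'_def)
        have "j \<noteq> j'" using j'(3) sum(2) by auto
        define a where "a = min j j'"
        define c where "c = max j j'"
        have ac: "i0 < a" "a < c" "c < j0" "a + c = N" "j \<in> {a, c}"
          using j' \<open>j \<noteq> j'\<close> 3 ij unfolding a_def c_def by (auto simp: min_def max_def)
        have "(l0, a, c) \<in> ?M" using ac v_bd by (intro N(1)) auto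
        then have y: "(l0, a, c) \<in> T" using below[of "(l0, a, c)"] ac v0 by auto
        then show False using disj[OF x y] ac by auto
      qed
    qed
    consider (q) "l0 = q" "i0 + j0 = 2 * b + 2 * m + 1" | (q1) "l0 = q + 1" "i0 + j0 = 2 * b + 2 * \<rho> + 2 * m + 1"
      using vM(1) unfolding v0 M by auto
    then show ?thesis
    proof cases
      case q
      have lq: "q \<le> l" if x: "(l, i, j) \<in> T" for l i j
      proof (rule ccontr)
        assume "\<not> q \<le> l"
        then have "(l, i, j) \<in> ?M" using below[of "(l, i, j)"] x v0 q by auto
        then show False using \<open>\<not> q \<le> l\<close> unfolding M by auto
      qed
      let ?Tq = "{x\<in>T. fst x = q}"
      have "fst (snd x) \<in> {b+1..b+m} - {i0}" if x: "x \<in> ?Tq" for x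
      proof -
        obtain i j where ij: "x = (q, i, j)" using x by (cases x) auto
        have xT: "(q, i, j) \<in> T" using x ij by simp
        have "i \<noteq> i0"
        proof
          assume "i = i0"
          show False
          proof (rule no_i0[of j "2 * b + 2 * m + 1"])
            show "(l0, i0, j) \<in> T" using xT q(1) \<open>i = i0\<close> by simp
            show "(l0, a, c) \<in> ?M" if "b < a" "a < c" "c \<le> b + 2 * \<rho>" "a + c = 2 * b + 2 * m + 1" for a c
              unfolding M using that q(1) by simp
            show "a + c = 2 * b + 2 * m + 1" if "(l0, a, c) \<in> ?M" for a c
              using that q(1) unfolding M by simp
          qed (use q(2) in simp_all)
        qed
        moreover have "i \<le> b + m"
        proof (cases "i > i0")
          case True
          then have "(q, i, j) \<in> ?M" using below[of "(q, i, j)"] xT v0 q by auto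
          then show ?thesis unfolding M by auto
        next
          case False then show ?thesis using q v_bd by linarith
        qed
        ultimately show ?thesis using bd[OF xT] ij by auto
      qed
      then have "(\<lambda>x. fst (snd x)) ` ?Tq \<subseteq> {b+1..b+m} - {i0}" by blast
      moreover have "inj_on (\<lambda>x. fst (snd x)) ?Tq" using inj by (rule inj_on_subset) auto
      ultimately have "card ?Tq \<le> card ({b+1..b+m} - {i0})" by (intro card_inj_on_le) auto
      also have "\<dots> = m - 1" using q v_bd by simp
      finally have cq: "card ?Tq \<le> m - 1" .
      have "(\<Sum>x\<in>T. q + 1) \<le> (\<Sum>x\<in>T. fst x + (if fst x = q then 1 else 0))"
      proof (rule sum_mono)
        fix x assume "x \<in> T"
        then have "q \<le> fst x" using lq by (cases x) auto
        then show "q + 1 \<le> fst x + (if fst x = q then 1 else 0)" by auto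
      qed
      also have "\<dots> = h + card ?Tq" by (rule sum_indicator)
      finally have "(q + 1) * \<rho> \<le> h + (m - 1)" using cardT cq by (simp add: mult.commute)
      then show ?thesis using h by (simp add: algebra_simps)
    next
      case q1
      have low: "(l, i, j) \<in> ?M" if x: "(l, i, j) \<in> T" "l \<le> q" for l i j
        using below[of "(l, i, j)"] x v0 q1 by auto
      have lq: "q \<le> l" if x: "(l, i, j) \<in> T" for l i j
        using low[OF x] unfolding M by (cases "l \<le> q") auto
      have Mq: "(q, i, j) \<in> T" if "(q, i, j) \<in> ?M" for i j
        using below[of "(q, i, j)"] that v0 q1 by auto
      let ?Tq = "{x\<in>T. fst x = q}"
      have Tq_img: "(\<lambda>x. fst (snd x)) ` ?Tq = {b+1..b+m}"
      proof
        show "(\<lambda>x. fst (snd x)) ` ?Tq \<subseteq> {b+1..b+m}"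
        proof (rule image_subsetI)
          fix x assume x: "x \<in> ?Tq"
          obtain l i j where lij: "x = (l, i, j)" by (cases x) auto
          then have "(l, i, j) \<in> ?M" "l = q" using low x by auto
          then show "fst (snd x) \<in> {b+1..b+m}" unfolding M lij by auto
        qed
        show "{b+1..b+m} \<subseteq> (\<lambda>x. fst (snd x)) ` ?Tq"
        proof
          fix i assume i: "i \<in> {b+1..b+m}"
          then have "(q, i, 2 * b + 2 * m + 1 - i) \<in> ?M" unfolding M using h by auto
          then have "(q, i, 2 * b + 2 * m + 1 - i) \<in> ?Tq" using Mq by auto
          then show "i \<in> (\<lambda>x. fst (snd x)) ` ?Tq" by force
        qed
      qed
      moreover have "inj_on (\<lambda>x. fst (snd x)) ?Tq" using inj by (rule inj_on_subset) auto
      ultimately have cq: "card ?Tq = m" using card_image by fastforce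
      have le: "\<forall>x\<in>T. q + 1 \<le> fst x + (if fst x = q then 1 else 0)"
      proof
        fix x assume "x \<in> T"
        then have "q \<le> fst x" using lq by (cases x) auto
        then show "q + 1 \<le> fst x + (if fst x = q then 1 else 0)" by auto
      qed
      have "(\<Sum>x\<in>T. fst x + (if fst x = q then 1 else 0)) = h + card ?Tq" by (rule sum_indicator)
      also have "\<dots> = (\<Sum>x\<in>T. q + 1)" using cq cardT h by (simp add: algebra_simps)
      finally have eqq: "\<forall>x\<in>T. q + 1 = fst x + (if fst x = q then 1 else 0)"
        using sum_mono_inv[of "\<lambda>_. q + 1" T "\<lambda>x. fst x + (if fst x = q then 1 else 0)"] le finT
        by (metis (no_types, lifting))
      have lev2: "fst x = q \<or> fst x = q + 1" if "x \<in> T" for x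
        using bspec[OF eqq that] by (cases "fst x = q") auto
      \<comment> \<open>The s edges of level q + 1 avoid the vertices covered at level q, and those starting after
          i0 are on the antidiagonal; this confines the smaller endpoints to an interval of length
          s.\<close>
      let ?R = "{x\<in>T. fst x = q + 1}"
      have "T = ?Tq \<union> ?R" using lev2 by auto
      then have "card T = card ?Tq + card ?R" using finT by (subst card_Un_disjoint[symmetric]) auto
      then have cR: "card ?R = s" using cq cardT h by simp
      have "(\<lambda>x. fst (snd x)) ` ?R \<subseteq> {b+2*m+1..b+\<rho>+m}"
      proof (rule image_subsetI)
        fix x assume xR: "x \<in> ?R"
        obtain l i j where lij: "x = (l, i, j)" by (cases x) auto
        have x: "(l, i, j) \<in> T" "fst (l, i, j) = q + 1" using xR lij by auto
        have "b + 2 * m < i"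
        proof (rule ccontr)
          assume i: "\<not> b + 2 * m < i"
          define i' where "i' = 2 * b + 2 * m + 1 - i"
          have i': "i + i' = 2 * b + 2 * m + 1" "b < i'" "i' \<le> b + 2 * m" "i \<noteq> i'"
            using i bd[OF x(1)] unfolding i'_def by (auto, presburger)
          define a where "a = min i i'"
          define c where "c = max i i'"
          have ac: "b < a" "a < c" "c \<le> b + 2 * m" "a + c = 2 * b + 2 * m + 1" "i \<in> {a, c}"
            using i' i bd[OF x(1)] unfolding a_def c_def by (auto simp: min_def max_def)
          then have "(q, a, c) \<in> ?M" unfolding M using h by auto
          then have "(q, a, c) \<in> T" by (rule Mq)
          then have "{i, j} \<inter> {a, c} = {}" using x(2) by (intro disj[OF x(1)]) auto
          then show False using ac(5) by blast
        qed
        moreover have "i \<le> b + \<rho> + m"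
        proof (cases "i > i0")
          case True
          then have "(l, i, j) \<in> ?M" using below[of "(l, i, j)"] x v0 q1 by auto
          then show ?thesis using x(2) unfolding M by auto
        next
          case False then show ?thesis using q1 v_bd by linarith
        qed
        ultimately show "fst (snd x) \<in> {b+2*m+1..b+\<rho>+m}" unfolding lij by auto
      qed
      moreover have "inj_on (\<lambda>x. fst (snd x)) ?R" using inj by (rule inj_on_subset) auto
      then have "card ((\<lambda>x. fst (snd x)) ` ?R) = card {b+2*m+1..b+\<rho>+m}"
        using card_image cR h by fastforce
      ultimately have "(\<lambda>x. fst (snd x)) ` ?R = {b+2*m+1..b+\<rho>+m}" by (intro card_subset_eq) auto
      moreover have "i0 \<in> {b+2*m+1..b+\<rho>+m}" using q1 v_bd by auto
      ultimately obtain j where "(q + 1, i0, j) \<in> T" by force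
      have False
      proof (rule no_i0[of j "2 * b + 2 * \<rho> + 2 * m + 1"])
        show "(l0, i0, j) \<in> T" using \<open>(q + 1, i0, j) \<in> T\<close> q1(1) by simp
        show "(l0, a, c) \<in> ?M" if "b < a" "a < c" "c \<le> b + 2 * \<rho>" "a + c = 2 * b + 2 * \<rho> + 2 * m + 1" for a c
          unfolding M using that q1(1) by simp
        show "a + c = 2 * b + 2 * \<rho> + 2 * m + 1" if "(l0, a, c) \<in> ?M" for a c
          using that q1(1) unfolding M by simp
      qed (use q1(2) in simp_all)
      then show ?thesis ..
    qed
  qed
qed

definition set_monomial :: "'v set \<Rightarrow> 'v monomial" where
  "set_monomial T = (\<Sum>x\<in>T. single x 1)"

lemma lookup_set_monomial: "finite T \<Longrightarrow> lookup (set_monomial T) x = (if x \<in> T then 1 else 0)"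
  unfolding set_monomial_def by (simp add: lookup_sum lookup_single when_def)

lemma keys_set_monomial: "finite T \<Longrightarrow> keys (set_monomial T) = T"
  by (auto simp: in_keys_iff lookup_set_monomial split: if_splits)

lemma mon_degree_set_monomial: "mon_degree (set_monomial T) = card T"
  unfolding set_monomial_def by (simp add: mon_degree_sum)

text \<open>
  Enumeration by smaller endpoints. At level \<open>q + 1\<close> these start at \<open>b + 2 m + 1\<close>, which explains
  the shift by \<open>m\<close>.
\<close>

lemma bij_leading_matching:
  assumes h: "h = q * \<rho> + s" "s < \<rho>" "m = \<rho> - s"
  shows "bij_betw (\<lambda>i. if i \<le> b + m then (q, i, 2 * b + 2 * m + 1 - i) else (q + 1, i + m, 2 * b + 2 * \<rho> + m + 1 - i))
    {b+1..b+\<rho>} (leading_matching b \<rho> h)" (is "bij_betw ?f _ _")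
  proof (rule bij_betw_byWitness[where f' = "\<lambda>(l, i, j). if l = q then i else i - m"])
    show "\<forall>a\<in>{b+1..b+\<rho>}. (case ?f a of (l, i, j) \<Rightarrow> if l = q then i else i - m) = a" by auto
    show "\<forall>a'\<in>leading_matching b \<rho> h. ?f (case a' of (l, i, j) \<Rightarrow> if l = q then i else i - m) = a'"
    proof
      fix x assume x: "x \<in> leading_matching b \<rho> h"
      obtain l i j where lij: "x = (l, i, j)" by (cases x) auto
      then show "?f (case x of (l, i, j) \<Rightarrow> if l = q then i else i - m) = x"
        using x[unfolded lij leading_matching_iff[OF h]] h(2,3) by auto
    qed
    show "?f ` {b+1..b+\<rho>} \<subseteq> leading_matching b \<rho> h"
      using h(2,3) by (auto simp: leading_matching_iff[OF h])
    show "(\<lambda>(l, i, j). if l = q then i else i - m) ` leading_matching b \<rho> h \<subseteq> {b+1..b+\<rho>}"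
    proof (rule image_subsetI)
      fix x assume x: "x \<in> leading_matching b \<rho> h"
      obtain l i j where lij: "x = (l, i, j)" by (cases x) auto
      then show "(case x of (l, i, j) \<Rightarrow> if l = q then i else i - m) \<in> {b+1..b+\<rho>}"
        using x[unfolded lij leading_matching_iff[OF h]] h(2,3) by auto
    qed
  qed

lemma card_leading_matching:
  assumes "\<rho> > 0" shows "card (leading_matching b \<rho> h) = \<rho>"
proof -
  have "h = h div \<rho> * \<rho> + h mod \<rho>" "h mod \<rho> < \<rho>" using assms by auto
  from bij_betw_same_card[OF bij_leading_matching[OF this refl]] show ?thesis by simp
qed

lemma card_leading_matching': "card (leading_matching b \<rho> h) = \<rho>"
proof (cases "\<rho> = 0")
  case True
  then have "leading_matching b \<rho> h = {}" by (auto simp: leading_matching_def)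
  then show ?thesis using True by simp
qed (simp add: card_leading_matching)

text \<open>
  In a degree reverse lexicographic order the monomial with the greater exponent at the smallest
  differing variable is the smaller one.
\<close>

lemma leveled_matching_prec:
  assumes "leveled_matching b \<rho> h T" "T \<noteq> leading_matching b \<rho> h"
  shows "jet_order (set_monomial T) (set_monomial (leading_matching b \<rho> h))"
proof -
  have fin: "finite T" "finite (leading_matching b \<rho> h)"
    using assms finite_leading_matching by (auto simp: leveled_matching_def)
  have "mon_degree (set_monomial T) = mon_degree (set_monomial (leading_matching b \<rho> h))"
    using assms by (simp add: mon_degree_set_monomial card_leading_matching' leveled_matching_def)
  moreover obtain v where "v \<in> T - leading_matching b \<rho> h"
    "\<forall>w. jet_var_less w v \<longrightarrow> (w \<in> T \<longleftrightarrow> w \<in> leading_matching b \<rho> h)"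
    using matching_first_difference[OF assms] by blast
  ultimately show ?thesis unfolding degrevlex_less_def
    by (intro disjI2 conjI exI[of _ v]) (auto simp: lookup_set_monomial fin)
qed

section \<open>The Pfaffian as a sum over matchings\<close>

definition pf_perms :: "nat \<Rightarrow> (nat \<Rightarrow> nat) set" where
  "pf_perms r = {s. s permutes {..<2 * r} \<and> (\<forall>i < r. s (2 * i) < s (2 * i + 1)) \<and>
           (\<forall>i j. i < j \<and> j < r \<longrightarrow> s (2 * i) < s (2 * j))}"

lemma finite_pf_perms: "finite (pf_perms r)"
  by (rule finite_subset[OF _ finite_permutations[of "{..<2 * r}"]]) (auto simp: pf_perms_def)

text \<open>
  A term of \<open>p^(h)\<close> is a matching, given by the permutation listing its edges, together with a
  level for each edge. Levels are extensional functions, so that terms correspond uniquely to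
  monomials.
\<close>

definition pf_terms :: "nat \<Rightarrow> nat \<Rightarrow> nat \<Rightarrow> ((nat \<Rightarrow> nat) \<times> (nat \<Rightarrow> nat)) set" where
  "pf_terms r k h = {(s, c). s \<in> pf_perms r \<and> c \<in> PiE {..<r} (\<lambda>_. {..<k}) \<and> (\<Sum>i<r. c i) = h}"

text \<open>The Pfaffian counts rows from \<open>0\<close>, the variables count them from \<open>1\<close>.\<close>

definition term_var :: "(nat \<Rightarrow> nat) \<Rightarrow> (nat \<Rightarrow> nat) \<Rightarrow> nat \<Rightarrow> jet_var" where
  "term_var s c i = (c i, s (2 * i) + 1, s (2 * i + 1) + 1)"

definition term_set :: "nat \<Rightarrow> (nat \<Rightarrow> nat) \<Rightarrow> (nat \<Rightarrow> nat) \<Rightarrow> jet_var set" where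
  "term_set r s c = term_var s c ` {..<r}"

lemma finite_pf_terms: "finite (pf_terms r k h)"
proof -
  have "pf_terms r k h \<subseteq> pf_perms r \<times> PiE {..<r} (\<lambda>_. {..<k})" by (auto simp: pf_terms_def)
  then show ?thesis by (rule finite_subset) (intro finite_cartesian_product finite_pf_perms finite_PiE, auto)
qed

lemma pf_perms_inj: "s \<in> pf_perms r \<Longrightarrow> s x = s y \<longleftrightarrow> x = y"
  by (auto simp: pf_perms_def permutes_inj dest: injD[OF permutes_inj])

lemma pf_perms_less: "s \<in> pf_perms r \<Longrightarrow> x < 2 * r \<Longrightarrow> s x < 2 * r"
  using permutes_in_image[of s "{..<2 * r}" x] by (auto simp: pf_perms_def)

lemma sum_pairs: "(\<Sum>x<2 * r. f x) = (\<Sum>i<r. f (2 * i) + f (2 * i + 1 :: nat) :: 'b::comm_monoid_add)"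
  by (induction r) (simp_all add: add.assoc)

lemma prod_monom: "finite A \<Longrightarrow> (\<Prod>i\<in>A. Polynomial.monom (f i) (c i)) = Polynomial.monom (\<Prod>i\<in>A. f i :: 'b::comm_semiring_1) (\<Sum>i\<in>A. c i)"
  by (induction A rule: finite_induct) (auto simp: mult_monom)

lemma coeff_of_int_mult: "Polynomial.coeff (of_int a * F) h = of_int a * Polynomial.coeff (F :: 'b::comm_ring_1 poly) h"
  by (simp add: of_int_poly)

lemma coeff_jet_pfaffian:
  fixes k r h :: nat
  shows "Polynomial.coeff (jet_pfaffian k [1..<2 * r + 1]) h =
    (\<Sum>(s, c)\<in>pf_terms r k h. of_int (sign s) * (\<Prod>i<r. mvar (term_var s c i) :: (jet_var, 'a::field) mpol))"
proof -
  let ?P = "\<lambda>s. PiE {..<r} (\<lambda>_::nat. {..<k})"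
  have len: "length [1..<2 * r + 1] div 2 = r" by simp
  have nth: "[1..<2 * r + 1] ! x = x + 1" if "x < 2 * r" for x using that by (subst nth_upt) auto
  have prod: "(\<Prod>i<r. jet_matrix k ([1..<2 * r + 1] ! s (2 * i)) ([1..<2 * r + 1] ! s (2 * i + 1)))
      = (\<Sum>c\<in>PiE {..<r} (\<lambda>_. {..<k}). Polynomial.monom (\<Prod>i<r. mvar (term_var s c i) :: (jet_var, 'a) mpol) (\<Sum>i<r. c i))"
    if s: "s \<in> pf_perms r" for s
  proof -
    have "(\<Prod>i<r. jet_matrix k ([1..<2 * r + 1] ! s (2 * i)) ([1..<2 * r + 1] ! s (2 * i + 1)))
       = (\<Prod>i<r. \<Sum>l<k. Polynomial.monom (mvar (l, s (2 * i) + 1, s (2 * i + 1) + 1) :: (jet_var, 'a) mpol) l)"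
    proof (rule prod.cong[OF refl])
      fix i assume i: "i \<in> {..<r}"
      have "s (2 * i) < s (2 * i + 1)" using s i by (auto simp: pf_perms_def)
      moreover have "s (2 * i) < 2 * r" "s (2 * i + 1) < 2 * r" using pf_perms_less[OF s] i by auto
      ultimately show "jet_matrix k ([1..<2 * r + 1] ! s (2 * i)) ([1..<2 * r + 1] ! s (2 * i + 1))
        = (\<Sum>l<k. Polynomial.monom (mvar (l, s (2 * i) + 1, s (2 * i + 1) + 1) :: (jet_var, 'a) mpol) l)"
        using nth by (simp add: jet_matrix_def jet_entry_def)
    qed
    also have "\<dots> = (\<Sum>c\<in>PiE {..<r} (\<lambda>_. {..<k}). \<Prod>i<r. Polynomial.monom (mvar (c i, s (2 * i) + 1, s (2 * i + 1) + 1)) (c i))"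
      by (rule prod_sum_PiE) auto
    finally show ?thesis by (simp add: prod_monom term_var_def)
  qed
  have "jet_pfaffian k [1..<2 * r + 1] = (\<Sum>s\<in>pf_perms r. of_int (sign s) *
      (\<Prod>i<r. jet_matrix k ([1..<2 * r + 1] ! s (2 * i)) ([1..<2 * r + 1] ! s (2 * i + 1)) :: (jet_var, 'a) mpol poly))"
    unfolding jet_pfaffian_def pfaffian_def pf_perms_def len ..
  also have "\<dots> = (\<Sum>s\<in>pf_perms r. of_int (sign s) * (\<Sum>c\<in>PiE {..<r} (\<lambda>_. {..<k}).
      Polynomial.monom (\<Prod>i<r. mvar (term_var s c i)) (\<Sum>i<r. c i)))"
    by (intro sum.cong refl arg_cong2[where f = "(*)"] prod)
  finally have "Polynomial.coeff (jet_pfaffian k [1..<2 * r + 1]) h = (\<Sum>s\<in>pf_perms r. of_int (sign s) *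
      (\<Sum>c\<in>PiE {..<r} (\<lambda>_. {..<k}). if (\<Sum>i<r. c i) = h then (\<Prod>i<r. mvar (term_var s c i) :: (jet_var, 'a) mpol) else 0))"
    by (simp add: coeff_sum coeff_of_int_mult)
  also have "\<dots> = (\<Sum>s\<in>pf_perms r. \<Sum>c\<in>{c\<in>PiE {..<r} (\<lambda>_. {..<k}). (\<Sum>i<r. c i) = h}.
      of_int (sign s) * (\<Prod>i<r. mvar (term_var s c i) :: (jet_var, 'a) mpol))"
    by (simp add: sum.inter_filter finite_PiE sum_distrib_left if_distrib[where f = "\<lambda>x. _ * x"] cong: if_cong)
  also have "\<dots> = (\<Sum>(s, c)\<in>pf_perms r \<times> {c\<in>PiE {..<r} (\<lambda>_. {..<k}). (\<Sum>i<r. c i) = h}.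
      of_int (sign s) * (\<Prod>i<r. mvar (term_var s c i) :: (jet_var, 'a) mpol))"
    by (rule sum.cartesian_product)
  also have "pf_perms r \<times> {c\<in>PiE {..<r} (\<lambda>_. {..<k}). (\<Sum>i<r. c i) = h} = pf_terms r k h"
    by (auto simp: pf_terms_def)
  finally show ?thesis .
qed

context
  fixes r :: nat and s :: "nat \<Rightarrow> nat"
  assumes s: "s \<in> pf_perms r"
begin

lemma term_var_inj: "inj_on (term_var s c) A"
  using pf_perms_inj[OF s] by (auto simp: inj_on_def term_var_def)

lemma card_term_set: "card (term_set r s c) = r"
  unfolding term_set_def by (simp add: card_image term_var_inj)

lemma sum_term_set: "(\<Sum>x\<in>term_set r s c. f x) = (\<Sum>i<r. f (term_var s c i))"
  unfolding term_set_def by (subst sum.reindex[OF term_var_inj]) simp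

lemma prod_term_set: "(\<Prod>x\<in>term_set r s c. f x) = (\<Prod>i<r. f (term_var s c i))"
  unfolding term_set_def by (subst prod.reindex[OF term_var_inj]) simp

lemma term_var_bounds:
  assumes "i < r" shows "s (2 * i) < s (2 * i + 1)" "s (2 * i + 1) < 2 * r"
  using s assms pf_perms_less[OF s, of "2 * i + 1"] by (auto simp: pf_perms_def)

lemma term_set_disjoint:
  assumes "(l, i, j) \<in> term_set r s c" "(l', i', j') \<in> term_set r s c" "(l, i, j) \<noteq> (l', i', j')"
  shows "{i, j} \<inter> {i', j'} = {}"
proof -
  obtain a a' where a: "(l, i, j) = term_var s c a" "(l', i', j') = term_var s c a'" using assms by (auto simp: term_set_def)
  then have "a \<noteq> a'" using assms by auto
  moreover have "2 * a \<noteq> 2 * a' + 1" "2 * a + 1 \<noteq> 2 * a'" by presburger+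
  ultimately show ?thesis using a pf_perms_inj[OF s] by (auto simp: term_var_def)
qed

lemma leveled_matching_term_set: "leveled_matching 0 r (\<Sum>i<r. c i) (term_set r s c)"
  unfolding leveled_matching_def
proof (intro conjI)
  show "\<forall>(l, i, j)\<in>term_set r s c. 0 < i \<and> i < j \<and> j \<le> 0 + 2 * r"
  proof clarify
    fix l i j assume "(l, i, j) \<in> term_set r s c"
    then obtain a where "a < r" "(l, i, j) = term_var s c a" by (auto simp: term_set_def)
    then show "0 < i \<and> i < j \<and> j \<le> 0 + 2 * r" using term_var_bounds[of a] by (auto simp: term_var_def)
  qed
  show "\<forall>(l, i, j)\<in>term_set r s c. \<forall>(l', i', j')\<in>term_set r s c. (l, i, j) \<noteq> (l', i', j') \<longrightarrow> {i, j} \<inter> {i', j'} = {}"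
    using term_set_disjoint by blast
  show "(\<Sum>x\<in>term_set r s c. fst x) = (\<Sum>i<r. c i)" by (simp add: sum_term_set term_var_def)
qed (auto simp: card_term_set, simp add: term_set_def)

text \<open>A perfect matching covers every vertex once.\<close>

lemma sum_vertices_term_set: "(\<Sum>(l, i, j)\<in>term_set r s c. i + j) = r * (2 * r + 1)"
proof -
  have "(\<Sum>(l, i, j)\<in>term_set r s c. i + j) = (\<Sum>i<r. (s (2 * i) + 1) + (s (2 * i + 1) + 1))"
    by (simp add: sum_term_set term_var_def)
  also have "\<dots> = (\<Sum>x<2 * r. s x + 1)" by (subst sum_pairs) simp
  also have "\<dots> = (\<Sum>x<2 * r. x + 1)"
    using sum.permute[of s "{..<2 * r}" "\<lambda>x. x + 1"] s by (simp add: pf_perms_def comp_def)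
  also have "\<dots> = r * (2 * r + 1)" by (induction r) (simp_all add: algebra_simps)
  finally show ?thesis .
qed

end

text \<open>
  The edges are listed by increasing smaller endpoint, so the set of smaller endpoints determines
  the order of the list.
\<close>

lemma term_set_inj:
  assumes s: "s \<in> pf_perms r" "s' \<in> pf_perms r" and c: "c \<in> PiE {..<r} B" "c' \<in> PiE {..<r} B"
    and eq: "term_set r s c = term_set r s' c'"
  shows "s = s'" "c = c'"
proof -
  have smaller: "set (map (\<lambda>i. s (2 * i)) [0..<r]) = (\<lambda>x. fst (snd x) - 1) ` term_set r s c" for s c
    unfolding term_set_def by (simp add: image_image term_var_def atLeast0LessThan)
  have sorted: "sorted_wrt (<) (map (\<lambda>i. s (2 * i)) [0..<r])" if "s \<in> pf_perms r" for s
    using that by (auto simp: pf_perms_def sorted_wrt_iff_nth_less)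
  have "map (\<lambda>i. s (2 * i)) [0..<r] = map (\<lambda>i. s' (2 * i)) [0..<r]"
    using smaller[of s c] smaller[of s' c'] eq sorted s by (intro strict_sorted_equal) auto
  then have even: "s (2 * i) = s' (2 * i)" if "i < r" for i using that by auto
  have var: "term_var s c i = term_var s' c' i" if i: "i < r" for i
  proof -
    have "term_var s c i \<in> term_set r s' c'" using i eq by (auto simp: term_set_def)
    then obtain a where a: "a < r" "term_var s c i = term_var s' c' a" by (auto simp: term_set_def)
    then have "s' (2 * a) = s' (2 * i)" using even[OF i] by (simp add: term_var_def)
    then show ?thesis using a pf_perms_inj[OF s(2)] by auto
  qed
  show "c = c'" using var by (intro PiE_ext[OF c]) (auto simp: term_var_def)
  show "s = s'"
  proof
    fix x
    show "s x = s' x"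
    proof (cases "x < 2 * r")
      case True
      then have "x div 2 < r" by auto
      then have "s (2 * (x div 2)) = s' (2 * (x div 2))" "s (2 * (x div 2) + 1) = s' (2 * (x div 2) + 1)"
        using var[of "x div 2"] by (auto simp: term_var_def)
      moreover have "x = 2 * (x div 2) \<or> x = 2 * (x div 2) + 1" by presburger
      ultimately show ?thesis by metis
    next
      case False
      then show ?thesis using s permutes_not_in[of s "{..<2 * r}" x] permutes_not_in[of s' "{..<2 * r}" x]
        by (auto simp: pf_perms_def)
    qed
  qed
qed

text \<open>Sort the edges by smaller endpoint and read off the permutation.\<close>

lemma exists_term_set:
  assumes T: "leveled_matching 0 r h T"
  shows "\<exists>s\<in>pf_perms r. \<exists>c\<in>PiE {..<r} (\<lambda>_. {..h}). term_set r s c = T"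
proof -
  have finT: "finite T" and cardT: "card T = r" and lev: "(\<Sum>x\<in>T. fst x) = h"
    using T by (auto simp: leveled_matching_def)
  note bd = leveled_matching_bounds[OF T, simplified] and disj = leveled_matching_disjoint[OF T]
  note inj = leveled_matching_inj[OF T]
  define xs where "xs = sorted_list_of_set ((\<lambda>x. fst (snd x)) ` T)"
  have xs: "set xs = (\<lambda>x. fst (snd x)) ` T" "length xs = r" "sorted_wrt (<) xs"
    using finT cardT inj by (auto simp: xs_def card_image)
  define e where "e a = the_inv_into T (\<lambda>x. fst (snd x)) (xs ! a)" for a
  have e: "e a \<in> T" "fst (snd (e a)) = xs ! a" if "a < r" for a
  proof -
    have "xs ! a \<in> (\<lambda>x. fst (snd x)) ` T" using xs that nth_mem by metis
    then show "e a \<in> T" "fst (snd (e a)) = xs ! a"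
      unfolding e_def using inj by (auto intro: the_inv_into_into f_the_inv_into_f)
  qed
  have e_inj: "a = b" if "a < r" "b < r" "e a = e b" for a b
  proof -
    have "xs ! a = xs ! b" using e that by metis
    moreover have "distinct xs" unfolding xs_def by simp
    ultimately show ?thesis using that xs by (simp add: nth_eq_iff_index_eq)
  qed
  have eT: "e ` {..<r} = T"
  proof (rule card_subset_eq[OF finT])
    show "e ` {..<r} \<subseteq> T" using e by auto
    have "inj_on e {..<r}" using e_inj by (auto simp: inj_on_def)
    then show "card (e ` {..<r}) = card T" using cardT by (simp add: card_image)
  qed
  define s where "s x = (if x < 2 * r then (if even x then fst (snd (e (x div 2))) - 1 else snd (snd (e (x div 2))) - 1) else x)" for x
  define c where "c = (\<lambda>i\<in>{..<r}. fst (e i))"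
  have ebd: "0 < fst (snd (e a))" "fst (snd (e a)) < snd (snd (e a))" "snd (snd (e a)) \<le> 2 * r" if "a < r" for a
    using bd[of "fst (e a)" "fst (snd (e a))" "snd (snd (e a))"] e(1)[OF that] by auto
  have s_even: "s (2 * a) + 1 = fst (snd (e a))" and s_odd: "s (2 * a + 1) + 1 = snd (snd (e a))" if "a < r" for a
    using that ebd[OF that] by (auto simp: s_def)
  have "s permutes {..<2 * r}"
  proof (rule bij_imp_permutes)
    have maps: "s ` {..<2 * r} \<subseteq> {..<2 * r}"
    proof clarify
      fix x assume "x < 2 * r"
      then have "x div 2 < r" by auto
      then show "s x < 2 * r" using ebd[of "x div 2"] \<open>x < 2 * r\<close> by (auto simp: s_def)
    qed
    have "inj_on s {..<2 * r}"
    proof (rule inj_onI)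
      fix x y assume xy: "x \<in> {..<2 * r}" "y \<in> {..<2 * r}" "s x = s y"
      define a where "a = x div 2"
      define b where "b = y div 2"
      have ab: "a < r" "b < r" using xy by (auto simp: a_def b_def)
      have x: "x = 2 * a \<or> x = 2 * a + 1" and y: "y = 2 * b \<or> y = 2 * b + 1" unfolding a_def b_def by presburger+
      have sx: "s x + 1 = (if x = 2 * a then fst (snd (e a)) else snd (snd (e a)))"
        using x s_even[OF ab(1)] s_odd[OF ab(1)] by auto
      have sy: "s y + 1 = (if y = 2 * b then fst (snd (e b)) else snd (snd (e b)))"
        using y s_even[OF ab(2)] s_odd[OF ab(2)] by auto
      have "e a = e b"
      proof (rule ccontr)
        assume "e a \<noteq> e b"
        then have "{fst (snd (e a)), snd (snd (e a))} \<inter> {fst (snd (e b)), snd (snd (e b))} = {}"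
          using disj[of "fst (e a)" "fst (snd (e a))" "snd (snd (e a))" "fst (e b)" "fst (snd (e b))" "snd (snd (e b))"]
            e(1)[OF ab(1)] e(1)[OF ab(2)] by auto
        moreover have "s x + 1 \<in> {fst (snd (e a)), snd (snd (e a))}" unfolding sx by simp
        moreover have "s x + 1 \<in> {fst (snd (e b)), snd (snd (e b))}" unfolding xy(3) sy by simp
        ultimately show False by blast
      qed
      then have "a = b" using e_inj ab by blast
      then show "x = y" using x y sx sy xy(3) ebd[OF ab(1)] by (elim disjE) auto
    qed
    then show "bij_betw s {..<2 * r} {..<2 * r}"
      unfolding bij_betw_def using endo_inj_surj[OF _ maps] by auto
    show "s x = x" if "x \<notin> {..<2 * r}" for x using that by (simp add: s_def)
  qed
  moreover have "s (2 * i) < s (2 * i + 1)" if "i < r" for i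
    using s_even[OF that] s_odd[OF that] ebd[OF that] by linarith
  moreover have "s (2 * i) < s (2 * j)" if "i < j" "j < r" for i j
  proof -
    have "xs ! i < xs ! j" using xs that by (auto simp: sorted_wrt_iff_nth_less)
    then show ?thesis using s_even[of i] s_even[of j] e(2)[of i] e(2)[of j] that by linarith
  qed
  ultimately have "s \<in> pf_perms r" by (auto simp: pf_perms_def)
  moreover have "c \<in> PiE {..<r} (\<lambda>_. {..h})"
  proof -
    have "fst x \<le> h" if "x \<in> T" for x unfolding lev[symmetric] using finT that by (intro member_le_sum) auto
    then show ?thesis using e(1) by (auto simp: c_def)
  qed
  moreover have "term_set r s c = T"
  proof -
    have "term_var s c i = e i" if "i < r" for i
      using s_even[OF that] s_odd[OF that] that by (auto simp: term_var_def c_def prod_eq_iff)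
    then have "term_set r s c = e ` {..<r}" unfolding term_set_def by (intro image_cong) auto
    then show ?thesis using eT by simp
  qed
  ultimately show ?thesis by blast
qed

text \<open>The sum of the levels is \<open>m q + s (q + 1) = h\<close>.\<close>

lemma leveled_leading_matching:
  assumes "\<rho> = 0 \<Longrightarrow> h = 0"
  shows "leveled_matching b \<rho> h (leading_matching b \<rho> h)"
proof (cases "\<rho> = 0")
  case True
  then have "leading_matching b \<rho> h = {}" by (auto simp: leading_matching_def)
  then show ?thesis using True assms by (simp add: leveled_matching_def)
next
  case False
  define q where "q = h div \<rho>"
  define s where "s = h mod \<rho>"
  define m where "m = \<rho> - s"
  have h: "h = q * \<rho> + s" "s < \<rho>" "m = \<rho> - s" using False by (auto simp: q_def s_def m_def)
  note M = leading_matching_iff[OF h]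
  show ?thesis
    unfolding leveled_matching_def
  proof (intro conjI ballI)
    show "\<And>x. x \<in> leading_matching b \<rho> h \<Longrightarrow> case x of (l, i, j) \<Rightarrow> b < i \<and> i < j \<and> j \<le> b + 2 * \<rho>"
      by (auto simp: leading_matching_def)
    have disj: "{i, j} \<inter> {i', j'} = {}" if "(l, i, j) \<in> leading_matching b \<rho> h" "(l', i', j') \<in> leading_matching b \<rho> h"
      "(l, i, j) \<noteq> (l', i', j')" for l i j l' i' j'
      using that h(2,3) unfolding M by auto
    then show "case x of (l, i, j) \<Rightarrow> \<forall>(l', i', j')\<in>leading_matching b \<rho> h.
        (l, i, j) \<noteq> (l', i', j') \<longrightarrow> {i, j} \<inter> {i', j'} = {}" if "x \<in> leading_matching b \<rho> h" for x
      using that by (cases x) blast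
    have "(\<Sum>x\<in>leading_matching b \<rho> h. fst x) = (\<Sum>i\<in>{b+1..b+\<rho>}. if i \<le> b + m then q else q + 1)"
      using sum.reindex_bij_betw[OF bij_leading_matching[OF h, of b], of fst]
      by (simp add: if_distrib[of fst] cong: if_cong)
    also have "\<dots> = (\<Sum>i\<in>{b+1..b+m}. q) + (\<Sum>i\<in>{b+m+1..b+\<rho>}. q + 1)"
    proof -
      have "{b+1..b+\<rho>} = {b+1..b+m} \<union> {b+m+1..b+\<rho>}" using h by auto
      then have "(\<Sum>i\<in>{b+1..b+\<rho>}. if i \<le> b + m then q else q + 1) =
        (\<Sum>i\<in>{b+1..b+m}. if i \<le> b + m then q else q + 1) + (\<Sum>i\<in>{b+m+1..b+\<rho>}. if i \<le> b + m then q else q + 1)"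
        by (simp add: sum.union_disjoint)
      then show ?thesis by simp
    qed
    also have "\<dots> = h" using h by (simp add: algebra_simps)
    finally show "(\<Sum>x\<in>leading_matching b \<rho> h. fst x) = h" .
  qed (simp_all add: finite_leading_matching card_leading_matching')
qed

section \<open>Evaluation and substitution\<close>

definition mon_eval :: "('v \<Rightarrow> 'b::comm_ring_1) \<Rightarrow> 'v monomial \<Rightarrow> 'b" where
  "mon_eval x m = (\<Prod>v\<in>keys m. x v ^ lookup m v)"

definition meval :: "('a::field \<Rightarrow> 'b::comm_ring_1) \<Rightarrow> ('v \<Rightarrow> 'b) \<Rightarrow> ('v, 'a) mpol \<Rightarrow> 'b" where
  "meval \<phi> x f = (\<Sum>m\<in>keys f. \<phi> (lookup f m) * mon_eval x m)"

lemma mon_eval_superset: "finite S \<Longrightarrow> keys m \<subseteq> S \<Longrightarrow> mon_eval x m = (\<Prod>v\<in>S. x v ^ lookup m v)"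
  unfolding mon_eval_def by (rule prod.mono_neutral_left) (auto simp: in_keys_iff)

lemma mon_eval_add: "mon_eval x (a + b) = mon_eval x a * mon_eval x b"
proof -
  let ?S = "keys a \<union> keys b"
  have "mon_eval x (a + b) = (\<Prod>v\<in>?S. x v ^ lookup (a + b) v)" by (rule mon_eval_superset) (auto simp: keys_add_nat)
  also have "\<dots> = (\<Prod>v\<in>?S. x v ^ lookup a v) * (\<Prod>v\<in>?S. x v ^ lookup b v)"
    by (simp add: lookup_add power_add prod.distrib)
  also have "\<dots> = mon_eval x a * mon_eval x b"
    using mon_eval_superset[of ?S a x] mon_eval_superset[of ?S b x] by simp
  finally show ?thesis .
qed

locale coefficient_hom =
  fixes \<phi> :: "'a::field \<Rightarrow> 'b::comm_ring_1"
  assumes \<phi>_0: "\<phi> 0 = 0" and \<phi>_1: "\<phi> 1 = 1" and \<phi>_add: "\<phi> (a + b) = \<phi> a + \<phi> b" and \<phi>_mult: "\<phi> (a * b) = \<phi> a * \<phi> b"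
begin

lemma meval_superset: "finite S \<Longrightarrow> keys f \<subseteq> S \<Longrightarrow> meval \<phi> x f = (\<Sum>m\<in>S. \<phi> (lookup f m) * mon_eval x m)"
  unfolding meval_def by (rule sum.mono_neutral_left) (auto simp: in_keys_iff \<phi>_0)

lemma meval_0 [simp]: "meval \<phi> x 0 = 0" by (simp add: meval_def)

lemma meval_add: "meval \<phi> x (f + g) = meval \<phi> x f + meval \<phi> x g"
proof -
  let ?S = "keys f \<union> keys g"
  have "meval \<phi> x (f + g) = (\<Sum>m\<in>?S. \<phi> (lookup (f + g) m) * mon_eval x m)"
    by (rule meval_superset) (use keys_add[of f g] in auto)
  also have "\<dots> = (\<Sum>m\<in>?S. \<phi> (lookup f m) * mon_eval x m) + (\<Sum>m\<in>?S. \<phi> (lookup g m) * mon_eval x m)"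
    by (simp add: lookup_add \<phi>_add distrib_right sum.distrib)
  also have "\<dots> = meval \<phi> x f + meval \<phi> x g"
    using meval_superset[of ?S f x] meval_superset[of ?S g x] by simp
  finally show ?thesis .
qed

lemma meval_sum: "meval \<phi> x (sum f A) = (\<Sum>i\<in>A. meval \<phi> x (f i))"
  by (induction A rule: infinite_finite_induct) (auto simp: meval_add)

lemma meval_single: "meval \<phi> x (single m c) = \<phi> c * mon_eval x m"
  by (cases "c = 0") (auto simp: meval_def \<phi>_0)

lemma meval_const [simp]: "meval \<phi> x (single 0 c) = \<phi> c"
  by (simp add: meval_single mon_eval_def)

lemma meval_1 [simp]: "meval \<phi> x 1 = 1"
  using meval_const[of x 1] by (simp add: \<phi>_1)

lemma meval_mvar [simp]: "meval \<phi> x (mvar v) = x v"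
  by (simp add: mvar_def meval_single mon_eval_def \<phi>_1)

lemma meval_mult: "meval \<phi> x (f * g) = meval \<phi> x f * meval \<phi> x g"
proof -
  have "f * g = (\<Sum>m\<in>keys f. single m (lookup f m)) * (\<Sum>n\<in>keys g. single n (lookup g n))"
    by (rule arg_cong2[where f = "(*)", OF mpol_eq_sum mpol_eq_sum])
  also have "\<dots> = (\<Sum>m\<in>keys f. \<Sum>n\<in>keys g. single m (lookup f m) * single n (lookup g n))"
    by (rule sum_product)
  also have "\<dots> = (\<Sum>m\<in>keys f. \<Sum>n\<in>keys g. single (m + n) (lookup f m * lookup g n))"
    by (simp add: mult_single)
  finally have "meval \<phi> x (f * g) = (\<Sum>m\<in>keys f. \<Sum>n\<in>keys g. \<phi> (lookup f m * lookup g n) * mon_eval x (m + n))"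
    by (simp add: meval_sum meval_single)
  also have "\<dots> = (\<Sum>m\<in>keys f. \<Sum>n\<in>keys g. (\<phi> (lookup f m) * mon_eval x m) * (\<phi> (lookup g n) * mon_eval x n))"
    by (simp add: \<phi>_mult mon_eval_add algebra_simps)
  also have "\<dots> = meval \<phi> x f * meval \<phi> x g" by (simp add: meval_def sum_product)
  finally show ?thesis .
qed

lemma meval_uminus: "meval \<phi> x (- f) = - meval \<phi> x f"
  using meval_add[of x f "- f"] by (simp add: add_eq_0_iff)

lemma meval_diff: "meval \<phi> x (f - g) = meval \<phi> x f - meval \<phi> x g"
  using meval_add[of x f "- g"] by (simp add: meval_uminus)

lemma meval_prod: "meval \<phi> x (prod f A) = (\<Prod>i\<in>A. meval \<phi> x (f i))"
  by (induction A rule: infinite_finite_induct) (auto simp: meval_mult)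

lemma meval_cong: "f \<in> polys U \<Longrightarrow> (\<And>v. v \<in> U \<Longrightarrow> x v = y v) \<Longrightarrow> meval \<phi> x f = meval \<phi> y f"
  by (induction rule: polys_induct) (auto simp: meval_add meval_mult)

end

section \<open>Leading monomials of the coefficients of the Pfaffian\<close>

definition pf_coeff :: "nat \<Rightarrow> nat \<Rightarrow> nat \<Rightarrow> (jet_var, 'a::field) mpol" where
  "pf_coeff r k h = Polynomial.coeff (jet_pfaffian k [1..<2 * r + 1]) h"

lemma prod_mvar_set: "(\<Prod>x\<in>T. mvar x) = single (set_monomial T) 1"
  unfolding mvar_def set_monomial_def by (rule prod_single)

lemma pf_coeff_eq:
  "pf_coeff r k h = (\<Sum>(s, c)\<in>pf_terms r k h. of_int (sign s) * single (set_monomial (term_set r s c)) (1::'a::field))"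
  unfolding pf_coeff_def coeff_jet_pfaffian
proof (rule sum.cong[OF refl])
  fix t assume t: "t \<in> pf_terms r k h"
  obtain s c where sc: "t = (s, c)" by (cases t)
  have s: "s \<in> pf_perms r" using t sc by (simp add: pf_terms_def)
  have "(\<Prod>i<r. mvar (term_var s c i)) = single (set_monomial (term_set r s c)) (1::'a)"
    by (rule trans[OF prod_term_set[OF s, of mvar c, symmetric] prod_mvar_set])
  then show "(case t of (s, c) \<Rightarrow> of_int (sign s) * (\<Prod>i<r. mvar (term_var s c i))) =
      (case t of (s, c) \<Rightarrow> of_int (sign s) * single (set_monomial (term_set r s c)) (1::'a))"
    unfolding sc by simp
qed

lemma finite_term_set: "finite (term_set r s c)" by (simp add: term_set_def)

context variable_order
begin

lemma lead_sign: "lead f m \<Longrightarrow> lead (of_int (sign s) * f) m"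
  by (auto simp: sign_def lead_def in_keys_iff)

end

lemma keys_sign: "keys (of_int (sign s) * f :: ('v, 'a::field) mpol) = keys f"
  by (auto simp: sign_def in_keys_iff)

lemma finite_jet_vars: "finite (jet_vars n k)"
  by (rule finite_subset[of _ "{..<k} \<times> {..n} \<times> {..n}"]) (auto simp: jet_vars_def)

lemma term_set_jet_vars:
  assumes "(s, c) \<in> pf_terms r k h" shows "term_set r s c \<subseteq> jet_vars (2 * r) k"
proof
  fix x assume "x \<in> term_set r s c"
  then obtain i where i: "i < r" "x = term_var s c i" by (auto simp: term_set_def)
  have "s \<in> pf_perms r" using assms by (simp add: pf_terms_def)
  moreover have "c i < k" using assms i by (auto simp: pf_terms_def)
  ultimately show "x \<in> jet_vars (2 * r) k" using term_var_bounds[of s r i] i by (auto simp: term_var_def jet_vars_def)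
qed

lemma pf_coeff_polys: "pf_coeff r k h \<in> polys (jet_vars (2 * r) k)"
  unfolding pf_coeff_eq
proof (intro polys_sum, clarify)
  fix s c assume "(s, c) \<in> pf_terms r k h"
  then have "set_monomial (term_set r s c) = set_monomial (term_set r s c) \<and> keys (set_monomial (term_set r s c)) \<subseteq> jet_vars (2 * r) k"
    using term_set_jet_vars by (simp add: keys_set_monomial finite_term_set)
  then have "single (set_monomial (term_set r s c)) (1::'a) \<in> polys (jet_vars (2 * r) k)" by (intro polys_single) simp
  then show "of_int (sign s) * single (set_monomial (term_set r s c)) (1::'a) \<in> polys (jet_vars (2 * r) k)"
    by (auto simp: sign_def polys_uminus)
qed

lemma pf_terms_leveled: "(s, c) \<in> pf_terms r k h \<Longrightarrow> leveled_matching 0 r h (term_set r s c)"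
  using leveled_matching_term_set[of s r c] by (auto simp: pf_terms_def)

lemma leading_term:
  assumes "r > 0" "h < k"
  obtains s c where "(s, c) \<in> pf_terms r k h" "term_set r s c = leading_matching 0 r h"
    "\<And>s' c'. (s', c') \<in> pf_terms r k h \<Longrightarrow> term_set r s' c' = leading_matching 0 r h \<Longrightarrow> s' = s \<and> c' = c"
proof -
  have L: "leveled_matching 0 r h (leading_matching 0 r h)" using assms by (intro leveled_leading_matching) simp
  obtain s c where sc: "s \<in> pf_perms r" "c \<in> PiE {..<r} (\<lambda>_. {..h})" "term_set r s c = leading_matching 0 r h"
    using exists_term_set[OF L] by blast
  have "(\<Sum>i<r. c i) = h"
    using leveled_matching_term_set[OF sc(1), of c] L sc(3) by (simp add: leveled_matching_def)
  have "PiE {..<r} (\<lambda>_. {..h}) \<subseteq> PiE {..<r} (\<lambda>_. {..<k})" by (rule PiE_mono) (use assms(2) in auto)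
  then have ck: "c \<in> PiE {..<r} (\<lambda>_. {..<k})" using sc(2) by blast
  with \<open>(\<Sum>i<r. c i) = h\<close> have mem: "(s, c) \<in> pf_terms r k h" using sc by (simp add: pf_terms_def)
  have "s' = s \<and> c' = c" if "(s', c') \<in> pf_terms r k h" "term_set r s' c' = leading_matching 0 r h" for s' c'
  proof -
    have c': "s' \<in> pf_perms r" "c' \<in> PiE {..<r} (\<lambda>_. {..<k})" using that(1) by (simp_all add: pf_terms_def)
    show ?thesis using term_set_inj[OF c'(1) sc(1) c'(2) ck] that(2) sc(3) by metis
  qed
  then show ?thesis using that mem sc(3) by blast
qed

text \<open>
  The leading matching belongs to exactly one term, so its coefficient is a sign, in every
  characteristic; the other terms have smaller monomials.
\<close>

lemma pf_coeff_lead: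
  assumes "r > 0" "h < k"
  shows "jet.lead (pf_coeff r k h :: (jet_var, 'a::field) mpol) (set_monomial (leading_matching 0 r h))"
proof -
  obtain s c where sc: "(s, c) \<in> pf_terms r k h" "term_set r s c = leading_matching 0 r h"
    "\<And>s' c'. (s', c') \<in> pf_terms r k h \<Longrightarrow> term_set r s' c' = leading_matching 0 r h \<Longrightarrow> s' = s \<and> c' = c"
    using leading_term[OF assms] by metis
  show ?thesis
    unfolding pf_coeff_eq
  proof (rule jet.lead_sum_dominant[OF finite_pf_terms sc(1)])
    show "jet.lead (case (s, c) of (s, c) \<Rightarrow> of_int (sign s) * single (set_monomial (term_set r s c)) (1::'a))
        (set_monomial (leading_matching 0 r h))"
      using sc(2) by (auto intro!: jet.lead_sign jet.lead_single)
    fix t m assume t: "t \<in> pf_terms r k h" "t \<noteq> (s, c)"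
      and m: "m \<in> keys (case t of (s, c) \<Rightarrow> of_int (sign s) * single (set_monomial (term_set r s c)) (1::'a))"
    obtain s' c' where t': "t = (s', c')" by (cases t)
    have "m = set_monomial (term_set r s' c')" using m unfolding t' by (simp add: keys_sign)
    moreover have "term_set r s' c' \<noteq> leading_matching 0 r h" using sc(3) t t' by auto
    ultimately show "jet_order m (set_monomial (leading_matching 0 r h))"
      using leveled_matching_prec[OF pf_terms_leveled] t(1) t' by simp
  qed
qed

lemma leading_matching_coprime: "h \<noteq> h' \<Longrightarrow> leading_matching b \<rho> h \<inter> leading_matching b \<rho> h' = {}"
  by (auto simp: leading_matching_def)

text \<open>Two leading matchings share no edge, as the defining equation recovers \<open>h\<close>.\<close>

lemma pf_coprime_leads:
  assumes "r > 0"
  shows "coprime_leads jet_var_less (jet_vars (2 * r) k) (pf_coeff r k :: nat \<Rightarrow> (jet_var, 'a::field) mpol)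
    (\<lambda>h. set_monomial (leading_matching 0 r h)) k"
proof
  show "finite (jet_vars (2 * r) k)" by (rule finite_jet_vars)
  show "keys (set_monomial (leading_matching 0 r i)) \<inter> keys (set_monomial (leading_matching 0 r j)) = {}" if "i < j" for i j
    using leading_matching_coprime[of i j] that by (simp add: keys_set_monomial finite_leading_matching)
qed (use assms pf_coeff_polys pf_coeff_lead in auto)

text \<open>The only increasing list of length \<open>2r\<close> in \<open>{1, ..., 2r}\<close> is the full one.\<close>

lemma pfaffian_jet_ideal_eq:
  "(pfaffian_jet_ideal (2 * r) k r :: (jet_var, 'a::field) mpol set) = genideal (jet_ring (2 * r) k) (pf_coeff r k ` {..<k})"
proof -
  have xs: "xs = [1..<2 * r + 1]" if "sorted_wrt (<) xs" "length xs = 2 * r" "set xs \<subseteq> {1..2 * r}" for xs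
  proof -
    have "distinct xs" using that(1) by (simp add: strict_sorted_iff)
    then have "card (set xs) = card {1..2 * r}" using that(2) by (simp add: distinct_card)
    then have "set xs = {1..2 * r}" using that(3) by (intro card_subset_eq) auto
    moreover have "set [1..<2 * r + 1] = {1..2 * r}" by (simp only: set_upt) auto
    ultimately have "set xs = set [1..<2 * r + 1]" by (simp only:)
    then show ?thesis by (rule strict_sorted_equal[OF sorted_wrt_upt that(1)])
  qed
  have "{Polynomial.coeff (jet_pfaffian k xs) h | xs h.
      sorted_wrt (<) xs \<and> length xs = 2 * r \<and> set xs \<subseteq> {1..2 * r} \<and> h < k} = (pf_coeff r k :: nat \<Rightarrow> (jet_var, 'a) mpol) ` {..<k}" (is "?A = ?B")
  proof
    show "?A \<subseteq> ?B" using xs by (auto simp: pf_coeff_def)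
    show "?B \<subseteq> ?A"
    proof clarify
      fix h assume "h < k"
      moreover have "sorted_wrt (<) [1..<2 * r + 1]" "length [1..<2 * r + 1] = 2 * r" "set [1..<2 * r + 1] \<subseteq> {1..2 * r}"
        by (auto simp: sorted_wrt_upt simp del: upt_Suc)
      ultimately show "\<exists>xs h'. (pf_coeff r k h :: (jet_var, 'a) mpol) = Polynomial.coeff (jet_pfaffian k xs) h' \<and>
          sorted_wrt (<) xs \<and> length xs = 2 * r \<and> set xs \<subseteq> {1..2 * r} \<and> h' < k"
        unfolding pf_coeff_def by blast
    qed
  qed
  then show ?thesis by (simp only: pfaffian_jet_ideal_def)
qed

section \<open>The cofactor of the variables x_12\<close>

text \<open>
  The factor of \<open>x_12^(h)\<close> in \<open>p^(h)\<close>: since level \<open>h\<close> is used up by the first edge, all other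
  edges have level \<open>0\<close>. It is the same polynomial for every \<open>h\<close>.
\<close>

definition pf_cofactor :: "nat \<Rightarrow> (jet_var, 'a::field) mpol" where
  "pf_cofactor r = (\<Sum>s\<in>{s\<in>pf_perms r. s 1 = 1}. of_int (sign s) * (\<Prod>i\<in>{1..<r}. mvar (term_var s (\<lambda>_. 0) i)))"

lemma pf_perms_0: "s \<in> pf_perms r \<Longrightarrow> r > 0 \<Longrightarrow> s 1 = 1 \<Longrightarrow> s 0 = 0"
  using term_var_bounds(1)[of s r 0] by simp

lemma pf_perms_first: "s \<in> pf_perms r \<Longrightarrow> i < r \<Longrightarrow> s (2 * i) = 0 \<Longrightarrow> i = 0"
proof (rule ccontr)
  assume a: "s \<in> pf_perms r" "i < r" "s (2 * i) = 0" "i \<noteq> 0"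
  then have "s (2 * 0) < s (2 * i)" unfolding pf_perms_def by blast
  then show False using a by simp
qed

abbreviation zero_levels :: "nat \<Rightarrow> nat \<Rightarrow> nat" where "zero_levels r \<equiv> (\<lambda>i\<in>{..<r}. 0)"

lemma term_set_split_first:
  assumes "s \<in> pf_perms r" "r > 0" "s 1 = 1"
  shows "term_set r s (zero_levels r) - {(0, 1, 2)} = term_var s (\<lambda>_. 0) ` {1..<r}" "(0, 1, 2) \<in> term_set r s (zero_levels r)"
proof -
  have var: "term_var s (zero_levels r) i = term_var s (\<lambda>_. 0) i" if "i < r" for i using that by (simp add: term_var_def)
  have first: "term_var s (\<lambda>_. 0) 0 = (0, 1, 2)" using assms pf_perms_0 by (simp add: term_var_def)
  have eq: "term_set r s (zero_levels r) = term_var s (\<lambda>_. 0) ` {..<r}" unfolding term_set_def using var by (intro image_cong) auto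
  have "{..<r} = insert 0 {1..<r}" using assms by auto
  then have eq2: "term_set r s (zero_levels r) = insert (0, 1, 2) (term_var s (\<lambda>_. 0) ` {1..<r})" using eq first by simp
  have "(0, 1, 2) \<notin> term_var s (\<lambda>_. 0) ` {1..<r}"
  proof
    assume "(0, 1, 2) \<in> term_var s (\<lambda>_. 0) ` {1..<r}"
    then obtain i where "i \<in> {1..<r}" "s (2 * i) = 0" by (auto simp: term_var_def)
    then show False using pf_perms_first[OF assms(1), of i] by auto
  qed
  then show "term_set r s (zero_levels r) - {(0, 1, 2)} = term_var s (\<lambda>_. 0) ` {1..<r}" using eq2 by auto
  show "(0, 1, 2) \<in> term_set r s (zero_levels r)" using eq2 by auto
qed

lemma pf_cofactor_eq:
  assumes "r > 0"
  shows "pf_cofactor r = (\<Sum>s\<in>{s\<in>pf_perms r. s 1 = 1}.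
    of_int (sign s) * single (set_monomial (term_set r s (zero_levels r) - {(0, 1, 2)})) (1::'a::field))"
  unfolding pf_cofactor_def
proof (intro sum.cong refl arg_cong2[where f = "(*)"])
  fix s assume "s \<in> {s\<in>pf_perms r. s 1 = 1}"
  then have s: "s \<in> pf_perms r" "s 1 = 1" by auto
  show "(\<Prod>i\<in>{1..<r}. mvar (term_var s (\<lambda>_. 0) i)) = single (set_monomial (term_set r s (zero_levels r) - {(0, 1, 2)})) (1::'a)"
    unfolding term_set_split_first(1)[OF s(1) assms s(2)] prod_mvar_set[symmetric]
    by (subst prod.reindex[OF term_var_inj[OF s(1)]]) simp
qed

lemma leveled_matching_drop_first:
  assumes T: "leveled_matching 0 r 0 T" and first: "(0, 1, 2) \<in> T"
  shows "leveled_matching 2 (r - 1) 0 (T - {(0, 1, 2)})"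
proof -
  have fin: "finite T" "card T = r" using T by (auto simp: leveled_matching_def)
  then have r: "r > 0" using first by (auto simp: card_gt_0_iff)
  show ?thesis
    unfolding leveled_matching_def
  proof (intro conjI)
    show "card (T - {(0, 1, 2)}) = r - 1" using fin first by simp
    show "\<forall>(l, i, j)\<in>T - {(0, 1, 2)}. 2 < i \<and> i < j \<and> j \<le> 2 + 2 * (r - 1)"
    proof (rule ballI)
      fix x assume xT: "x \<in> T - {(0, 1, 2)}"
      obtain l i j where lij: "x = (l, i, j)" by (cases x)
      have x: "(l, i, j) \<in> T" "(l, i, j) \<noteq> (0, 1, 2)" using xT lij by auto
      have "0 < i" "i < j" "j \<le> 2 * r" using leveled_matching_bounds[OF T x(1)] by auto
      moreover have "{i, j} \<inter> {1, 2} = {}" by (rule leveled_matching_disjoint[OF T x(1) first x(2)])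
      ultimately show "case x of (l, i, j) \<Rightarrow> 2 < i \<and> i < j \<and> j \<le> 2 + 2 * (r - 1)" unfolding lij using r by auto
    qed
    show "\<forall>(l, i, j)\<in>T - {(0, 1, 2)}. \<forall>(l', i', j')\<in>T - {(0, 1, 2)}. (l, i, j) \<noteq> (l', i', j') \<longrightarrow> {i, j} \<inter> {i', j'} = {}"
      using leveled_matching_disjoint[OF T] by blast
    have "(\<Sum>x\<in>T. fst x) = 0" using T by (simp add: leveled_matching_def)
    then show "(\<Sum>x\<in>T - {(0, 1, 2)}. fst x) = 0" using fin by simp
  qed (use fin in simp)
qed

lemma leveled_matching_add_first:
  assumes T: "leveled_matching 2 (r - 1) 0 T" and r: "r > 0"
  shows "leveled_matching 0 r 0 (insert (0, 1, 2) T)" "(0, 1, 2) \<notin> T"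
proof -
  have fin: "finite T" "card T = r - 1" using T by (auto simp: leveled_matching_def)
  note bd = leveled_matching_bounds[OF T]
  show nT: "(0, 1, 2) \<notin> T" using bd(1)[of 0 1 2] by auto
  show "leveled_matching 0 r 0 (insert (0, 1, 2) T)"
    unfolding leveled_matching_def
  proof (intro conjI)
    show "card (insert (0, 1, 2) T) = r" using fin nT r by simp
    have "0 < i \<and> i < j \<and> j \<le> 0 + 2 * r" if "(l, i, j) \<in> T" for l i j
      using bd[OF that] r by auto
    then show "\<forall>(l, i, j)\<in>insert (0, 1, 2) T. 0 < i \<and> i < j \<and> j \<le> 0 + 2 * r" using r by auto
    have d1: "{i, j} \<inter> {1, 2} = {}" if "(l, i, j) \<in> T" for l i j using bd[OF that] by auto
    show "\<forall>(l, i, j)\<in>insert (0, 1, 2) T. \<forall>(l', i', j')\<in>insert (0, 1, 2) T. (l, i, j) \<noteq> (l', i', j') \<longrightarrow> {i, j} \<inter> {i', j'} = {}"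
    proof (intro ballI, unfold case_prod_unfold, intro ballI impI)
      fix x y :: jet_var
      assume xy0: "x \<in> insert (0, 1, 2) T" "y \<in> insert (0, 1, 2) T"
        "(fst x, fst (snd x), snd (snd x)) \<noteq> (fst y, fst (snd y), snd (snd y))"
      define l i j l' i' j' where "l = fst x" "i = fst (snd x)" "j = snd (snd x)" "l' = fst y" "i' = fst (snd y)" "j' = snd (snd y)"
      then have xy: "(l, i, j) \<in> insert (0, 1, 2) T" "(l', i', j') \<in> insert (0, 1, 2) T" "(l, i, j) \<noteq> (l', i', j')"
        using xy0 by simp_all
      consider "(l, i, j) \<in> T" "(l', i', j') \<in> T" | "(l, i, j) = (0, 1, 2)" "(l', i', j') \<in> T" | "(l, i, j) \<in> T" "(l', i', j') = (0, 1, 2)"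
        using xy by auto
      then have "{i, j} \<inter> {i', j'} = {}"
      proof cases
        case 1 then show ?thesis using leveled_matching_disjoint[OF T _ _ xy(3)] by simp
      next
        case 2 then show ?thesis using d1[OF 2(2)] by auto
      next
        case 3 then show ?thesis using d1[OF 3(1)] by auto
      qed
      then show "{fst (snd x), snd (snd x)} \<inter> {fst (snd y), snd (snd y)} = {}"
        unfolding \<open>i = fst (snd x)\<close> \<open>j = snd (snd x)\<close> \<open>i' = fst (snd y)\<close> \<open>j' = snd (snd y)\<close> .
    qed
    have "(\<Sum>x\<in>T. fst x) = 0" using T by (simp add: leveled_matching_def)
    then show "(\<Sum>x\<in>insert (0, 1, 2) T. fst x) = 0" using fin nT by simp
  qed (use fin in simp)
qed

lemma zero_levels_terms: "s \<in> pf_perms r \<Longrightarrow> leveled_matching 0 r 0 (term_set r s (zero_levels r))"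
  using leveled_matching_term_set[of s r "zero_levels r"] by simp

text \<open>
  Removing the edge \<open>{1, 2}\<close> identifies the terms with the matchings of \<open>{3, ..., 2r}\<close> of total
  level \<open>0\<close>, to which the description of the leading matching applies with offset \<open>2\<close>.
\<close>

lemma pf_cofactor_lead:
  assumes r: "r > 0"
  shows "jet.lead (pf_cofactor r :: (jet_var, 'a::field) mpol) (set_monomial (leading_matching 2 (r - 1) 0))"
proof -
  let ?M = "leading_matching 2 (r - 1) 0"
  have M: "leveled_matching 2 (r - 1) 0 ?M" by (rule leveled_leading_matching) simp
  note add = leveled_matching_add_first[OF M r]
  obtain s c where sc: "s \<in> pf_perms r" "c \<in> PiE {..<r} (\<lambda>_. {..0})" "term_set r s c = insert (0, 1, 2) ?M"
    using exists_term_set[OF add(1)] by blast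
  have c: "c = zero_levels r" using sc(2) by (intro PiE_ext[of c "{..<r}" "\<lambda>_. {..0}" "zero_levels r"]) (auto simp: PiE_iff)
  have s1: "s 1 = 1"
  proof -
    have "(0, 1, 2) \<in> term_set r s c" using sc(3) by simp
    then obtain i where i: "i < r" "(0, 1, 2) = term_var s c i" by (auto simp: term_set_def)
    then have "i = 0" using pf_perms_first[OF sc(1)] by (auto simp: term_var_def)
    then show ?thesis using i by (simp add: term_var_def)
  qed
  have T: "term_set r s (zero_levels r) - {(0, 1, 2)} = ?M" using sc(3) c add(2) by auto
  show ?thesis
    unfolding pf_cofactor_eq[OF r]
  proof (rule jet.lead_sum_dominant)
    show "finite {s \<in> pf_perms r. s 1 = 1}" using finite_pf_perms by simp
    show "s \<in> {s \<in> pf_perms r. s 1 = 1}" using sc s1 by simp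
    show "jet.lead (of_int (sign s) * single (set_monomial (term_set r s (zero_levels r) - {(0, 1, 2)})) (1::'a)) (set_monomial ?M)"
      unfolding T by (intro jet.lead_sign jet.lead_single) simp
    fix t m assume t: "t \<in> {s \<in> pf_perms r. s 1 = 1}" "t \<noteq> s"
      and m: "m \<in> keys (of_int (sign t) * single (set_monomial (term_set r t (zero_levels r) - {(0, 1, 2)})) (1::'a))"
    let ?T = "term_set r t (zero_levels r) - {(0, 1, 2)}"
    have tp: "t \<in> pf_perms r" "t 1 = 1" using t by auto
    have first: "(0, 1, 2) \<in> term_set r t (zero_levels r)" by (rule term_set_split_first(2)[OF tp(1) r tp(2)])
    have lm: "leveled_matching 2 (r - 1) 0 ?T" by (rule leveled_matching_drop_first[OF zero_levels_terms[OF tp(1)] first])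
    have "?T \<noteq> ?M"
    proof
      assume "?T = ?M"
      then have "term_set r t (zero_levels r) = term_set r s (zero_levels r)"
        using insert_Diff[OF first] sc(3) c by simp
      then have "t = s" by (intro term_set_inj(1)[OF tp(1) sc(1), of "zero_levels r" "\<lambda>_. {..0}" "zero_levels r"]) auto
      then show False using t by simp
    qed
    then show "jet_order m (set_monomial ?M)" using leveled_matching_prec[OF lm] m by (simp add: keys_sign)
  qed
qed

lemma pf_cofactor_polys:
  assumes "r > 0" "k > 0" shows "pf_cofactor r \<in> polys (jet_vars (2 * r) k - {(h, 1, 2) | h. True})"
  unfolding pf_cofactor_def
proof (intro polys_sum polys_mult polys_prod polys_mvar)
  fix s i assume s: "s \<in> {s \<in> pf_perms r. s 1 = 1}" and i: "i \<in> {1..<r}"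
  then show "term_var s (\<lambda>_. 0) i \<in> jet_vars (2 * r) k - {(h, 1, 2) | h. True}"
    using term_var_bounds[of s r i] pf_perms_first[of s r i] assms by (auto simp: term_var_def jet_vars_def)
qed (auto simp: sign_def polys_uminus)

text \<open>
  A term of \<open>p^(h)\<close> containing \<open>x_12^(h')\<close> has \<open>h' \<le> h\<close>, with equality only if the other edges
  have level \<open>0\<close>.
\<close>

lemma pf_coeff_split:
  assumes r: "r > 0" and h: "h < k"
  obtains g where "pf_coeff r k h = mvar (h, 1, 2) * pf_cofactor r + g"
    "g \<in> polys (jet_vars (2 * r) k - {(h', 1, 2) | h'. h \<le> h'})"
proof
  let ?F = "\<lambda>(s, c). of_int (sign s) * (\<Prod>i<r. mvar (term_var s c i) :: (jet_var, 'a) mpol)"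
  let ?T = "{(s, c). (s, c) \<in> pf_terms r k h \<and> s 1 = 1 \<and> c 0 = h}"
  let ?c = "\<lambda>i\<in>{..<r}. if i = 0 then h else 0"
  let ?g = "\<Sum>t\<in>pf_terms r k h - ?T. ?F t"
  have "?T \<subseteq> pf_terms r k h" by auto
  then have "pf_coeff r k h = ?g + (\<Sum>t\<in>?T. ?F t)"
    unfolding pf_coeff_def coeff_jet_pfaffian by (rule sum.subset_diff[OF _ finite_pf_terms])
  also have "(\<Sum>t\<in>?T. ?F t) = (\<Sum>s\<in>{s\<in>pf_perms r. s 1 = 1}. ?F (s, ?c))"
  proof -
    have sum_c: "(\<Sum>i<r. ?c i) = h"
    proof -
      have "(\<Sum>i<r. ?c i) = (\<Sum>i<r. if i = 0 then h else 0)" by (intro sum.cong) auto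
      then show ?thesis using r by simp
    qed
    have "c = ?c" if c: "c \<in> PiE {..<r} (\<lambda>_. {..<k})" "(\<Sum>i<r. c i) = h" "c 0 = h" for c
    proof (rule PiE_ext[OF c(1)])
      show "?c \<in> PiE {..<r} (\<lambda>_. {..<k})" using h by auto
      fix i assume i: "i \<in> {..<r}"
      have "(\<Sum>i<r. c i) = c 0 + (\<Sum>i\<in>{..<r} - {0}. c i)" using r by (intro sum.remove) auto
      then have "(\<Sum>i\<in>{..<r} - {0}. c i) = 0" using c by simp
      then have "c i = 0" if "i \<noteq> 0" using that i by auto
      then show "c i = ?c i" using c(3) i by auto
    qed
    then have c_eq: "c = ?c" if "(s, c) \<in> ?T" for s c using that by (simp add: pf_terms_def)
    have c_in: "(s, ?c) \<in> ?T" if "s \<in> pf_perms r" "s 1 = 1" for s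
    proof -
      have "?c \<in> PiE {..<r} (\<lambda>_. {..<k})" using h by auto
      moreover have "?c 0 = h" using r by simp
      ultimately show ?thesis using that sum_c unfolding pf_terms_def by blast
    qed
    have "?T = (\<lambda>s. (s, ?c)) ` {s\<in>pf_perms r. s 1 = 1}"
    proof
      show "?T \<subseteq> (\<lambda>s. (s, ?c)) ` {s\<in>pf_perms r. s 1 = 1}"
      proof
        fix t assume t: "t \<in> ?T"
        obtain s c where sc: "t = (s, c)" by (cases t)
        have "s \<in> {s\<in>pf_perms r. s 1 = 1}" using t sc by (simp add: pf_terms_def)
        then show "t \<in> (\<lambda>s. (s, ?c)) ` {s\<in>pf_perms r. s 1 = 1}" using c_eq t sc by blast
      qed
      show "(\<lambda>s. (s, ?c)) ` {s\<in>pf_perms r. s 1 = 1} \<subseteq> ?T" using c_in by blast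
    qed
    then show ?thesis by (simp add: sum.reindex inj_on_def)
  qed
  also have "\<dots> = (\<Sum>s\<in>{s\<in>pf_perms r. s 1 = 1}. mvar (h, 1, 2) * (of_int (sign s) * (\<Prod>i\<in>{1..<r}. mvar (term_var s (\<lambda>_. 0) i))))"
  proof (rule sum.cong[OF refl])
    fix s assume "s \<in> {s\<in>pf_perms r. s 1 = 1}"
    then have s: "s \<in> pf_perms r" "s 1 = 1" by auto
    have "{..<r} = insert 0 {1..<r}" using r by auto
    then have "(\<Prod>i<r. mvar (term_var s ?c i) :: (jet_var, 'a) mpol) = mvar (term_var s ?c 0) * (\<Prod>i\<in>{1..<r}. mvar (term_var s ?c i))"
      by simp
    also have "term_var s ?c 0 = (h, 1, 2)" using s pf_perms_0[OF s(1) r] r by (simp add: term_var_def)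
    also have "(\<Prod>i\<in>{1..<r}. mvar (term_var s ?c i) :: (jet_var, 'a) mpol) = (\<Prod>i\<in>{1..<r}. mvar (term_var s (\<lambda>_. 0) i))"
      by (intro prod.cong) (auto simp: term_var_def)
    finally have pe: "(\<Prod>i<r. mvar (term_var s ?c i) :: (jet_var, 'a) mpol) =
      mvar (h, 1, 2) * (\<Prod>i\<in>{1..<r}. mvar (term_var s (\<lambda>_. 0) i))" .
    show "?F (s, ?c) = mvar (h, 1, 2) * (of_int (sign s) * (\<Prod>i\<in>{1..<r}. mvar (term_var s (\<lambda>_. 0) i)))"
      by (simp only: prod.case pe mult.left_commute)
  qed
  finally show "pf_coeff r k h = mvar (h, 1, 2) * pf_cofactor r + ?g"
    by (simp add: pf_cofactor_def sum_distrib_left add.commute)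
  show "?g \<in> polys (jet_vars (2 * r) k - {(h', 1, 2) | h'. h \<le> h'})"
  proof (intro polys_sum)
    fix t assume t: "t \<in> pf_terms r k h - ?T"
    obtain s c where sc: "t = (s, c)" by (cases t)
    have s: "s \<in> pf_perms r" "(\<Sum>i<r. c i) = h" "(s, c) \<in> pf_terms r k h" "\<not> (s 1 = 1 \<and> c 0 = h)"
      using t sc by (auto simp: pf_terms_def)
    have "term_var s c i \<in> jet_vars (2 * r) k - {(h', 1, 2) | h'. h \<le> h'}" if i: "i < r" for i
    proof -
      have "term_var s c i \<in> jet_vars (2 * r) k" using term_set_jet_vars[OF s(3)] i by (auto simp: term_set_def)
      moreover have "term_var s c i \<noteq> (h', 1, 2)" if "h \<le> h'" for h'
      proof
        assume e: "term_var s c i = (h', 1, 2)"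
        then have "i = 0" using pf_perms_first[OF s(1) i] by (simp add: term_var_def)
        then have "s 1 = 1" "c 0 = h'" using e by (auto simp: term_var_def)
        moreover have "c 0 \<le> (\<Sum>i<r. c i)" using r by (intro member_le_sum) auto
        ultimately show False using s that by auto
      qed
      ultimately show ?thesis by blast
    qed
    then have "(\<Prod>i<r. mvar (term_var s c i) :: (jet_var, 'a) mpol) \<in> polys (jet_vars (2 * r) k - {(h', 1, 2) | h'. h \<le> h'})"
      by (intro polys_prod polys_mvar) auto
    then show "?F t \<in> polys (jet_vars (2 * r) k - {(h', 1, 2) | h'. h \<le> h'})"
      unfolding sc by (auto simp: sign_def polys_uminus)
  qed
qed

section \<open>Primality\<close>

lemma id_coefficient_hom: "coefficient_hom (\<lambda>a::'a::field. a)"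
  by standard auto

lemma zero_ideal_prime: "primeideal {0} (polynomial_ring V :: (jet_var, 'a::field) mpol ring)"
proof (rule primeidealI)
  show "ideal {0} (polynomial_ring V :: (jet_var, 'a) mpol ring)" by (rule ideal_polynomial_ringI) auto
  show "cring (polynomial_ring V :: (jet_var, 'a) mpol ring)" by (rule polynomial_ring_cring)
  have "(1 :: (jet_var, 'a) mpol) \<in> polys V" by simp
  then show "carrier (polynomial_ring V :: (jet_var, 'a) mpol ring) \<noteq> {0}" by (metis polynomial_ring_simps(1) singletonD zero_neq_one)
  show "a \<in> {0} \<or> b \<in> {0}" if "a \<otimes>\<^bsub>polynomial_ring V\<^esub> b \<in> {0}" for a b :: "(jet_var, 'a) mpol"
    using that mpol_no_zero_divisors[OF jet.variable_order_axioms, of a b] by simp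
qed

text \<open>
  On the right-hand side an edge of level \<open>0\<close> has \<open>i + j = 2r + 3\<close>, but on the left-hand side
  \<open>i + j \<le> 2r + 1\<close>. For a higher level the right-hand side would require \<open>i + j > 4r\<close>.
\<close>

lemma cofactor_coprime:
  assumes "r > 0" shows "leading_matching 0 r h \<inter> leading_matching 2 (r - 1) 0 = {}"
proof (rule ccontr)
  assume "\<not> ?thesis"
  then obtain l i j where x: "(l, i, j) \<in> leading_matching 0 r h" "(l, i, j) \<in> leading_matching 2 (r - 1) 0" by auto
  obtain m where m: "r = Suc m" using assms by (cases r) auto
  have e: "2 * h + i + j = 2 * l * r + 2 * r + 1" "i < j" "j \<le> 2 * r" using x(1) by (auto simp: leading_matching_def)
  have e2: "i + j = 2 * l * m + 2 * m + 5" using x(2) m by (auto simp: leading_matching_def)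
  show False
  proof (cases l)
    case 0 then show False using e e2 m by simp
  next
    case (Suc l') then show False using e e2 m by simp
  qed
qed

text \<open>
  Since \<open>p^(h)\<close> is linear in \<open>x_12^(h)\<close> with invertible coefficient \<open>\<chi>(q)\<close> and contains no later
  \<open>x_12^(h')\<close>, the values of \<open>x_12^(0), x_12^(1), ...\<close> can be chosen one after the other.
\<close>

lemma pf_coeffs_common_zero:
  fixes \<chi> :: "(jet_var, 'a::field) mpol \<Rightarrow> 'a"
  assumes r: "r > 0" and k: "k > 0"
    and add: "\<And>x y. x \<in> polys (jet_vars (2 * r) k) \<Longrightarrow> y \<in> polys (jet_vars (2 * r) k) \<Longrightarrow> \<chi> (x + y) = \<chi> x + \<chi> y"
    and mult: "\<And>x y. x \<in> polys (jet_vars (2 * r) k) \<Longrightarrow> y \<in> polys (jet_vars (2 * r) k) \<Longrightarrow> \<chi> (x * y) = \<chi> x * \<chi> y"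
    and const: "\<And>c. \<chi> (single 0 c) = c" and q: "\<chi> (pf_cofactor r) \<noteq> 0" and H: "H \<le> k"
  shows "\<exists>x. (\<forall>f\<in>polys (jet_vars (2 * r) k - {(h, 1, 2) | h. True}). meval (\<lambda>a. a) x f = \<chi> f) \<and>
    (\<forall>h<H. meval (\<lambda>a. a) x (pf_coeff r k h) = 0)"
  using H
proof (induction H)
  let ?V = "jet_vars (2 * r) k"
  let ?W = "\<lambda>h. ?V - {(h', 1, 2) | h'. h \<le> h'}"
  interpret coefficient_hom "\<lambda>a::'a. a" by (rule id_coefficient_hom)
  {
    case 0
    have "meval (\<lambda>a. a) (\<lambda>v. \<chi> (mvar v)) f = \<chi> f" if "f \<in> polys ?V" for f
    proof -
      have "f \<in> polys ?V \<and> meval (\<lambda>a. a) (\<lambda>v. \<chi> (mvar v)) f = \<chi> f" using that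
        by (induction rule: polys_induct) (auto simp: const add mult meval_add meval_mult polys_mvar)
      then show ?thesis by simp
    qed
    then show ?case using polys_mono[of "?V - {(h, 1, 2) | h. True}" ?V] by (intro exI[of _ "\<lambda>v. \<chi> (mvar v)"]) auto
  next
    case (Suc H)
    then obtain x where x: "\<And>f. f \<in> polys (?V - {(h, 1, 2) | h. True}) \<Longrightarrow> meval (\<lambda>a. a) x f = \<chi> f"
      "\<And>h. h < H \<Longrightarrow> meval (\<lambda>a. a) x (pf_coeff r k h) = 0" by auto
    have Hk: "H < k" using Suc by simp
    obtain g :: "(jet_var, 'a) mpol" where g: "pf_coeff r k H = mvar (H, 1, 2) * pf_cofactor r + g" "g \<in> polys (?W H)"
      by (rule pf_coeff_split[OF r Hk])
    define x' where "x' = x((H, 1, 2) := - meval (\<lambda>a. a) x g / \<chi> (pf_cofactor r))"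
    have same: "meval (\<lambda>a. a) x' f = meval (\<lambda>a. a) x f" if "f \<in> polys U" "(H, 1, 2) \<notin> U" for f U
      using that by (intro meval_cong[of f U]) (auto simp: x'_def)
    have B: "meval (\<lambda>a. a) x' f = \<chi> f" if "f \<in> polys (?V - {(h, 1, 2) | h. True})" for f
      using same[OF that] x(1)[OF that] by simp
    have q': "meval (\<lambda>a. a) x' (pf_cofactor r) = \<chi> (pf_cofactor r)" by (rule B[OF pf_cofactor_polys[OF r k]])
    have "meval (\<lambda>a. a) x' g = meval (\<lambda>a. a) x g" by (rule same[OF g(2)]) auto
    then have "meval (\<lambda>a. a) x' (pf_coeff r k H) = 0"
      unfolding g(1) meval_add meval_mult q' using q by (simp add: x'_def)
    moreover have "meval (\<lambda>a. a) x' (pf_coeff r k h) = 0" if h: "h < H" for h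
    proof -
      have hk: "h < k" using h Hk by simp
      obtain g :: "(jet_var, 'a) mpol" where g: "pf_coeff r k h = mvar (h, 1, 2) * pf_cofactor r + g" "g \<in> polys (?W h)"
        by (rule pf_coeff_split[OF r hk])
      have "(h, 1, 2) \<in> ?W H" using h hk r by (auto simp: jet_vars_def)
      moreover have "pf_cofactor r \<in> polys (?W H)"
        by (rule subsetD[OF polys_mono pf_cofactor_polys[OF r k]]) auto
      moreover have "g \<in> polys (?W H)" by (rule subsetD[OF polys_mono g(2)]) (use h in auto)
      ultimately have "(pf_coeff r k h :: (jet_var, 'a) mpol) \<in> polys (?W H)" unfolding g(1) by (intro polys_add polys_mult polys_mvar)
      then show ?thesis using same[of "pf_coeff r k h" "?W H"] x(2)[OF h] by auto
    qed
    ultimately show ?case using B less_Suc_eq by (intro exI[of _ x']) auto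
  }
qed

text \<open>
  With \<open>q\<close> inverted, the quotient is the localization of the polynomial ring \<open>B\<close> in the variables
  other than the \<open>x_12^(h)\<close>, which is a domain; as \<open>q\<close> is a nonzerodivisor modulo the ideal,
  primality descends. Localizations are avoided by multiplying with powers of \<open>q\<close>.
\<close>

theorem pf_ideal_prime:
  assumes r: "r > 0" and k: "k > 0"
  shows "primeideal (genideal (polynomial_ring (jet_vars (2 * r) k)) (pf_coeff r k ` {..<k}))
    (polynomial_ring (jet_vars (2 * r) k) :: (jet_var, 'a::alg_closed_field) mpol ring)"
proof -
  let ?V = "jet_vars (2 * r) k"
  let ?B = "?V - {(h, 1, 2) | h. True}"
  let ?q = "pf_cofactor r :: (jet_var, 'a) mpol"
  interpret C: coprime_leads jet_var_less ?V "pf_coeff r k :: nat \<Rightarrow> (jet_var, 'a) mpol"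
    "\<lambda>h. set_monomial (leading_matching 0 r h)" k
    by (rule pf_coprime_leads[OF r])
  define I where "I = C.J k"
  have I_gen: "I = genideal (polynomial_ring ?V) (pf_coeff r k ` {..<k})"
    unfolding I_def by (rule C.J_eq_genideal) simp
  have I_ideal: "ideal I (polynomial_ring ?V)" unfolding I_def by (rule C.J_ideal) simp
  note ID = ideal_polynomial_ringD[OF I_ideal]
  have BV: "f \<in> polys ?B \<Longrightarrow> f \<in> polys ?V" for f :: "(jet_var, 'a) mpol" using polys_mono[of ?B ?V] by auto
  have qB: "?q \<in> polys ?B" by (rule pf_cofactor_polys[OF r k])
  have qV: "?q \<in> polys ?V" using BV qB by simp
  have q_power: "?q ^ n \<in> polys ?V" "?q ^ n \<in> polys ?B" for n using qB qV by auto
  have q_nzd: "a \<in> I" if "a \<in> polys ?V" "?q * a \<in> I" for a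
    unfolding I_def
  proof (rule C.nonzerodivisor_mod_J[OF order.refl qV pf_cofactor_lead[OF r] _ that(1)])
    show "?q * a \<in> C.J k" using that(2) by (simp add: I_def)
    show "keys (set_monomial (leading_matching 0 r j)) \<inter> keys (set_monomial (leading_matching 2 (r - 1) 0)) = {}" for j
      using cofactor_coprime[OF r] by (simp add: keys_set_monomial finite_leading_matching)
  qed
  have q_nzd_power: "a \<in> I" if "a \<in> polys ?V" "?q ^ n * a \<in> I" for a n
    using that(2)
  proof (induction n)
    case (Suc n)
    then have "?q * (?q ^ n * a) \<in> I" by (simp add: mult.assoc)
    moreover have "?q ^ n * a \<in> polys ?V" using q_power that by (intro polys_mult)
    ultimately show ?case using q_nzd Suc.IH by blast
  qed simp
  \<comment> \<open>T a: up to a power of q, the element a is congruent to a polynomial in the variables other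
      than the x_12^(h).\<close>
  define T where "T a \<longleftrightarrow> a \<in> polys ?V \<and> (\<exists>n. \<exists>b\<in>polys ?B. ?q ^ n * a - b \<in> I)" for a
  have T_B: "T a" if "a \<in> polys ?B" for a
    unfolding T_def using that BV ID(2) by (auto intro!: exI[of _ 0] bexI[of _ a])
  have T_add: "T (a + a')" if a: "T a" "T a'" for a a'
  proof -
    obtain n b m b' where b: "b \<in> polys ?B" "b' \<in> polys ?B" "?q ^ n * a - b \<in> I" "?q ^ m * a' - b' \<in> I"
      using a unfolding T_def by blast
    have "?q ^ (n + m) * (a + a') - (?q ^ m * b + ?q ^ n * b')
        = ?q ^ m * (?q ^ n * a - b) + ?q ^ n * (?q ^ m * a' - b')"
      by (simp add: power_add algebra_simps)
    also have "\<dots> \<in> I" using b q_power by (intro ID(3) ID(4))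
    finally show ?thesis unfolding T_def using a b q_power
      by (intro conjI exI[of _ "n + m"] bexI[of _ "?q ^ m * b + ?q ^ n * b'"]) (auto simp: T_def)
  qed
  have T_mult: "T (a * a')" if a: "T a" "T a'" for a a'
  proof -
    obtain n b m b' where b: "b \<in> polys ?B" "b' \<in> polys ?B" "?q ^ n * a - b \<in> I" "?q ^ m * a' - b' \<in> I"
      using a unfolding T_def by blast
    have aV: "?q ^ n * a \<in> polys ?V" using a q_power by (auto simp: T_def)
    have "?q ^ (n + m) * (a * a') - b * b' = (?q ^ n * a) * (?q ^ m * a' - b') + b' * (?q ^ n * a - b)"
      by (simp add: power_add algebra_simps)
    also have "\<dots> \<in> I" using b BV aV by (intro ID(3) ID(4))
    finally show ?thesis unfolding T_def using a b
      by (intro conjI exI[of _ "n + m"] bexI[of _ "b * b'"]) (auto simp: T_def)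
  qed
  have T_first: "T (mvar (h, 1, 2))" if "h < k" for h
    using that
  proof (induction h rule: less_induct)
    case (less h)
    let ?W = "?V - {(h', 1, 2) | h'. h \<le> h'}"
    obtain g :: "(jet_var, 'a) mpol" where g: "pf_coeff r k h = mvar (h, 1, 2) * ?q + g" "g \<in> polys ?W"
      by (rule pf_coeff_split[OF r less.prems])
    have "T g" using g(2)
    proof (induction rule: polys_induct)
      case (const c) then show ?case by (intro T_B) simp
    next
      case (var v)
      show ?case
      proof (cases "v \<in> ?B")
        case True then show ?thesis by (intro T_B polys_mvar)
      next
        case False
        then obtain h' where "v = (h', 1, 2)" "h' < h" using var by fastforce
        then show ?thesis using less by auto
      qed
    qed (simp_all add: T_add T_mult)
    then obtain n b where b: "b \<in> polys ?B" "?q ^ n * g - b \<in> I" by (auto simp: T_def)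
    have "?q ^ Suc n * mvar (h, 1, 2) - (- b) = ?q ^ n * pf_coeff r k h - (?q ^ n * g - b)"
      unfolding g(1) by (simp add: algebra_simps)
    also have "pf_coeff r k h \<in> I" unfolding I_def using less.prems by (rule C.J_gen)
    then have "?q ^ n * pf_coeff r k h - (?q ^ n * g - b) \<in> I" by (rule ID(6)[OF ID(4)[OF _ q_power(1)] b(2)])
    finally have "?q ^ Suc n * mvar (h, 1, 2) - (- b) \<in> I" .
    moreover have "(h, 1, 2) \<in> ?V" using less.prems r by (auto simp: jet_vars_def)
    ultimately show ?case unfolding T_def using b by (blast intro: polys_mvar polys_uminus)
  qed
  have T_all: "T a" if "a \<in> polys ?V" for a
    using that
  proof (induction rule: polys_induct)
    case (const c) then show ?case by (intro T_B) simp
  next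
    case (var v)
    show ?case
    proof (cases "v \<in> ?B")
      case True then show ?thesis by (intro T_B polys_mvar)
    next
      case False
      then obtain h where "v = (h, 1, 2)" using var by blast
      moreover have "h < k" using var \<open>v = (h, 1, 2)\<close> by (simp add: jet_vars_def)
      ultimately show ?thesis using T_first by simp
    qed
  qed (simp_all add: T_add T_mult)
  \<comment> \<open>A nonzero b would be nonzero at a common zero of the generators.\<close>
  have I_B: "b = 0" if b: "b \<in> polys ?B" "b \<in> I" for b
  proof (rule ccontr)
    assume "b \<noteq> 0"
    then have "b * ?q \<notin> {0}"
      using mpol_no_zero_divisors[OF jet.variable_order_axioms, of b ?q] jet.lead_nonzero[OF pf_cofactor_lead[OF r]] by auto
    moreover have "b * ?q \<in> polys ?V" using b BV qV by blast
    ultimately obtain \<chi> :: "(jet_var, 'a) mpol \<Rightarrow> 'a" where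
      add: "\<And>x y. x \<in> polys ?V \<Longrightarrow> y \<in> polys ?V \<Longrightarrow> \<chi> (x + y) = \<chi> x + \<chi> y"
      and mult: "\<And>x y. x \<in> polys ?V \<Longrightarrow> y \<in> polys ?V \<Longrightarrow> \<chi> (x * y) = \<chi> x * \<chi> y"
      and const: "\<And>c. \<chi> (single 0 c) = c" and nz: "\<chi> (b * ?q) \<noteq> 0"
      using nullstellensatz[OF finite_jet_vars zero_ideal_prime, of "b * ?q" "2 * r" k] by metis
    have nz': "\<chi> b \<noteq> 0" "\<chi> ?q \<noteq> 0" using nz mult[of b ?q] b BV qV by auto
    obtain x where x: "\<forall>f\<in>polys ?B. meval (\<lambda>a. a) x f = \<chi> f" "\<forall>h<k. meval (\<lambda>a. a) x (pf_coeff r k h) = 0"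
      using pf_coeffs_common_zero[OF r k add mult const nz'(2) order.refl] by blast
    interpret E: coefficient_hom "\<lambda>a::'a. a" by (rule id_coefficient_hom)
    obtain a where "b = (\<Sum>h<k. a h * pf_coeff r k h)" using b(2) unfolding I_def C.J_def by blast
    then have "meval (\<lambda>a. a) x b = 0" using x(2) by (simp add: E.meval_sum E.meval_mult)
    then show False using x(1) b nz' by auto
  qed
  have "primeideal I (polynomial_ring ?V)"
  proof (rule primeidealI[OF I_ideal polynomial_ring_cring])
    have "1 \<notin> I" unfolding I_def
    proof (rule C.one_notin_J)
      fix j
      have "leading_matching 0 r j \<noteq> {}" using card_leading_matching[OF r, of 0 j] r by auto
      then show "set_monomial (leading_matching 0 r j) \<noteq> 0"
        using keys_set_monomial[OF finite_leading_matching, of 0 r j] by auto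
    qed simp
    then show "carrier (polynomial_ring ?V) \<noteq> I" by auto
    fix a a' assume "a \<in> carrier (polynomial_ring ?V)" "a' \<in> carrier (polynomial_ring ?V)" "a \<otimes>\<^bsub>polynomial_ring ?V\<^esub> a' \<in> I"
    then have a: "a \<in> polys ?V" "a' \<in> polys ?V" "a * a' \<in> I" by auto
    obtain n b where b: "b \<in> polys ?B" "?q ^ n * a - b \<in> I" using T_all[OF a(1)] by (auto simp: T_def)
    obtain m b' where b': "b' \<in> polys ?B" "?q ^ m * a' - b' \<in> I" using T_all[OF a(2)] by (auto simp: T_def)
    have "b * b' = ?q ^ (n + m) * (a * a') - ((?q ^ n * a) * (?q ^ m * a' - b') + b' * (?q ^ n * a - b))"
      by (simp add: power_add algebra_simps)
    also have "\<dots> \<in> I"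
      using polys_mult[OF q_power(1) a(1)]
      by (intro ID(6)[OF ID(4)[OF a(3) q_power(1)] ID(3)[OF ID(4)[OF b'(2)] ID(4)[OF b(2) BV[OF b'(1)]]]])
    finally have "b * b' = 0" using b b' by (intro I_B polys_mult)
    then consider "b = 0" | "b' = 0" using mpol_no_zero_divisors[OF jet.variable_order_axioms] by blast
    then show "a \<in> I \<or> a' \<in> I"
    proof cases
      case 1 then show ?thesis using q_nzd_power[OF a(1), of n] b(2) by simp
    next
      case 2 then show ?thesis using q_nzd_power[OF a(2), of m] b'(2) by simp
    qed
  qed
  then show ?thesis using I_gen by simp
qed

section \<open>Noether coordinates\<close>

lemma variable_order_rank:
  fixes \<rho> :: "'v \<Rightarrow> nat" and lt :: "'v \<Rightarrow> 'v \<Rightarrow> bool"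
  assumes "variable_order lt" shows "variable_order (\<lambda>v w. \<rho> v < \<rho> w \<or> \<rho> v = \<rho> w \<and> lt v w)"
proof -
  interpret variable_order lt by fact
  show ?thesis
  proof
    show "\<rho> u < \<rho> w \<or> \<rho> u = \<rho> w \<and> lt u w"
      if "\<rho> u < \<rho> v \<or> \<rho> u = \<rho> v \<and> lt u v" "\<rho> v < \<rho> w \<or> \<rho> v = \<rho> w \<and> lt v w" for u v w
      using that vless_trans[of u v w] by auto
    show "(\<rho> v < \<rho> w \<or> \<rho> v = \<rho> w \<and> lt v w) \<or> (\<rho> w < \<rho> v \<or> \<rho> w = \<rho> v \<and> lt w v)" if "v \<noteq> w" for v w
      using vless_total[OF that] by linarith
  qed (use vless_irrefl in simp)
qed

text \<open>
  The edge of the leading matching of \<open>h\<close> that starts at vertex \<open>1\<close>. It represents this matching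
  in the coordinate change.
\<close>

definition zvar :: "nat \<Rightarrow> nat \<Rightarrow> jet_var" where
  "zvar r h = (h div r, 1, 2 * (r - h mod r))"

lemma zvar_leading_matching: assumes "r > 0" shows "zvar r h \<in> leading_matching 0 r h"
proof -
  have h: "h = h div r * r + h mod r" "h mod r < r" "r - h mod r = r - h mod r" using assms by auto
  show ?thesis unfolding zvar_def leading_matching_iff[OF h] using h(2) by auto
qed

lemma leading_matching_unique: "x \<in> leading_matching b r h \<Longrightarrow> x \<in> leading_matching b r h' \<Longrightarrow> h = h'"
  using leading_matching_coprime[of h h' b r] by blast

lemma zvar_inj: "r > 0 \<Longrightarrow> zvar r h = zvar r h' \<longleftrightarrow> h = h'"
  using leading_matching_unique[of "zvar r h" 0 r h h'] zvar_leading_matching[of r h] zvar_leading_matching[of r h'] by auto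

text \<open>
  All variables other than the \<open>z_h\<close> come first, followed by \<open>z_0 < z_1 < ...\<close>. At most one
  summand occurs; the empty sum gives rank \<open>0\<close> to the other variables.
\<close>

definition z_rank :: "nat \<Rightarrow> nat \<Rightarrow> jet_var \<Rightarrow> nat" where
  "z_rank r k v = (\<Sum>h\<in>{h. h < k \<and> v = zvar r h}. Suc h)"

lemma z_rank_zvar: assumes "r > 0" "h < k" shows "z_rank r k (zvar r h) = Suc h"
proof -
  have "{h'. h' < k \<and> zvar r h = zvar r h'} = {h}" using assms zvar_inj by auto
  then show ?thesis by (simp add: z_rank_def)
qed

lemma z_rank_other: "(\<And>h. h < k \<Longrightarrow> v \<noteq> zvar r h) \<Longrightarrow> z_rank r k v = 0"
  by (auto simp: z_rank_def)

definition z_less :: "nat \<Rightarrow> nat \<Rightarrow> jet_var \<Rightarrow> jet_var \<Rightarrow> bool" where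
  "z_less r k v w \<longleftrightarrow> z_rank r k v < z_rank r k w \<or> z_rank r k v = z_rank r k w \<and> jet_var_less v w"

lemma z_less_order: "variable_order (z_less r k)"
  using variable_order_rank[OF jet.variable_order_axioms, of "z_rank r k"] by (simp add: z_less_def[abs_def])

text \<open>
  The linear substitution \<open>to_z\<close> adds \<open>z_h\<close> to the other variables of the leading matching of \<open>h\<close>
  and fixes all remaining variables. As the leading matchings are disjoint, at most one summand
  occurs.
\<close>

definition z_shift :: "nat \<Rightarrow> nat \<Rightarrow> jet_var \<Rightarrow> (jet_var, 'a::field) mpol" where
  "z_shift r k v = (\<Sum>h\<in>{h. h < k \<and> v \<in> leading_matching 0 r h \<and> v \<noteq> zvar r h}. mvar (zvar r h))"

definition to_z :: "nat \<Rightarrow> nat \<Rightarrow> (jet_var, 'a::field) mpol \<Rightarrow> (jet_var, 'a) mpol" where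
  "to_z r k = meval (single 0) (\<lambda>v. mvar v + z_shift r k v)"

definition from_z :: "nat \<Rightarrow> nat \<Rightarrow> (jet_var, 'a::field) mpol \<Rightarrow> (jet_var, 'a) mpol" where
  "from_z r k = meval (single 0) (\<lambda>v. mvar v - z_shift r k v)"

interpretation const: coefficient_hom "single 0 :: 'a::field \<Rightarrow> ('v, 'a) mpol"
  by standard (auto simp: single_add mult_single)

lemma polys_UNIV: "f \<in> polys UNIV" by (simp add: polys_def)

lemma z_shift_member:
  assumes "r > 0" "h < k" "v \<in> leading_matching 0 r h"
  shows "z_shift r k v = (if v = zvar r h then 0 else mvar (zvar r h))"
proof -
  have u: "h' = h" if "v \<in> leading_matching 0 r h'" for h' by (rule leading_matching_unique[OF that assms(3)])
  show ?thesis
  proof (cases "v = zvar r h")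
    case True
    have "{h'. h' < k \<and> v \<in> leading_matching 0 r h' \<and> v \<noteq> zvar r h'} = {}" using u True by blast
    then have "z_shift r k v = 0" unfolding z_shift_def by (simp only: sum.empty)
    then show ?thesis using True by simp
  next
    case False
    have "{h'. h' < k \<and> v \<in> leading_matching 0 r h' \<and> v \<noteq> zvar r h'} = {h}"
      using u False assms(2,3) by blast
    then show ?thesis using False by (simp add: z_shift_def)
  qed
qed

lemma z_shift_other:
  assumes "\<And>h. h < k \<Longrightarrow> v \<notin> leading_matching 0 r h" shows "z_shift r k v = 0"
proof -
  have "{h. h < k \<and> v \<in> leading_matching 0 r h \<and> v \<noteq> zvar r h} = {}" using assms by blast
  then show ?thesis unfolding z_shift_def by (simp only: sum.empty)
qed

lemma z_shift_zvar: "r > 0 \<Longrightarrow> h < k \<Longrightarrow> z_shift r k (zvar r h) = 0"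
  using z_shift_member[of r h k "zvar r h"] zvar_leading_matching by simp

lemma z_shift_polys: assumes "r > 0" shows "z_shift r k v \<in> polys (zvar r ` {..<k})"
  unfolding z_shift_def by (intro polys_sum polys_mvar) auto

lemma meval_z_shift:
  assumes "r > 0" "\<And>h. h < k \<Longrightarrow> x (zvar r h) = mvar (zvar r h)"
  shows "meval (single 0) x (z_shift r k v) = (z_shift r k v :: (jet_var, 'a::field) mpol)"
  unfolding z_shift_def const.meval_sum using assms by (intro sum.cong) auto

lemma to_z_from_z: assumes "r > 0" shows "to_z r k (from_z r k f) = (f :: (jet_var, 'a::field) mpol)"
  using polys_UNIV[of f]
proof (induction rule: polys_induct)
  case (var v)
  show ?case using assms unfolding to_z_def from_z_def
    by (simp add: const.meval_diff meval_z_shift z_shift_zvar)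
qed (simp_all add: to_z_def from_z_def const.meval_add const.meval_mult)

lemma from_z_to_z: assumes "r > 0" shows "from_z r k (to_z r k f) = (f :: (jet_var, 'a::field) mpol)"
  using polys_UNIV[of f]
proof (induction rule: polys_induct)
  case (var v)
  show ?case using assms unfolding to_z_def from_z_def
    by (simp add: const.meval_add meval_z_shift z_shift_zvar)
qed (simp_all add: to_z_def from_z_def const.meval_add const.meval_mult)

lemma leading_matching_jet_vars:
  assumes "r > 0" "h < k" shows "leading_matching 0 r h \<subseteq> jet_vars (2 * r) k"
proof -
  obtain s c where "(s, c) \<in> pf_terms r k h" "term_set r s c = leading_matching 0 r h"
    using leading_term[OF assms] by metis
  then show ?thesis using term_set_jet_vars by metis
qed

lemma zvar_jet_vars: "r > 0 \<Longrightarrow> h < k \<Longrightarrow> zvar r h \<in> jet_vars (2 * r) k"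
  using leading_matching_jet_vars zvar_leading_matching by blast

lemma meval_polys:
  fixes f :: "('v, 'a::field) mpol"
  assumes "f \<in> polys V" "\<And>v. v \<in> V \<Longrightarrow> x v \<in> polys V"
  shows "meval (single 0) x f \<in> polys V"
  using assms(1) by (induction rule: polys_induct) (auto simp: const.meval_add const.meval_mult assms(2))

lemma z_shift_polys': "r > 0 \<Longrightarrow> z_shift r k v \<in> polys (jet_vars (2 * r) k)"
  using polys_mono[of "zvar r ` {..<k}" "jet_vars (2 * r) k"] z_shift_polys[of r k v] zvar_jet_vars[of r] by blast

lemma to_z_polys: "r > 0 \<Longrightarrow> f \<in> polys (jet_vars (2 * r) k) \<Longrightarrow> to_z r k f \<in> polys (jet_vars (2 * r) k)"
  unfolding to_z_def by (intro meval_polys polys_add polys_mvar z_shift_polys')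

lemma from_z_polys: "r > 0 \<Longrightarrow> f \<in> polys (jet_vars (2 * r) k) \<Longrightarrow> from_z r k f \<in> polys (jet_vars (2 * r) k)"
  unfolding from_z_def by (intro meval_polys polys_diff polys_mvar z_shift_polys')

lemma sum_single: "(\<Sum>x\<in>A. single v 1) = (single v (card A) :: 'v monomial)"
  by (induction A rule: infinite_finite_induct) (auto simp: single_add[symmetric])

context
  fixes r k :: nat assumes r: "r > 0"
begin

interpretation Z: variable_order "z_less r k" by (rule z_less_order)

text \<open>The leading variable of the image of \<open>v\<close> under the substitution.\<close>

definition z_image :: "jet_var \<Rightarrow> jet_var" where
  "z_image v = (if \<exists>h<k. v \<in> leading_matching 0 r h then zvar r (THE h. h < k \<and> v \<in> leading_matching 0 r h) else v)"

lemma z_image_member: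
  assumes "h < k" "v \<in> leading_matching 0 r h" shows "z_image v = zvar r h"
proof -
  have "(THE h. h < k \<and> v \<in> leading_matching 0 r h) = h"
    using assms leading_matching_unique[OF _ assms(2)] by (intro the_equality) blast+
  then show ?thesis using assms unfolding z_image_def by auto
qed

lemma z_image_other: "(\<And>h. h < k \<Longrightarrow> v \<notin> leading_matching 0 r h) \<Longrightarrow> z_image v = v"
  by (auto simp: z_image_def)

lemma z_less_zvar: "h < k \<Longrightarrow> (\<And>h'. h' < k \<Longrightarrow> v \<noteq> zvar r h') \<Longrightarrow> z_less r k v (zvar r h)"
  using z_rank_zvar[OF r] z_rank_other[of k v r] by (simp add: z_less_def)

lemma zvar_less: "h < k \<Longrightarrow> h' < h \<Longrightarrow> z_less r k (zvar r h') (zvar r h)"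
  using z_rank_zvar[OF r] by (simp add: z_less_def)

text \<open>The smallest variable of \<open>m\<close> decides, and it is smaller than \<open>w\<close>.\<close>

lemma prec_of_smaller_variable:
  assumes "mon_degree m = d" "v \<in> keys m" "z_less r k v w"
  shows "degrevlex_less (z_less r k) m (single w d)"
proof -
  obtain u where u: "u \<in> keys m" "\<And>u'. z_less r k u' u \<Longrightarrow> u' \<notin> keys m"
    using Z.finite_vless_minimal[OF finite_keys, of m] assms(2) by (metis empty_iff)
  have uw: "z_less r k u w"
  proof (cases "u = v")
    case False
    then have "z_less r k u v" using Z.vless_total u(2) assms(2) by blast
    then show ?thesis using Z.vless_trans assms(3) by blast
  qed (use assms in simp)
  have "u \<noteq> w" using uw Z.vless_irrefl by metis
  then have "lookup m u > lookup (single w d) u"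
    using u(1) by (simp add: in_keys_iff lookup_single when_def)
  moreover have "lookup m u' = lookup (single w d) u'" if "z_less r k u' u" for u'
  proof -
    have "u' \<noteq> w" using that uw Z.vless_trans Z.vless_irrefl by metis
    then show ?thesis using u(2)[OF that] by (simp add: in_keys_iff lookup_single when_def)
  qed
  ultimately show ?thesis using assms(1) unfolding degrevlex_less_def mon_degree_single by blast
qed

lemma variable_image_lead:
  "Z.lead (mvar v + z_shift r k v :: (jet_var, 'a::field) mpol) (single (z_image v) 1)"
proof (cases "\<exists>h<k. v \<in> leading_matching 0 r h")
  case False
  then have "z_shift r k v = (0 :: (jet_var, 'a) mpol)" "z_image v = v"
    using z_shift_other[of k v r] z_image_other[of v] by auto
  then show ?thesis using Z.lead_mvar[of v] by simp
next
  case True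
  then obtain h where h: "h < k" "v \<in> leading_matching 0 r h" by blast
  show ?thesis
  proof (cases "v = zvar r h")
    case True
    then have "z_shift r k v = (0 :: (jet_var, 'a) mpol)" "z_image v = v"
      using z_shift_member[OF r h] z_image_member[OF h] by auto
    then show ?thesis using Z.lead_mvar[of v] by simp
  next
    case False
    have "v \<noteq> zvar r h'" for h'
      using False h(2) leading_matching_unique[OF h(2), of h'] zvar_leading_matching[OF r, of h'] by auto
    then have less: "z_less r k v (zvar r h)" using z_less_zvar[OF h(1)] by blast
    have "Z.lead (mvar (zvar r h) + mvar v :: (jet_var, 'a) mpol) (single (zvar r h) 1)"
    proof (rule Z.lead_add[OF Z.lead_mvar])
      fix m assume "m \<in> keys (mvar v :: (jet_var, 'a) mpol)"
      then have "m = single v 1" by (simp add: mvar_def)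
      then show "degrevlex_less (z_less r k) m (single (zvar r h) 1)"
        using less by (intro prec_of_smaller_variable[of _ _ v]) auto
    qed
    moreover have "z_shift r k v = (mvar (zvar r h) :: (jet_var, 'a) mpol)"
      using z_shift_member[OF r h] False by simp
    ultimately show ?thesis using z_image_member[OF h] by (simp add: add.commute)
  qed
qed

lemma to_z_set_monomial_lead:
  assumes "finite T"
  shows "Z.lead (to_z r k (single (set_monomial T) 1) :: (jet_var, 'a::field) mpol) (\<Sum>v\<in>T. single (z_image v) 1)"
  unfolding prod_mvar_set[symmetric] to_z_def const.meval_prod const.meval_mvar
  by (rule Z.lead_prod[OF assms variable_image_lead])

lemma to_z_sign: "to_z r k (of_int (sign s) * f) = of_int (sign s) * (to_z r k f :: (jet_var, 'a::field) mpol)"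
  by (auto simp: sign_def to_z_def const.meval_uminus)

text \<open>
  For a variable \<open>(l, i, j)\<close> define a rational number \<open>\<eta>\<close> by \<open>2 \<eta> + i + j = 2 l r + 2 r + 1\<close>; the
  variable lies in the leading matching of \<open>\<eta>\<close> or in none. Over a perfect matching of total level
  \<open>h\<close> the numbers \<open>\<eta>\<close> add up to \<open>h r\<close>. So unless all of them equal \<open>h\<close>, which characterizes the
  leading matching, some variable has \<open>\<eta> < h\<close>. The leading variable of its image is \<open>z_\<eta>\<close> or the
  variable itself, in both cases smaller than \<open>z_h\<close>.
\<close>

lemma term_image_prec:
  assumes sc: "(s, c) \<in> pf_terms r k h" and h: "h < k" and ne: "term_set r s c \<noteq> leading_matching 0 r h"
  shows "degrevlex_less (z_less r k) (\<Sum>v\<in>term_set r s c. single (z_image v) 1) (single (zvar r h) r)"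
proof -
  let ?T = "term_set r s c"
  have s: "s \<in> pf_perms r" using sc by (simp add: pf_terms_def)
  have fin: "finite ?T" by (rule finite_term_set)
  have card: "card ?T = r" by (rule card_term_set[OF s])
  have "\<exists>v\<in>?T. z_less r k (z_image v) (zvar r h)"
  proof (rule ccontr)
    assume neg: "\<not> ?thesis"
    have "\<exists>h'. h \<le> h' \<and> v \<in> leading_matching 0 r h'" if v: "v \<in> ?T" for v
    proof (cases "\<exists>h'<k. v \<in> leading_matching 0 r h'")
      case True
      then obtain h' where h': "h' < k" "v \<in> leading_matching 0 r h'" by blast
      then have "\<not> z_less r k (zvar r h') (zvar r h)" using neg v z_image_member[OF h'] by auto
      then have "h \<le> h'" using zvar_less[OF h, of h'] by (cases "h' < h") auto
      then show ?thesis using h' by blast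
    next
      case False
      have "v \<noteq> zvar r h'" if "h' < k" for h' using False that zvar_leading_matching[OF r] by blast
      then have "z_less r k v (zvar r h)" using z_less_zvar[OF h] by blast
      then show ?thesis using neg v False z_image_other[of v] by auto
    qed
    then obtain \<eta> where \<eta>: "\<And>v. v \<in> ?T \<Longrightarrow> h \<le> \<eta> v" "\<And>v. v \<in> ?T \<Longrightarrow> v \<in> leading_matching 0 r (\<eta> v)" by metis
    have lev: "(\<Sum>v\<in>?T. fst v) = h" using pf_terms_leveled[OF sc] by (simp add: leveled_matching_def)
    have eq: "2 * \<eta> v + (case v of (l, i, j) \<Rightarrow> i + j) = 2 * r * fst v + (2 * r + 1)" if "v \<in> ?T" for v
      using \<eta>(2)[OF that] by (cases v) (auto simp: leading_matching_def mult_ac)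
    have "(\<Sum>v\<in>?T. 2 * \<eta> v + (case v of (l, i, j) \<Rightarrow> i + j)) = (\<Sum>v\<in>?T. 2 * r * fst v + (2 * r + 1))"
      using eq by (intro sum.cong) auto
    then have "2 * (\<Sum>v\<in>?T. \<eta> v) + r * (2 * r + 1) = 2 * r * h + r * (2 * r + 1)"
      unfolding sum.distrib sum_distrib_left[symmetric] sum_vertices_term_set[OF s] lev by (simp add: card)
    then have "(\<Sum>v\<in>?T. \<eta> v) = (\<Sum>v\<in>?T. h)" by (simp add: card)
    then have "\<eta> v = h" if "v \<in> ?T" for v
      using sum_mono_inv[of "\<lambda>_. h" ?T \<eta> v] \<eta>(1) that fin by auto
    then have "?T \<subseteq> leading_matching 0 r h" using \<eta>(2) by auto
    then have "?T = leading_matching 0 r h"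
      using card card_leading_matching[OF r] by (intro card_subset_eq finite_leading_matching) auto
    then show False using ne by simp
  qed
  then obtain v where v: "v \<in> ?T" "z_less r k (z_image v) (zvar r h)" by blast
  show ?thesis
  proof (rule prec_of_smaller_variable[OF _ _ v(2)])
    show "mon_degree (\<Sum>v\<in>?T. single (z_image v) 1) = r" by (simp add: mon_degree_sum card)
    define X where "X = lookup (\<Sum>u\<in>?T. single (z_image u) (1::nat)) (z_image v)"
    have "lookup (single (z_image v) 1) (z_image v) \<le> X"
      unfolding X_def lookup_sum
      using v(1) fin by (intro member_le_sum[of v ?T "\<lambda>u. lookup (single (z_image u) 1) (z_image v)"]) auto
    then have "X \<noteq> 0" unfolding lookup_single_eq by simp
    then show "z_image v \<in> keys (\<Sum>v\<in>?T. single (z_image v) (1::nat))" unfolding in_keys_iff X_def .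
  qed
qed

text \<open>
  The substitution maps the term of the leading matching to a product with leading monomial
  \<open>z_h^r\<close>, and all other terms to polynomials with smaller monomials.
\<close>

lemma to_z_pf_coeff_lead:
  assumes h: "h < k"
  shows "Z.lead (to_z r k (pf_coeff r k h) :: (jet_var, 'a::field) mpol) (single (zvar r h) r)"
proof -
  obtain s c where sc: "(s, c) \<in> pf_terms r k h" "term_set r s c = leading_matching 0 r h"
    "\<And>s' c'. (s', c') \<in> pf_terms r k h \<Longrightarrow> term_set r s' c' = leading_matching 0 r h \<Longrightarrow> s' = s \<and> c' = c"
    using leading_term[OF r h] by metis
  let ?F = "\<lambda>t. to_z r k (case t of (s, c) \<Rightarrow> of_int (sign s) * single (set_monomial (term_set r s c)) (1::'a))"
  have "to_z r k (pf_coeff r k h) = (\<Sum>t\<in>pf_terms r k h. ?F t)"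
    unfolding pf_coeff_eq to_z_def const.meval_sum by simp
  moreover have "Z.lead (\<Sum>t\<in>pf_terms r k h. ?F t) (single (zvar r h) r)"
  proof (rule Z.lead_sum_dominant[OF finite_pf_terms sc(1)])
    have "(\<Sum>v\<in>leading_matching 0 r h. single (z_image v) 1) = (\<Sum>v\<in>leading_matching 0 r h. single (zvar r h) 1)"
      using z_image_member[OF h] by (intro sum.cong) auto
    also have "\<dots> = single (zvar r h) r" unfolding sum_single card_leading_matching[OF r] ..
    finally have e: "(\<Sum>v\<in>term_set r s c. single (z_image v) 1) = single (zvar r h) r" using sc(2) by simp
    show "Z.lead (?F (s, c)) (single (zvar r h) r)"
      using Z.lead_sign[OF to_z_set_monomial_lead[OF finite_term_set, of r s c]] unfolding e
      by (simp add: to_z_sign)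
    fix t m assume t: "t \<in> pf_terms r k h" "t \<noteq> (s, c)" and m: "m \<in> keys (?F t)"
    obtain s' c' where t': "t = (s', c')" by (cases t)
    have "term_set r s' c' \<noteq> leading_matching 0 r h" using sc(3) t t' by auto
    then have "degrevlex_less (z_less r k) (\<Sum>v\<in>term_set r s' c'. single (z_image v) 1) (single (zvar r h) r)"
      using term_image_prec[OF _ h] t(1) t' by simp
    moreover have "m \<in> keys (to_z r k (single (set_monomial (term_set r s' c')) (1::'a)))"
      using m unfolding t' by (simp add: to_z_sign keys_sign)
    ultimately show "degrevlex_less (z_less r k) m (single (zvar r h) r)"
      using Z.lead_prec[OF to_z_set_monomial_lead[OF finite_term_set]] by blast
  qed
  ultimately show ?thesis by simp
qed

end

section \<open>Homogeneous polynomials\<close>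

definition homogeneous :: "nat \<Rightarrow> ('v, 'a::field) mpol \<Rightarrow> bool" where
  "homogeneous d f \<longleftrightarrow> (\<forall>m\<in>keys f. mon_degree m = d)"

lemma homogeneous_0 [simp]: "homogeneous d 0" by (simp add: homogeneous_def)
lemma homogeneous_const: "homogeneous 0 (single 0 c)" by (simp add: homogeneous_def)
lemma homogeneous_mvar: "homogeneous 1 (mvar v)" by (simp add: homogeneous_def mvar_def)
lemma homogeneous_uminus: "homogeneous d f \<Longrightarrow> homogeneous d (- f)" by (simp add: homogeneous_def in_keys_iff)
lemma homogeneous_add: "homogeneous d f \<Longrightarrow> homogeneous d g \<Longrightarrow> homogeneous d (f + g)"
  unfolding homogeneous_def using keys_add[of f g] by blast
lemma homogeneous_diff: "homogeneous d f \<Longrightarrow> homogeneous d g \<Longrightarrow> homogeneous d (f - g)"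
  using homogeneous_add[OF _ homogeneous_uminus, of d f g] by simp
lemma homogeneous_mult: "homogeneous d f \<Longrightarrow> homogeneous e g \<Longrightarrow> homogeneous (d + e) (f * g)"
  unfolding homogeneous_def using keys_mult[of f g] by (fastforce simp: mon_degree_add)
lemma homogeneous_sum: "(\<And>x. x \<in> S \<Longrightarrow> homogeneous d (f x)) \<Longrightarrow> homogeneous d (sum f S)"
  by (induction S rule: infinite_finite_induct) (auto intro: homogeneous_add)
lemma homogeneous_power: "homogeneous d f \<Longrightarrow> homogeneous (n * d) (f ^ n)"
proof (induction n)
  case 0 show ?case using homogeneous_const[of 1] by simp
next
  case (Suc n) then show ?case by (simp add: homogeneous_mult)
qed
lemma homogeneous_prod:
  assumes "finite S" "\<And>x. x \<in> S \<Longrightarrow> homogeneous (d x) (f x)"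
  shows "homogeneous (sum d S) (prod f S)"
  using assms
proof (induction S rule: finite_induct)
  case empty then show ?case using homogeneous_const[of 1] by simp
next
  case (insert x S) then show ?case by (simp add: homogeneous_mult)
qed

lemma meval_monomial_homogeneous:
  assumes "\<And>v. homogeneous 1 (x v)"
  shows "homogeneous (mon_degree m) (meval (single 0) x (single m c))"
proof -
  have "homogeneous (0 + (\<Sum>v\<in>keys m. lookup m v * 1)) (single 0 c * (\<Prod>v\<in>keys m. x v ^ lookup m v))"
    by (intro homogeneous_mult homogeneous_const homogeneous_prod homogeneous_power assms) simp
  then show ?thesis by (simp add: const.meval_single mon_eval_def mon_degree_def)
qed

lemma meval_keys_degree:
  fixes f :: "('v, 'a::field) mpol" and x :: "'v \<Rightarrow> ('w, 'a) mpol"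
  assumes "\<And>v. homogeneous 1 (x v)" "m \<in> keys (meval (single 0) x f)"
  shows "\<exists>n\<in>keys f. mon_degree n = mon_degree m"
proof -
  have "meval (single 0) x f = (\<Sum>n\<in>keys f. meval (single 0) x (single n (lookup f n)))"
    by (subst mpol_eq_sum[of f]) (simp only: const.meval_sum)
  then have "m \<in> keys (\<Sum>n\<in>keys f. meval (single 0) x (single n (lookup f n)))" using assms(2) by simp
  from in_keys_sum[OF this] obtain n where
    n: "n \<in> keys f" "m \<in> keys (meval (single 0) x (single n (lookup f n)))" by blast
  then have "mon_degree m = mon_degree n"
    using meval_monomial_homogeneous[OF assms(1), where m = n and c = "lookup f n"] by (auto simp: homogeneous_def)
  then show ?thesis using n by auto
qed

lemma homogeneous_z_shift: "homogeneous 1 (z_shift r k v)"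
  unfolding z_shift_def by (intro homogeneous_sum homogeneous_mvar)

lemma to_z_keys_degree: "m \<in> keys (to_z r k f) \<Longrightarrow> \<exists>n\<in>keys f. mon_degree n = mon_degree m"
  unfolding to_z_def
  by (rule meval_keys_degree) (auto intro!: homogeneous_add homogeneous_mvar homogeneous_z_shift simp del: One_nat_def)

lemma from_z_keys_degree: "m \<in> keys (from_z r k f) \<Longrightarrow> \<exists>n\<in>keys f. mon_degree n = mon_degree m"
  unfolding from_z_def
  by (rule meval_keys_degree) (auto intro!: homogeneous_diff homogeneous_mvar homogeneous_z_shift simp del: One_nat_def)

lemma to_z_homogeneous: "homogeneous d f \<Longrightarrow> homogeneous d (to_z r k f)"
  unfolding homogeneous_def using to_z_keys_degree by metis

lemma from_z_homogeneous: "homogeneous d f \<Longrightarrow> homogeneous d (from_z r k f)"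
  unfolding homogeneous_def using from_z_keys_degree by metis

lemma pf_coeff_homogeneous: "homogeneous r (pf_coeff r k h :: (jet_var, 'a::field) mpol)"
  unfolding pf_coeff_eq
proof (intro homogeneous_sum, clarify)
  fix s c assume "(s, c) \<in> pf_terms r k h"
  then have "card (term_set r s c) = r" using card_term_set by (auto simp: pf_terms_def)
  then show "homogeneous r (of_int (sign s) * single (set_monomial (term_set r s c)) (1::'a))"
    by (simp add: homogeneous_def keys_sign mon_degree_set_monomial)
qed

section \<open>Regular sequences under automorphisms\<close>

text \<open>The preimage of an ideal under a ring homomorphism is an ideal.\<close>

lemma genideal_automorphism:
  assumes S: "\<And>f g. S (f + g) = S f + S g" "\<And>f g. S (f * g) = S f * S g" "S 0 = 0"
    "\<And>f. f \<in> polys V \<Longrightarrow> S f \<in> polys V"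
    and X: "X \<subseteq> polys V" and f: "f \<in> genideal (polynomial_ring V) X"
  shows "S f \<in> genideal (polynomial_ring V) (S ` X)"
proof -
  interpret A: cring "polynomial_ring V" by (rule polynomial_ring_cring)
  have SX: "S ` X \<subseteq> carrier (polynomial_ring V)" using S X by auto
  have J: "ideal (genideal (polynomial_ring V) (S ` X)) (polynomial_ring V)" by (rule A.genideal_ideal[OF SX])
  note JD = ideal_polynomial_ringD[OF J]
  have "ideal {f \<in> polys V. S f \<in> genideal (polynomial_ring V) (S ` X)} (polynomial_ring V)"
    by (rule ideal_polynomial_ringI) (auto simp: S JD(2-4))
  moreover have "X \<subseteq> {f \<in> polys V. S f \<in> genideal (polynomial_ring V) (S ` X)}"
    using X A.genideal_self[OF SX] by auto
  ultimately have "genideal (polynomial_ring V) X \<subseteq> {f \<in> polys V. S f \<in> genideal (polynomial_ring V) (S ` X)}"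
    by (rule A.genideal_minimal)
  then show ?thesis using f by blast
qed

lemma regular_sequence_automorphism:
  assumes S: "\<And>f g. S (f + g) = S f + S g" "\<And>f g. S (f * g) = S f * S g" "S 0 = 0" "S 1 = 1"
      "\<And>f. f \<in> polys V \<Longrightarrow> S f \<in> polys V"
    and S': "\<And>f g. S' (f + g) = S' f + S' g" "\<And>f g. S' (f * g) = S' f * S' g" "S' 0 = 0"
      "\<And>f. f \<in> polys V \<Longrightarrow> S' f \<in> polys V"
    and inv: "\<And>f. S' (S f) = f"
    and fs: "set fs \<subseteq> polys V" and reg: "regular_sequence (polynomial_ring V) (map S fs)"
  shows "regular_sequence (polynomial_ring V) fs"
proof -
  interpret A: cring "polynomial_ring V" by (rule polynomial_ring_cring)
  have there: "S f \<in> genideal (polynomial_ring V) (S ` X)" if "X \<subseteq> polys V" "f \<in> genideal (polynomial_ring V) X" for f X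
    by (rule genideal_automorphism[OF S(1-3,5) that])
  have backward: "f \<in> genideal (polynomial_ring V) X" if "X \<subseteq> polys V" "S f \<in> genideal (polynomial_ring V) (S ` X)" for f X
  proof -
    have SX: "S ` X \<subseteq> polys V" using that(1) S(5) by auto
    have "S' ` S ` X = X" by (simp add: image_image inv)
    then show ?thesis using genideal_automorphism[of S', OF S' SX that(2)] by (simp add: inv)
  qed
  show ?thesis
    unfolding regular_sequence_def
  proof (intro conjI allI impI ballI)
    show "set fs \<subseteq> carrier (polynomial_ring V)" using fs by simp
    show "genideal (polynomial_ring V) (set fs) \<noteq> carrier (polynomial_ring V)"
    proof
      assume "genideal (polynomial_ring V) (set fs) = carrier (polynomial_ring V)"
      then have "1 \<in> genideal (polynomial_ring V) (set fs)" by simp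
      then have "1 \<in> genideal (polynomial_ring V) (set (map S fs))" using there[OF fs] S(4) by fastforce
      moreover have "ideal (genideal (polynomial_ring V) (set (map S fs))) (polynomial_ring V)"
        using fs S(5) by (intro A.genideal_ideal) auto
      ultimately have "genideal (polynomial_ring V) (set (map S fs)) = carrier (polynomial_ring V)"
        using ideal.one_imp_carrier by fastforce
      then show False using reg unfolding regular_sequence_def by blast
    qed
    fix i a assume i: "i < length fs" and a: "a \<in> carrier (polynomial_ring V)"
      and m: "fs ! i \<otimes>\<^bsub>polynomial_ring V\<^esub> a \<in> genideal (polynomial_ring V) (set (take i fs))"
    have X: "set (take i fs) \<subseteq> polys V" using fs set_take_subset[of i fs] by (rule subset_trans[rotated])
    have "S (fs ! i * a) \<in> genideal (polynomial_ring V) (S ` set (take i fs))" using there[OF X] m by simp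
    moreover have "\<forall>i<length (map S fs). \<forall>a\<in>polys V. map S fs ! i * a \<in> genideal (polynomial_ring V) (set (take i (map S fs))) \<longrightarrow>
        a \<in> genideal (polynomial_ring V) (set (take i (map S fs)))"
      using reg unfolding regular_sequence_def by simp
    from this[rule_format, of i "S a"]
    have "S (fs ! i) * S a \<in> genideal (polynomial_ring V) (S ` set (take i fs)) \<Longrightarrow> S a \<in> genideal (polynomial_ring V) (S ` set (take i fs))"
      using i a S(5) by (simp add: take_map)
    ultimately have "S a \<in> genideal (polynomial_ring V) (S ` set (take i fs))" by (simp add: S(2))
    then show "a \<in> genideal (polynomial_ring V) (set (take i fs))" by (rule backward[OF X])
  qed
qed

section \<open>Vector space dimension in a quotient of the polynomial ring\<close>

text \<open>The constants are the polynomials in no variables.\<close>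

lemma constants_subfield: "subfield (range (single 0)) (polynomial_ring V :: ('v, 'a::field) mpol ring)"
proof -
  interpret A: cring "polynomial_ring V :: ('v, 'a) mpol ring" by (rule polynomial_ring_cring)
  have "polys {} = range (single 0 :: 'a \<Rightarrow> ('v, 'a) mpol)"
  proof
    show "polys {} \<subseteq> range (single 0 :: 'a \<Rightarrow> ('v, 'a) mpol)"
    proof
      fix f :: "('v, 'a) mpol" assume "f \<in> polys {}"
      then show "f \<in> range (single 0)"
        by (induction rule: polys_induct) (auto simp: single_add[symmetric] mult_single)
    qed
  qed auto
  then have eq: "polynomial_ring V\<lparr>carrier := range (single 0)\<rparr> = (polynomial_ring {} :: ('v, 'a) mpol ring)"
    by (simp add: polynomial_ring_def polys_def)
  interpret K: cring "polynomial_ring {} :: ('v, 'a) mpol ring" by (rule polynomial_ring_cring)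
  have K: "carrier (polynomial_ring {} :: ('v, 'a) mpol ring) = range (single 0)"
    using \<open>polys {} = _\<close> by simp
  have "field (polynomial_ring {} :: ('v, 'a) mpol ring)"
  proof (rule K.cring_fieldI)
    show "Units (polynomial_ring {} :: ('v, 'a) mpol ring) = carrier (polynomial_ring {}) - {\<zero>\<^bsub>polynomial_ring {}\<^esub>}"
    proof
      show "Units (polynomial_ring {} :: ('v, 'a) mpol ring) \<subseteq> carrier (polynomial_ring {}) - {\<zero>\<^bsub>polynomial_ring {}\<^esub>}"
        by (auto simp: Units_def)
      show "carrier (polynomial_ring {}) - {\<zero>\<^bsub>polynomial_ring {}\<^esub>} \<subseteq> Units (polynomial_ring {} :: ('v, 'a) mpol ring)"
      proof
        fix f :: "('v, 'a) mpol" assume "f \<in> carrier (polynomial_ring {}) - {\<zero>\<^bsub>polynomial_ring {}\<^esub>}"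
        then have "f \<in> range (single 0)" "f \<noteq> 0" using K by auto
        then obtain c where "f = single 0 c" by blast
        moreover then have "c \<noteq> 0" using \<open>f \<noteq> 0\<close> by auto
        ultimately have c: "f = single 0 c" "c \<noteq> 0" by auto
        have "single 0 (inverse c) * f = 1" "f * single 0 (inverse c) = 1" using c by (simp_all add: mult_single)
        then show "f \<in> Units (polynomial_ring {})" using c
          unfolding Units_def by (auto intro!: bexI[of _ "single 0 (inverse c)"])
      qed
    qed
  qed
  then show ?thesis by (intro A.subfield_iff(1)) (auto simp: eq)
qed

locale mpol_quotient = cring_ideal I "polynomial_ring V :: ('v, 'a::field) mpol ring" for I and V :: "'v set" +
  assumes proper: "1 \<notin> I"
begin

abbreviation "quot \<equiv> polynomial_ring V Quot I"
abbreviation "base_field \<equiv> proj ` range (single 0)"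

lemma base_subfield: "subfield base_field quot"
proof -
  have "\<one>\<^bsub>quot\<^esub> \<noteq> \<zero>\<^bsub>quot\<^esub>"
  proof -
    have "proj 1 = \<one>\<^bsub>quot\<^esub>" using P.hom_one by simp
    then show ?thesis using proj_eq_zero_iff[of 1] proper by simp
  qed
  then show ?thesis by (rule ring_hom_ring.img_is_subfield(2)[OF I.rcos_ring_hom_ring constants_subfield])
qed

lemma ID: "f \<in> I \<Longrightarrow> g \<in> I \<Longrightarrow> f - g \<in> I" "f \<in> I \<Longrightarrow> c \<in> polys V \<Longrightarrow> c * f \<in> I" "0 \<in> I"
  using ideal_polynomial_ringD[OF I.is_ideal] by auto

lemma proj_eq: "f \<in> polys V \<Longrightarrow> g \<in> polys V \<Longrightarrow> proj f = proj g \<longleftrightarrow> f - g \<in> I"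
  using proj_eq_iff[of f g] polynomial_ring_minus[of f V g] by simp

lemma Span_eq:
  fixes b :: "'i \<Rightarrow> ('v, 'a) mpol"
  assumes "\<And>u. u \<in> set us \<Longrightarrow> b u \<in> polys V" "distinct us"
  shows "Q.Span base_field (map (\<lambda>u. proj (b u)) us) = {proj (\<Sum>u\<in>set us. single 0 (c u) * b u) | c. True}"
  using assms
proof (induction us)
  case Nil
  have "proj 0 = \<zero>\<^bsub>quot\<^esub>" using P.hom_zero by simp
  then show ?case by simp
next
  case (Cons u us)
  have b: "b u \<in> polys V" "\<And>w. w \<in> set us \<Longrightarrow> b w \<in> polys V" using Cons.prems by auto
  have IH: "Q.Span base_field (map (\<lambda>u. proj (b u)) us) = {proj (\<Sum>u\<in>set us. single 0 (c u) * b u) | c. True}"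
    using Cons by auto
  have s: "(\<Sum>w\<in>set us. single 0 (c w) * b w) \<in> polys V" for c using b by (intro polys_sum polys_mult) auto
  have step: "proj (single 0 a) \<otimes>\<^bsub>quot\<^esub> proj (b u) \<oplus>\<^bsub>quot\<^esub> proj (\<Sum>w\<in>set us. single 0 (c w) * b w)
      = proj (single 0 a * b u + (\<Sum>w\<in>set us. single 0 (c w) * b w))" for a c
  proof -
    have "proj (single 0 a) \<otimes>\<^bsub>quot\<^esub> proj (b u) = proj (single 0 a * b u)"
      using P.hom_mult[of "single 0 a" "b u"] b by simp
    moreover have "proj (single 0 a * b u) \<oplus>\<^bsub>quot\<^esub> proj (\<Sum>w\<in>set us. single 0 (c w) * b w)
      = proj (single 0 a * b u + (\<Sum>w\<in>set us. single 0 (c w) * b w))"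
      using P.hom_add[of "single 0 a * b u" "\<Sum>w\<in>set us. single 0 (c w) * b w"] b s[of c]
      by (simp add: polys_mult)
    ultimately show ?thesis by simp
  qed
  have "Q.Span base_field (map (\<lambda>u. proj (b u)) (u # us)) =
      {proj (single 0 a) \<otimes>\<^bsub>quot\<^esub> proj (b u) \<oplus>\<^bsub>quot\<^esub> proj (\<Sum>w\<in>set us. single 0 (c w) * b w) | a c. True}"
  proof (rule Set.set_eqI)
    fix x
    have "x \<in> Q.Span base_field (map (\<lambda>u. proj (b u)) (u # us)) \<longleftrightarrow>
        x \<in> Q.line_extension base_field (proj (b u)) (Q.Span base_field (map (\<lambda>u. proj (b u)) us))" by simp
    also have "\<dots> \<longleftrightarrow> (\<exists>k\<in>base_field. \<exists>v\<in>{proj (\<Sum>u\<in>set us. single 0 (c u) * b u) | c. True}.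
        x = k \<otimes>\<^bsub>quot\<^esub> proj (b u) \<oplus>\<^bsub>quot\<^esub> v)"
      unfolding IH by (rule Q.line_extension_mem_iff)
    also have "\<dots> \<longleftrightarrow> x \<in> {proj (single 0 a) \<otimes>\<^bsub>quot\<^esub> proj (b u) \<oplus>\<^bsub>quot\<^esub>
        proj (\<Sum>w\<in>set us. single 0 (c w) * b w) | a c. True}" by blast
    finally show "x \<in> Q.Span base_field (map (\<lambda>u. proj (b u)) (u # us)) \<longleftrightarrow> x \<in> {proj (single 0 a) \<otimes>\<^bsub>quot\<^esub> proj (b u) \<oplus>\<^bsub>quot\<^esub>
        proj (\<Sum>w\<in>set us. single 0 (c w) * b w) | a c. True}" .
  qed
  also have "\<dots> = {proj (\<Sum>w\<in>set (u # us). single 0 (c w) * b w) | c. True}" (is "?L = ?R")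
  proof
    show "?L \<subseteq> ?R"
    proof clarify
      fix a :: 'a and c :: "'i \<Rightarrow> 'a"
      let ?c = "c(u := a)"
      have "(\<Sum>w\<in>set us. single 0 (?c w) * b w) = (\<Sum>w\<in>set us. single 0 (c w) * b w)"
        using Cons.prems by (intro sum.cong) auto
      then have e: "(\<Sum>w\<in>set (u # us). single 0 (?c w) * b w) = single 0 a * b u + (\<Sum>w\<in>set us. single 0 (c w) * b w)"
        using Cons.prems by simp
      then show "\<exists>c'. proj (single 0 a) \<otimes>\<^bsub>quot\<^esub> proj (b u) \<oplus>\<^bsub>quot\<^esub> proj (\<Sum>w\<in>set us. single 0 (c w) * b w)
          = proj (\<Sum>w\<in>set (u # us). single 0 (c' w) * b w) \<and> True"
        unfolding step by (intro exI[of _ ?c] conjI TrueI arg_cong[where f = proj] e[symmetric])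
    qed
    show "?R \<subseteq> ?L" unfolding step using Cons.prems by auto
  qed
  finally show ?case .
qed

lemma quotient_dimension:
  assumes U: "finite U" "\<And>u. u \<in> U \<Longrightarrow> b u \<in> polys V" and indep: "lin_indep_mod I U b"
    and E: "E = {proj (\<Sum>u\<in>U. single 0 (c u) * b u) | c. True}"
  shows "Q.dim base_field E = card U"
proof -
  obtain us where us: "set us = U" "distinct us" using finite_distinct_list[OF U(1)] by blast
  have "Q.independent base_field (map (\<lambda>u. proj (b u)) ws)" if "distinct ws" "set ws \<subseteq> U" for ws
    using that
  proof (induction ws)
    case (Cons w ws)
    have bw: "b w \<in> polys V" "\<And>u. u \<in> set ws \<Longrightarrow> b u \<in> polys V" using Cons.prems U by auto
    have "proj (b w) \<notin> Q.Span base_field (map (\<lambda>u. proj (b u)) ws)"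
    proof
      assume "proj (b w) \<in> Q.Span base_field (map (\<lambda>u. proj (b u)) ws)"
      then obtain c where c: "proj (b w) = proj (\<Sum>u\<in>set ws. single 0 (c u) * b u)"
        using Span_eq[of ws b] bw Cons.prems by auto
      have "(\<Sum>u\<in>set ws. single 0 (c u) * b u) \<in> polys V" using bw by (intro polys_sum polys_mult) auto
      then have cI: "b w - (\<Sum>u\<in>set ws. single 0 (c u) * b u) \<in> I" using c proj_eq bw by blast
      let ?c = "\<lambda>u. if u = w then 1 else if u \<in> set ws then - c u else 0"
      have "(\<Sum>u\<in>U. single 0 (?c u) * b u) = (\<Sum>u\<in>set (w # ws). single 0 (?c u) * b u)"
        using Cons.prems U(1) by (intro sum.mono_neutral_right) auto
      also have "\<dots> = b w + (\<Sum>u\<in>set ws. single 0 (?c u) * b u)" using Cons.prems by simp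
      also have "(\<Sum>u\<in>set ws. single 0 (?c u) * b u) = (\<Sum>u\<in>set ws. - (single 0 (c u) * b u))"
        using Cons.prems by (intro sum.cong) (auto simp: single_uminus)
      finally have "(\<Sum>u\<in>U. single 0 (?c u) * b u) \<in> I" using cI by (simp add: sum_negf)
      then have "\<forall>u\<in>U. ?c u = 0" using indep[unfolded lin_indep_mod_def, THEN spec, of ?c] by blast
      then show False using Cons.prems by auto
    qed
    moreover have "proj (b w) \<in> carrier quot" using bw carrier_Quot by auto
    ultimately show ?case using Cons by (auto intro: Q.li_Cons)
  qed simp
  then have "Q.independent base_field (map (\<lambda>u. proj (b u)) us)" using us by simp
  then have "Q.dimension (length us) base_field (Q.Span base_field (map (\<lambda>u. proj (b u)) us))"
    using Q.dimension_independent by fastforce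
  moreover have "Q.Span base_field (map (\<lambda>u. proj (b u)) us) = E"
    using Span_eq[of us b] U us E by simp
  ultimately have "Q.dimension (card U) base_field E" using us distinct_card by metis
  then show ?thesis using Q.dimI[OF base_subfield] by (simp add: over_def)
qed

end

section \<open>Counting monomials\<close>

definition restr :: "'v monomial \<Rightarrow> 'v set \<Rightarrow> 'v monomial" where
  "restr m W = (\<Sum>v\<in>keys m \<inter> W. single v (lookup m v))"

lemma lookup_restr: "lookup (restr m W) v = (if v \<in> W then lookup m v else 0)"
  unfolding restr_def by (auto simp: lookup_sum lookup_single when_def in_keys_iff)

lemma keys_restr: "keys (restr m W) = keys m \<inter> W"
  by (auto simp: in_keys_iff lookup_restr split: if_splits)

lemma lookup_sum_single: "finite W \<Longrightarrow> lookup (\<Sum>v\<in>W. single v (f v)) w = (if w \<in> W then f w else 0 :: nat)"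
  by (simp add: lookup_sum lookup_single when_def)

definition bounded_monomials :: "'v set \<Rightarrow> nat \<Rightarrow> 'v monomial set" where
  "bounded_monomials Z r = {m. keys m \<subseteq> Z \<and> (\<forall>z\<in>Z. lookup m z < r)}"

definition monomials_of_degree :: "'v set \<Rightarrow> nat \<Rightarrow> 'v monomial set" where
  "monomials_of_degree Y e = {m. keys m \<subseteq> Y \<and> mon_degree m = e}"

lemma bij_bounded_monomials:
  assumes "finite Z"
  shows "bij_betw (\<lambda>m. restrict (lookup m) Z) (bounded_monomials Z r) (PiE Z (\<lambda>_. {..<r}))"
proof (rule bij_betw_byWitness[where f' = "\<lambda>f. \<Sum>z\<in>Z. single z (f z)"])
  show "\<forall>m\<in>bounded_monomials Z r. (\<Sum>z\<in>Z. single z (restrict (lookup m) Z z)) = m"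
  proof
    fix m assume m: "m \<in> bounded_monomials Z r"
    show "(\<Sum>z\<in>Z. single z (restrict (lookup m) Z z)) = m"
    proof (rule poly_mapping_eqI)
      fix v
      have "v \<notin> Z \<Longrightarrow> v \<notin> keys m" using m by (auto simp: bounded_monomials_def)
      then show "lookup (\<Sum>z\<in>Z. single z (restrict (lookup m) Z z)) v = lookup m v"
        unfolding lookup_sum_single[OF assms] by (auto simp: in_keys_iff)
    qed
  qed
  show "\<forall>f\<in>PiE Z (\<lambda>_. {..<r}). restrict (lookup (\<Sum>z\<in>Z. single z (f z))) Z = f"
  proof (intro ballI ext)
    fix f z assume f: "f \<in> PiE Z (\<lambda>_. {..<r})"
    show "restrict (lookup (\<Sum>z\<in>Z. single z (f z))) Z z = f z"
      using PiE_arb[OF f, of z] by (cases "z \<in> Z") (simp_all add: lookup_sum_single[OF assms])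
  qed
  show "(\<lambda>m. restrict (lookup m) Z) ` bounded_monomials Z r \<subseteq> PiE Z (\<lambda>_. {..<r})"
    by (auto simp: bounded_monomials_def)
  show "(\<lambda>f. \<Sum>z\<in>Z. single z (f z)) ` PiE Z (\<lambda>_. {..<r}) \<subseteq> bounded_monomials Z r"
    using assms by (auto simp: bounded_monomials_def lookup_sum_single in_keys_iff PiE_iff split: if_splits)
qed

lemma finite_bounded_monomials: "finite Z \<Longrightarrow> finite (bounded_monomials Z r)"
  using bij_betw_finite[OF bij_bounded_monomials] by (auto intro: finite_PiE)

lemma card_bounded_monomials: "finite Z \<Longrightarrow> card (bounded_monomials Z r) = r ^ card Z"
  by (simp add: bij_betw_same_card[OF bij_bounded_monomials] card_PiE)

text \<open>Stars and bars.\<close>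

lemma card_monomials_of_degree:
  assumes "finite Y"
  shows "card (monomials_of_degree Y e) = (e + card Y - 1) choose e"
proof -
  obtain ys where ys: "set ys = Y" "distinct ys" using finite_distinct_list[OF assms] by blast
  have len: "length ys = card Y" using ys distinct_card by metis
  have deg: "mon_degree m = sum_list (map (lookup m) ys)" if "keys m \<subseteq> Y" for m
    using mon_degree_superset[OF assms that] ys by (simp add: sum_list_distinct_conv_sum_set)
  have "bij_betw (\<lambda>m. map (lookup m) ys) (monomials_of_degree Y e) {l. length l = card Y \<and> sum_list l = e}"
  proof (rule bij_betw_imageI)
    show "inj_on (\<lambda>m. map (lookup m) ys) (monomials_of_degree Y e)"
    proof (rule inj_onI)
      fix a b assume ab: "a \<in> monomials_of_degree Y e" "b \<in> monomials_of_degree Y e" "map (lookup a) ys = map (lookup b) ys"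
      show "a = b"
      proof (rule poly_mapping_eqI)
        fix v show "lookup a v = lookup b v"
        proof (cases "v \<in> Y")
          case True then show ?thesis using ab(3) ys by auto
        next
          case False
          then have "v \<notin> keys a" "v \<notin> keys b" using ab by (auto simp: monomials_of_degree_def)
          then show ?thesis by (simp add: in_keys_iff)
        qed
      qed
    qed
    show "(\<lambda>m. map (lookup m) ys) ` monomials_of_degree Y e = {l. length l = card Y \<and> sum_list l = e}"
    proof
      show "(\<lambda>m. map (lookup m) ys) ` monomials_of_degree Y e \<subseteq> {l. length l = card Y \<and> sum_list l = e}"
        using deg len by (auto simp: monomials_of_degree_def)
      show "{l. length l = card Y \<and> sum_list l = e} \<subseteq> (\<lambda>m. map (lookup m) ys) ` monomials_of_degree Y e"
      proof clarify
        fix l :: "nat list" assume l: "length l = card Y" "e = sum_list l"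
        define f where "f v = (case map_of (zip ys l) v of None \<Rightarrow> 0 | Some n \<Rightarrow> n)" for v
        have f: "f (ys ! i) = l ! i" if "i < length ys" for i
          using map_of_zip_nth[of ys l i] l len ys that by (simp add: f_def)
        let ?m = "\<Sum>v\<in>Y. single v (f v)"
        have kY: "keys ?m \<subseteq> Y" using assms by (auto simp: in_keys_iff lookup_sum_single split: if_splits)
        have "map (lookup ?m) ys = map f ys" using ys assms by (auto simp: lookup_sum_single)
        also have "\<dots> = l" using f l len by (intro nth_equalityI) auto
        finally have ml: "map (lookup ?m) ys = l" .
        then have "?m \<in> monomials_of_degree Y e" using deg[OF kY] kY l by (simp add: monomials_of_degree_def)
        then show "l \<in> (\<lambda>m. map (lookup m) ys) ` monomials_of_degree Y (sum_list l)" using ml l by force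
      qed
    qed
  qed
  from bij_betw_same_card[OF this] show ?thesis by (simp add: card_length_sum_list)
qed

lemma finite_monomials_of_degree: "finite Y \<Longrightarrow> finite (monomials_of_degree Y e)"
  by (rule finite_subset[OF _ monomials_degree_le(1)[of Y e]]) (auto simp: monomials_of_degree_def)

text \<open>The binomial coefficient \<open>(e + n) choose n\<close> as a polynomial in \<open>e\<close>.\<close>

definition count_poly :: "nat \<Rightarrow> rat poly" where
  "count_poly n = Polynomial.smult (1 / fact n) (\<Prod>i<n. [:of_nat (i + 1), 1:])"

lemma poly_count_poly: "poly (count_poly n) (of_nat e) = of_nat ((e + n) choose n)"
proof -
  have "of_nat ((e + n) choose n) = (of_nat (e + n) gchoose n :: rat)" by (rule binomial_gbinomial)
  also have "\<dots> = pochhammer (of_nat e + 1) n / fact n" by (simp add: gbinomial_pochhammer')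
  also have "pochhammer (of_nat e + 1) n = (\<Prod>i<n. of_nat e + 1 + of_nat i :: rat)"
    by (simp add: pochhammer_prod atLeast0LessThan)
  finally show ?thesis by (simp add: count_poly_def poly_prod add_ac)
qed

lemma degree_count_poly: "degree (count_poly n) = n" "lead_coeff (count_poly n) = 1 / fact n"
proof -
  have "degree (\<Prod>i<n. [:of_nat (i + 1), 1:] :: rat poly) = (\<Sum>i<n. degree [:of_nat (i + 1), 1 :: rat:])"
    by (rule degree_prod_eq_sum_degree) auto
  then have d: "degree (\<Prod>i<n. [:of_nat (i + 1), 1:] :: rat poly) = n" by simp
  then show "degree (count_poly n) = n" by (simp add: count_poly_def)
  have "lead_coeff (\<Prod>i<n. [:of_nat (i + 1), 1:] :: rat poly) = 1" by (simp add: lead_coeff_prod)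
  then show "lead_coeff (count_poly n) = 1 / fact n" by (simp add: count_poly_def)
qed

text \<open>This makes the Hilbert polynomial unique.\<close>

lemma poly_eqI_eventually:
  fixes P Q :: "rat poly"
  assumes "\<And>d. d \<ge> N \<Longrightarrow> poly P (of_nat d) = poly Q (of_nat d)"
  shows "P = Q"
proof (rule ccontr)
  assume "P \<noteq> Q"
  then have fin: "finite {x. poly (P - Q) x = 0}" by (intro poly_roots_finite) simp
  have "of_nat ` {N..} \<subseteq> {x. poly (P - Q) x = 0}" using assms by auto
  then have "finite (of_nat ` {N..} :: rat set)" using fin finite_subset by blast
  then have "finite {N..}" by (rule finite_imageD) (auto simp: inj_on_def)
  then show False using infinite_Ici by blast
qed

section \<open>A basis of the Pfaffian jet ring and its Hilbert polynomial\<close>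

lemma mdvd_single: "mdvd (single v n) m \<longleftrightarrow> n \<le> lookup m v"
  by (auto simp: mdvd_def lookup_single when_def)

text \<open>
  \<open>Zs\<close> are the variables \<open>z_h\<close>, \<open>Ys\<close> the others, and their number \<open>D\<close> will be the dimension of the
  quotient.
\<close>

locale pfaffian_jets =
  fixes r k :: nat
  assumes r: "r > 0" and k: "k > 0"
begin

abbreviation "V \<equiv> jet_vars (2 * r) k"
abbreviation "Zs \<equiv> zvar r ` {..<k}"
abbreviation "Ys \<equiv> V - Zs"

definition pf_ideal :: "(jet_var, 'a::field) mpol set" where
  "pf_ideal = genideal (polynomial_ring V) (pf_coeff r k ` {..<k})"

text \<open>
  In the new coordinates the leading monomials of the generators are the powers \<open>z_h^r\<close>. These are
  the monomials divisible by none of them.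
\<close>

definition std :: "jet_var monomial \<Rightarrow> bool" where
  "std m \<longleftrightarrow> keys m \<subseteq> V \<and> (\<forall>z\<in>Zs. lookup m z < r)"

abbreviation D :: nat where "D \<equiv> card Ys"

lemma finite_sets: "finite V" "finite Zs" "finite Ys"
  by (simp_all add: finite_jet_vars)

lemma Zs_subset: "Zs \<subseteq> V" using zvar_jet_vars[OF r] by auto

lemma card_Zs: "card Zs = k"
  using zvar_inj[OF r] by (subst card_image) (auto simp: inj_on_def)

lemma card_V: "card V = D + k"
  using card_Diff_subset[OF finite_sets(2) Zs_subset] card_mono[OF finite_sets(1) Zs_subset] card_Zs by simp

lemma pf_ideal_ideal: "ideal (pf_ideal :: (jet_var, 'a::field) mpol set) (polynomial_ring V)"
proof -
  interpret A: cring "polynomial_ring V :: (jet_var, 'a) mpol ring" by (rule polynomial_ring_cring)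
  show ?thesis unfolding pf_ideal_def using pf_coeff_polys by (intro A.genideal_ideal) auto
qed

lemmas pf_idealD = ideal_polynomial_ringD[OF pf_ideal_ideal]

lemma z_coprime_leads:
  "coprime_leads (z_less r k) V (\<lambda>h. to_z r k (pf_coeff r k h) :: (jet_var, 'a::field) mpol) (\<lambda>h. single (zvar r h) r) k"
proof -
  interpret Z: variable_order "z_less r k" by (rule z_less_order)
  show ?thesis
  proof
    show "to_z r k (pf_coeff r k h) \<in> polys V" for h by (rule to_z_polys[OF r pf_coeff_polys])
    show "keys (single (zvar r i) r) \<inter> keys (single (zvar r j) r) = {}" if "i < j" for i j
      using zvar_inj[OF r] that by auto
  qed (use finite_jet_vars to_z_pf_coeff_lead[OF r] in auto)
qed

abbreviation z_ideal :: "(jet_var, 'a::field) mpol set" where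
  "z_ideal \<equiv> coprime_leads.J V (\<lambda>h. to_z r k (pf_coeff r k h)) k"

lemma z_std:
  assumes "keys m \<subseteq> V" shows "coprime_leads.std (\<lambda>h. single (zvar r h) r) k m \<longleftrightarrow> std m"
  using assms by (auto simp: coprime_leads.std_def[OF z_coprime_leads] std_def mdvd_single not_le)

lemma to_z_hom: "to_z r k (f + g) = to_z r k f + to_z r k g" "to_z r k (f * g) = to_z r k f * to_z r k g"
    "to_z r k 0 = 0" "to_z r k 1 = 1" "to_z r k (f - g) = to_z r k f - to_z r k g" "to_z r k (single 0 c) = single 0 c"
    "to_z r k (sum F S) = (\<Sum>x\<in>S. to_z r k (F x))"
  by (simp_all add: to_z_def const.meval_add const.meval_mult const.meval_diff const.meval_sum)

lemma from_z_hom: "from_z r k (f + g) = from_z r k f + from_z r k g" "from_z r k (f * g) = from_z r k f * from_z r k g"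
    "from_z r k 0 = 0" "from_z r k 1 = 1" "from_z r k (f - g) = from_z r k f - from_z r k g" "from_z r k (single 0 c) = single 0 c"
    "from_z r k (sum F S) = (\<Sum>x\<in>S. from_z r k (F x))"
  by (simp_all add: from_z_def const.meval_add const.meval_mult const.meval_diff const.meval_sum)

lemma z_ideal_eq:
  "(z_ideal :: (jet_var, 'a::field) mpol set) = genideal (polynomial_ring V) (to_z r k ` pf_coeff r k ` {..<k})"
  using coprime_leads.J_eq_genideal[OF z_coprime_leads, of k] by (simp add: image_image)

lemma pf_gens_polys: "pf_coeff r k ` {..<k} \<subseteq> polys V"
  using pf_coeff_polys by auto

lemma to_z_pf_ideal: "f \<in> pf_ideal \<Longrightarrow> to_z r k f \<in> z_ideal"
  unfolding pf_ideal_def z_ideal_eq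
  by (rule genideal_automorphism[OF to_z_hom(1,2,3) to_z_polys[OF r] pf_gens_polys])

lemma from_z_pf_ideal: "f \<in> z_ideal \<Longrightarrow> from_z r k f \<in> pf_ideal"
proof -
  assume f: "f \<in> z_ideal"
  have "from_z r k f \<in> genideal (polynomial_ring V) (from_z r k ` to_z r k ` pf_coeff r k ` {..<k})"
    using f pf_gens_polys to_z_polys[OF r] unfolding z_ideal_eq
    by (intro genideal_automorphism[OF from_z_hom(1,2,3) from_z_polys[OF r]]) auto
  then show ?thesis unfolding pf_ideal_def by (simp add: image_image from_z_to_z[OF r])
qed

text \<open>
  Division in the new coordinates, transported back. The substitution is linear and the generators
  are homogeneous, so degrees are preserved.
\<close>

lemma standard_form:
  fixes f :: "(jet_var, 'a::field) mpol"
  assumes "f \<in> polys V"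
  obtains g where "g \<in> polys V" "f - from_z r k g \<in> pf_ideal"
    "\<And>m. m \<in> keys g \<Longrightarrow> std m" "\<And>m. m \<in> keys g \<Longrightarrow> \<exists>n\<in>keys f. mon_degree m = mon_degree n"
proof -
  interpret Z: coprime_leads "z_less r k" V "\<lambda>h. to_z r k (pf_coeff r k h) :: (jet_var, 'a) mpol" "\<lambda>h. single (zvar r h) r" k
    by (rule z_coprime_leads)
  have Z_homog: "Z.homog k"
    unfolding Z.homog_def mon_degree_single
    using to_z_homogeneous[OF pf_coeff_homogeneous, unfolded homogeneous_def] by blast
  obtain g where g: "g \<in> polys V" "to_z r k f - g \<in> z_ideal" "\<And>m. m \<in> keys g \<Longrightarrow> Z.std k m"
    "\<And>m. m \<in> keys g \<Longrightarrow> \<exists>n\<in>keys (to_z r k f). (m = n \<or> degrevlex_less (z_less r k) m n) \<and> (Z.homog k \<longrightarrow> mon_degree m = mon_degree n)"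
    using Z.division[OF order.refl to_z_polys[OF r assms]] by metis
  have "from_z r k (to_z r k f - g) \<in> pf_ideal" using g(2) by (rule from_z_pf_ideal)
  then have "f - from_z r k g \<in> pf_ideal" by (simp add: from_z_hom from_z_to_z[OF r])
  moreover have "std m" if "m \<in> keys g" for m
    using g(3)[OF that] z_std[of m] that g(1) by (auto simp: polys_def)
  moreover have "\<exists>n\<in>keys f. mon_degree m = mon_degree n" if m: "m \<in> keys g" for m
  proof -
    obtain n where "n \<in> keys (to_z r k f)" "mon_degree m = mon_degree n" using g(4)[OF m] Z_homog by blast
    then show ?thesis using to_z_keys_degree by metis
  qed
  ultimately show ?thesis using that g(1) by blast
qed

abbreviation std_elem :: "jet_var monomial \<Rightarrow> (jet_var, 'a::field) mpol" where
  "std_elem m \<equiv> from_z r k (single m 1)"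

lemma std_elem_polys: "keys m \<subseteq> V \<Longrightarrow> std_elem m \<in> polys V"
  by (intro from_z_polys[OF r] polys_single)

lemma from_z_expand:
  assumes "finite U" "keys g \<subseteq> U"
  shows "from_z r k g = (\<Sum>m\<in>U. single 0 (lookup g m) * std_elem m)"
proof -
  have "g = (\<Sum>m\<in>keys g. single m (lookup g m))" by (rule mpol_eq_sum)
  also have "\<dots> = (\<Sum>m\<in>U. single m (lookup g m))"
    using assms by (intro sum.mono_neutral_left) (auto simp: in_keys_iff)
  also have "\<dots> = (\<Sum>m\<in>U. single 0 (lookup g m) * single m 1)" by (simp add: mult_single)
  finally have "from_z r k g = from_z r k (\<Sum>m\<in>U. single 0 (lookup g m) * single m 1)" by simp
  then show ?thesis by (simp add: from_z_hom)
qed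

text \<open>Uniqueness of normal forms in the new coordinates.\<close>

lemma std_elem_indep:
  assumes "finite U" "\<And>m. m \<in> U \<Longrightarrow> std m"
  shows "lin_indep_mod (pf_ideal :: (jet_var, 'a::field) mpol set) U std_elem"
  unfolding lin_indep_mod_def
proof (intro allI impI)
  interpret Z: coprime_leads "z_less r k" V "\<lambda>h. to_z r k (pf_coeff r k h) :: (jet_var, 'a) mpol" "\<lambda>h. single (zvar r h) r" k
    by (rule z_coprime_leads)
  fix c :: "jet_var monomial \<Rightarrow> 'a"
  let ?g = "\<Sum>m\<in>U. single m (c m)"
  assume "(\<Sum>m\<in>U. single 0 (c m) * std_elem m) \<in> pf_ideal"
  then have "to_z r k (\<Sum>m\<in>U. single 0 (c m) * std_elem m) \<in> z_ideal" by (rule to_z_pf_ideal)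
  then have gJ: "?g \<in> z_ideal" by (simp add: to_z_hom to_z_from_z[OF r] mult_single)
  have lk: "lookup ?g m = (if m \<in> U then c m else 0)" for m
    using assms(1) by (simp add: lookup_sum lookup_single when_def)
  have "?g = 0"
  proof (rule Z.std_in_J_zero[OF order.refl gJ])
    fix m assume "m \<in> keys ?g"
    then have "m \<in> U" by (simp add: in_keys_iff lk split: if_splits)
    then show "Z.std k m" using assms(2)[of m] z_std[of m] by (auto simp: std_def)
  qed
  then show "\<forall>m\<in>U. c m = 0" using lk by (metis lookup_zero)
qed

lemma std_split:
  assumes "std m"
  shows "restr m Zs \<in> bounded_monomials Zs r" "keys (restr m Ys) \<subseteq> Ys" "restr m Zs + restr m Ys = m"
proof -
  show "restr m Zs \<in> bounded_monomials Zs r"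
    using assms by (auto simp: bounded_monomials_def keys_restr lookup_restr std_def)
  show "keys (restr m Ys) \<subseteq> Ys" by (auto simp: keys_restr)
  show "restr m Zs + restr m Ys = m"
  proof (rule poly_mapping_eqI)
    fix v
    have "v \<notin> V \<Longrightarrow> lookup m v = 0" using assms by (auto simp: std_def in_keys_iff)
    then show "lookup (restr m Zs + restr m Ys) v = lookup m v"
      using Zs_subset by (auto simp: lookup_add lookup_restr)
  qed
qed

lemma std_add:
  assumes "a \<in> bounded_monomials Zs r" "keys b \<subseteq> Ys"
  shows "std (a + b)" "restr (a + b) Zs = a" "restr (a + b) Ys = b"
proof -
  have b0: "lookup b z = 0" if "z \<in> Zs" for z using assms(2) that by (auto simp: in_keys_iff)
  have a0: "lookup a v = 0" if "v \<notin> Zs" for v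
    using assms(1) that in_keys_iff[of v a] unfolding bounded_monomials_def by blast
  have b1: "lookup b v = 0" if "v \<notin> Ys" for v using assms(2) that in_keys_iff[of v b] by blast
  show "std (a + b)"
    unfolding std_def
  proof (intro conjI ballI)
    show "keys (a + b) \<subseteq> V" using assms Zs_subset unfolding keys_add_nat bounded_monomials_def by blast
    show "lookup (a + b) z < r" if "z \<in> Zs" for z
    proof -
      have "lookup a z < r" using assms(1) that unfolding bounded_monomials_def by blast
      then show ?thesis using b0[OF that] by (simp add: lookup_add)
    qed
  qed
  show "restr (a + b) Zs = a" using a0 b0 by (intro poly_mapping_eqI) (simp add: lookup_restr lookup_add)
  show "restr (a + b) Ys = b"
  proof (rule poly_mapping_eqI)
    fix v show "lookup (restr (a + b) Ys) v = lookup b v"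
      using a0[of v] b1[of v] by (cases "v \<in> Ys") (simp_all add: lookup_restr lookup_add)
  qed
qed

lemma finite_std_le: "finite {m. std m \<and> mon_degree m \<le> d}"
  by (rule finite_subset[OF _ monomials_degree_le(1)[OF finite_sets(1), of d]]) (auto simp: std_def)

lemma card_std_le: "card {m. std m \<and> mon_degree m \<le> d} \<le> r ^ k * (d + 1) ^ D"
proof -
  let ?B = "bounded_monomials Zs r" and ?Y = "{m. keys m \<subseteq> Ys \<and> mon_degree m \<le> d}"
  have "{m. std m \<and> mon_degree m \<le> d} \<subseteq> (\<lambda>(a, b). a + b) ` (?B \<times> ?Y)"
  proof
    fix m assume m: "m \<in> {m. std m \<and> mon_degree m \<le> d}"
    then have s: "std m" by simp
    have "mon_degree (restr m Ys) \<le> mon_degree m"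
      using mon_degree_add[of "restr m Zs" "restr m Ys"] std_split(3)[OF s] by simp
    then have "(restr m Zs, restr m Ys) \<in> ?B \<times> ?Y" using std_split[OF s] m by auto
    then show "m \<in> (\<lambda>(a, b). a + b) ` (?B \<times> ?Y)" using std_split(3)[OF s] by (metis (mono_tags, lifting) image_eqI prod.case)
  qed
  moreover have fin: "finite (?B \<times> ?Y)"
    using finite_bounded_monomials[OF finite_sets(2)] monomials_degree_le(1)[OF finite_sets(3)] by blast
  ultimately have "card {m. std m \<and> mon_degree m \<le> d} \<le> card (?B \<times> ?Y)"
    by (meson card_image_le card_mono finite_imageI order_trans)
  also have "\<dots> = card ?B * card ?Y" by (rule card_cartesian_product)
  also have "\<dots> \<le> r ^ k * (d + 1) ^ D"
    using card_bounded_monomials[OF finite_sets(2), of r] card_Zs monomials_degree_le(2)[OF finite_sets(3), of d]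
    by simp
  finally show ?thesis .
qed

text \<open>
  A standard monomial is the product of a monomial in the \<open>z_h\<close> with exponents below \<open>r\<close> and an
  arbitrary monomial in the other variables.
\<close>

lemma card_std_degree:
  "card {m. std m \<and> mon_degree m = d} =
    (\<Sum>a\<in>{a\<in>bounded_monomials Zs r. mon_degree a \<le> d}. card (monomials_of_degree Ys (d - mon_degree a)))"
proof -
  let ?B = "{a\<in>bounded_monomials Zs r. mon_degree a \<le> d}"
  have "bij_betw (\<lambda>m. (restr m Zs, restr m Ys)) {m. std m \<and> mon_degree m = d}
    (SIGMA a:?B. monomials_of_degree Ys (d - mon_degree a))"
  proof (rule bij_betw_byWitness[where f' = "\<lambda>(a, b). a + b"])
    show "\<forall>m\<in>{m. std m \<and> mon_degree m = d}. (case (restr m Zs, restr m Ys) of (a, b) \<Rightarrow> a + b) = m"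
      using std_split(3) by simp
    show "\<forall>x\<in>(SIGMA a:?B. monomials_of_degree Ys (d - mon_degree a)).
        (restr (case x of (a, b) \<Rightarrow> a + b) Zs, restr (case x of (a, b) \<Rightarrow> a + b) Ys) = x"
      using std_add(2,3) by (auto simp: monomials_of_degree_def)
    show "(\<lambda>m. (restr m Zs, restr m Ys)) ` {m. std m \<and> mon_degree m = d} \<subseteq> (SIGMA a:?B. monomials_of_degree Ys (d - mon_degree a))"
    proof (rule image_subsetI)
      fix m assume m: "m \<in> {m. std m \<and> mon_degree m = d}"
      then have s: "std m" by simp
      have "mon_degree (restr m Zs) + mon_degree (restr m Ys) = d"
        using m mon_degree_add[of "restr m Zs" "restr m Ys"] std_split(3)[OF s] by simp
      then show "(restr m Zs, restr m Ys) \<in> (SIGMA a:?B. monomials_of_degree Ys (d - mon_degree a))"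
        using std_split[OF s] by (auto simp: monomials_of_degree_def)
    qed
    show "(\<lambda>(a, b). a + b) ` (SIGMA a:?B. monomials_of_degree Ys (d - mon_degree a)) \<subseteq> {m. std m \<and> mon_degree m = d}"
    proof (rule image_subsetI)
      fix x assume "x \<in> (SIGMA a:?B. monomials_of_degree Ys (d - mon_degree a))"
      then obtain a b where x: "x = (a, b)" "a \<in> bounded_monomials Zs r" "mon_degree a \<le> d"
        "keys b \<subseteq> Ys" "mon_degree b = d - mon_degree a" by (auto simp: monomials_of_degree_def)
      then show "(case x of (a, b) \<Rightarrow> a + b) \<in> {m. std m \<and> mon_degree m = d}"
        using std_add(1)[OF x(2,4)] by (simp add: mon_degree_add)
    qed
  qed
  then have "card {m. std m \<and> mon_degree m = d} = card (SIGMA a:?B. monomials_of_degree Ys (d - mon_degree a))"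
    by (rule bij_betw_same_card)
  also have "\<dots> = (\<Sum>a\<in>?B. card (monomials_of_degree Ys (d - mon_degree a)))"
    using finite_bounded_monomials[OF finite_sets(2)] finite_monomials_of_degree[OF finite_sets(3)]
    by (intro card_SigmaI) auto
  finally show ?thesis .
qed

text \<open>
  Each of the \<open>r^k\<close> monomials \<open>a\<close> in the \<open>z_h\<close> with exponents below \<open>r\<close> contributes the number of
  monomials of degree \<open>d - deg a\<close> in \<open>D\<close> variables. For \<open>d \<ge> deg a\<close> this number is polynomial in
  \<open>d\<close>.
\<close>

definition hilb_poly :: "rat poly" where
  "hilb_poly = (\<Sum>a\<in>bounded_monomials Zs r. pcompose (count_poly (D - 1)) [:- of_nat (mon_degree a), 1:])"

lemma bounded_degree: "\<exists>N. \<forall>a\<in>bounded_monomials Zs r. mon_degree a \<le> N"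
  using finite_bounded_monomials[OF finite_sets(2), of r] finite_nat_set_iff_bounded_le[of "mon_degree ` bounded_monomials Zs r"]
  by auto

lemma hilb_poly_eventually:
  assumes "D > 0"
  shows "\<exists>N. \<forall>d\<ge>N. poly hilb_poly (of_nat d) = of_nat (card {m. std m \<and> mon_degree m = d})"
proof -
  obtain N where N: "\<And>a. a \<in> bounded_monomials Zs r \<Longrightarrow> mon_degree a \<le> N" using bounded_degree by blast
  have "poly hilb_poly (of_nat d) = of_nat (card {m. std m \<and> mon_degree m = d})" if d: "d \<ge> N" for d
  proof -
    have "{a\<in>bounded_monomials Zs r. mon_degree a \<le> d} = bounded_monomials Zs r" using N d by force
    then have "card {m. std m \<and> mon_degree m = d} = (\<Sum>a\<in>bounded_monomials Zs r. card (monomials_of_degree Ys (d - mon_degree a)))"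
      by (simp add: card_std_degree)
    also have "\<dots> = (\<Sum>a\<in>bounded_monomials Zs r. ((d - mon_degree a) + (D - 1)) choose (D - 1))"
    proof (rule sum.cong[OF refl])
      fix a
      let ?e = "d - mon_degree a"
      have "card (monomials_of_degree Ys ?e) = (?e + (D - 1)) choose ?e"
        using card_monomials_of_degree[OF finite_sets(3), of ?e] assms by simp
      also have "\<dots> = (?e + (D - 1)) choose (D - 1)" using binomial_symmetric[of ?e "?e + (D - 1)"] by simp
      finally show "card (monomials_of_degree Ys ?e) = (?e + (D - 1)) choose (D - 1)" .
    qed
    finally have "of_nat (card {m. std m \<and> mon_degree m = d}) =
      (\<Sum>a\<in>bounded_monomials Zs r. of_nat (((d - mon_degree a) + (D - 1)) choose (D - 1)) :: rat)" by simp
    also have "\<dots> = (\<Sum>a\<in>bounded_monomials Zs r. poly (count_poly (D - 1)) (of_nat (d - mon_degree a)))"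
      by (simp add: poly_count_poly)
    also have "\<dots> = (\<Sum>a\<in>bounded_monomials Zs r. poly (count_poly (D - 1)) (of_nat d - of_nat (mon_degree a)))"
    proof (rule sum.cong[OF refl])
      fix a assume "a \<in> bounded_monomials Zs r"
      then have "mon_degree a \<le> d" using N d by fastforce
      then show "poly (count_poly (D - 1)) (of_nat (d - mon_degree a)) = poly (count_poly (D - 1)) (of_nat d - of_nat (mon_degree a))"
        by (simp add: of_nat_diff)
    qed
    also have "\<dots> = poly hilb_poly (of_nat d)" by (simp add: hilb_poly_def poly_sum poly_pcompose)
    finally show ?thesis by simp
  qed
  then show ?thesis by blast
qed

lemma coeff_hilb_poly: "Polynomial.coeff hilb_poly (D - 1) = of_nat (r ^ k) / fact (D - 1)"
proof -
  have "Polynomial.coeff (pcompose (count_poly (D - 1)) [:- of_nat a, 1:]) (D - 1) = 1 / fact (D - 1)" for a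
  proof -
    let ?q = "pcompose (count_poly (D - 1)) [:- of_nat a, 1:]"
    have "degree ?q = D - 1" using degree_pcompose[of "count_poly (D - 1)" "[:- of_nat a, 1:]"] degree_count_poly(1) by simp
    moreover have "lead_coeff ?q = lead_coeff (count_poly (D - 1)) * lead_coeff [:- of_nat a, 1:] ^ degree (count_poly (D - 1))"
      by (rule lead_coeff_comp) simp
    then have "lead_coeff ?q = 1 / fact (D - 1)" using degree_count_poly(2) by simp
    ultimately show ?thesis by simp
  qed
  then show ?thesis
    using card_bounded_monomials[OF finite_sets(2), of r] card_Zs by (simp add: hilb_poly_def coeff_sum)
qed

definition shifted :: "(jet_var \<Rightarrow> 'a::field) \<Rightarrow> jet_var \<Rightarrow> (jet_var, 'a) mpol" where
  "shifted c v = from_z r k (mvar v) - single 0 (c v)"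

text \<open>
  In the new coordinates these are the polynomials with leading monomials \<open>z_h^r\<close>, followed by the
  other variables minus constants. Constants do not affect leading monomials, so the sequence is
  regular for every choice of them.
\<close>

lemma pf_regular_sequence:
  fixes c :: "jet_var \<Rightarrow> 'a::field"
  assumes ys: "set ys = Ys" "distinct ys"
  shows "regular_sequence (polynomial_ring V) (map (pf_coeff r k) [0..<k] @ map (shifted c) ys)"
proof -
  define F :: "nat \<Rightarrow> (jet_var, 'a) mpol" where "F i = (if i < k then to_z r k (pf_coeff r k i) else mvar (ys ! (i - k)) - single 0 (c (ys ! (i - k))))" for i
  define \<mu> where "\<mu> i = (if i < k then single (zvar r i) r else single (ys ! (i - k)) 1)" for i
  let ?l = "k + length ys"
  interpret Z: variable_order "z_less r k" by (rule z_less_order)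
  have ysV: "ys ! i \<in> Ys" if "i < length ys" for i using ys(1) that nth_mem by blast
  interpret S: coprime_leads "z_less r k" V F \<mu> ?l
  proof
    show "F i \<in> polys V" if "i < ?l" for i
      using that ysV[of "i - k"] to_z_polys[OF r pf_coeff_polys, of k i] unfolding F_def
      by (auto intro!: polys_diff polys_mvar)
    show "Z.lead (F i) (\<mu> i)" if i: "i < ?l" for i
    proof (cases "i < k")
      case True then show ?thesis using to_z_pf_coeff_lead[OF r True] by (simp add: F_def \<mu>_def)
    next
      case False
      let ?v = "ys ! (i - k)"
      have "Z.lead (mvar ?v + - single 0 (c ?v) :: (jet_var, 'a) mpol) (single ?v 1)"
      proof (rule Z.lead_add[OF Z.lead_mvar])
        fix m assume "m \<in> keys (- single 0 (c ?v) :: (jet_var, 'a) mpol)"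
        then have "m = 0" by (auto simp: in_keys_iff lookup_single when_def split: if_splits)
        then show "degrevlex_less (z_less r k) m (single ?v 1)" by (simp add: degrevlex_less_def)
      qed
      then show ?thesis using False by (simp add: F_def \<mu>_def)
    qed
    show "keys (\<mu> i) \<inter> keys (\<mu> j) = {}" if ij: "i < j" "j < ?l" for i j
    proof -
      consider "j < k" | "i < k" "\<not> j < k" | "\<not> i < k" using ij by linarith
      then show ?thesis
      proof cases
        case 1 then show ?thesis using zvar_inj[OF r] ij by (auto simp: \<mu>_def)
      next
        case 2
        then have "ys ! (j - k) \<in> Ys" using ij by (intro ysV) linarith
        then have "zvar r i \<noteq> ys ! (j - k)" using 2(1) by (metis Diff_iff imageI lessThan_iff)
        then show ?thesis using 2 by (simp add: \<mu>_def)
      next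
        case 3
        then have "ys ! (i - k) \<noteq> ys ! (j - k)" using ij ys(2) by (subst nth_eq_iff_index_eq) auto
        then show ?thesis using 3 ij by (simp add: \<mu>_def)
      qed
    qed
  qed (rule finite_jet_vars)
  have nz: "\<mu> j \<noteq> 0" for j using r by (auto simp: \<mu>_def dest: arg_cong[where f = keys])
  have "map F [0..<?l] = map (to_z r k) (map (pf_coeff r k) [0..<k] @ map (shifted c) ys)"
  proof (rule nth_equalityI)
    show "map F [0..<?l] ! i = map (to_z r k) (map (pf_coeff r k) [0..<k] @ map (shifted c) ys) ! i"
      if "i < length (map F [0..<?l])" for i
      using that by (simp add: F_def nth_append shifted_def to_z_hom to_z_from_z[OF r])
  qed simp
  then have reg: "regular_sequence (polynomial_ring V) (map (to_z r k) (map (pf_coeff r k) [0..<k] @ map (shifted c) ys))"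
    using S.F_regular_sequence nz by metis
  show ?thesis
  proof (rule regular_sequence_automorphism[OF to_z_hom(1-4) to_z_polys[OF r] from_z_hom(1-3) from_z_polys[OF r] from_z_to_z[OF r] _ reg])
    show "set (map (pf_coeff r k) [0..<k] @ map (shifted c) ys) \<subseteq> polys V"
      using pf_coeff_polys ys(1) by (auto simp: shifted_def intro!: polys_diff from_z_polys[OF r] polys_mvar)
  qed
qed

lemma pf_gens_list: "set (map (pf_coeff r k) [0..<k]) = pf_coeff r k ` {..<k}"
  by auto

lemma pf_coeffs_regular: "regular_sequence (polynomial_ring V) (map (pf_coeff r k) [0..<k] :: (jet_var, 'a::field) mpol list)"
proof -
  obtain ys where ys: "set ys = Ys" "distinct ys" using finite_distinct_list[OF finite_sets(3)] by blast
  interpret C: coprime_leads jet_var_less V "pf_coeff r k :: nat \<Rightarrow> (jet_var, 'a) mpol"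
    "\<lambda>h. set_monomial (leading_matching 0 r h)" k
    by (rule pf_coprime_leads[OF r])
  show ?thesis
  proof (rule C.F_regular_sequence)
    fix j
    have "leading_matching 0 r j \<noteq> {}" using card_leading_matching[OF r, of 0 j] r by auto
    then show "set_monomial (leading_matching 0 r j) \<noteq> 0"
      using keys_set_monomial[OF finite_leading_matching, of 0 r j] by auto
  qed
qed

lemma pf_ideal_grows: "grows V (pf_ideal :: (jet_var, 'a::field) mpol set) D"
proof -
  obtain ys where ys: "set ys = Ys" "distinct ys" using finite_distinct_list[OF finite_sets(3)] by blast
  have "grows V (genideal (polynomial_ring V) (set (map (pf_coeff r k) [0..<k] :: (jet_var, 'a) mpol list))) (length (map (shifted (\<lambda>_. 0 :: 'a)) ys))"
    by (rule grows_regular_sequence[OF pf_regular_sequence[OF ys]])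
  then show ?thesis unfolding pf_gens_list using ys distinct_card by (metis length_map pf_ideal_def)
qed

lemma pf_ideal_growth_bound:
  assumes "grows V (pf_ideal :: (jet_var, 'a::field) mpol set) a" shows "a \<le> D"
proof (rule grows_le[OF pf_ideal_ideal assms, of "\<lambda>d. {m. std m \<and> mon_degree m \<le> d}" "r ^ k" D std_elem])
  fix d and f :: "(jet_var, 'a) mpol" assume f: "f \<in> polys_le V d"
  let ?U = "{m. std m \<and> mon_degree m \<le> d}"
  obtain g where g: "g \<in> polys V" "f - from_z r k g \<in> pf_ideal" "\<And>m. m \<in> keys g \<Longrightarrow> std m"
    "\<And>m. m \<in> keys g \<Longrightarrow> \<exists>n\<in>keys f. mon_degree m = mon_degree n"
    using standard_form[OF polys_le_polys[OF f]] by metis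
  have "keys g \<subseteq> ?U" using g(3,4) f by (fastforce simp: polys_le_def)
  then have "from_z r k g = (\<Sum>m\<in>?U. single 0 (lookup g m) * std_elem m)" by (rule from_z_expand[OF finite_std_le])
  then show "\<exists>c. f - (\<Sum>m\<in>?U. single 0 (c m) * std_elem m) \<in> pf_ideal" using g(2) by auto
qed (use finite_std_le card_std_le in auto)

section \<open>Height, depth and multiplicity\<close>

lemma one_notin_pf_ideal: "1 \<notin> (pf_ideal :: (jet_var, 'a::field) mpol set)"
proof
  assume "1 \<in> (pf_ideal :: (jet_var, 'a) mpol set)"
  then have "pf_ideal = carrier (polynomial_ring V :: (jet_var, 'a) mpol ring)"
    using ideal.one_imp_carrier[OF pf_ideal_ideal] by simp
  then have "genideal (polynomial_ring V) (set (map (pf_coeff r k) [0..<k])) = carrier (polynomial_ring V :: (jet_var, 'a) mpol ring)"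
    unfolding pf_gens_list pf_ideal_def .
  then show False using pf_coeffs_regular[where ?'a = 'a] unfolding regular_sequence_def by blast
qed

lemma mpol_quotient: "mpol_quotient (pf_ideal :: (jet_var, 'a::field) mpol set) V"
  by (intro mpol_quotient.intro cring_ideal.intro mpol_quotient_axioms.intro polynomial_ring_cring pf_ideal_ideal one_notin_pf_ideal)

text \<open>
  At least \<open>k\<close> because of the regular sequence of generators. A chain of length \<open>m\<close> below the
  ideal contains a prime with growth exponent \<open>D + m\<close>, which is at most the number \<open>D + k\<close> of
  variables.
\<close>

lemma height_pf_ideal:
  "ideal_height (polynomial_ring V) (pf_ideal :: (jet_var, 'a::alg_closed_field) mpol set) = enat k"
proof -
  let ?A = "polynomial_ring V :: (jet_var, 'a) mpol ring" and ?I = "pf_ideal :: (jet_var, 'a) mpol set"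
  interpret A: cring ?A by (rule polynomial_ring_cring)
  have prime: "primeideal ?I ?A" unfolding pf_ideal_def by (rule pf_ideal_prime[OF r k])
  have "set (map (pf_coeff r k) [0..<k]) \<subseteq> ?I"
    unfolding pf_gens_list pf_ideal_def using pf_gens_polys by (intro A.genideal_self) simp
  then have "enat (length (map (pf_coeff r k) [0..<k] :: (jet_var, 'a) mpol list)) \<le> ideal_depth ?A ?I"
    unfolding ideal_depth_def using pf_coeffs_regular by (intro Sup_upper) blast
  then have ge: "enat k \<le> prime_height ?A ?I" using A.depth_le_height[OF prime] by (simp add: order_trans)
  have "prime_height ?A ?I \<le> enat k"
  proof (rule prime_height_le)
    fix Ps assume Ps: "prime_chain ?A (Ps @ [?I])"
    obtain P where P: "P \<in> set (Ps @ [?I])" "grows V P (D + length Ps)"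
      using grows_prime_chain[OF Ps pf_ideal_grows] by blast
    have "ideal P ?A" using P(1) Ps primeideal.axioms(1) unfolding prime_chain_def by blast
    then have "D + length Ps \<le> card V" using grows_le_card[OF finite_sets(1) _ P(2)] by blast
    then show "length Ps \<le> k" using card_V by simp
  qed
  then show ?thesis using ge ideal_height_prime[OF prime] by simp
qed

text \<open>
  The preimage of a chain of length \<open>m\<close> has growth exponent at least \<open>0\<close> at its top, so it
  contains a prime with exponent at least \<open>m\<close>; as this prime contains the Pfaffian jet ideal,
  \<open>m \<le> D\<close>.
\<close>

lemma quotient_height_le:
  assumes "primeideal P (polynomial_ring V Quot (pf_ideal :: (jet_var, 'a::field) mpol set))"
  shows "prime_height (polynomial_ring V Quot pf_ideal) P \<le> enat D"
proof (rule prime_height_le)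
  interpret Q: mpol_quotient "pf_ideal :: (jet_var, 'a) mpol set" V by (rule mpol_quotient)
  fix Ps assume "prime_chain (polynomial_ring V Quot (pf_ideal :: (jet_var, 'a) mpol set)) (Ps @ [P])"
  note chain = Q.prime_chain_vimage[OF this]
  let ?v = "\<lambda>L. {a \<in> carrier (polynomial_ring V). Q.proj a \<in> L}"
  have "primeideal (?v P) (polynomial_ring V)" using Q.vimage_prime(1)[OF assms] .
  then have "ideal (?v P) (polynomial_ring V)" "1 \<notin> ?v P"
    using primeideal.axioms(1) primeideal.I_notcarr ideal.one_imp_carrier[of "?v P" "polynomial_ring V"] by fastforce+
  then have g0: "grows V (?v P) 0" by (rule grows_0)
  have "prime_chain (polynomial_ring V) (map ?v Ps @ [?v P])" using chain(1) by simp
  from grows_prime_chain[OF this g0] obtain L where L: "L \<in> set (map ?v Ps @ [?v P])" "grows V L (length Ps)" by auto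
  then have "pf_ideal \<subseteq> L" using chain(2) by auto
  then have "grows V (pf_ideal :: (jet_var, 'a) mpol set) (length Ps)" by (rule grows_antimono[OF L(2)])
  then show "length Ps \<le> D" by (rule pf_ideal_growth_bound)
qed

lemma quotient_regular_sequence:
  fixes c :: "jet_var \<Rightarrow> 'a::field"
  assumes ys: "set ys = Ys" "distinct ys"
  shows "regular_sequence (polynomial_ring V Quot pf_ideal) (map (\<lambda>v. a_r_coset (polynomial_ring V) pf_ideal (shifted c v)) ys)"
  using regular_sequence_Quot[OF polynomial_ring_cring pf_regular_sequence[OF ys, of c]]
  unfolding pf_gens_list pf_ideal_def[symmetric] by (simp add: comp_def)

text \<open>
  By the Nullstellensatz the preimage of \<open>P\<close> is contained in the kernel of an evaluation \<open>\<chi>\<close>, and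
  by maximality \<open>P\<close> is the image of this kernel. The coordinates shifted by their values under \<open>\<chi>\<close>
  lie in \<open>P\<close> and form a regular sequence of length \<open>D\<close>.
\<close>

lemma quotient_maximal_depth:
  assumes "maximalideal P (polynomial_ring V Quot (pf_ideal :: (jet_var, 'a::alg_closed_field) mpol set))"
  shows "enat D \<le> ideal_depth (polynomial_ring V Quot pf_ideal) P"
proof -
  interpret Q: mpol_quotient "pf_ideal :: (jet_var, 'a) mpol set" V by (rule mpol_quotient)
  let ?A = "polynomial_ring V :: (jet_var, 'a) mpol ring"
  have prime: "primeideal P Q.quot" by (rule Q.Q.maximalideal_prime[OF assms])
  interpret P: maximalideal P Q.quot by fact
  let ?L = "{a \<in> carrier ?A. Q.proj a \<in> P}"
  have L: "primeideal ?L ?A" "pf_ideal \<subseteq> ?L" by (rule Q.vimage_prime[OF prime])+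
  have one: "1 \<notin> ?L"
    using primeideal.I_notcarr[OF L(1)] ideal.one_imp_carrier[OF primeideal.axioms(1)[OF L(1)]] by fastforce
  obtain \<chi> :: "(jet_var, 'a) mpol \<Rightarrow> 'a" where
    add: "\<And>x y. x \<in> polys V \<Longrightarrow> y \<in> polys V \<Longrightarrow> \<chi> (x + y) = \<chi> x + \<chi> y"
    and mult: "\<And>x y. x \<in> polys V \<Longrightarrow> y \<in> polys V \<Longrightarrow> \<chi> (x * y) = \<chi> x * \<chi> y"
    and const: "\<And>c. \<chi> (single 0 c) = c" and zero: "\<And>x. x \<in> ?L \<Longrightarrow> \<chi> x = 0"
    by (rule nullstellensatz[OF finite_jet_vars L(1) polys_1 one]) (rule that, assumption+)
  define N where "N = {f \<in> polys V. \<chi> f = 0}"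
  have \<chi>0: "\<chi> 0 = 0" "\<chi> 1 = 1" using const[of 0] const[of 1] by auto
  have N: "ideal N ?A" unfolding N_def by (rule ideal_polynomial_ringI) (auto simp: add mult \<chi>0)
  have LN: "?L \<subseteq> N" using zero by (auto simp: N_def)
  have "P = Q.proj ` N"
  proof -
    have "ideal (Q.proj ` N) Q.quot" by (rule Q.proj_image_ideal[OF N])
    moreover have "P \<subseteq> Q.proj ` N"
    proof
      fix x assume x: "x \<in> P"
      then obtain a where "a \<in> carrier ?A" "x = Q.proj a" using P.Icarr Q.carrier_Quot by auto
      then show "x \<in> Q.proj ` N" using LN x by blast
    qed
    moreover have "Q.proj ` N \<subseteq> carrier Q.quot" using Q.carrier_Quot by (auto simp: N_def)
    moreover have "Q.proj ` N \<noteq> carrier Q.quot"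
    proof
      assume "Q.proj ` N = carrier Q.quot"
      then have "Q.proj 1 \<in> Q.proj ` N" using Q.carrier_Quot by auto
      then have "1 \<in> N" using Q.proj_mem_image[OF N, of 1] L(2) LN by auto
      then show False using \<chi>0 by (simp add: N_def)
    qed
    ultimately show ?thesis using P.I_maximal by blast
  qed
  moreover define c where "c v = \<chi> (from_z r k (mvar v))" for v
  have "shifted c v \<in> N" if "v \<in> V" for v
  proof -
    have v: "from_z r k (mvar v) \<in> polys V" using that by (intro from_z_polys[OF r] polys_mvar)
    have "single 0 (- c v) \<in> polys V" by simp
    then have "\<chi> (from_z r k (mvar v) + single 0 (- c v)) = 0" using add[OF v] const by (simp add: c_def)
    then show ?thesis using v unfolding N_def shifted_def by (auto simp: single_uminus)
  qed
  moreover obtain ys where ys: "set ys = Ys" "distinct ys" using finite_distinct_list[OF finite_sets(3)] by blast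
  ultimately have "set (map (\<lambda>v. Q.proj (shifted c v)) ys) \<subseteq> P" by auto
  then have "enat (length (map (\<lambda>v. Q.proj (shifted c v)) ys)) \<le> ideal_depth Q.quot P"
    unfolding ideal_depth_def using quotient_regular_sequence[OF ys, of c] by (intro Sup_upper) blast
  moreover have "length (map (\<lambda>v. Q.proj (shifted c v)) ys) = D" using ys distinct_card by (metis length_map)
  ultimately show ?thesis by simp
qed

lemma quotient_cohen_macaulay:
  "cohen_macaulay (polynomial_ring V Quot (pf_ideal :: (jet_var, 'a::alg_closed_field) mpol set))"
  unfolding cohen_macaulay_def
proof (intro conjI allI impI)
  interpret Q: mpol_quotient "pf_ideal :: (jet_var, 'a) mpol set" V by (rule mpol_quotient)
  show "cring Q.quot" by (rule Q.Quot_cring)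
  show "noetherian_ring Q.quot" by (intro Q.noetherian_Quot jet.polynomial_ring_noetherian finite_jet_vars)
  fix P assume max: "maximalideal P Q.quot"
  have prime: "primeideal P Q.quot" by (rule Q.Q.maximalideal_prime[OF max])
  have "ideal_depth Q.quot P \<le> prime_height Q.quot P" by (rule Q.Q.depth_le_height[OF prime])
  moreover have "prime_height Q.quot P \<le> enat D" by (rule quotient_height_le[OF prime])
  moreover have "enat D \<le> ideal_depth Q.quot P" by (rule quotient_maximal_depth[OF max])
  ultimately show "ideal_depth Q.quot P = ideal_height Q.quot P" unfolding ideal_height_prime[OF prime] by simp
qed

text \<open>Some prime contains the regular sequence of the \<open>D\<close> other coordinates.\<close>

lemma quotient_krull_dim: "krull_dim (polynomial_ring V Quot (pf_ideal :: (jet_var, 'a::field) mpol set)) = enat D"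
proof -
  interpret Q: mpol_quotient "pf_ideal :: (jet_var, 'a) mpol set" V by (rule mpol_quotient)
  obtain ys where ys: "set ys = Ys" "distinct ys" using finite_distinct_list[OF finite_sets(3)] by blast
  let ?fs = "map (\<lambda>v. Q.proj (shifted (\<lambda>_. 0 :: 'a) v)) ys"
  have reg: "regular_sequence Q.quot ?fs" by (rule quotient_regular_sequence[OF ys])
  then have c: "set ?fs \<subseteq> carrier Q.quot" "genideal Q.quot (set ?fs) \<noteq> carrier Q.quot" by (simp_all add: regular_sequence_def)
  have id: "ideal (genideal Q.quot (set ?fs)) Q.quot" by (rule Q.Q.genideal_ideal[OF c(1)])
  have "\<one>\<^bsub>Q.quot\<^esub> \<notin> genideal Q.quot (set ?fs)" using ideal.one_imp_carrier[OF id] c(2) by blast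
  then obtain P where P: "primeideal P Q.quot" "genideal Q.quot (set ?fs) \<subseteq> P"
    using Q.Q.exists_prime_disjoint[OF id, of "{\<one>\<^bsub>Q.quot\<^esub>}"] by auto
  have "set ?fs \<subseteq> P" using Q.Q.genideal_self[OF c(1)] P(2) by blast
  then have "enat (length ?fs) \<le> ideal_depth Q.quot P" unfolding ideal_depth_def using reg by (intro Sup_upper) blast
  also have "\<dots> \<le> prime_height Q.quot P" by (rule Q.Q.depth_le_height[OF P(1)])
  also have "\<dots> \<le> krull_dim Q.quot" unfolding krull_dim_def using P(1) by (intro Sup_upper) blast
  finally have "enat D \<le> krull_dim Q.quot" using ys distinct_card by (metis length_map)
  moreover have "krull_dim Q.quot \<le> enat D" unfolding krull_dim_def using quotient_height_le by (intro Sup_least) blast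
  ultimately show ?thesis by simp
qed

lemma quotient_dim_span:
  assumes U: "finite U" "\<And>m. m \<in> U \<Longrightarrow> std m"
    and E: "E \<subseteq> polys V" "\<And>f. f \<in> E \<Longrightarrow> \<exists>g. f - from_z r k g \<in> (pf_ideal :: (jet_var, 'a::field) mpol set) \<and> keys g \<subseteq> U"
    "\<And>c. (\<Sum>m\<in>U. single 0 (c m) * std_elem m) \<in> E"
  shows "ring.dim (polynomial_ring V Quot pf_ideal) (a_r_coset (polynomial_ring V) pf_ideal ` range (single 0))
    (a_r_coset (polynomial_ring V) pf_ideal ` E) = card U"
proof -
  interpret Q: mpol_quotient "pf_ideal :: (jet_var, 'a) mpol set" V by (rule mpol_quotient)
  have UV: "std_elem m \<in> polys V" if "m \<in> U" for m using U(2)[OF that] by (intro std_elem_polys) (simp add: std_def)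
  show ?thesis
  proof (rule Q.quotient_dimension[OF U(1) UV std_elem_indep[OF U]])
    show "Q.proj ` E = {Q.proj (\<Sum>m\<in>U. single 0 (c m) * std_elem m) | c. True}"
    proof
      show "Q.proj ` E \<subseteq> {Q.proj (\<Sum>m\<in>U. single 0 (c m) * std_elem m) | c. True}"
      proof (rule image_subsetI)
        fix f assume f: "f \<in> E"
        then obtain g where g: "f - from_z r k g \<in> pf_ideal" "keys g \<subseteq> U" using E(2) by blast
        have e: "from_z r k g = (\<Sum>m\<in>U. single 0 (lookup g m) * std_elem m)" by (rule from_z_expand[OF U(1) g(2)])
        have "(\<Sum>m\<in>U. single 0 (lookup g m) * std_elem m) \<in> polys V" using E(1,3) by blast
        then have "Q.proj f = Q.proj (\<Sum>m\<in>U. single 0 (lookup g m) * std_elem m)"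
          using Q.proj_eq[of f] E(1) f g(1) unfolding e by blast
        then show "Q.proj f \<in> {Q.proj (\<Sum>m\<in>U. single 0 (c m) * std_elem m) | c. True}" by blast
      qed
      show "{Q.proj (\<Sum>m\<in>U. single 0 (c m) * std_elem m) | c. True} \<subseteq> Q.proj ` E" using E(3) by blast
    qed
  qed
qed

text \<open>
  For \<open>D > 0\<close> the multiplicity is read off from the leading coefficient of the Hilbert polynomial.
  The case \<open>D = 0\<close> occurs (for \<open>r = 1\<close> there are just the \<open>k\<close> variables \<open>x_12^(h)\<close>); then the
  quotient has the standard monomials in the \<open>z_h\<close> as a finite basis.
\<close>

lemma quotient_multiplicity: "multiplicity_quotient V (pf_ideal :: (jet_var, 'a::field) mpol set) = of_nat (r ^ k)"
proof -
  let ?A = "polynomial_ring V :: (jet_var, 'a) mpol ring" and ?I = "pf_ideal :: (jet_var, 'a) mpol set"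
  interpret Q: mpol_quotient ?I V by (rule mpol_quotient)
  have hf: "ring.dim Q.quot Q.base_field (Q.proj ` homogeneous_part V d) = card {m. std m \<and> mon_degree m = d}" for d
  proof (rule quotient_dim_span)
    show "finite {m. std m \<and> mon_degree m = d}" by (rule finite_subset[OF _ finite_std_le[of d]]) auto
    show "homogeneous_part V d \<subseteq> polys V" by (auto simp: homogeneous_part_def)
    show "\<exists>g. f - from_z r k g \<in> pf_ideal \<and> keys g \<subseteq> {m. std m \<and> mon_degree m = d}"
      if "f \<in> homogeneous_part V d" for f :: "(jet_var, 'a) mpol"
    proof -
      have f: "f \<in> polys V" "\<forall>m\<in>keys f. mon_degree m = d" using that by (auto simp: homogeneous_part_def)
      obtain g where "f - from_z r k g \<in> pf_ideal" "\<And>m. m \<in> keys g \<Longrightarrow> std m"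
        "\<And>m. m \<in> keys g \<Longrightarrow> \<exists>n\<in>keys f. mon_degree m = mon_degree n"
        using standard_form[OF f(1)] by metis
      then show ?thesis using f(2) by (intro exI[of _ g]) auto
    qed
    show "(\<Sum>m\<in>{m. std m \<and> mon_degree m = d}. single 0 (c m) * std_elem m) \<in> homogeneous_part V d" for c :: "jet_var monomial \<Rightarrow> 'a"
    proof -
      have "homogeneous d (\<Sum>m\<in>{m. std m \<and> mon_degree m = d}. single 0 (c m) * std_elem m)"
      proof (rule homogeneous_sum)
        fix m assume "m \<in> {m. std m \<and> mon_degree m = d}"
        then have "homogeneous d (single m (1::'a))" by (simp add: homogeneous_def)
        then have "homogeneous (0 + d) (single 0 (c m) * std_elem m)"
          by (intro homogeneous_mult homogeneous_const from_z_homogeneous)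
        then show "homogeneous d (single 0 (c m) * std_elem m)" by simp
      qed
      moreover have "(\<Sum>m\<in>{m. std m \<and> mon_degree m = d}. single 0 (c m) * std_elem m) \<in> polys V"
      proof (rule polys_sum)
        fix m assume "m \<in> {m. std m \<and> mon_degree m = d}"
        then have "std_elem m \<in> polys V" by (intro std_elem_polys) (simp add: std_def)
        then show "single 0 (c m) * std_elem m \<in> polys V" by (rule polys_mult[OF polys_const])
      qed
      ultimately show ?thesis unfolding homogeneous_part_def homogeneous_def polynomial_ring_simps by blast
    qed
  qed simp
  show ?thesis
  proof (cases "D = 0")
    case True
    then have VZ: "V = Zs" using finite_sets Zs_subset by auto
    have "ring.dim Q.quot Q.base_field (Q.proj ` polys V) = card (bounded_monomials Zs r)"
    proof (rule quotient_dim_span)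
      show "finite (bounded_monomials Zs r)" by (rule finite_bounded_monomials[OF finite_sets(2)])
      show "std m" if "m \<in> bounded_monomials Zs r" for m using that VZ by (auto simp: bounded_monomials_def std_def)
      show "\<exists>g. f - from_z r k g \<in> pf_ideal \<and> keys g \<subseteq> bounded_monomials Zs r" if f: "f \<in> polys V" for f :: "(jet_var, 'a) mpol"
      proof -
        obtain g where g: "f - from_z r k g \<in> pf_ideal" "\<And>m. m \<in> keys g \<Longrightarrow> std m"
          using standard_form[OF f] by metis
        have "keys g \<subseteq> bounded_monomials Zs r"
        proof
          fix m assume "m \<in> keys g"
          then show "m \<in> bounded_monomials Zs r" using g(2)[of m] VZ by (simp add: bounded_monomials_def std_def)
        qed
        then show ?thesis using g(1) by blast
      qed
      show "(\<Sum>m\<in>bounded_monomials Zs r. single 0 (c m) * std_elem m) \<in> polys V" for c :: "jet_var monomial \<Rightarrow> 'a"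
        using VZ by (intro polys_sum polys_mult std_elem_polys) (auto simp: bounded_monomials_def)
    qed simp
    moreover have "carrier Q.quot = Q.proj ` polys V" using Q.carrier_Quot by simp
    ultimately show ?thesis
      using True card_bounded_monomials[OF finite_sets(2), of r] card_Zs
      unfolding multiplicity_quotient_def multiplicity_graded_def quotient_krull_dim by simp
  next
    case False
    then have D: "D > 0" by simp
    obtain N where N: "\<And>d. d \<ge> N \<Longrightarrow> poly hilb_poly (of_nat d) = of_nat (card {m. std m \<and> mon_degree m = d})"
      using hilb_poly_eventually[OF D] by blast
    have "hilbert_polynomial Q.quot Q.base_field (\<lambda>d. Q.proj ` homogeneous_part V d) = hilb_poly"
      unfolding hilbert_polynomial_def hilbert_function_def hf
    proof (rule the_equality)
      show "\<exists>N. \<forall>d\<ge>N. poly hilb_poly (of_nat d) = of_nat (card {m. std m \<and> mon_degree m = d})" using N by blast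
      fix H :: "rat poly" assume "\<exists>N. \<forall>d\<ge>N. poly H (of_nat d) = of_nat (card {m. std m \<and> mon_degree m = d})"
      then obtain N' where N': "\<And>d. d \<ge> N' \<Longrightarrow> poly H (of_nat d) = of_nat (card {m. std m \<and> mon_degree m = d})" by blast
      show "H = hilb_poly" by (rule poly_eqI_eventually[of "max N N'"]) (simp add: N N')
    qed
    then show ?thesis
      using False coeff_hilb_poly unfolding multiplicity_quotient_def multiplicity_graded_def quotient_krull_dim by simp
  qed
qed

text \<open>
  The leading monomial of every member of the ideal is a multiple of the leading monomial of a
  generator.
\<close>

lemma pf_groebner_basis:
  "groebner_basis jet_order V (pf_ideal :: (jet_var, 'a::field) mpol set) (pf_coeff r k ` {..<k})"
  unfolding groebner_basis_def
proof (intro conjI)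
  let ?A = "polynomial_ring V :: (jet_var, 'a) mpol ring"
  let ?lead = "\<lambda>F :: (jet_var, 'a) mpol set. {single (leading_monomial jet_order f) (1::'a) | f. f \<in> F \<and> f \<noteq> 0}"
  let ?G = "pf_coeff r k ` {..<k} :: (jet_var, 'a) mpol set"
  interpret A: cring ?A by (rule polynomial_ring_cring)
  interpret C: coprime_leads jet_var_less V "pf_coeff r k :: nat \<Rightarrow> (jet_var, 'a) mpol"
    "\<lambda>h. set_monomial (leading_matching 0 r h)" k
    by (rule pf_coprime_leads[OF r])
  have IJ: "pf_ideal = C.J k" unfolding pf_ideal_def using C.J_eq_genideal[of k] by simp
  show "finite ?G" by simp
  show GI: "?G \<subseteq> pf_ideal" unfolding IJ using C.J_gen by auto
  have lead_V: "?lead pf_ideal \<subseteq> polys V"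
  proof clarify
    fix f :: "(jet_var, 'a) mpol" assume f: "f \<in> pf_ideal" "f \<noteq> 0"
    obtain m where m: "jet.lead f m" using jet.lead_exists[OF f(2)] by blast
    have "f \<in> polys V" using f(1) pf_idealD(1) by blast
    then have "keys m \<subseteq> V" using jet.lead_keys[OF m] by (simp add: polys_def)
    then show "single (leading_monomial jet_order f) 1 \<in> polys V"
      unfolding jet.leading_monomial_eq[OF m] by (rule polys_single)
  qed
  have sub: "?lead ?G \<subseteq> ?lead pf_ideal" using GI by blast
  have GV: "?lead ?G \<subseteq> carrier ?A" using sub lead_V by simp
  have id: "ideal (genideal ?A (?lead ?G)) ?A" by (rule A.genideal_ideal[OF GV])
  show "leading_ideal jet_order V ?G = leading_ideal jet_order V pf_ideal"
    unfolding leading_ideal_def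
  proof
    show "genideal ?A (?lead ?G) \<subseteq> genideal ?A (?lead pf_ideal)"
      using sub lead_V by (intro A.subset_Idl_subset) auto
    show "genideal ?A (?lead pf_ideal) \<subseteq> genideal ?A (?lead ?G)"
    proof (rule A.genideal_minimal[OF id], clarify)
      fix f :: "(jet_var, 'a) mpol" assume f: "f \<in> pf_ideal" "f \<noteq> 0"
      obtain m where m: "jet.lead f m" using jet.lead_exists[OF f(2)] by blast
      obtain j where j: "j < k" "mdvd (set_monomial (leading_matching 0 r j)) m"
        using C.lead_in_J[OF order.refl f(1)[unfolded IJ] m] by blast
      obtain u where u: "m = set_monomial (leading_matching 0 r j) + u" using mdvdE[OF j(2)] .
      have "f \<in> polys V" using f(1) pf_idealD(1) by blast
      then have mV: "keys m \<subseteq> V" using jet.lead_keys[OF m] by (simp add: polys_def)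
      have lj: "jet.lead (pf_coeff r k j :: (jet_var, 'a) mpol) (set_monomial (leading_matching 0 r j))"
        by (rule pf_coeff_lead[OF r j(1)])
      have "pf_coeff r k j \<in> ?G" using j(1) by simp
      then have "single (leading_monomial jet_order (pf_coeff r k j :: (jet_var, 'a) mpol)) 1 \<in> ?lead ?G"
        using jet.lead_nonzero[OF lj] by (intro CollectI exI[of _ "pf_coeff r k j"] conjI refl)
      then have "single (set_monomial (leading_matching 0 r j)) 1 \<in> ?lead ?G"
        unfolding jet.leading_monomial_eq[OF lj] .
      then have "single (set_monomial (leading_matching 0 r j)) 1 \<in> genideal ?A (?lead ?G)"
        by (rule subsetD[OF A.genideal_self[OF GV]])
      moreover have "single u (1::'a) \<in> polys V" using mV u by (intro polys_single) (simp add: keys_add_nat)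
      ultimately have "single u 1 * single (set_monomial (leading_matching 0 r j)) 1 \<in> genideal ?A (?lead ?G)"
        by (rule ideal_polynomial_ringD(4)[OF id])
      then show "single (leading_monomial jet_order f) 1 \<in> genideal ?A (?lead ?G)"
        unfolding jet.leading_monomial_eq[OF m] by (simp add: mult_single u add.commute)
    qed
  qed
qed

end

theorem theorem3p1:
  fixes n k r :: nat
    and A :: "(jet_var, 'a::alg_closed_field) mpol ring"
    and I :: "(jet_var, 'a) mpol set"
    and p :: "(jet_var, 'a) mpol poly"
  assumes "r > 0" and "k > 0" and "n = 2 * r"
    and "A = jet_ring n k"
    and "I = pfaffian_jet_ideal n k r"
    and "p = jet_pfaffian k [1..<n + 1]"
  shows "groebner_basis jet_order (jet_vars n k) I {Polynomial.coeff p h | h. h < k} \<and>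
    (primeideal I A \<and> ideal_height A I = enat k) \<and>
    (complete_intersection_quotient A I \<and> cohen_macaulay (A Quot I) \<and>
      multiplicity_quotient (jet_vars n k) I = of_nat (r ^ k))"
proof -
  interpret pfaffian_jets r k by standard (use assms in auto)
  have n: "n = 2 * r" by fact
  have A: "A = polynomial_ring V" using assms by (simp add: jet_ring_def)
  have I: "I = pf_ideal"
    unfolding assms(5) n pfaffian_jet_ideal_eq pf_ideal_def jet_ring_def ..
  have G: "{Polynomial.coeff p h | h. h < k} = pf_coeff r k ` {..<k}"
    unfolding assms(6) n pf_coeff_def by blast
  have "complete_intersection_quotient A I"
    unfolding complete_intersection_quotient_def A I
    using pf_coeffs_regular pf_gens_list pf_ideal_def by metis
  moreover have "primeideal I A" unfolding A I pf_ideal_def by (rule pf_ideal_prime[OF r k])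
  moreover have "ideal_height A I = enat k" unfolding A I by (rule height_pf_ideal)
  moreover have "cohen_macaulay (A Quot I)" unfolding A I by (rule quotient_cohen_macaulay)
  moreover have "multiplicity_quotient (jet_vars n k) I = of_nat (r ^ k)" unfolding n I by (rule quotient_multiplicity)
  moreover have "groebner_basis jet_order (jet_vars n k) I {Polynomial.coeff p h | h. h < k}"
    unfolding n I G by (rule pf_groebner_basis)
  ultimately show ?thesis by blast
qed

end
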